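(* Let $p\in\,]3,+\infty[$. There is a constant $C_0>0$ such that for every $R_0\in B^{-1+3/p}_{p,2}(\mathbb T^3)$, $F\in L^1(\mathbb R^+;B^{-1+3/p}_{p,2})$ and $u^{(0)}\in L^2(\mathbb R^+;L^\infty(\mathbb T^3))$ satisfying $$\|R_0\|_{B^{-1+3/p}_{p,2}}+\|F\|_{L^1(\mathbb R^+;B^{-1+3/p}_{p,2})}\le C_0^{-1}\exp\big(-C_0\|u^{(0)}\|^2_{L^2(\mathbb R^+;L^\infty)}\big),$$ there is a unique global solution $R$ of $(PNS)$ with data $R_0$ and $F$ such that $$R\in C_b(\mathbb R^+;B^{-1+3/p}_{p,2})\cap L^2(\mathbb R^+;B^{3/p}_{p,2}).$$
   Context: $\mathbb T^3=(\mathbb R/2\pi\mathbb Z)^3$, all vector fields mean free. $\mathbf P=\mathrm{Id}-\nabla\Delta^{-1}\operatorname{div}$ the Leray projector, $Q(a,b)=\mathbf P\operatorname{div}(a\otimes b+b\otimes a)$. $(PNS)$ is the system $\partial_tR+\mathbf P(R\cdot\nabla R)+Q(u^{(0)},R)-\Delta R=F$, $R_{|t=0}=R_0$ (understood in Duhamel form). Littlewood–Paley: fix smooth $\chi$ with $\hat\chi(\xi)=1$ for $|\xi|\le1$, $\hat\chi(\xi)=0$ for $|\xi|>2$; $S_j$ is the Fourier multiplier $\hat\chi(2^{-j}\xi)$, $\Delta_j=S_j-S_{j-1}$, $j\in\mathbb Z$. For $s\in\mathbb R$, $p,q\in[1,\infty]$, $\|f\|_{B^s_{p,q}}=\big\|2^{js}\|\Delta_jf\|_{L^p}\big\|_{\ell^q(\mathbb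 Z)}$ (for $s<0$ this is equivalent to $\|t^{-s/2}\|e^{t\Delta}f\|_{L^p}\|_{L^q(\mathbb R^+,dt/t)}$).
   Formalization: The term P(R·∇R) is taken in conservative form P div(R⊗R); the two agree for divergence-free data, while for other data P(R·∇R) may fail to be mean free, or to be defined when p ≥ 6. *)

theory Defs
  imports "HOL-Analysis.Analysis"
begin

text \<open>Periodic vector fields on the torus (R/2 pi Z)^3 are represented by their Fourier
coefficients, a map from the lattice int^3 to complex^3.  (Negative-regularity Besov
elements are distributions, so the coefficient representation is used throughout.)\<close>

type_synonym field = "int^3 \<Rightarrow> complex^3"

definition rvec :: "int^3 \<Rightarrow> real^3" where
  "rvec k = (\<chi> i. real_of_int (k $ i))"

definition ksq :: "int^3 \<Rightarrow> real" where
  "ksq k = (\<Sum>i\<in>UNIV. (real_of_int (k $ i))^2)"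

definition cube :: "(real^3) set" where
  "cube = {x. \<forall>i. 0 \<le> x $ i \<and> x $ i \<le> 2 * pi}"

coinductive smooth3 :: "(real^3 \<Rightarrow> real) \<Rightarrow> bool" where
  "continuous_on UNIV f \<Longrightarrow>
   (\<forall>i. \<exists>g. (\<forall>x. ((\<lambda>h. f (x + h *\<^sub>R axis i 1)) has_real_derivative g x) (at 0)) \<and> smooth3 g)
   \<Longrightarrow> smooth3 f"

text \<open>Admissible Littlewood-Paley cutoff: chi is the Fourier transform hat-chi.\<close>
definition lp_cutoff :: "(real^3 \<Rightarrow> real) \<Rightarrow> bool" where
  "lp_cutoff chi \<longleftrightarrow> smooth3 chi \<and> (\<forall>\<xi>. norm \<xi> \<le> 1 \<longrightarrow> chi \<xi> = 1)
      \<and> (\<forall>\<xi>. norm \<xi> > 2 \<longrightarrow> chi \<xi> = 0)"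

text \<open>Dyadic block Delta_j f = (S_j - S_{j-1}) f as a trigonometric polynomial on R^3.\<close>
definition LP_block :: "(real^3 \<Rightarrow> real) \<Rightarrow> int \<Rightarrow> field \<Rightarrow> real^3 \<Rightarrow> complex^3" where
  "LP_block chi j c x = (\<Sum>\<^sub>\<infinity>k. complex_of_real
       (chi ((2 powr (- real_of_int j)) *\<^sub>R rvec k) - chi ((2 powr (- real_of_int (j - 1))) *\<^sub>R rvec k))
       * cis (rvec k \<bullet> x) *s c k)"

definition Lp_norm :: "real \<Rightarrow> (real^3 \<Rightarrow> complex^3) \<Rightarrow> real" where
  "Lp_norm p g = (LINT x:cube|lborel. norm (g x) powr p) powr (1 / p)"

definition besov_sq :: "(real^3 \<Rightarrow> real) \<Rightarrow> real \<Rightarrow> real \<Rightarrow> field \<Rightarrow> ennreal" where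
  "besov_sq chi s p c = (\<integral>\<^sup>+ j. ennreal ((2 powr (real_of_int j * s) * Lp_norm p (LP_block chi j c))^2)
                           \<partial>count_space UNIV)"

definition in_besov :: "(real^3 \<Rightarrow> real) \<Rightarrow> real \<Rightarrow> real \<Rightarrow> field \<Rightarrow> bool" where
  "in_besov chi s p c \<longleftrightarrow> besov_sq chi s p c < \<infinity>"

definition besov :: "(real^3 \<Rightarrow> real) \<Rightarrow> real \<Rightarrow> real \<Rightarrow> field \<Rightarrow> real" where
  "besov chi s p c = sqrt (enn2real (besov_sq chi s p c))"

definition besov_enn :: "(real^3 \<Rightarrow> real) \<Rightarrow> real \<Rightarrow> real \<Rightarrow> field \<Rightarrow> ennreal" where
  "besov_enn chi s p c = (if in_besov chi s p c then ennreal (besov chi s p c) else \<infinity>)"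

text \<open>Mean-free, real-valued (Hermitian-symmetric coefficients) fields.\<close>
definition admissible :: "field \<Rightarrow> bool" where
  "admissible c \<longleftrightarrow> c 0 = 0 \<and> (\<forall>k. c (- k) = (\<chi> i. cnj (c k $ i)))"

definition fcoeff :: "(real^3 \<Rightarrow> real^3) \<Rightarrow> field" where
  "fcoeff f k = (\<chi> i. complex_of_real (1 / (2 * pi)^3) *
       (LINT x:cube|lborel. cis (- (rvec k \<bullet> x)) * complex_of_real (f x $ i)))"

definition periodic3 :: "(real^3 \<Rightarrow> 'a) \<Rightarrow> bool" where
  "periodic3 f \<longleftrightarrow> (\<forall>x i. f (x + (2 * pi) *\<^sub>R axis i 1) = f x)"

definition Linf_norm :: "(real^3 \<Rightarrow> real^3) \<Rightarrow> ennreal" where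
  "Linf_norm f = Inf {M. AE x in lborel. x \<in> cube \<longrightarrow> ennreal (norm (f x)) \<le> M}"

text \<open>Fourier coefficients of a product of two scalar fields (discrete convolution).\<close>
definition conv :: "(int^3 \<Rightarrow> complex) \<Rightarrow> (int^3 \<Rightarrow> complex) \<Rightarrow> int^3 \<Rightarrow> complex" where
  "conv a b k = (\<Sum>\<^sub>\<infinity>m. a m * b (k - m))"

definition leray :: "int^3 \<Rightarrow> complex^3 \<Rightarrow> complex^3" where
  "leray k v = (if k = 0 then v else
     v - (((\<Sum>i\<in>UNIV. complex_of_real (real_of_int (k $ i)) * v $ i) / complex_of_real (ksq k))
          *s (\<chi> i. complex_of_real (real_of_int (k $ i)))))"

definition Pdiv_tensor :: "field \<Rightarrow> field \<Rightarrow> field" where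
  "Pdiv_tensor a b k = leray k (\<chi> i. \<i> * (\<Sum>j\<in>UNIV. complex_of_real (real_of_int (k $ j)) *
        conv (\<lambda>m. a m $ i) (\<lambda>m. b m $ j) k))"

text \<open>Nonlinear part of (PNS): P(R . grad R) + Q(u0,R), with P(R . grad R) = P div(R (x) R).\<close>
definition PNS_nonlin :: "field \<Rightarrow> field \<Rightarrow> field" where
  "PNS_nonlin u r k = Pdiv_tensor r r k + Pdiv_tensor u r k + Pdiv_tensor r u k"

definition PNS_duhamel :: "(real \<Rightarrow> real^3 \<Rightarrow> real^3) \<Rightarrow> field \<Rightarrow> (real \<Rightarrow> field)
     \<Rightarrow> (real \<Rightarrow> field) \<Rightarrow> bool" where
  "PNS_duhamel u0 R0 F R \<longleftrightarrow> (\<forall>t\<ge>0. \<forall>k.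
     ((\<lambda>s. exp (- (t - s) * ksq k) *\<^sub>R (F s k - PNS_nonlin (fcoeff (u0 s)) (R s) k))
        has_integral (R t k - exp (- t * ksq k) *\<^sub>R R0 k)) {0..t})"

definition sol_class :: "(real^3 \<Rightarrow> real) \<Rightarrow> real \<Rightarrow> (real \<Rightarrow> field) \<Rightarrow> bool" where
  "sol_class chi p R \<longleftrightarrow>
     (\<forall>t\<ge>0. admissible (R t) \<and> in_besov chi (-1 + 3/p) p (R t))
   \<and> (\<forall>t\<ge>0. \<forall>e>0. \<exists>d>0. \<forall>t'\<ge>0. \<bar>t' - t\<bar> < d \<longrightarrow>
          besov chi (-1 + 3/p) p (\<lambda>k. R t' k - R t k) < e)
   \<and> (\<exists>M. \<forall>t\<ge>0. besov chi (-1 + 3/p) p (R t) \<le> M)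
   \<and> (\<integral>\<^sup>+ t. indicator {0..} t * (besov_enn chi (3/p) p (R t))^2 \<partial>lborel) < \<infinity>"

end

theory Submission
  imports Defs
begin

text \<open>Let \<open>N j c\<close> be the \<open>L^p\<close> norm of the \<open>j\<close>-th block of \<open>c\<close>; blocks with \<open>j < 0\<close> vanish on mean-free
  fields, so \<open>j\<close> is a natural number. Put \<open>\<sigma> = -1 + 3/p\<close> and \<open>\<kappa> j \<tau> = (1 + 4^j \<tau>)^(-2)\<close>. Smooth
  multipliers have integrable kernels, with a quantitative bound from a weighted Parseval identity.
  This gives Bernstein's inequality, the decay \<open>C \<kappa> j \<tau>\<close> of the heat semigroup on the \<open>j\<close>-th block,
  and the bound of the \<open>j\<close>-th block of \<open>exp (\<tau> \<Delta>) P div (a \<otimes> b)\<close> by \<open>C 2^j \<kappa> j \<tau>\<close> times the sum over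
  \<open>i\<close>, \<open>i'\<close> of \<open>2^((3/p) min i i' j) N i a N i' b\<close>; if one factor is bounded, its sup norm replaces
  the weight and the first sum.

  In time, one controls the supremum of \<open>2^(j\<sigma>) N j\<close> and the \<open>L^2\<close> norm of \<open>2^(j(\<sigma>+1)) N j\<close> through
  Young's inequality for \<open>\<kappa> j\<close>. As \<open>-1 < \<sigma> < 0\<close>, the sums over \<open>i\<close>, \<open>i'\<close> decay geometrically off the
  diagonal, so multiples of one square summable frequency envelope are preserved. The drift
  \<open>u0\<close> is absorbed by cutting the time axis into pieces on which the integral of its squared sup norm
  is at most \<open>\<epsilon>\<close> and letting the majorant double from each piece to the next. There are at most
  \<open>1 + T/\<epsilon>\<close> pieces, where \<open>T\<close> is the total integral, whence the exponential in the smallness condition.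
  With this majorant the Picard iteration contracts; square summability of the envelope yields
  continuity in time. Uniqueness follows from the same estimates with the constant envelope on a short
  interval starting at the first time where two solutions differ.\<close>

text \<open>The divergence costs \<open>2^j\<close> and parabolic smoothing returns exactly that, so
  at this regularity no positive power of time is left from which to gain smallness. It has to come
  from the size of the data or, for the drift, from the smallness of an integral over a piece of the
  time axis.

  A product of two fields of negative regularity has no meaning by itself; the convolution of
  coefficients converges once both factors lie in \<open>B^(3/p)\<close>, which is known at almost
  every time only. Identities between nonlinear terms therefore hold almost everywhere, and bounds
  take values in \<open>ennreal\<close>, where an infinite right-hand side needs no separate
  treatment.

  No paraproduct decomposition is made. When this is the output, the passage is from
  \<open>L^(p/2)\<close> to \<open>L^p\<close>, and \<open>p > 3\<close> keeps the exponent
  \<open>p/2\<close> above 1. The rational profile \<open>\<kappa>\<close> replaces exponential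
  decay because its integral and its square root are both explicit.\<close>

abbreviation bmeas :: "('a::topological_space \<Rightarrow> 'b::topological_space) set" where
  "bmeas \<equiv> borel_measurable borel"

section \<open>Integration over the torus\<close>

text \<open>The weighted arithmetic-geometric mean inequality is integrated after dividing
  \<open>F\<close> and \<open>G\<close> by their integrals. Putting the exponents on nonnegative
  densities lets one statement serve as Hoelder, Cauchy-Schwarz and Jensen below.\<close>

lemma Holder_integral:
  fixes F G :: "'a \<Rightarrow> real"
  assumes ab: "0 < a" "0 < b" "a + b = 1"
    and F: "integrable M F" "\<And>x. 0 \<le> F x" and G: "integrable M G" "\<And>x. 0 \<le> G x"
  shows "integrable M (\<lambda>x. F x powr a * G x powr b)"
    and "(\<integral>x. F x powr a * G x powr b \<partial>M) \<le> (\<integral>x. F x \<partial>M) powr a * (\<integral>x. G x \<partial>M) powr b"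
proof -
  have [measurable]: "F \<in> borel_measurable M" "G \<in> borel_measurable M" using F G by auto
  have Y: "x powr a * y powr b \<le> a * x + b * y" if "0 \<le> x" "0 \<le> y" for x y
    using Youngs_inequality_0[of a b x y] ab that by (cases "x = 0 \<or> y = 0") auto
  show int: "integrable M (\<lambda>x. F x powr a * G x powr b)"
  proof (rule Bochner_Integration.integrable_bound)
    show "integrable M (\<lambda>x. a * F x + b * G x)" using F G by auto
    show "AE x in M. norm (F x powr a * G x powr b) \<le> norm (a * F x + b * G x)"
      using Y F G ab by (auto intro!: AE_I2)
  qed auto
  define A where "A = (\<integral>x. F x \<partial>M)"
  define B where "B = (\<integral>x. G x \<partial>M)"
  have A0: "A \<ge> 0" "B \<ge> 0" unfolding A_def B_def using F G by auto
  show "(\<integral>x. F x powr a * G x powr b \<partial>M) \<le> (\<integral>x. F x \<partial>M) powr a * (\<integral>x. G x \<partial>M) powr b"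
  proof (cases "A = 0 \<or> B = 0")
    case True
    then have "(AE x in M. F x = 0) \<or> (AE x in M. G x = 0)"
      unfolding A_def B_def using F G by (auto simp: integral_nonneg_eq_0_iff_AE)
    then have "AE x in M. F x powr a * G x powr b = 0" by auto
    then have "(\<integral>x. F x powr a * G x powr b \<partial>M) = (\<integral>x. 0 \<partial>M)"
      by (intro integral_cong_AE) auto
    then show ?thesis by simp
  next
    case False
    with A0 have AB: "A > 0" "B > 0" by auto
    have "F x powr a * G x powr b \<le> A powr a * B powr b * (a * (F x / A) + b * (G x / B))" for x
    proof -
      have "F x powr a * G x powr b = A powr a * B powr b * ((F x / A) powr a * (G x / B) powr b)"
        using AB F G by (simp add: powr_divide)
      also have "\<dots> \<le> A powr a * B powr b * (a * (F x / A) + b * (G x / B))"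
        using AB F G by (intro mult_left_mono Y) auto
      finally show ?thesis .
    qed
    then have "(\<integral>x. F x powr a * G x powr b \<partial>M)
        \<le> (\<integral>x. A powr a * B powr b * (a * (F x / A) + b * (G x / B)) \<partial>M)"
      using F G int by (intro integral_mono) auto
    also have "\<dots> = A powr a * B powr b * (a * (A / A) + b * (B / B))"
      using F G by (simp add: A_def B_def)
    also have "\<dots> = A powr a * B powr b" using AB ab by simp
    finally show ?thesis by (simp add: A_def B_def)
  qed
qed

text \<open>Integration over a period cell as a finite measure. Functions stay on
  \<open>real^3\<close>, and periodicity is a separate hypothesis wherever translations are
  used.\<close>

definition torus :: "(real^3) measure" where
  "torus = density lborel (\<lambda>x. ennreal (indicator cube x))"

lemma cube_cbox: "cube = cbox 0 (\<chi> i. 2 * pi)"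
  by (auto simp: cube_def cbox_def Basis_vec_def inner_axis)

lemma cube_sets[measurable]: "cube \<in> sets borel"
  unfolding cube_cbox by simp

lemma space_torus[simp]: "space torus = UNIV" by (simp add: torus_def)
lemma sets_torus[simp, measurable_cong]: "sets torus = sets borel" by (simp add: torus_def)

lemma emeasure_cbox_2pi: "emeasure lborel (cbox 0 ((\<chi> i. 2 * pi)::real^3)) = ennreal ((2*pi)^3)"
proof -
  have "(\<Prod>b\<in>(Basis::(real^3) set). ((\<chi> i. 2 * pi) - 0) \<bullet> b) = (\<Prod>b\<in>(Basis::(real^3) set). 2 * pi)"
    by (intro prod.cong) (auto simp: Basis_vec_def inner_axis)
  also have "\<dots> = (2*pi)^3" by simp
  finally show ?thesis
    by (subst emeasure_lborel_cbox) (auto simp: Basis_vec_def inner_axis)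
qed

lemma emeasure_torus: "emeasure torus UNIV = ennreal ((2*pi)^3)"
  unfolding torus_def using emeasure_cbox_2pi
  by (subst emeasure_density) (auto simp: cube_cbox[symmetric] ennreal_indicator)

interpretation torus: finite_measure torus
  by standard (simp add: emeasure_torus)

lemma torus_measure[simp]: "measure torus UNIV = (2*pi)^3"
  using emeasure_torus by (simp add: measure_def)

lemma set_integral_cube:
  fixes f :: "real^3 \<Rightarrow> 'b::{banach, second_countable_topology}"
  assumes [measurable]: "f \<in> bmeas"
  shows "(LINT x:cube|lborel. f x) = (\<integral>x. f x \<partial>torus)"
  unfolding torus_def set_lebesgue_integral_def by (subst integral_density) auto

lemma nn_integral_torus:
  assumes [measurable]: "f \<in> bmeas"
  shows "(\<integral>\<^sup>+x. f x \<partial>torus) = (\<integral>\<^sup>+x. indicator cube x * f x \<partial>lborel)"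
  unfolding torus_def by (subst nn_integral_density) (auto simp: ennreal_indicator)

lemma AE_torus:
  assumes "AE x in lborel. x \<in> cube \<longrightarrow> P x"
  shows "AE x in torus. P x"
  unfolding torus_def using assms by (subst AE_density) (auto simp: indicator_def elim!: AE_mp)

lemma integrable_torus_bounded:
  fixes f :: "real^3 \<Rightarrow> 'b::{banach, second_countable_topology}"
  assumes "f \<in> bmeas" "\<And>x. norm (f x) \<le> B"
  shows "integrable torus f"
  using assms by (intro torus.integrable_const_bound[of f B]) auto

subsection \<open>Periodicity\<close>

lemma rvec_inner: "rvec k \<bullet> x = (\<Sum>i\<in>UNIV. real_of_int (k $ i) * x $ i)"
  by (simp add: rvec_def inner_vec_def)

lemma rvec_diff: "rvec (k - l) = rvec k - rvec l" by (simp add: rvec_def vec_eq_iff)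
lemma rvec_minus: "rvec (- k) = - rvec k" by (simp add: rvec_def vec_eq_iff)
lemma rvec_0[simp]: "rvec 0 = 0" by (simp add: rvec_def vec_eq_iff)

lemma periodic3_int_axis:
  assumes "periodic3 f"
  shows "f (x + (2 * pi * real_of_int n) *\<^sub>R axis i 1) = f x"
proof -
  have nat: "f (x + (2 * pi * real m) *\<^sub>R axis i 1) = f x" for m x
  proof (induction m)
    case (Suc m)
    have "x + (2 * pi * real (Suc m)) *\<^sub>R axis i 1
        = (x + (2 * pi * real m) *\<^sub>R axis i 1) + (2 * pi) *\<^sub>R axis i 1"
      by (simp add: algebra_simps)
    then show ?case using assms Suc unfolding periodic3_def by metis
  qed simp
  show ?thesis
  proof (cases "n \<ge> 0")
    case True then show ?thesis using nat[of x "nat n"] by simp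
  next
    case False
    then show ?thesis
      using nat[of "x + (2 * pi * real_of_int n) *\<^sub>R axis i 1" "nat (-n)"]
      by (simp add: algebra_simps)
  qed
qed

lemma periodic3_lattice:
  assumes "periodic3 f"
  shows "f (x + (2 * pi) *\<^sub>R rvec z) = f x"
proof -
  have "f (x + (\<Sum>i\<in>I. (2 * pi * real_of_int (z $ i)) *\<^sub>R axis i 1)) = f x" if "finite I" for I
    using that
  proof (induction I rule: finite_induct)
    case (insert i I)
    then show ?case
      using periodic3_int_axis[OF assms, of "x + (\<Sum>i\<in>I. (2 * pi * real_of_int (z $ i)) *\<^sub>R axis i 1)" "z $ i" i]
      by (simp add: algebra_simps)
  qed simp
  moreover have "(\<Sum>i\<in>UNIV. (2 * pi * real_of_int (z $ i)) *\<^sub>R axis i 1) = (2*pi) *\<^sub>R rvec z"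
    by (simp add: vec_eq_iff rvec_def axis_def if_distrib[of "\<lambda>x. _ * x"] cong: if_cong)
  ultimately show ?thesis by (metis finite)
qed

text \<open>Half-open, so that its translates by the lattice \<open>2 pi Z^3\<close> are disjoint;
  the closed \<open>cube\<close> differs from it by a null set.\<close>

definition hcube :: "(real^3) set" where "hcube = {x. \<forall>i. 0 \<le> x $ i \<and> x $ i < 2 * pi}"

lemma hcube_sets[measurable]: "hcube \<in> sets borel"
proof -
  have eq: "hcube = (\<Inter>i\<in>UNIV. {x. 0 \<le> x $ i} \<inter> {x. x $ i < 2*pi})" by (auto simp: hcube_def)
  have "(\<lambda>x::real^3. x $ i) \<in> bmeas" for i
    by (intro borel_measurable_continuous_onI continuous_intros)
  then have "{x. 0 \<le> x $ i} \<inter> {x. x $ i < 2*pi} \<in> sets borel" for i :: 3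
    by measurable
  then show ?thesis unfolding eq by (intro sets.finite_INT) auto
qed

lemma AE_cube_hcube: "AE x in lborel. x \<in> cube \<longleftrightarrow> x \<in> hcube"
proof -
  let ?b = "(\<chi> i. 2 * pi) :: real^3"
  have e: "emeasure lborel (box 0 ?b) = emeasure lborel (cbox 0 ?b)"
    by (subst emeasure_lborel_cbox, force simp: Basis_vec_def inner_axis,
        subst emeasure_lborel_box, force simp: Basis_vec_def inner_axis, simp)
  have "emeasure lborel (cbox 0 ?b - box 0 ?b) = emeasure lborel (cbox 0 ?b) - emeasure lborel (box 0 ?b)"
    by (rule emeasure_Diff) (auto simp: e emeasure_cbox_2pi box_subset_cbox)
  also have "\<dots> = 0" unfolding e by (simp add: emeasure_cbox_2pi)
  finally have "cbox 0 ?b - box 0 ?b \<in> null_sets lborel" by auto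
  moreover have "{x. \<not> (x \<in> cube \<longleftrightarrow> x \<in> hcube)} \<subseteq> cbox 0 ?b - box 0 ?b"
    by (force simp: cube_def hcube_def cbox_def box_def Basis_vec_def inner_axis less_imp_le)
  ultimately show ?thesis by (intro AE_I') auto
qed

lemma hcube_tile: "(\<integral>\<^sup>+z. indicator hcube (x + (2*pi) *\<^sub>R rvec z) \<partial>count_space (UNIV::(int^3) set)) = 1"
proof -
  define z0 :: "int^3" where "z0 = (\<chi> i. - \<lfloor>x $ i / (2*pi)\<rfloor>)"
  have iff: "x + (2*pi) *\<^sub>R rvec z \<in> hcube \<longleftrightarrow> z = z0" for z
  proof -
    have "(0 \<le> x $ i + 2*pi*real_of_int (z $ i) \<and> x $ i + 2*pi*real_of_int (z $ i) < 2*pi)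
       \<longleftrightarrow> \<lfloor>x $ i / (2*pi)\<rfloor> = - z $ i" for i
      by (simp add: floor_eq_iff field_simps) argo
    then show ?thesis
      by (auto simp: hcube_def rvec_def z0_def vec_eq_iff)
  qed
  then have "(indicator hcube (x + (2*pi) *\<^sub>R rvec z)::ennreal) = indicator {z0} z" for z
    by (auto simp: indicator_def)
  then show ?thesis by simp
qed

lemma nn_integral_torus_hcube:
  assumes [measurable]: "f \<in> bmeas"
  shows "(\<integral>\<^sup>+x. f x \<partial>torus) = (\<integral>\<^sup>+x. indicator hcube x * f x \<partial>lborel)"
  unfolding nn_integral_torus[OF assms]
  by (rule nn_integral_cong_AE) (use AE_cube_hcube in \<open>auto simp: indicator_def\<close>)

lemma nn_integral_lborel_translate:
  fixes f :: "'a::euclidean_space \<Rightarrow> ennreal"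
  assumes [measurable]: "f \<in> bmeas"
  shows "(\<integral>\<^sup>+x. f (x + c) \<partial>lborel) = (\<integral>\<^sup>+x. f x \<partial>lborel)"
proof -
  have "(\<integral>\<^sup>+x. f x \<partial>lborel) = (\<integral>\<^sup>+x. f x \<partial>distr lborel borel ((+) c))"
    by (simp add: lborel_distr_plus)
  also have "\<dots> = (\<integral>\<^sup>+x. f (c + x) \<partial>lborel)" by (subst nn_integral_distr) auto
  finally show ?thesis by (simp add: add.commute)
qed

text \<open>Both cells \<open>hcube\<close> and \<open>hcube + h\<close> tile space under the period lattice, so the integral over
  one is a sum over lattice translates of the pieces of the other.\<close>
lemma nn_integral_torus_shift:
  fixes f :: "real^3 \<Rightarrow> ennreal"
  assumes [measurable]: "f \<in> bmeas" and per: "periodic3 f"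
  shows "(\<integral>\<^sup>+x. f (x + h) \<partial>torus) = (\<integral>\<^sup>+x. f x \<partial>torus)"
proof -
  let ?C = "count_space (UNIV::(int^3) set)"
  have "(\<integral>\<^sup>+x. f (x + h) \<partial>torus) = (\<integral>\<^sup>+x. indicator hcube (x + h - h) * f (x + h) \<partial>lborel)"
    by (subst nn_integral_torus_hcube) auto
  also have "\<dots> = (\<integral>\<^sup>+x. indicator hcube (x - h) * f x \<partial>lborel)"
    by (rule nn_integral_lborel_translate) measurable
  also have "\<dots> = (\<integral>\<^sup>+x. (\<integral>\<^sup>+z. indicator hcube (x + (2*pi) *\<^sub>R rvec z) \<partial>?C) * (indicator hcube (x - h) * f x) \<partial>lborel)"
    by (simp add: hcube_tile)
  also have "\<dots> = (\<integral>\<^sup>+x. (\<integral>\<^sup>+z. indicator hcube (x + (2*pi) *\<^sub>R rvec z) * (indicator hcube (x - h) * f x) \<partial>?C) \<partial>lborel)"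
    by (subst nn_integral_multc) auto
  also have "\<dots> = (\<integral>\<^sup>+z. (\<integral>\<^sup>+x. indicator hcube (x + (2*pi) *\<^sub>R rvec z) * (indicator hcube (x - h) * f x) \<partial>lborel) \<partial>?C)"
    by (rule nn_integral_count_space_nn_integral) auto
  also have "\<dots> = (\<integral>\<^sup>+z. (\<integral>\<^sup>+x. indicator hcube x * (indicator hcube (x - (2*pi) *\<^sub>R rvec z - h) * f x) \<partial>lborel) \<partial>?C)"
  proof (rule nn_integral_cong)
    fix z :: "int^3"
    have "(\<integral>\<^sup>+x. indicator hcube (x + (2*pi) *\<^sub>R rvec z) * (indicator hcube (x - h) * f x) \<partial>lborel)
      = (\<integral>\<^sup>+x. indicator hcube (x + (2*pi) *\<^sub>R rvec z) * (indicator hcube ((x + (2*pi) *\<^sub>R rvec z) - (2*pi) *\<^sub>R rvec z - h) * f (x + (2*pi) *\<^sub>R rvec z)) \<partial>lborel)"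
      using periodic3_lattice[OF per] by simp
    also have "\<dots> = (\<integral>\<^sup>+x. indicator hcube x * (indicator hcube (x - (2*pi) *\<^sub>R rvec z - h) * f x) \<partial>lborel)"
      by (rule nn_integral_lborel_translate) measurable
    finally show "(\<integral>\<^sup>+x. indicator hcube (x + (2*pi) *\<^sub>R rvec z) * (indicator hcube (x - h) * f x) \<partial>lborel)
      = (\<integral>\<^sup>+x. indicator hcube x * (indicator hcube (x - (2*pi) *\<^sub>R rvec z - h) * f x) \<partial>lborel)" .
  qed
  also have "\<dots> = (\<integral>\<^sup>+x. (\<integral>\<^sup>+z. indicator hcube x * (indicator hcube (x - (2*pi) *\<^sub>R rvec z - h) * f x) \<partial>?C) \<partial>lborel)"
    by (rule nn_integral_count_space_nn_integral[symmetric]) auto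
  also have "\<dots> = (\<integral>\<^sup>+x. (\<integral>\<^sup>+z. indicator hcube (x - (2*pi) *\<^sub>R rvec z - h) \<partial>?C) * (indicator hcube x * f x) \<partial>lborel)"
    by (subst nn_integral_multc[symmetric]) (auto simp: mult_ac)
  also have "\<dots> = (\<integral>\<^sup>+x. indicator hcube x * f x \<partial>lborel)"
  proof (intro nn_integral_cong)
    fix x :: "real^3"
    have "(\<integral>\<^sup>+z. indicator hcube (x - (2*pi) *\<^sub>R rvec z - h) \<partial>?C)
        = (\<integral>\<^sup>+z. indicator hcube ((x - h) + (2*pi) *\<^sub>R rvec (- z)) \<partial>?C)"
      by (simp add: rvec_minus algebra_simps)
    also have "\<dots> = (\<integral>\<^sup>+z. indicator hcube ((x - h) + (2*pi) *\<^sub>R rvec z) \<partial>?C)"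
      by (rule nn_integral_bij_count_space[where g="uminus"]) (auto intro!: bij_betwI[of _ _ _ uminus])
    also have "\<dots> = 1" by (rule hcube_tile)
    finally show "(\<integral>\<^sup>+z. indicator hcube (x - (2*pi) *\<^sub>R rvec z - h) \<partial>?C) * (indicator hcube x * f x) = indicator hcube x * f x"
      by simp
  qed
  also have "\<dots> = (\<integral>\<^sup>+x. f x \<partial>torus)" by (subst nn_integral_torus_hcube) auto
  finally show ?thesis .
qed

text \<open>The map \<open>x -> c - x\<close> with \<open>c = (2 pi, 2 pi, 2 pi)\<close> preserves
  Lebesgue measure and maps \<open>cube\<close> onto itself. As \<open>c\<close> is a lattice
  vector, periodicity removes it, and translation invariance removes \<open>h\<close>. Kernels occur
  as \<open>K (x - y)\<close> integrated in \<open>y\<close>, which calls for this form.\<close>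

lemma nn_integral_torus_reflect:
  fixes f :: "real^3 \<Rightarrow> ennreal"
  assumes [measurable]: "f \<in> bmeas" and per: "periodic3 f"
  shows "(\<integral>\<^sup>+x. f (h - x) \<partial>torus) = (\<integral>\<^sup>+x. f x \<partial>torus)"
proof -
  let ?c = "(\<chi> i. 2 * pi) :: real^3"
  have ind: "indicator cube (?c - x) = (indicator cube x :: ennreal)" for x
    by (auto simp: indicator_def cube_def)
  have fc: "f (h + (?c - x)) = f (h - x)" for x
  proof -
    have "?c = (2*pi) *\<^sub>R rvec (\<chi> i. 1)" by (simp add: rvec_def vec_eq_iff)
    then show ?thesis using periodic3_lattice[OF per, of "h - x" "\<chi> i. 1"]
      by (simp add: algebra_simps)
  qed
  have "(\<integral>\<^sup>+x. f (h + x) \<partial>torus) = (\<integral>\<^sup>+x. indicator cube x * f (h + x) \<partial>lborel)"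
    by (subst nn_integral_torus) auto
  also have "\<dots> = (\<integral>\<^sup>+x. indicator cube x * f (h + x) \<partial>distr lborel borel ((-) ?c))"
    using lborel_affine[of "-1" ?c] by (simp add: density_1)
  also have "\<dots> = (\<integral>\<^sup>+x. indicator cube (?c - x) * f (h + (?c - x)) \<partial>lborel)"
    by (subst nn_integral_distr) auto
  also have "\<dots> = (\<integral>\<^sup>+x. f (h - x) \<partial>torus)"
    unfolding ind fc by (subst nn_integral_torus) auto
  finally show ?thesis using nn_integral_torus_shift[OF assms, of h] by (simp add: add.commute)
qed

lemma integral_torus_shift:
  fixes f :: "real^3 \<Rightarrow> real"
  assumes [measurable]: "f \<in> bmeas" and per: "periodic3 f" and B: "\<And>x. \<bar>f x\<bar> \<le> B"
  shows "(\<integral>x. f (x + h) \<partial>torus) = (\<integral>x. f x \<partial>torus)"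
proof -
  \<comment> \<open>Adding the bound \<open>B\<close> makes the function nonnegative, so translation
    invariance of the nonnegative integral applies.\<close>
  have B': "0 \<le> f x + B" for x using B[of x] by linarith
  have *: "(\<integral>x. f (x + h) + B \<partial>torus) = (\<integral>x. f x + B \<partial>torus)"
  proof -
    have "(\<integral>\<^sup>+x. ennreal (f (x + h) + B) \<partial>torus) = (\<integral>\<^sup>+x. ennreal (f x + B) \<partial>torus)"
      by (rule nn_integral_torus_shift) (use per in \<open>auto simp: periodic3_def\<close>)
    then show ?thesis using B' by (subst (1 2) integral_eq_nn_integral) auto
  qed
  have "integrable torus (\<lambda>x. f (x + h))" "integrable torus f"
    using B by (auto intro!: integrable_torus_bounded[where B=B])
  with * show ?thesis by simp
qed

section \<open>Lebesgue norms on the torus\<close>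

definition lpn :: "real \<Rightarrow> (real^3 \<Rightarrow> 'b::{real_normed_vector}) \<Rightarrow> real" where
  "lpn p f = (\<integral>x. norm (f x) powr p \<partial>torus) powr (1 / p)"

lemma Lp_norm_lpn:
  assumes [measurable]: "g \<in> bmeas"
  shows "Lp_norm p g = lpn p g"
  unfolding Lp_norm_def lpn_def by (subst set_integral_cube) auto

lemma lpn_nonneg[simp]: "0 \<le> lpn p f" by (simp add: lpn_def)

lemma lpn_powr:
  assumes "p > 0" shows "lpn p f powr p = (\<integral>x. norm (f x) powr p \<partial>torus)"
proof -
  have "0 \<le> (\<integral>x. norm (f x) powr p \<partial>torus)" by simp
  then show ?thesis using assms by (simp add: lpn_def powr_powr)
qed

lemma lpn_leI:
  assumes "p > 0" "0 \<le> B" "(\<integral>x. norm (f x) powr p \<partial>torus) \<le> B powr p"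
  shows "lpn p f \<le> B"
proof -
  have "lpn p f \<le> (B powr p) powr (1/p)"
    unfolding lpn_def using assms by (intro powr_mono2) auto
  also have "\<dots> = B" using assms by (simp add: powr_powr)
  finally show ?thesis .
qed

lemma lpn_norm: "lpn p (\<lambda>x. norm (f x)) = lpn p f" by (simp add: lpn_def)

lemma integrable_powr_torus:
  fixes f :: "real^3 \<Rightarrow> 'b::{banach, second_countable_topology}"
  assumes [measurable]: "f \<in> bmeas" and "\<And>x. norm (f x) \<le> B" and "p > 0"
  shows "integrable torus (\<lambda>x. norm (f x) powr p)"
  using assms by (intro integrable_torus_bounded[where B="B powr p"]) (auto intro!: powr_mono2)

lemma lpn_mono:
  fixes f :: "real^3 \<Rightarrow> 'b::{banach, second_countable_topology}"
    and g :: "real^3 \<Rightarrow> 'c::{banach, second_countable_topology}"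
  assumes "f \<in> bmeas" "g \<in> bmeas"
    and "\<And>x. norm (g x) \<le> B" "\<And>x. norm (f x) \<le> norm (g x)" "p > 0"
  shows "lpn p f \<le> lpn p g"
proof (rule lpn_leI)
  have "norm (f x) \<le> B" for x using assms(3,4) order_trans by blast
  then show "(\<integral>x. norm (f x) powr p \<partial>torus) \<le> lpn p g powr p"
    unfolding lpn_powr[OF \<open>p > 0\<close>] using assms
    by (intro integral_mono integrable_powr_torus powr_mono2) auto
qed (use assms in auto)

lemma lpn_cmult:
  fixes f :: "real^3 \<Rightarrow> 'b::{real_normed_vector}"
  assumes "p > 0" "\<And>x. norm (g x) = c * norm (f x)" "0 \<le> c"
  shows "lpn p g = c * lpn p f"
  using assms by (simp add: lpn_def powr_mult powr_powr)

lemma lpn_le_sup: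
  fixes f :: "real^3 \<Rightarrow> 'b::{banach, second_countable_topology}"
  assumes [measurable]: "f \<in> bmeas" and B: "\<And>x. norm (f x) \<le> B" and "p > 0"
  shows "lpn p f \<le> ((2*pi)^3) powr (1/p) * B"
proof (rule lpn_leI[OF \<open>p > 0\<close>])
  have B0: "0 \<le> B" using B[of 0] norm_ge_zero order_trans by blast
  then show "0 \<le> ((2*pi)^3) powr (1/p) * B" by simp
  have "(\<integral>x. norm (f x) powr p \<partial>torus) \<le> (\<integral>x. B powr p \<partial>torus)"
    using assms by (intro integral_mono integrable_powr_torus powr_mono2) auto
  also have "\<dots> = (((2*pi)^3) powr (1/p) * B) powr p"
    using B0 \<open>p > 0\<close> by (simp add: powr_mult powr_powr)
  finally show "(\<integral>x. norm (f x) powr p \<partial>torus) \<le> (((2*pi)^3) powr (1/p) * B) powr p" .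
qed

text \<open>The form needed to prove Minkowski's inequality by duality: \<open>|f|^(p-1)\<close> is
  the extremal test function for the \<open>L^p\<close> norm of \<open>f\<close>.\<close>

lemma Holder_lpn:
  fixes f g :: "real^3 \<Rightarrow> 'b::{banach, second_countable_topology}"
  assumes [measurable]: "f \<in> bmeas" "g \<in> bmeas"
    and B: "\<And>x. norm (f x) \<le> B" "\<And>x. norm (g x) \<le> B'" and p: "p > 1"
  shows "(\<integral>x. norm (f x) powr (p - 1) * norm (g x) \<partial>torus) \<le> lpn p f powr (p - 1) * lpn p g"
proof -
  have I: "integrable torus (\<lambda>x. norm (f x) powr p)" "integrable torus (\<lambda>x. norm (g x) powr p)"
    using integrable_powr_torus[OF assms(1) B(1)] integrable_powr_torus[OF assms(2) B(2)] p by auto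
  have "(\<integral>x. (norm (f x) powr p) powr (1 - 1/p) * (norm (g x) powr p) powr (1/p) \<partial>torus)
     \<le> (\<integral>x. norm (f x) powr p \<partial>torus) powr (1 - 1/p) * (\<integral>x. norm (g x) powr p \<partial>torus) powr (1/p)"
    using p I by (intro Holder_integral) auto
  moreover have "p * (1 - 1/p) = p - 1" "(1/p) * (p - 1) = 1 - 1/p" using p by (simp_all add: field_simps)
  ultimately show ?thesis
    using p by (simp add: powr_powr lpn_def)
qed

text \<open>Two factors in \<open>L^p\<close> meet in \<open>L^(p/2)\<close>. This is the starting
  point for products whose output frequency is the lowest one.\<close>

lemma lpn_mult_half:
  fixes f g :: "real^3 \<Rightarrow> complex"
  assumes [measurable]: "f \<in> bmeas" "g \<in> bmeas"
    and B: "\<And>x. norm (f x) \<le> B" "\<And>x. norm (g x) \<le> B'" and p: "p > 0"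
  shows "lpn (p/2) (\<lambda>x. f x * g x) \<le> lpn p f * lpn p g"
proof (rule lpn_leI)
  have I: "integrable torus (\<lambda>x. norm (f x) powr p)" "integrable torus (\<lambda>x. norm (g x) powr p)"
    using integrable_powr_torus[OF assms(1) B(1)] integrable_powr_torus[OF assms(2) B(2)] p by auto
  have "(\<integral>x. (norm (f x) powr p) powr (1/2) * (norm (g x) powr p) powr (1/2) \<partial>torus)
     \<le> (\<integral>x. norm (f x) powr p \<partial>torus) powr (1/2) * (\<integral>x. norm (g x) powr p \<partial>torus) powr (1/2)"
    using p I by (intro Holder_integral) auto
  then show "(\<integral>x. norm (f x * g x) powr (p/2) \<partial>torus) \<le> (lpn p f * lpn p g) powr (p/2)"
    using p by (simp add: powr_powr lpn_def field_simps norm_mult powr_mult)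
qed (use p in auto)

text \<open>Write \<open>|h|^p = |h|^(p-1) |h|\<close>, insert the bound on \<open>|h|\<close>,
  exchange the integrals, apply Hoelder for each \<open>s\<close>, and cancel the power
  \<open>p - 1\<close> of the norm of \<open>h\<close>. The index space is a finite set for the
  triangle inequality and the time axis for Duhamel integrals.\<close>

lemma Minkowski_nn_integral:
  fixes g :: "'s \<Rightarrow> real^3 \<Rightarrow> 'b::{banach, second_countable_topology}"
    and h :: "real^3 \<Rightarrow> 'c::{banach, second_countable_topology}"
  assumes S: "sigma_finite_measure S"
    and [measurable]: "(\<lambda>(s, x). g s x) \<in> borel_measurable (S \<Otimes>\<^sub>M borel)" "h \<in> bmeas"
    and hB: "\<And>x. norm (h x) \<le> B" and gB: "\<And>s x. norm (g s x) \<le> B' s"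
    and le: "\<And>x. ennreal (norm (h x)) \<le> (\<integral>\<^sup>+s. ennreal (norm (g s x)) \<partial>S)"
    and p: "p > 1"
  shows "ennreal (lpn p h) \<le> (\<integral>\<^sup>+s. ennreal (lpn p (g s)) \<partial>S)"
proof (cases "lpn p h = 0")
  case False
  interpret S: sigma_finite_measure S by fact
  interpret P: pair_sigma_finite S torus ..
  define H where "H = lpn p h"
  have H: "H > 0" using False lpn_nonneg[of p h] unfolding H_def by linarith
  have [measurable]: "(\<lambda>(s, x). g s x) \<in> borel_measurable (S \<Otimes>\<^sub>M torus)"
    using assms(2) by simp
  have "ennreal (H powr p) = ennreal (\<integral>x. norm (h x) powr p \<partial>torus)"
    using p by (simp add: H_def lpn_powr)
  also have "\<dots> = (\<integral>\<^sup>+x. ennreal (norm (h x) powr p) \<partial>torus)"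
    using integrable_powr_torus[OF assms(3) hB] p by (subst nn_integral_eq_integral) auto
  also have "\<dots> \<le> (\<integral>\<^sup>+x. ennreal (norm (h x) powr (p - 1)) * (\<integral>\<^sup>+s. ennreal (norm (g s x)) \<partial>S) \<partial>torus)"
  proof (rule nn_integral_mono)
    fix x
    have "norm (h x) powr p = norm (h x) powr (p - 1) * norm (h x)"
      by (cases "h x = 0") (auto simp: powr_diff)
    then have "ennreal (norm (h x) powr p) = ennreal (norm (h x) powr (p - 1)) * ennreal (norm (h x))"
      by (simp add: ennreal_mult')
    then show "ennreal (norm (h x) powr p) \<le> ennreal (norm (h x) powr (p - 1)) * (\<integral>\<^sup>+s. ennreal (norm (g s x)) \<partial>S)"
      using le[of x] by (simp add: mult_left_mono)
  qed
  also have "\<dots> = (\<integral>\<^sup>+x. (\<integral>\<^sup>+s. ennreal (norm (h x) powr (p - 1) * norm (g s x)) \<partial>S) \<partial>torus)"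
    by (subst nn_integral_cmult[symmetric]) (auto simp: ennreal_mult')
  also have "\<dots> = (\<integral>\<^sup>+s. (\<integral>\<^sup>+x. ennreal (norm (h x) powr (p - 1) * norm (g s x)) \<partial>torus) \<partial>S)"
    by (rule P.Fubini') measurable
  also have "\<dots> \<le> (\<integral>\<^sup>+s. ennreal (H powr (p - 1)) * ennreal (lpn p (g s)) \<partial>S)"
  proof (rule nn_integral_mono)
    fix s assume s: "s \<in> space S"
    have [measurable]: "g s \<in> bmeas" using s by simp
    have ii: "integrable torus (\<lambda>x. norm (h x) powr (p - 1) * norm (g s x))"
    proof (rule integrable_torus_bounded)
      show "norm (norm (h x) powr (p - 1) * norm (g s x)) \<le> B powr (p - 1) * B' s" for x
        using hB[of x] gB[of s x] p
        by (simp, intro mult_mono powr_mono2) auto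
    qed measurable
    have "(\<integral>\<^sup>+x. ennreal (norm (h x) powr (p - 1) * norm (g s x)) \<partial>torus)
        = ennreal (\<integral>x. norm (h x) powr (p - 1) * norm (g s x) \<partial>torus)"
      using ii by (subst nn_integral_eq_integral) auto
    also have "\<dots> \<le> ennreal (H powr (p - 1) * lpn p (g s))"
      using Holder_lpn[of "\<lambda>x. norm (h x)" "\<lambda>x. norm (g s x)" B "B' s" p] hB gB p
      by (auto simp: lpn_norm H_def intro!: ennreal_leI)
    finally show "(\<integral>\<^sup>+x. ennreal (norm (h x) powr (p - 1) * norm (g s x)) \<partial>torus)
        \<le> ennreal (H powr (p - 1)) * ennreal (lpn p (g s))" by (simp add: ennreal_mult')
  qed
  also have "\<dots> = ennreal (H powr (p - 1)) * (\<integral>\<^sup>+s. ennreal (lpn p (g s)) \<partial>S)"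
    unfolding lpn_def by (rule nn_integral_cmult) measurable
  finally have *: "ennreal (H powr (p - 1)) * ennreal H \<le> ennreal (H powr (p - 1)) * (\<integral>\<^sup>+s. ennreal (lpn p (g s)) \<partial>S)"
    using H by (simp add: ennreal_mult'[symmetric] powr_diff)
  have "0 < H powr (p - 1)" using H by simp
  then show ?thesis using * unfolding H_def[symmetric]
    by (subst (asm) ennreal_mult_le_mult_iff) auto
qed simp

lemma lpn_sum_le:
  fixes g :: "'s \<Rightarrow> real^3 \<Rightarrow> 'b::{banach, second_countable_topology}"
    and h :: "real^3 \<Rightarrow> 'c::{banach, second_countable_topology}"
  assumes I: "finite I" and [measurable]: "\<And>s. s \<in> I \<Longrightarrow> g s \<in> bmeas" "h \<in> bmeas"
    and gB: "\<And>s x. s \<in> I \<Longrightarrow> norm (g s x) \<le> B' s"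
    and le: "\<And>x. norm (h x) \<le> (\<Sum>s\<in>I. norm (g s x))" and p: "p > 1"
  shows "lpn p h \<le> (\<Sum>s\<in>I. lpn p (g s))"
proof -
  define g' where "g' s x = (if s \<in> I then g s x else 0)" for s x
  have [measurable]: "g' s \<in> bmeas" for s
    using assms(2) by (cases "s \<in> I") (auto simp: g'_def[abs_def])
  have "ennreal (lpn p h) \<le> (\<integral>\<^sup>+s. ennreal (lpn p (g' s)) \<partial>count_space I)"
  proof (rule Minkowski_nn_integral)
    show "sigma_finite_measure (count_space I)"
      using I by (intro sigma_finite_measure_count_space_countable countable_finite)
    show "(\<lambda>(s, x). g' s x) \<in> borel_measurable (count_space I \<Otimes>\<^sub>M borel)"
      using I by (intro measurable_pair_measure_countable1) (auto simp: countable_finite)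
    show "norm (h x) \<le> (\<Sum>s\<in>I. B' s)" for x
      using le[of x] sum_mono[of I "\<lambda>s. norm (g s x)" B'] gB by (meson order_trans)
    show "norm (g' s x) \<le> (if s \<in> I then B' s else 0)" for s x using gB by (auto simp: g'_def)
    show "ennreal (norm (h x)) \<le> (\<integral>\<^sup>+s. ennreal (norm (g' s x)) \<partial>count_space I)" for x
      using I le[of x] by (subst nn_integral_count_space_finite) (auto simp: g'_def ennreal_leI sum_ennreal)
  qed (use p in auto)
  also have "\<dots> = ennreal (\<Sum>s\<in>I. lpn p (g s))"
    using I by (subst nn_integral_count_space_finite) (auto simp: g'_def[abs_def] sum_ennreal)
  finally show ?thesis by (simp add: sum_nonneg)
qed

section \<open>Trigonometric polynomials and Fourier multipliers\<close>

definition tp :: "(int^3) set \<Rightarrow> (int^3 \<Rightarrow> complex) \<Rightarrow> real^3 \<Rightarrow> complex" where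
  "tp A c x = (\<Sum>k\<in>A. c k * cis (rvec k \<bullet> x))"

definition fc :: "(real^3 \<Rightarrow> complex) \<Rightarrow> int^3 \<Rightarrow> complex" where
  "fc f k = (\<integral>x. cis (- (rvec k \<bullet> x)) * f x \<partial>torus) / of_real ((2*pi)^3)"

lemma cis_periodic: "cis (rvec k \<bullet> (x + (2*pi) *\<^sub>R axis i 1)) = cis (rvec k \<bullet> x)"
proof -
  have "rvec k \<bullet> (x + (2*pi) *\<^sub>R axis i 1) = rvec k \<bullet> x + 2 * pi * real_of_int (k $ i)"
    by (simp add: inner_add_right inner_axis rvec_def)
  then show ?thesis by (simp add: cis_mult[symmetric] cis_multiple_2pi)
qed

lemma continuous_cis_rvec[continuous_intros]: "continuous_on S (\<lambda>x. cis (rvec k \<bullet> x))"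
  by (intro continuous_intros)

lemma measurable_cis_rvec[measurable]: "(\<lambda>x. cis (rvec k \<bullet> x)) \<in> bmeas"
  by (intro borel_measurable_continuous_onI continuous_intros)

lemma measurable_cis_rvec_minus[measurable]: "(\<lambda>x. cis (- (rvec k \<bullet> x))) \<in> bmeas"
  by (intro borel_measurable_continuous_onI continuous_intros)

lemma tp_periodic: "periodic3 (tp A c)"
  unfolding periodic3_def tp_def by (auto simp: cis_periodic)

lemma tp_measurable[measurable]: "tp A c \<in> bmeas"
  unfolding tp_def by measurable

lemma tp_bound: "norm (tp A c x) \<le> (\<Sum>k\<in>A. norm (c k))"
  unfolding tp_def by (rule order_trans[OF norm_sum]) (simp add: norm_mult)

lemma integrable_tp: "integrable torus (tp A c)"
  by (rule integrable_torus_bounded[OF tp_measurable tp_bound])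

lemma integrable_norm_tp: "integrable torus (\<lambda>x. norm (tp A c x))"
  by (rule integrable_norm[OF integrable_tp])

text \<open>A translation that advances the phase by \<open>pi\<close>, along a coordinate with
  \<open>k $ i \<noteq> 0\<close>, changes the sign of cosine and sine, while translation invariance
  preserves their integrals.\<close>

lemma integral_cis:
  "(\<integral>x. cis (rvec k \<bullet> x) \<partial>torus) = (if k = 0 then of_real ((2*pi)^3) else 0)"
proof (cases "k = 0")
  case False
  then obtain i where i: "k $ i \<noteq> 0" by (auto simp: vec_eq_iff)
  define h :: "real^3" where "h = (pi / real_of_int (k $ i)) *\<^sub>R axis i 1"
  have kh: "rvec k \<bullet> (x + h) = rvec k \<bullet> x + pi" for x
    using i by (simp add: h_def inner_add_right inner_axis rvec_def)
  have per: "periodic3 (\<lambda>x. cos (rvec k \<bullet> x))" "periodic3 (\<lambda>x. sin (rvec k \<bullet> x))"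
    using cis_periodic unfolding periodic3_def cis.ctr complex.inject by blast+
  have m: "(\<lambda>x. cos (rvec k \<bullet> x)) \<in> bmeas" "(\<lambda>x. sin (rvec k \<bullet> x)) \<in> bmeas"
    by (intro borel_measurable_continuous_onI continuous_intros)+
  have "(\<integral>x. cos (rvec k \<bullet> x) \<partial>torus) = 0"
    using integral_torus_shift[OF m(1) per(1), of 1 h] unfolding kh by simp
  moreover have "(\<integral>x. sin (rvec k \<bullet> x) \<partial>torus) = 0"
    using integral_torus_shift[OF m(2) per(2), of 1 h] unfolding kh by simp
  moreover have int: "integrable torus (\<lambda>x. cis (rvec k \<bullet> x))"
    by (rule integrable_torus_bounded[where B=1]) auto
  ultimately have "(\<integral>x. cis (rvec k \<bullet> x) \<partial>torus) = 0"
    using integral_Re[OF int] integral_Im[OF int] by (intro complex_eqI) auto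
  then show ?thesis using False by simp
qed (simp add: scaleR_conv_of_real)

lemma integral_cis_cis:
  "(\<integral>x. cis (rvec k \<bullet> x) * cis (- (rvec l \<bullet> x)) \<partial>torus) = (if k = l then of_real ((2*pi)^3) else 0)"
  using integral_cis[of "k - l"] by (simp add: cis_mult rvec_diff inner_diff_left)

lemma fc_tp:
  assumes "finite A"
  shows "fc (tp A c) k = (if k \<in> A then c k else 0)"
proof -
  have "(\<integral>x. cis (- (rvec k \<bullet> x)) * tp A c x \<partial>torus)
      = (\<integral>x. (\<Sum>l\<in>A. c l * (cis (rvec l \<bullet> x) * cis (- (rvec k \<bullet> x)))) \<partial>torus)"
    unfolding tp_def by (simp add: sum_distrib_left mult_ac)
  also have "\<dots> = (\<Sum>l\<in>A. c l * (if l = k then of_real ((2*pi)^3) else 0))"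
  proof -
    have "integrable torus (\<lambda>x. cis (rvec l \<bullet> x) * cis (- (rvec k \<bullet> x)))" for l
      by (rule integrable_torus_bounded[where B=1]) (auto simp: norm_mult)
    then show ?thesis by (subst Bochner_Integration.integral_sum) (auto simp: integral_cis_cis)
  qed
  also have "\<dots> = (if k \<in> A then c k * of_real ((2*pi)^3) else 0)"
    using assms by (simp add: if_distrib sum.delta cong: if_cong)
  finally show ?thesis by (simp add: fc_def)
qed

lemma tp_multiplier:
  assumes f: "integrable torus f"
  shows "tp A (\<lambda>k. m k * fc f k) x = (\<integral>y. tp A m (x - y) * f y \<partial>torus) / of_real ((2*pi)^3)"
proof -
  have int: "integrable torus (\<lambda>y. cis (- (rvec k \<bullet> y)) * f y)" for k
    by (rule Bochner_Integration.integrable_bound[OF f]) (use f borel_measurable_integrable[OF f] in \<open>auto simp: norm_mult\<close>)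
  have "(\<integral>y. tp A m (x - y) * f y \<partial>torus)
      = (\<integral>y. (\<Sum>k\<in>A. (m k * cis (rvec k \<bullet> x)) * (cis (- (rvec k \<bullet> y)) * f y)) \<partial>torus)"
  proof -
    have "cis (rvec k \<bullet> (x - y)) = cis (rvec k \<bullet> x) * cis (- (rvec k \<bullet> y))" for k y
      by (simp add: cis_mult inner_diff_right)
    then show ?thesis unfolding tp_def by (simp add: sum_distrib_right sum_distrib_left mult_ac)
  qed
  also have "\<dots> = (\<Sum>k\<in>A. (m k * cis (rvec k \<bullet> x)) * (\<integral>y. cis (- (rvec k \<bullet> y)) * f y \<partial>torus))"
    using int by (subst Bochner_Integration.integral_sum) auto
  also have "\<dots> = of_real ((2*pi)^3) * tp A (\<lambda>k. m k * fc f k) x"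
    unfolding tp_def fc_def sum_distrib_left by (intro sum.cong) auto
  finally show ?thesis by simp
qed

lemma Parseval_tp:
  assumes "finite A"
  shows "(\<integral>x. (norm (tp A c x))^2 \<partial>torus) = (2*pi)^3 * (\<Sum>k\<in>A. (norm (c k))^2)"
proof -
  have int: "integrable torus (\<lambda>x. cis (rvec l \<bullet> x) * cis (- (rvec k \<bullet> x)))" for l k
    by (rule integrable_torus_bounded[where B=1]) (auto simp: norm_mult)
  have "complex_of_real (\<integral>x. (norm (tp A c x))^2 \<partial>torus) = (\<integral>x. complex_of_real ((norm (tp A c x))^2) \<partial>torus)"
    by (rule integral_complex_of_real[symmetric])
  also have "\<dots> = (\<integral>x. (\<Sum>k\<in>A. \<Sum>l\<in>A. (c k * cnj (c l)) * (cis (rvec k \<bullet> x) * cis (- (rvec l \<bullet> x)))) \<partial>torus)"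
    unfolding complex_norm_square tp_def
    by (simp add: sum_product cnj_sum cis_cnj mult_ac)
  also have "\<dots> = (\<Sum>k\<in>A. \<Sum>l\<in>A. (c k * cnj (c l)) * (if k = l then of_real ((2*pi)^3) else 0))"
    using int by (subst Bochner_Integration.integral_sum, force,
      subst Bochner_Integration.integral_sum, force, simp add: integral_cis_cis)
  also have "\<dots> = (\<Sum>k\<in>A. (c k * cnj (c k)) * of_real ((2*pi)^3))"
    using assms by (intro sum.cong) (auto simp: if_distrib sum.delta cong: if_cong)
  also have "\<dots> = complex_of_real ((2*pi)^3 * (\<Sum>k\<in>A. (norm (c k))^2))"
    unfolding of_real_mult of_real_sum complex_norm_square sum_distrib_left by (simp add: mult_ac)
  finally show ?thesis using of_real_eq_iff by blast
qed

lemma integral_norm_tp_reflect: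
  "(\<integral>y. norm (tp A m (x - y)) \<partial>torus) = (\<integral>y. norm (tp A m y) \<partial>torus)"
proof -
  have "(\<integral>\<^sup>+y. ennreal (norm (tp A m (x - y))) \<partial>torus) = (\<integral>\<^sup>+y. ennreal (norm (tp A m y)) \<partial>torus)"
    by (rule nn_integral_torus_reflect) (use tp_periodic[of A m] in \<open>auto simp: periodic3_def\<close>)
  then show ?thesis by (subst (1 2) integral_eq_nn_integral) auto
qed

lemma nn_integral_norm_tp_shift:
  "(\<integral>\<^sup>+x. ennreal (norm (tp A m (x - y))) \<partial>torus) = ennreal (\<integral>y. norm (tp A m y) \<partial>torus)"
proof -
  have "(\<integral>\<^sup>+x. ennreal (norm (tp A m (x + (- y)))) \<partial>torus) = (\<integral>\<^sup>+y. ennreal (norm (tp A m y)) \<partial>torus)"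
    by (rule nn_integral_torus_shift) (use tp_periodic[of A m] in \<open>auto simp: periodic3_def\<close>)
  then show ?thesis using integrable_norm_tp[of A m] by (subst (asm) nn_integral_eq_integral) auto
qed

text \<open>The bound on \<open>f\<close> is assumed almost everywhere because the drift is known
  only to be essentially bounded in space.\<close>

lemma multiplier_sup_AE:
  assumes [measurable]: "f \<in> bmeas" and B: "AE x in torus. norm (f x) \<le> B"
  shows "norm (tp A (\<lambda>k. m k * fc f k) x) \<le> (\<integral>y. norm (tp A m y) \<partial>torus) * B"
proof -
  have int: "integrable torus f" using B by (intro torus.integrable_const_bound[where B=B]) auto
  have i1: "integrable torus (\<lambda>y. norm (tp A m (x - y)) * B)"
    by (rule integrable_torus_bounded[where B="(\<Sum>k\<in>A. norm (m k)) * \<bar>B\<bar>"])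
       (auto simp: abs_mult intro!: mult_right_mono tp_bound)
  have "norm (\<integral>y. tp A m (x - y) * f y \<partial>torus) \<le> (\<integral>y. norm (tp A m (x - y)) * B \<partial>torus)"
  proof -
    have "norm (\<integral>y. tp A m (x - y) * f y \<partial>torus) \<le> (\<integral>y. norm (tp A m (x - y) * f y) \<partial>torus)"
      by (rule integral_norm_bound)
    also have "\<dots> \<le> (\<integral>y. norm (tp A m (x - y)) * B \<partial>torus)"
    proof (rule integral_mono_AE)
      show "integrable torus (\<lambda>y. norm (tp A m (x - y) * f y))"
        by (rule Bochner_Integration.integrable_bound[OF i1])
           (use B in \<open>auto simp: norm_mult abs_mult intro!: mult_left_mono elim!: AE_mp\<close>)
    qed (use B i1 in \<open>auto simp: norm_mult intro!: mult_left_mono elim!: AE_mp\<close>)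
    finally show ?thesis .
  qed
  also have "\<dots> = (\<integral>y. norm (tp A m y) \<partial>torus) * B" by (simp add: integral_norm_tp_reflect)
  finally have *: "norm (\<integral>y. tp A m (x - y) * f y \<partial>torus) \<le> (\<integral>y. norm (tp A m y) \<partial>torus) * B" .
  \<comment> \<open>The normalising factor \<open>1/(2*pi)^3\<close> of the coefficients is at most
    one and is dropped.\<close>
  have "1 \<le> (2*pi)^3" using pi_ge_two by (intro one_le_power) auto
  then have "norm (tp A (\<lambda>k. m k * fc f k) x) \<le> norm (\<integral>y. tp A m (x - y) * f y \<partial>torus)"
    unfolding tp_multiplier[OF int] by (simp add: norm_divide norm_power norm_mult divide_le_eq mult_le_cancel_left1)
  with * show ?thesis by linarith
qed

text \<open>Jensen's inequality for the measure \<open>|K(x - y)| dy\<close>: taking the supremum over \<open>x\<close> gives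
  Bernstein's inequality, integrating in \<open>x\<close> gives Young's.\<close>
lemma multiplier_Jensen:
  assumes [measurable]: "f \<in> bmeas" and B: "\<And>x. norm (f x) \<le> B" and q: "q > 1"
  shows "norm (tp A (\<lambda>k. m k * fc f k) x) powr q
     \<le> (\<integral>y. norm (tp A m y) \<partial>torus) powr (q - 1) * (\<integral>y. norm (tp A m (x - y)) * norm (f y) powr q \<partial>torus)"
proof -
  let ?K = "\<lambda>y. norm (tp A m (x - y))"
  have int: "integrable torus f" using B by (intro integrable_torus_bounded) auto
  have B0: "0 \<le> B" using B[of 0] norm_ge_zero order_trans by blast
  have i1: "integrable torus ?K"
    by (rule integrable_torus_bounded) (auto intro: tp_bound)
  have i2: "integrable torus (\<lambda>y. ?K y * norm (f y) powr q)"
    by (rule integrable_torus_bounded[where B="(\<Sum>k\<in>A. norm (m k)) * B powr q"])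
       (use q B in \<open>auto simp: abs_mult intro!: mult_mono tp_bound powr_mono2 sum_nonneg\<close>)
  have eq: "?K y * norm (f y) = ?K y powr (1 - 1/q) * (?K y * norm (f y) powr q) powr (1/q)" for y
  proof -
    have "?K y powr (1 - 1/q) * ?K y powr (1/q) = ?K y" by (simp add: powr_add[symmetric])
    then show ?thesis using q by (simp add: powr_mult powr_powr mult.assoc[symmetric])
  qed
  have "1 \<le> (2*pi)^3" using pi_ge_two by (intro one_le_power) auto
  then have "norm (tp A (\<lambda>k. m k * fc f k) x) \<le> norm (\<integral>y. tp A m (x - y) * f y \<partial>torus)"
    unfolding tp_multiplier[OF int] by (simp add: norm_divide norm_power norm_mult divide_le_eq mult_le_cancel_left1)
  also have "\<dots> \<le> (\<integral>y. ?K y * norm (f y) \<partial>torus)"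
    using integral_norm_bound[of torus "\<lambda>y. tp A m (x - y) * f y"] by (simp add: norm_mult)
  also have "\<dots> \<le> (\<integral>y. ?K y \<partial>torus) powr (1 - 1/q) * (\<integral>y. ?K y * norm (f y) powr q \<partial>torus) powr (1/q)"
    unfolding eq using q i1 i2 by (intro Holder_integral) auto
  finally have "norm (tp A (\<lambda>k. m k * fc f k) x) powr q
    \<le> ((\<integral>y. ?K y \<partial>torus) powr (1 - 1/q) * (\<integral>y. ?K y * norm (f y) powr q \<partial>torus) powr (1/q)) powr q"
    using q by (intro powr_mono2) auto
  also have "\<dots> = (\<integral>y. ?K y \<partial>torus) powr ((1 - 1/q) * q) * (\<integral>y. ?K y * norm (f y) powr q \<partial>torus)"
  proof -
    have "0 \<le> (\<integral>y. ?K y * norm (f y) powr q \<partial>torus)" by simp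
    then show ?thesis using q by (simp add: powr_mult powr_powr)
  qed
  also have "(1 - 1/q) * q = q - 1" using q by (simp add: field_simps)
  finally show ?thesis unfolding integral_norm_tp_reflect .
qed

lemma multiplier_lpn:
  assumes [measurable]: "f \<in> bmeas" and B: "\<And>x. norm (f x) \<le> B" and q: "q > 1"
  shows "lpn q (tp A (\<lambda>k. m k * fc f k)) \<le> (\<integral>y. norm (tp A m y) \<partial>torus) * lpn q f"
proof (rule lpn_leI)
  let ?k = "(\<integral>y. norm (tp A m y) \<partial>torus)"
  let ?g = "tp A (\<lambda>k. m k * fc f k)"
  have k0: "0 \<le> ?k" by simp
  interpret P: pair_sigma_finite torus torus ..
  have fq: "integrable torus (\<lambda>y. norm (f y) powr q)" using integrable_powr_torus[OF assms(1) B] q by auto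
  have i2: "integrable torus (\<lambda>y. norm (tp A m (x - y)) * norm (f y) powr q)" for x
    by (rule integrable_torus_bounded[where B="(\<Sum>k\<in>A. norm (m k)) * B powr q"])
       (use q B in \<open>auto simp: abs_mult intro!: mult_mono tp_bound powr_mono2 sum_nonneg\<close>)
  have "ennreal (\<integral>x. norm (?g x) powr q \<partial>torus) = (\<integral>\<^sup>+x. ennreal (norm (?g x) powr q) \<partial>torus)"
    using integrable_powr_torus[OF tp_measurable tp_bound, of q] q by (subst nn_integral_eq_integral) auto
  also have "\<dots> \<le> (\<integral>\<^sup>+x. ennreal (?k powr (q - 1)) * (\<integral>\<^sup>+y. ennreal (norm (tp A m (x - y))) * ennreal (norm (f y) powr q) \<partial>torus) \<partial>torus)"
  proof (rule nn_integral_mono)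
    fix x
    have "ennreal (norm (?g x) powr q) \<le> ennreal (?k powr (q - 1) * (\<integral>y. norm (tp A m (x - y)) * norm (f y) powr q \<partial>torus))"
      using multiplier_Jensen[OF assms(1) B q] by (rule ennreal_leI)
    also have "\<dots> = ennreal (?k powr (q - 1)) * (\<integral>\<^sup>+y. ennreal (norm (tp A m (x - y)) * norm (f y) powr q) \<partial>torus)"
      using i2[of x] by (subst nn_integral_eq_integral) (auto simp: ennreal_mult')
    finally show "ennreal (norm (?g x) powr q) \<le> ennreal (?k powr (q - 1)) * (\<integral>\<^sup>+y. ennreal (norm (tp A m (x - y))) * ennreal (norm (f y) powr q) \<partial>torus)"
      by (simp add: ennreal_mult')
  qed
  also have "\<dots> = ennreal (?k powr (q - 1)) * (\<integral>\<^sup>+x. (\<integral>\<^sup>+y. ennreal (norm (tp A m (x - y))) * ennreal (norm (f y) powr q) \<partial>torus) \<partial>torus)"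
    by (rule nn_integral_cmult) measurable
  also have "(\<integral>\<^sup>+x. (\<integral>\<^sup>+y. ennreal (norm (tp A m (x - y))) * ennreal (norm (f y) powr q) \<partial>torus) \<partial>torus)
     = (\<integral>\<^sup>+y. (\<integral>\<^sup>+x. ennreal (norm (tp A m (x - y))) * ennreal (norm (f y) powr q) \<partial>torus) \<partial>torus)"
    by (rule P.Fubini'[symmetric]) measurable
  also have "\<dots> = ennreal ?k * (\<integral>\<^sup>+y. ennreal (norm (f y) powr q) \<partial>torus)"
    by (simp add: nn_integral_multc nn_integral_norm_tp_shift nn_integral_cmult)
  also have "(\<integral>\<^sup>+y. ennreal (norm (f y) powr q) \<partial>torus) = ennreal (lpn q f powr q)"
    using fq q by (subst nn_integral_eq_integral) (auto simp: lpn_powr)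
  finally have "ennreal (\<integral>x. norm (?g x) powr q \<partial>torus) \<le> ennreal (?k powr (q - 1) * (?k * lpn q f powr q))"
    by (simp add: ennreal_mult')
  then have "(\<integral>x. norm (?g x) powr q \<partial>torus) \<le> ?k powr (q - 1) * (?k * lpn q f powr q)"
    by simp
  also have "\<dots> = (?k * lpn q f) powr q"
    using k0 by (cases "?k = 0") (auto simp: powr_mult powr_diff)
  finally show "(\<integral>x. norm (?g x) powr q \<partial>torus) \<le> (?k * lpn q f) powr q" .
qed (use q in auto)

text \<open>\<open>L\<close> is the ratio allowed between the sup norm and the integral of the
  kernel. It will be \<open>8^j\<close> on the \<open>j\<close>-th block, which makes
  \<open>L powr (1/q)\<close> the Bernstein factor \<open>2^(3j/q)\<close>.\<close>

lemma multiplier_sup: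
  assumes [measurable]: "f \<in> bmeas" and B: "\<And>x. norm (f x) \<le> B" and q: "q > 1"
    and M1: "(\<integral>y. norm (tp A m y) \<partial>torus) \<le> M" and M2: "\<And>y. norm (tp A m y) \<le> M * L" and L: "0 \<le> L"
  shows "norm (tp A (\<lambda>k. m k * fc f k) x) \<le> M * L powr (1/q) * lpn q f"
proof -
  let ?k = "(\<integral>y. norm (tp A m y) \<partial>torus)"
  have k0: "0 \<le> ?k" by simp
  have M0: "0 \<le> M" using M1 k0 by linarith
  have fq: "integrable torus (\<lambda>y. norm (f y) powr q)" using integrable_powr_torus[OF assms(1) B] q by auto
  have i2: "integrable torus (\<lambda>y. norm (tp A m (x - y)) * norm (f y) powr q)"
    by (rule integrable_torus_bounded[where B="(\<Sum>k\<in>A. norm (m k)) * B powr q"])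
       (use q B in \<open>auto simp: abs_mult intro!: mult_mono tp_bound powr_mono2 sum_nonneg\<close>)
  have "norm (tp A (\<lambda>k. m k * fc f k) x) powr q
     \<le> ?k powr (q - 1) * (\<integral>y. norm (tp A m (x - y)) * norm (f y) powr q \<partial>torus)"
    by (rule multiplier_Jensen[OF assms(1) B q])
  also have "\<dots> \<le> M powr (q - 1) * (\<integral>y. M * L * norm (f y) powr q \<partial>torus)"
    using fq i2 M1 M2 q k0 by (intro mult_mono powr_mono2 integral_mono mult_right_mono) auto
  also have "\<dots> = M powr (q - 1) * (M * L * lpn q f powr q)"
    using q by (simp add: lpn_powr)
  also have "\<dots> = (M * L powr (1/q) * lpn q f) powr q"
    using M0 L q by (cases "M = 0") (auto simp: powr_mult powr_diff powr_powr)
  finally have *: "norm (tp A (\<lambda>k. m k * fc f k) x) powr q \<le> (M * L powr (1/q) * lpn q f) powr q" .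
  have "0 \<le> M * L powr (1/q) * lpn q f" using M0 by simp
  then show ?thesis using * q powr_less_mono2[of q] by (meson not_le order_less_le_trans q less_trans zero_less_one)
qed

section \<open>Kernels of smooth multipliers\<close>

definition pd :: "3 \<Rightarrow> (real^3 \<Rightarrow> real) \<Rightarrow> real \<Rightarrow> real^3 \<Rightarrow> bool" where
  "pd i f d x \<longleftrightarrow> ((\<lambda>h. f (x + h *\<^sub>R axis i 1)) has_real_derivative d) (at 0)"

text \<open>One constant \<open>M\<close> bounds all iterated partial derivatives of order at most
  \<open>n\<close> on \<open>\<Omega>\<close>. Only derivatives along the axes enter, as in
  \<open>smooth3\<close>, and each of them is a witness chosen at its stage of the
  recursion.\<close>

primrec bd :: "nat \<Rightarrow> (real^3) set \<Rightarrow> (real^3 \<Rightarrow> real) \<Rightarrow> real \<Rightarrow> bool" where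
  "bd 0 \<Omega> f M \<longleftrightarrow> (\<forall>x\<in>\<Omega>. \<bar>f x\<bar> \<le> M)"
| "bd (Suc n) \<Omega> f M \<longleftrightarrow> (\<forall>x\<in>\<Omega>. \<bar>f x\<bar> \<le> M) \<and> (\<forall>i. \<exists>g. (\<forall>x\<in>\<Omega>. pd i f (g x) x) \<and> bd n \<Omega> g M)"

lemma pd_const: "pd i (\<lambda>_. c) 0 x" by (simp add: pd_def)
lemma pd_add: "pd i f a x \<Longrightarrow> pd i g b x \<Longrightarrow> pd i (\<lambda>x. f x + g x) (a + b) x"
  unfolding pd_def by (rule DERIV_add)
lemma pd_diff: "pd i f a x \<Longrightarrow> pd i g b x \<Longrightarrow> pd i (\<lambda>x. f x - g x) (a - b) x"
  unfolding pd_def by (rule DERIV_diff)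
lemma pd_mult: "pd i f a x \<Longrightarrow> pd i g b x \<Longrightarrow> pd i (\<lambda>x. f x * g x) (a * g x + f x * b) x"
  unfolding pd_def using DERIV_mult[of "\<lambda>h. f (x + h *\<^sub>R axis i 1)" a 0 UNIV "\<lambda>h. g (x + h *\<^sub>R axis i 1)" b]
  by (simp add: mult.commute add.commute)
lemma pd_coord: "pd i (\<lambda>x. x $ j) (if i = j then 1 else 0) x"
  unfolding pd_def by (auto simp: axis_def intro!: derivative_eq_intros)

lemma pd_chain: "pd i f a x \<Longrightarrow> (\<phi> has_real_derivative b) (at (f x)) \<Longrightarrow> pd i (\<lambda>x. \<phi> (f x)) (b * a) x"
  unfolding pd_def using DERIV_chain2[of \<phi> b "\<lambda>h. f (x + h *\<^sub>R axis i 1)" 0 a UNIV] by simp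

lemma pd_transform:
  assumes "open \<Omega>" "x \<in> \<Omega>" "\<And>y. y \<in> \<Omega> \<Longrightarrow> f y = g y" "pd i f d x"
  shows "pd i g d x"
proof -
  have "((\<lambda>h::real. x + h *\<^sub>R axis i 1) \<longlongrightarrow> x + 0 *\<^sub>R axis i 1) (at 0)"
    by (intro tendsto_intros)
  then have "eventually (\<lambda>h. x + h *\<^sub>R axis i 1 \<in> \<Omega>) (at (0::real))"
    using assms(1,2) by (simp add: topological_tendstoD)
  then have "eventually (\<lambda>h. f (x + h *\<^sub>R axis i 1) = g (x + h *\<^sub>R axis i 1)) (nhds (0::real))"
    using assms(2,3) unfolding eventually_at_filter by (auto elim!: eventually_mono)
  then show ?thesis using assms(4) unfolding pd_def by (subst (asm) DERIV_cong_ev) auto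
qed

lemma pd_unique: "pd i f a x \<Longrightarrow> pd i f b x \<Longrightarrow> a = b"
  unfolding pd_def by (rule DERIV_unique)

lemma bd_SucI:
  assumes "\<And>x. x \<in> \<Omega> \<Longrightarrow> \<bar>f x\<bar> \<le> M" "\<And>i x. x \<in> \<Omega> \<Longrightarrow> pd i f (g i x) x" "\<And>i. bd n \<Omega> (g i) M"
  shows "bd (Suc n) \<Omega> f M"
proof -
  have "\<exists>g. (\<forall>x\<in>\<Omega>. pd i f (g x) x) \<and> bd n \<Omega> g M" for i
    using assms(2,3) by (intro exI[of _ "g i"]) auto
  with assms(1) show ?thesis by simp
qed

lemma bd_SucE:
  assumes "bd (Suc n) \<Omega> f M"
  obtains g where "\<And>i x. x \<in> \<Omega> \<Longrightarrow> pd i f (g i x) x" "\<And>i. bd n \<Omega> (g i) M"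
proof -
  have "\<exists>g. \<forall>i. (\<forall>x\<in>\<Omega>. pd i f (g i x) x) \<and> bd n \<Omega> (g i) M"
    using assms by (intro choice) simp
  then show ?thesis using that by blast
qed

lemma bd_bound: "bd n \<Omega> f M \<Longrightarrow> x \<in> \<Omega> \<Longrightarrow> \<bar>f x\<bar> \<le> M" by (cases n) auto

lemma bd_mono: "bd n \<Omega> f M \<Longrightarrow> M \<le> M' \<Longrightarrow> bd n \<Omega> f M'"
proof (induction n arbitrary: f)
  case (Suc n)
  obtain g where g: "\<And>i x. x \<in> \<Omega> \<Longrightarrow> pd i f (g i x) x" "\<And>i. bd n \<Omega> (g i) M"
    using Suc.prems(1) by (rule bd_SucE) blast
  have "bd n \<Omega> (g i) M'" for i using Suc g by blast
  moreover have "\<bar>f x\<bar> \<le> M'" if "x \<in> \<Omega>" for x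
    using bd_bound[OF Suc.prems(1) that] Suc.prems(2) by linarith
  ultimately show ?case by (intro bd_SucI[where g=g] g(1)) auto
qed fastforce

lemma bd_Suc: "bd (Suc n) \<Omega> f M \<Longrightarrow> bd n \<Omega> f M"
proof (induction n arbitrary: f)
  case (Suc n)
  obtain g where g: "\<And>i x. x \<in> \<Omega> \<Longrightarrow> pd i f (g i x) x" "\<And>i. bd (Suc n) \<Omega> (g i) M"
    using Suc.prems by (rule bd_SucE) blast
  then show ?case using Suc.IH bd_bound[OF Suc.prems] by (intro bd_SucI[where g=g]) auto
qed simp

lemma bd_const: "\<bar>c\<bar> \<le> M \<Longrightarrow> bd n \<Omega> (\<lambda>_. c) M"
proof (induction n arbitrary: c)
  case (Suc n)
  moreover have "bd n \<Omega> (\<lambda>_. 0) M" using Suc.IH[of 0] Suc.prems by auto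
  ultimately show ?case using Suc.prems pd_const by (intro bd_SucI[where g="\<lambda>_ _. 0"]) auto
qed simp

lemma bd_transform:
  assumes "open \<Omega>"
  shows "bd n \<Omega> f M \<Longrightarrow> (\<And>x. x \<in> \<Omega> \<Longrightarrow> f x = g x) \<Longrightarrow> bd n \<Omega> g M"
proof (cases n)
  case (Suc m)
  assume *: "bd n \<Omega> f M" "\<And>x. x \<in> \<Omega> \<Longrightarrow> f x = g x"
  obtain G where G: "\<And>i x. x \<in> \<Omega> \<Longrightarrow> pd i f (G i x) x" "\<And>i. bd m \<Omega> (G i) M"
    using *(1) unfolding Suc by (rule bd_SucE) blast
  have "pd i g (G i x) x" if "x \<in> \<Omega>" for i x
    by (rule pd_transform[OF assms that _ G(1)[OF that]]) (rule *(2))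
  moreover have "\<bar>g x\<bar> \<le> M" if "x \<in> \<Omega>" for x using bd_bound[OF *(1) that] *(2)[OF that] by simp
  ultimately show ?thesis unfolding Suc using G(2) by (intro bd_SucI[where g=G]) auto
qed auto

lemma bd_add: "bd n \<Omega> f M \<Longrightarrow> bd n \<Omega> g M' \<Longrightarrow> bd n \<Omega> (\<lambda>x. f x + g x) (M + M')"
proof (induction n arbitrary: f g)
  case 0
  then show ?case by (auto intro: order_trans[OF abs_triangle_ineq] add_mono)
next
  case (Suc n)
  obtain f' where f': "\<And>i x. x \<in> \<Omega> \<Longrightarrow> pd i f (f' i x) x" "\<And>i. bd n \<Omega> (f' i) M"
    using Suc.prems(1) by (rule bd_SucE) blast
  obtain g' where g': "\<And>i x. x \<in> \<Omega> \<Longrightarrow> pd i g (g' i x) x" "\<And>i. bd n \<Omega> (g' i) M'"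
    using Suc.prems(2) by (rule bd_SucE) blast
  show ?case
  proof (rule bd_SucI[where g="\<lambda>i x. f' i x + g' i x"])
    show "\<bar>f x + g x\<bar> \<le> M + M'" if "x \<in> \<Omega>" for x
      using bd_bound[OF Suc.prems(1) that] bd_bound[OF Suc.prems(2) that] by linarith
  qed (use f' g' Suc.IH pd_add in auto)
qed

text \<open>Leibniz' rule doubles the number of terms at each order, hence
  \<open>2^n\<close>.\<close>

lemma bd_mult:
  assumes "0 \<le> M" "0 \<le> M'"
  shows "bd n \<Omega> f M \<Longrightarrow> bd n \<Omega> g M' \<Longrightarrow> bd n \<Omega> (\<lambda>x. f x * g x) (2^n * M * M')"
proof (induction n arbitrary: f g)
  case 0
  then show ?case using assms by (auto simp: abs_mult intro!: mult_mono)
next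
  case (Suc n)
  obtain f' where f': "\<And>i x. x \<in> \<Omega> \<Longrightarrow> pd i f (f' i x) x" "\<And>i. bd n \<Omega> (f' i) M"
    using Suc.prems(1) by (rule bd_SucE) blast
  obtain g' where g': "\<And>i x. x \<in> \<Omega> \<Longrightarrow> pd i g (g' i x) x" "\<And>i. bd n \<Omega> (g' i) M'"
    using Suc.prems(2) by (rule bd_SucE) blast
  have "bd n \<Omega> (\<lambda>x. f' i x * g x + f x * g' i x) (2^n * M * M' + 2^n * M * M')" for i
    by (intro bd_add Suc.IH f'(2) g'(2) bd_Suc[OF Suc.prems(1)] bd_Suc[OF Suc.prems(2)])
  then have B: "bd n \<Omega> (\<lambda>x. f' i x * g x + f x * g' i x) (2^Suc n * M * M')" for i by (simp add: mult_ac)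
  have "\<bar>f x * g x\<bar> \<le> 2^Suc n * M * M'" if "x \<in> \<Omega>" for x
  proof -
    have "\<bar>f x * g x\<bar> \<le> 1 * (M * M')"
      using bd_bound[OF Suc.prems(1) that] bd_bound[OF Suc.prems(2) that] assms
      by (auto simp: abs_mult intro!: mult_mono)
    also have "\<dots> \<le> 2^Suc n * (M * M')" using assms by (intro mult_right_mono one_le_power) auto
    finally show ?thesis by (simp add: mult.assoc)
  qed
  then show ?case
    by (intro bd_SucI[where g="\<lambda>i x. f' i x * g x + f x * g' i x"] pd_mult f' g' B) auto
qed

lemma bd_cmult: "bd n \<Omega> f M \<Longrightarrow> bd n \<Omega> (\<lambda>x. c * f x) (\<bar>c\<bar> * M)"
proof (induction n arbitrary: f)
  case 0
  then show ?case by (auto simp: abs_mult intro!: mult_left_mono)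
next
  case (Suc n)
  obtain f' where f': "\<And>i x. x \<in> \<Omega> \<Longrightarrow> pd i f (f' i x) x" "\<And>i. bd n \<Omega> (f' i) M"
    using Suc.prems(1) by (rule bd_SucE) blast
  have "pd i (\<lambda>x. c * f x) (c * f' i x) x" if "x \<in> \<Omega>" for i x
    using pd_mult[OF pd_const[of i c] f'(1)[OF that]] by simp
  then show ?case using Suc.IH f' bd_bound[OF Suc.prems]
    by (intro bd_SucI[where g="\<lambda>i x. c * f' i x"]) (auto simp: abs_mult intro!: mult_left_mono)
qed

lemma bd_coord:
  assumes "\<And>x. x \<in> \<Omega> \<Longrightarrow> \<bar>x $ j\<bar> \<le> M" "1 \<le> M"
  shows "bd n \<Omega> (\<lambda>x. x $ j) M"
proof (cases n)
  case (Suc m)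
  have "bd m \<Omega> (\<lambda>_. if i = j then 1 else 0) M" for i
    using assms(2) by (intro bd_const) auto
  then show ?thesis using pd_coord assms(1) unfolding Suc
    by (intro bd_SucI[where g="\<lambda>i _. if i = j then 1 else 0"]) auto
qed (use assms in auto)

text \<open>Off the closed set \<open>K\<close> the function vanishes on an open set, so its
  derivatives are zero there; on \<open>\<Omega>\<close> they agree with the given ones by
  uniqueness. The derivatives therefore vanish off \<open>K\<close> as well, which keeps the
  induction going.\<close>

lemma bd_extend:
  assumes \<Omega>: "open \<Omega>" "closed K" "K \<subseteq> \<Omega>" and M: "0 \<le> M"
  shows "bd n \<Omega> f M \<Longrightarrow> (\<And>x. x \<notin> K \<Longrightarrow> f x = 0) \<Longrightarrow> bd n UNIV f M"
proof (induction n arbitrary: f)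
  case 0
  then show ?case using M \<Omega> by simp (metis abs_zero subsetD)
next
  case (Suc n)
  obtain g where g: "\<And>i x. x \<in> \<Omega> \<Longrightarrow> pd i f (g i x) x" "\<And>i. bd n \<Omega> (g i) M"
    using Suc.prems(1) by (rule bd_SucE) blast
  define G where "G i x = (if x \<in> K then g i x else 0)" for i x
  have pd0: "pd i f 0 x" if "x \<notin> K" for i x
    by (rule pd_transform[of "- K" x "\<lambda>_. 0"]) (use \<Omega> that Suc.prems(2) pd_const in auto)
  have pdG: "pd i f (G i x) x" for i x using g(1)[of x i] \<Omega> pd0[of x i] by (auto simp: G_def)
  have gG: "g i x = G i x" if "x \<in> \<Omega>" for i x
    using pd_unique[OF g(1)[OF that] pdG] .
  have bdG: "bd n \<Omega> (G i) M" for i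
    by (rule bd_transform[OF \<Omega>(1) g(2)[of i]]) (rule gG)
  have "bd n UNIV (G i) M" for i by (rule Suc.IH[OF bdG]) (simp add: G_def)
  moreover have "\<bar>f x\<bar> \<le> M" for x
    using bd_bound[OF Suc.prems(1)] Suc.prems(2)[of x] M \<Omega>(3) by (cases "x \<in> K") auto
  ultimately show ?case using pdG by (intro bd_SucI[where g=G]) auto
qed

text \<open>By the mean value theorem each difference quotient costs one derivative.\<close>
lemma bd_difference:
  assumes "0 \<le> h"
  shows "bd (Suc n) UNIV f M \<Longrightarrow> bd n UNIV (\<lambda>x. f (x + h *\<^sub>R axis l 1) - f x) (h * M)"
proof (induction n arbitrary: f)
  have sup: "\<bar>f (x + h *\<^sub>R axis l 1) - f x\<bar> \<le> h * M" if bd1: "bd (Suc 0) UNIV f M" for f x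
  proof -
    obtain G where G: "\<And>i x. x \<in> UNIV \<Longrightarrow> pd i f (G i x) x" "\<And>i. bd 0 UNIV (G i) M"
      using bd1 by (rule bd_SucE) blast
    define g where "g = G l"
    have g: "\<And>x. pd l f (g x) x" "\<And>x. \<bar>g x\<bar> \<le> M" using G by (auto simp: g_def)
    have d: "((\<lambda>t. f (x + t *\<^sub>R axis l 1)) has_real_derivative g (x + t *\<^sub>R axis l 1)) (at t)" for t
    proof -
      have "((\<lambda>s. f ((x + t *\<^sub>R axis l 1) + s *\<^sub>R axis l 1)) has_real_derivative g (x + t *\<^sub>R axis l 1)) (at (t - t))"
        using g(1)[of "x + t *\<^sub>R axis l 1"] by (simp add: pd_def)
      then have "((\<lambda>t'. f ((x + t *\<^sub>R axis l 1) + (t' - t) *\<^sub>R axis l 1)) has_real_derivative g (x + t *\<^sub>R axis l 1)) (at t)"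
        using DERIV_chain2[of "\<lambda>s. f ((x + t *\<^sub>R axis l 1) + s *\<^sub>R axis l 1)" _ "\<lambda>t'. t' - t" t 1 UNIV]
          DERIV_diff[OF DERIV_ident[of "at t"] DERIV_const[of t "at t"]] by simp
      then show ?thesis by (simp add: algebra_simps)
    qed
    show ?thesis
    proof (cases "h = 0")
      case False
      then have "h > 0" using assms by simp
      from MVT2[OF this d] obtain z where "f (x + h *\<^sub>R axis l 1) - f (x + 0 *\<^sub>R axis l 1) = (h - 0) * g (x + z *\<^sub>R axis l 1)"
        by blast
      then show ?thesis using g(2) assms by (auto simp: abs_mult intro!: mult_left_mono)
    qed simp
  qed
  {
    case 0
    then show ?case using sup by simp
  next
    case (Suc n)
    obtain g where g: "\<And>i x. pd i f (g i x) x" "\<And>i. bd (Suc n) UNIV (g i) M"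
      using Suc.prems by (rule bd_SucE) auto
    have "pd i (\<lambda>x. f (x + h *\<^sub>R axis l 1) - f x) (g i (x + h *\<^sub>R axis l 1) - g i x) x" for i x
    proof (rule pd_diff)
      show "pd i (\<lambda>x. f (x + h *\<^sub>R axis l 1)) (g i (x + h *\<^sub>R axis l 1)) x"
        using g(1)[of i "x + h *\<^sub>R axis l 1"] by (simp add: pd_def algebra_simps)
    qed (use g in auto)
    moreover have "bd (Suc 0) UNIV f M"
      using bd_bound[OF Suc.prems] g(1) bd_bound[OF g(2)] by (intro bd_SucI[where g=g]) auto
    ultimately show ?case using sup Suc.IH[OF g(2)]
      by (intro bd_SucI[where g="\<lambda>i x. g i (x + h *\<^sub>R axis l 1) - g i x"]) auto
  }
qed

text \<open>Continuity on the compact closure of \<open>\<Omega>\<close> bounds each derivative. The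
  dilation by \<open>c\<close> is carried along because the cutoff is used at several scales; each
  derivative then gains a factor \<open>c\<close>.\<close>

lemma smooth3_bd:
  assumes \<Omega>: "bounded \<Omega>"
  shows "smooth3 f \<Longrightarrow> \<exists>M\<ge>0. bd n \<Omega> (\<lambda>x. f (c *\<^sub>R x)) M"
proof (induction n arbitrary: f)
  have sup: "\<exists>M\<ge>0. \<forall>x\<in>\<Omega>. \<bar>f (c *\<^sub>R x)\<bar> \<le> M" if "smooth3 f" for f
  proof -
    have "continuous_on UNIV f" using that by (rule smooth3.cases) auto
    then have "continuous_on (closure \<Omega>) (\<lambda>x. f (c *\<^sub>R x))"
      by (rule continuous_on_compose2) (auto intro!: continuous_intros)
    then have "compact ((\<lambda>x. f (c *\<^sub>R x)) ` closure \<Omega>)"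
      using \<Omega> by (intro compact_continuous_image) auto
    then have "bounded ((\<lambda>x. f (c *\<^sub>R x)) ` closure \<Omega>)" by (rule compact_imp_bounded)
    then obtain M where M: "\<forall>y\<in>(\<lambda>x. f (c *\<^sub>R x)) ` closure \<Omega>. norm y \<le> M"
      unfolding bounded_iff ..
    have "\<bar>f (c *\<^sub>R x)\<bar> \<le> \<bar>M\<bar>" if "x \<in> \<Omega>" for x
    proof -
      have "x \<in> closure \<Omega>" using that closure_subset by (rule subsetD[rotated])
      then show ?thesis using bspec[OF M imageI] by fastforce
    qed
    then show ?thesis by (intro exI[of _ "\<bar>M\<bar>"]) auto
  qed
  {
    case 0 then show ?case using sup by simp
  next
    case (Suc n)
    have "\<exists>g. (\<forall>x. pd i f (g x) x) \<and> smooth3 g" for i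
      using Suc.prems by (rule smooth3.cases) (auto simp: pd_def)
    then have "\<exists>g. \<forall>i. (\<forall>x. pd i f (g i x) x) \<and> smooth3 (g i)" by (intro choice) simp
    then obtain g where g: "\<And>i x. pd i f (g i x) x" "\<And>i. smooth3 (g i)" by blast
    obtain M0 where M0: "\<forall>x\<in>\<Omega>. \<bar>f (c *\<^sub>R x)\<bar> \<le> M0" "M0 \<ge> 0" using sup[OF Suc.prems] by auto
    have "\<exists>M. \<forall>i. M i \<ge> 0 \<and> bd n \<Omega> (\<lambda>x. g i (c *\<^sub>R x)) (M i)" using Suc.IH[OF g(2)] by (intro choice) simp
    then obtain M where M: "\<And>i. M i \<ge> 0" "\<And>i. bd n \<Omega> (\<lambda>x. g i (c *\<^sub>R x)) (M i)" by blast
    \<comment> \<open>The sum dominates the bound for the function and those for all its first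
      derivatives at once.\<close>
    define S where "S = M0 + (\<Sum>i\<in>UNIV. \<bar>c\<bar> * M i)"
    have S: "\<bar>c\<bar> * M i \<le> S" for i
      using member_le_sum[of i UNIV "\<lambda>i. \<bar>c\<bar> * M i"] M M0 by (auto simp: S_def)
    have "M0 \<le> S" using M by (auto simp: S_def intro!: sum_nonneg)
    moreover have "pd i (\<lambda>x. f (c *\<^sub>R x)) (c * g i (c *\<^sub>R x)) x" for i x
    proof -
      have "((\<lambda>h. f (c *\<^sub>R x + (c * h) *\<^sub>R axis i 1)) has_real_derivative (g i (c *\<^sub>R x) * c)) (at 0)"
        using g(1)[of i "c *\<^sub>R x"] DERIV_chain2[of "\<lambda>s. f (c *\<^sub>R x + s *\<^sub>R axis i 1)" _ "\<lambda>h. c * h" 0 c UNIV]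
          DERIV_cmult_Id[of c 0 UNIV] by (simp add: pd_def)
      then show ?thesis by (simp add: pd_def algebra_simps)
    qed
    moreover have "bd n \<Omega> (\<lambda>x. c * g i (c *\<^sub>R x)) S" for i
      using bd_mono[OF bd_cmult[OF M(2)] S] .
    ultimately have "bd (Suc n) \<Omega> (\<lambda>x. f (c *\<^sub>R x)) S" using M0(1) \<open>M0 \<le> S\<close>
      by (intro bd_SucI[where g="\<lambda>i x. c * g i (c *\<^sub>R x)"]) (auto intro: order_trans[OF _ \<open>M0 \<le> S\<close>])
    then show ?case using \<open>M0 \<le> S\<close> M0(2) by (intro exI[of _ S]) linarith
  }
qed

subsection \<open>Multipliers on an annulus\<close>

text \<open>An open neighbourhood of the shell \<open>1/4 \<le> norm x \<le> 4\<close> that carries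
  the dyadic symbols. It stays away from the origin, where the Leray projector is singular and the
  heat factor does not decay.\<close>

definition annulus :: "(real^3) set" where "annulus = {x. 1/8 < norm x \<and> norm x < 5}"

lemma open_annulus: "open annulus"
  unfolding annulus_def by (intro open_Collect_conj open_Collect_less continuous_intros)

lemma bounded_annulus: "bounded annulus"
  by (rule bounded_subset[OF bounded_ball[of 0 5]]) (auto simp: annulus_def)

lemma bd_annulus_coord: "bd n annulus (\<lambda>x. x $ j) 5"
proof (rule bd_coord)
  show "\<bar>x $ j\<bar> \<le> 5" if "x \<in> annulus" for x
    using that component_le_norm_cart[of x j] by (auto simp: annulus_def)
qed simp

lemma pd_norm_sq: "pd i (\<lambda>x. (norm x)^2) (2 * x $ i) x"
proof -
  have "(norm (x + h *\<^sub>R axis i 1))^2 = (norm x)^2 + 2 * h * x $ i + h^2" for h :: real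
    unfolding power2_norm_eq_inner
    by (simp add: inner_add_left inner_add_right inner_axis inner_axis' algebra_simps power2_eq_square)
  then show ?thesis unfolding pd_def by (auto intro!: derivative_eq_intros)
qed

text \<open>The derivative \<open>-2 x_i |x|^(-4)\<close> is a coordinate times two copies of the
  function itself, so the bound of order \<open>n\<close> and the product rule give the one of order
  \<open>n + 1\<close>.\<close>

lemma bd_annulus_inverse: "\<exists>M\<ge>0. bd n annulus (\<lambda>x. 1 / (norm x)^2) M"
proof (induction n)
  have sup: "\<bar>1 / (norm x)^2\<bar> \<le> 64" if "x \<in> annulus" for x
  proof -
    have "(1/8)^2 \<le> (norm x)^2" using that by (intro power_mono) (auto simp: annulus_def)
    moreover have "norm x > 0" using that norm_ge_zero[of x] by (auto simp: annulus_def)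
    ultimately show ?thesis by (simp add: field_simps power2_eq_square)
  qed
  {
    case 0 then show ?case using sup by (intro exI[of _ 64]) simp
  next
    case (Suc n)
    then obtain M where M: "M \<ge> 0" "bd n annulus (\<lambda>x. 1 / (norm x)^2) M" by auto
    let ?g = "\<lambda>i x::real^3. (- 2) * (x $ i * (1 / (norm x)^2 * (1 / (norm x)^2)))"
    let ?M = "\<bar>- 2\<bar> * (2^n * 5 * (2^n * M * M))"
    have "bd n annulus (?g i) ?M" for i
      using M by (intro bd_cmult bd_mult bd_annulus_coord) auto
    then have "bd n annulus (?g i) (max 64 ?M)" for i using bd_mono by (meson max.cobounded2)
    moreover have "pd i (\<lambda>x. 1 / (norm x)^2) (?g i x) x" if "x \<in> annulus" for i x
    proof -
      have "norm x \<noteq> 0" using that norm_ge_zero[of x] by (auto simp: annulus_def)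
      then have "((\<lambda>y. 1 / y) has_real_derivative (- 1 / ((norm x)^2)^2)) (at ((norm x)^2))"
        by (auto intro!: derivative_eq_intros simp: power2_eq_square)
      from pd_chain[OF pd_norm_sq this, of i] show ?thesis
        by (simp add: power2_eq_square field_simps)
    qed
    ultimately have "bd (Suc n) annulus (\<lambda>x. 1 / (norm x)^2) (max 64 ?M)"
      using sup by (intro bd_SucI[where g="?g"]) (auto intro: max.coboundedI1)
    then show ?case by (intro exI[of _ "max 64 ?M"]) auto
  }
qed

text \<open>Each derivative produces a factor \<open>\<tau>\<close>, hence the polynomial loss;
  \<open>exp (- \<tau> / 64)\<close> survives because \<open>norm x > 1/8\<close> on
  \<open>annulus\<close>.\<close>

lemma bd_annulus_exp:
  "\<exists>C\<ge>0. \<forall>\<tau>\<ge>0. bd n annulus (\<lambda>x. exp (- \<tau> * (norm x)^2)) (C * (1 + \<tau>)^n * exp (- \<tau> / 64))"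
proof (induction n)
  have sup: "\<bar>exp (- \<tau> * (norm x)^2)\<bar> \<le> exp (- \<tau> / 64)" if "x \<in> annulus" "\<tau> \<ge> 0" for x :: "real^3" and \<tau> :: real
  proof -
    have "(1/8)^2 \<le> (norm x)^2" using that by (intro power_mono) (auto simp: annulus_def)
    then have "\<tau> * (1/64) \<le> \<tau> * (norm x)^2" using that by (intro mult_left_mono) (auto simp: power2_eq_square)
    then show ?thesis by simp
  qed
  {
    case 0 then show ?case using sup by (intro exI[of _ 1]) simp
  next
    case (Suc n)
    then obtain C where C: "C \<ge> 0" "\<And>\<tau>. \<tau> \<ge> 0 \<Longrightarrow> bd n annulus (\<lambda>x. exp (- \<tau> * (norm x)^2)) (C * (1 + \<tau>)^n * exp (- \<tau> / 64))"
      by auto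
    define C' where "C' = max 1 (2 * 2^n * 5 * C)"
    have "bd (Suc n) annulus (\<lambda>x. exp (- \<tau> * (norm x)^2)) (C' * (1 + \<tau>)^Suc n * exp (- \<tau> / 64))" if \<tau>: "\<tau> \<ge> 0" for \<tau>
    proof -
      let ?B = "C' * (1 + \<tau>)^Suc n * exp (- \<tau> / 64)"
      let ?g = "\<lambda>i x::real^3. (- 2 * \<tau>) * (x $ i * exp (- \<tau> * (norm x)^2))"
      have "bd n annulus (?g i) (\<bar>- 2 * \<tau>\<bar> * (2^n * 5 * (C * (1 + \<tau>)^n * exp (- \<tau> / 64))))" for i
        using C \<tau> by (intro bd_cmult bd_mult bd_annulus_coord) auto
      moreover have "\<bar>- 2 * \<tau>\<bar> * (2^n * 5 * (C * (1 + \<tau>)^n * exp (- \<tau> / 64))) \<le> ?B"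
      proof -
        have "\<bar>- 2 * \<tau>\<bar> * (2^n * 5 * (C * (1 + \<tau>)^n * exp (- \<tau> / 64)))
          = (2 * 2^n * 5 * C) * (\<tau> * (1 + \<tau>)^n) * exp (- \<tau> / 64)" using \<tau> by simp
        also have "\<dots> \<le> C' * ((1 + \<tau>) * (1 + \<tau>)^n) * exp (- \<tau> / 64)"
          using \<tau> C by (intro mult_right_mono mult_mono) (auto simp: C'_def)
        finally show ?thesis by simp
      qed
      ultimately have "bd n annulus (?g i) ?B" for i using bd_mono by blast
      moreover have "pd i (\<lambda>x. exp (- \<tau> * (norm x)^2)) (?g i x) x" for i x
      proof -
        have "((\<lambda>y. exp (- \<tau> * y)) has_real_derivative (exp (- \<tau> * (norm x)^2) * (- \<tau>))) (at ((norm x)^2))"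
          by (auto intro!: derivative_eq_intros)
        from pd_chain[OF pd_norm_sq this, of i] show ?thesis by (simp add: mult_ac)
      qed
      moreover have "exp (- \<tau> / 64) \<le> ?B"
      proof -
        have "1 * 1 \<le> C' * (1 + \<tau>)^Suc n" using \<tau> by (intro mult_mono one_le_power) (auto simp: C'_def)
        then show ?thesis by (simp only: mult_le_cancel_right1) simp
      qed
      ultimately show ?thesis using order_trans[OF sup[OF _ \<tau>]] by (intro bd_SucI[where g="?g"]) blast+
    qed
    then show ?case by (intro exI[of _ C']) (auto simp: C'_def)
  }
qed

text \<open>The exponential absorbs the polynomial loss of three derivatives together with two
  further powers of \<open>1 + \<tau>\<close>. The factor \<open>(1 + \<tau>)^(-2)\<close> left over
  becomes \<open>kap\<close> after rescaling.\<close>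

lemma heat_multiplier_bd:
  assumes g: "bd 3 annulus g M" "0 \<le> M" and supp: "\<And>x. norm x < 1/4 \<or> 4 < norm x \<Longrightarrow> g x = 0"
  shows "\<exists>C\<ge>0. \<forall>\<tau>\<ge>0. bd 3 UNIV (\<lambda>x. g x * exp (- \<tau> * (norm x)^2)) (C / (1 + \<tau>)^2)"
proof -
  obtain C where C: "C \<ge> 0" "\<And>\<tau>. \<tau> \<ge> 0 \<Longrightarrow> bd 3 annulus (\<lambda>x. exp (- \<tau> * (norm x)^2)) (C * (1 + \<tau>)^3 * exp (- \<tau> / 64))"
    using bd_annulus_exp[of 3] by auto
  define C' where "C' = 2^3 * M * (C * 320^5)"
  have "bd 3 UNIV (\<lambda>x. g x * exp (- \<tau> * (norm x)^2)) (C' / (1 + \<tau>)^2)" if \<tau>: "\<tau> \<ge> 0" for \<tau>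
  proof (rule bd_extend[OF open_annulus, of "{x. 1/4 \<le> norm x \<and> norm x \<le> 4}"])
    show "closed {x::real^3. 1/4 \<le> norm x \<and> norm x \<le> 4}"
      by (intro closed_Collect_conj closed_Collect_le continuous_intros)
    \<comment> \<open>\<open>1 + \<tau> \<le> 320 (1 + \<tau>/320)\<close> with
      \<open>320 = 5 * 64\<close>, and \<open>(1 + y/5)^5 \<le> exp y\<close> at
      \<open>y = \<tau>/64\<close>.\<close>
    have "(1 + \<tau>)^5 * exp (- \<tau> / 64) \<le> 320^5"
    proof -
      have "(1 + (\<tau>/64) / real 5)^5 \<le> exp (\<tau>/64)"
        using \<tau> by (intro exp_ge_one_plus_x_over_n_power_n) auto
      moreover have "(1 + \<tau>)^5 \<le> (320 * (1 + (\<tau>/64) / real 5))^5"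
        using \<tau> by (intro power_mono) auto
      ultimately have "(1 + \<tau>)^5 \<le> 320^5 * exp (\<tau>/64)"
        by (simp only: power_mult_distrib) (smt (verit) mult_left_mono zero_le_power)
      then show ?thesis by (simp add: exp_minus field_simps)
    qed
    then have "(1 + \<tau>)^3 * exp (- \<tau> / 64) \<le> 320^5 / (1 + \<tau>)^2"
      using \<tau> by (simp add: field_simps power_add[symmetric])
    then have "2^3 * M * (C * ((1 + \<tau>)^3 * exp (- \<tau> / 64))) \<le> 2^3 * M * (C * (320^5 / (1 + \<tau>)^2))"
      using g C by (intro mult_left_mono) auto
    also have "\<dots> = C' / (1 + \<tau>)^2" by (simp add: C'_def)
    finally have "2^3 * M * (C * (1 + \<tau>)^3 * exp (- \<tau> / 64)) \<le> C' / (1 + \<tau>)^2" by (simp add: mult.assoc)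
    moreover have "bd 3 annulus (\<lambda>x. g x * exp (- \<tau> * (norm x)^2)) (2^3 * M * (C * (1 + \<tau>)^3 * exp (- \<tau> / 64)))"
      using g C \<tau> by (intro bd_mult) auto
    ultimately show "bd 3 annulus (\<lambda>x. g x * exp (- \<tau> * (norm x)^2)) (C' / (1 + \<tau>)^2)"
      using bd_mono by blast
    show "0 \<le> C' / (1 + \<tau>)^2" using C g by (simp add: C'_def)
    show "g x * exp (- \<tau> * (norm x)^2) = 0" if "x \<notin> {x. 1/4 \<le> norm x \<and> norm x \<le> 4}" for x
      using supp[of x] that by auto
  qed (auto simp: annulus_def)
  moreover have "C' \<ge> 0" using C g by (simp add: C'_def)
  ultimately show ?thesis by blast
qed

subsection \<open>Kernel bounds by weighted Parseval\<close>

definition bx :: "nat \<Rightarrow> (int^3) set" where "bx n = {k. \<forall>i. \<bar>k $ i\<bar> \<le> int n}"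

lemma bx_image: "bx n = (\<lambda>f. \<chi> i. f i) ` (PiE UNIV (\<lambda>_::3. {- int n..int n}))"
proof (intro equalityI subsetI)
  fix k assume "k \<in> bx n"
  then have "(\<lambda>i. k $ i) \<in> PiE UNIV (\<lambda>_::3. {- int n..int n})" by (auto simp: bx_def abs_le_iff) (smt (verit))
  then show "k \<in> (\<lambda>f. \<chi> i. f i) ` (PiE UNIV (\<lambda>_::3. {- int n..int n}))"
    by (intro image_eqI[of _ _ "\<lambda>i. k $ i"]) (auto simp: vec_eq_iff)
qed (auto simp: bx_def PiE_def Pi_def abs_le_iff, smt (verit))

lemma finite_bx[simp]: "finite (bx n)"
  unfolding bx_image by (intro finite_imageI finite_PiE) auto

lemma card_bx: "card (bx n) \<le> (2 * n + 1)^3"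
proof -
  have "card (bx n) \<le> card (PiE UNIV (\<lambda>_::3. {- int n..int n}))"
    unfolding bx_image by (intro card_image_le finite_PiE) auto
  also have "\<dots> = (2 * n + 1)^3" by (subst card_PiE) (auto simp: nat_add_distrib nat_mult_distrib)
  finally show ?thesis .
qed

lemma tp_mono_neutral:
  assumes "finite B" "A \<subseteq> B" "\<And>k. k \<in> B - A \<Longrightarrow> m k = 0"
  shows "tp A m x = tp B m x"
  unfolding tp_def using assms by (intro sum.mono_neutral_left) auto

text \<open>Summation by parts: multiplying a kernel by \<open>cis (- x $ l) - 1\<close> takes a
  forward difference of its coefficients in direction \<open>l\<close>. The vanishing assumptions
  remove the boundary terms of the finite sum.\<close>

lemma tp_shift:
  assumes A: "finite A" and m: "\<And>k. k \<notin> A \<Longrightarrow> m k = 0" "\<And>k. k \<notin> A \<Longrightarrow> m (k + axis l 1) = 0"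
  shows "(cis (- (x $ l)) - 1) * tp A m x = tp A (\<lambda>k. m (k + axis l 1) - m k) x"
proof -
  let ?e = "axis l 1 :: int^3"
  have re: "rvec ?e \<bullet> x = x $ l" by (simp add: rvec_inner axis_def if_distrib[of of_int] if_distrib[of "\<lambda>z. z * _"] cong: if_cong)
  have "tp A (\<lambda>k. m (k + ?e)) x = (\<Sum>k\<in>(\<lambda>k. k + ?e) ` A. m k * cis (rvec (k - ?e) \<bullet> x))"
    unfolding tp_def by (subst sum.reindex) (auto simp: inj_on_def)
  also have "\<dots> = (\<Sum>k\<in>A. m k * cis (rvec (k - ?e) \<bullet> x))"
  proof (rule sum.mono_neutral_cong)
    fix k assume "k \<in> A - (\<lambda>k. k + ?e) ` A"
    then have "k - ?e \<notin> A" by (metis DiffD2 diff_add_cancel imageI)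
    then show "m k * cis (rvec (k - ?e) \<bullet> x) = 0" using m(2)[of "k - ?e"] by simp
  qed (use A m in auto)
  also have "\<dots> = cis (- (x $ l)) * tp A m x"
  proof -
    have "cis (rvec (k - ?e) \<bullet> x) = cis (- (x $ l)) * cis (rvec k \<bullet> x)" for k
      by (simp add: rvec_diff inner_diff_left re cis_mult)
    then show ?thesis unfolding tp_def sum_distrib_left by (simp add: mult_ac)
  qed
  finally show ?thesis by (simp add: tp_def algebra_simps sum_subtractf)
qed

lemma integrable_torus_continuous:
  fixes f :: "real^3 \<Rightarrow> 'b::{banach, second_countable_topology}"
  assumes "continuous_on UNIV f"
  shows "integrable torus f"
proof -
  have "compact (f ` cube)"
    unfolding cube_cbox using assms continuous_on_subset by (intro compact_continuous_image) auto
  then have "bounded (f ` cube)" by (rule compact_imp_bounded)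
  then obtain B where "\<forall>y\<in>f ` cube. norm y \<le> B" unfolding bounded_iff ..
  then have "AE x in torus. norm (f x) \<le> B" by (intro AE_torus AE_I2) auto
  moreover have "f \<in> borel_measurable torus" using borel_measurable_continuous_onI[OF assms] by simp
  ultimately show ?thesis by (intro torus.integrable_const_bound)
qed

lemma continuous_tp[continuous_intros]: "continuous_on S (tp A c)"
  unfolding tp_def by (intro continuous_intros)

text \<open>Each direction in \<open>L\<close> splits the weighted integral into one for
  \<open>f\<close> and one for its difference with step \<open>h\<close>. The difference has size
  \<open>h * M\<close>, which cancels the \<open>h^2\<close> in the weight, so a direction costs a
  factor 2. Every difference enlarges the support by \<open>h\<close>; the condition on
  \<open>\<rho>\<close> keeps it inside the box.\<close>

lemma weighted_Parseval:
  fixes f :: "real^3 \<Rightarrow> real"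
  assumes h: "0 < h"
  shows "bd (length L) UNIV f M \<Longrightarrow> 0 \<le> M \<Longrightarrow> (\<And>x i. \<rho> < \<bar>x $ i\<bar> \<Longrightarrow> f x = 0) \<Longrightarrow> \<rho> + real (length L) * h \<le> h * real n \<Longrightarrow>
    (\<integral>x. (norm (tp (bx n) (\<lambda>k. of_real (f (h *\<^sub>R rvec k))) x))^2 * (\<Prod>l\<leftarrow>L. 1 + (norm (cis (- (x $ l)) - 1))^2 / h^2) \<partial>torus)
     \<le> 2 ^ length L * ((2*pi)^3 * real (card (bx n)) * M^2)"
proof (induction L arbitrary: f M \<rho>)
  case Nil
  have "(norm (complex_of_real (f (h *\<^sub>R rvec k))))^2 \<le> M^2" for k
    using Nil(1) by (auto simp: power2_le_iff_abs_le Nil(2) power_mono)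
  then have "(\<Sum>k\<in>bx n. (norm (complex_of_real (f (h *\<^sub>R rvec k))))^2) \<le> (\<Sum>k\<in>bx n. M^2)"
    by (intro sum_mono)
  then show ?case by (simp add: Parseval_tp mult.assoc)
next
  case (Cons l L)
  define Df where "Df x = f (x + h *\<^sub>R axis l 1) - f x" for x
  define V where "V x = (\<Prod>l\<leftarrow>L. 1 + (norm (cis (- (x $ l)) - 1))^2 / h^2)" for x :: "real^3"
  have V: "continuous_on UNIV V"
    unfolding V_def by (induction L) (auto intro!: continuous_intros simp: less_imp_neq[OF h, symmetric])
  let ?K = "\<lambda>f. tp (bx n) (\<lambda>k. of_real (f (h *\<^sub>R rvec k)))"
  have bdD: "bd (length L) UNIV Df (h * M)"
    unfolding Df_def using h Cons.prems(1) by (intro bd_difference) auto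
  have supp: "Df x = 0" if "\<rho> + h < \<bar>x $ i\<bar>" for x i
  proof -
    have "\<rho> < \<bar>(x + h *\<^sub>R axis l 1) $ i\<bar>" "\<rho> < \<bar>x $ i\<bar>"
      using that h by (auto simp: axis_def)
    then show ?thesis using Cons.prems(3) by (simp add: Df_def)
  qed
  have out: "f (h *\<^sub>R rvec k) = 0 \<and> f (h *\<^sub>R rvec (k + axis l 1)) = 0" if kn: "k \<notin> bx n" for k
  proof -
    obtain i where i: "int n < \<bar>k $ i\<bar>" using kn by (auto simp: bx_def not_le)
    have "\<rho> + h \<le> h * real n" using Cons.prems(4) h by (simp add: algebra_simps) (smt (verit) mult_nonneg_nonneg of_nat_0_le_iff)
    also have "\<dots> < h * \<bar>real_of_int (k $ i)\<bar>" using i h by simp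
    finally have 1: "\<rho> + h < \<bar>(h *\<^sub>R rvec k) $ i\<bar>" using h by (simp add: rvec_def abs_mult)
    have eq: "h *\<^sub>R rvec (k + axis l 1) = h *\<^sub>R rvec k + h *\<^sub>R axis l 1"
      by (simp add: rvec_def vec_eq_iff axis_def algebra_simps)
    have "\<rho> < \<bar>(h *\<^sub>R rvec (k + axis l 1)) $ i\<bar>"
      unfolding eq using 1 h by (auto simp: axis_def)
    moreover have "\<rho> < \<bar>(h *\<^sub>R rvec k) $ i\<bar>" using 1 h by linarith
    ultimately show ?thesis using Cons.prems(3) by blast
  qed
  have KD: "?K Df x = (cis (- (x $ l)) - 1) * ?K f x" for x
  proof -
    have "h *\<^sub>R rvec (k + axis l 1) = h *\<^sub>R rvec k + h *\<^sub>R axis l 1" for k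
      by (simp add: rvec_def vec_eq_iff axis_def algebra_simps)
    then show ?thesis using out by (subst tp_shift) (auto simp: Df_def)
  qed
  have "(\<integral>x. (norm (?K f x))^2 * (\<Prod>l\<leftarrow>l#L. 1 + (norm (cis (- (x $ l)) - 1))^2 / h^2) \<partial>torus)
      = (\<integral>x. (norm (?K f x))^2 * V x + (norm (?K Df x))^2 * V x / h^2 \<partial>torus)"
  proof (intro Bochner_Integration.integral_cong refl)
    fix x
    have 1: "b * ((1 + a / h^2) * v) = b * v + a * b * v / h^2" for a b v :: real
      by (simp add: algebra_simps)
    show "(norm (?K f x))^2 * (\<Prod>l\<leftarrow>l#L. 1 + (norm (cis (- (x $ l)) - 1))^2 / h^2)
        = (norm (?K f x))^2 * V x + (norm (?K Df x))^2 * V x / h^2"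
      unfolding KD norm_mult power_mult_distrib V_def list.map prod_list.Cons by (rule 1)
  qed
  also have "\<dots> = (\<integral>x. (norm (?K f x))^2 * V x \<partial>torus) + (\<integral>x. (norm (?K Df x))^2 * V x \<partial>torus) / h^2"
    using h by (subst Bochner_Integration.integral_add)
       (auto intro!: integrable_torus_continuous continuous_intros V simp: less_imp_neq[OF h])
  also have "\<dots> \<le> 2 ^ length L * ((2*pi)^3 * real (card (bx n)) * M^2) + 2 ^ length L * ((2*pi)^3 * real (card (bx n)) * (h * M)^2) / h^2"
  proof (intro add_mono divide_right_mono)
    show "(\<integral>x. (norm (?K f x))^2 * V x \<partial>torus) \<le> 2 ^ length L * ((2*pi)^3 * real (card (bx n)) * M^2)"
      unfolding V_def using Cons.prems h by (intro Cons.IH[of f M \<rho>]) (auto intro: bd_Suc simp: algebra_simps)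
    show "(\<integral>x. (norm (?K Df x))^2 * V x \<partial>torus) \<le> 2 ^ length L * ((2*pi)^3 * real (card (bx n)) * (h * M)^2)"
      unfolding V_def using Cons.prems h by (intro Cons.IH[of Df "h * M" "\<rho> + h"] bdD supp) (auto simp: algebra_simps)
  qed auto
  also have "\<dots> = 2 ^ length (l#L) * ((2*pi)^3 * real (card (bx n)) * M^2)"
    using h by (simp add: power_mult_distrib)
  finally show ?case .
qed

text \<open>The right side is \<open>4 sin^2 (t/2)\<close>, and \<open>sin s \<ge> s/2\<close> for
  \<open>s \<le> pi/2\<close> follows from the Taylor bound \<open>sin s \<ge> s - s^3/6\<close>,
  since \<open>s^2 \<le> 3\<close>.\<close>

lemma norm_cis_minus_one_lower:
  assumes "0 \<le> t" "t \<le> pi"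
  shows "(t/2)^2 \<le> 2 - 2 * cos t"
proof -
  define s where "s = t/2"
  have s: "0 \<le> s" "s \<le> pi/2" "t = 2 * s" using assms by (auto simp: s_def)
  have "\<bar>sin s - (\<Sum>m<3. sin_coeff m * s ^ m)\<bar> \<le> inverse (fact 3) * \<bar>s\<bar> ^ 3"
    by (rule Maclaurin_sin_bound)
  then have 1: "\<bar>sin s - s\<bar> \<le> s^3 / 6"
    using s by (simp add: sin_coeff_def numeral_eq_Suc)
  have "s^2 \<le> 2^2" using s pi_less_4 by (intro power_mono) auto
  then have "s * s^2 \<le> s * 4" using s by (intro mult_left_mono) auto
  then have "s^3 \<le> 4 * s" by (simp add: power3_eq_cube power2_eq_square)
  then have 2: "\<bar>sin s - s\<bar> \<le> 2/3 * s" using 1 by linarith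
  have "s^2 \<le> 3"
  proof -
    have "s \<le> 1.71" using s pi_approx by simp
    then have "s^2 \<le> 1.71^2" using s by (intro power_mono) auto
    then show ?thesis by (simp add: power2_eq_square)
  qed
  then have "s * s^2 \<le> s * 3" using s by (intro mult_left_mono) auto
  then have "s^3 \<le> 3 * s" by (simp add: power3_eq_cube power2_eq_square)
  then have "s / 2 \<le> sin s" using 1 by linarith
  then have "(s/2)^2 \<le> (sin s)^2" using s by (intro power_mono) auto
  moreover have "2 - 2 * cos t = 4 * (sin s)^2" unfolding s(3) cos_double_sin by simp
  ultimately show ?thesis unfolding s(3) by (simp add: power_divide)
qed

text \<open>The weight is at least \<open>1 + (t/(2h))^2\<close> on the first half of the period and
  the reflected expression on the second, whence the two summands of \<open>G\<close> with
  arctangent primitives. What matters is that the integral is \<open>O(h)\<close>.\<close>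

lemma weight_integral_1d:
  assumes h: "0 < h"
  shows "(\<integral>\<^sup>+t. ennreal (1 / (1 + (norm (cis (- t) - 1))^2 / h^2)) * indicator {0..2*pi} t \<partial>lborel) \<le> ennreal (2 * pi * h)"
proof -
  define G where "G t = 1 / (1 + (t / (2*h))^2) + 1 / (1 + ((2*pi - t) / (2*h))^2)" for t
  define F where "F t = 2 * h * arctan (t / (2*h)) - 2 * h * arctan ((2*pi - t) / (2*h))" for t
  have n: "(norm (cis (- t) - 1))^2 = 2 - 2 * cos t" for t
  proof -
    have "(norm (cis (- t) - 1))^2 = (cos t - 1)^2 + (sin t)^2" by (simp add: cmod_power2)
    also have "\<dots> = ((cos t)^2 + (sin t)^2) - 2 * cos t + 1" by (simp add: power2_eq_square algebra_simps)
    finally show ?thesis by simp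
  qed
  have le: "1 / (1 + (norm (cis (- t) - 1))^2 / h^2) \<le> G t" if t: "0 \<le> t" "t \<le> 2*pi" for t
  proof -
    have aux: "1 / (1 + (2 - 2 * cos t) / h^2) \<le> 1 / (1 + (s / (2*h))^2)" if "(s/2)^2 \<le> 2 - 2 * cos t" for s
    proof -
      have "(s / (2*h))^2 = (s/2)^2 / h^2" by (simp add: power_divide power_mult_distrib)
      also have "\<dots> \<le> (2 - 2 * cos t) / h^2" using that by (intro divide_right_mono) auto
      finally have "1 + (s / (2*h))^2 \<le> 1 + (2 - 2 * cos t) / h^2" by simp
      then show ?thesis by (intro divide_left_mono mult_pos_pos add_pos_nonneg) (auto intro: add_pos_nonneg)
    qed
    have pos: "0 \<le> 1 / (1 + (s / (2*h))^2)" for s :: real by simp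
    show ?thesis
    proof (cases "t \<le> pi")
      case True
      have "1 / (1 + (2 - 2 * cos t) / h^2) \<le> 1 / (1 + (t / (2*h))^2)"
        using t True by (intro aux norm_cis_minus_one_lower) auto
      then show ?thesis unfolding n G_def using pos[of "2*pi - t"] by linarith
    next
      case False
      have "((2*pi - t)/2)^2 \<le> 2 - 2 * cos (2*pi - t)"
        using t False by (intro norm_cis_minus_one_lower) auto
      then have "1 / (1 + (2 - 2 * cos t) / h^2) \<le> 1 / (1 + ((2*pi - t) / (2*h))^2)"
        by (intro aux) (simp add: cos_2pi_minus)
      then show ?thesis unfolding n G_def using pos[of t] by linarith
    qed
  qed
  have "(\<integral>\<^sup>+t. ennreal (1 / (1 + (norm (cis (- t) - 1))^2 / h^2)) * indicator {0..2*pi} t \<partial>lborel)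
      \<le> (\<integral>\<^sup>+t\<in>{0..2*pi}. ennreal (G t) \<partial>lborel)"
    by (intro nn_integral_mono) (auto simp: indicator_def le intro!: ennreal_leI)
  also have "\<dots> = ennreal (F (2*pi) - F 0)"
  proof (rule nn_integral_FTC_Icc)
    show "G \<in> bmeas" unfolding G_def by measurable
    show "DERIV F t :> G t" for t
    proof -
      have d1: "((\<lambda>t. t / (2*h)) has_real_derivative 1 / (2*h)) (at t)"
        and d2: "((\<lambda>t. (2*pi - t) / (2*h)) has_real_derivative - 1 / (2*h)) (at t)"
        using h by (auto intro!: derivative_eq_intros)
      have "2 * h * (inverse X * (1 / (2*h))) - 2 * h * (inverse Y * (- 1 / (2*h))) = 1/X + 1/Y" for X Y
        using h by (simp add: inverse_eq_divide)
      with DERIV_diff[OF DERIV_cmult[OF DERIV_chain2[OF DERIV_arctan d1], of "2*h"] DERIV_cmult[OF DERIV_chain2[OF DERIV_arctan d2], of "2*h"]]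
      show ?thesis unfolding F_def G_def by simp
    qed
    show "0 \<le> G t" for t unfolding G_def by (intro add_nonneg_nonneg) auto
  qed auto
  also have "F (2*pi) - F 0 = 4 * h * arctan (pi / h)" using h by (simp add: F_def)
  also have "ennreal (4 * h * arctan (pi / h)) \<le> ennreal (2 * pi * h)"
  proof (rule ennreal_leI)
    have "4 * h * arctan (pi / h) \<le> 4 * h * (pi/2)"
      using h arctan_ubound[of "pi/h"] by (intro mult_left_mono) auto
    then show "4 * h * arctan (pi / h) \<le> 2 * pi * h" by simp
  qed
  finally show ?thesis .
qed

lemma prod_Basis_vec: "(\<Prod>b\<in>(Basis::(real^3) set). g (x \<bullet> b)) = (\<Prod>i\<in>UNIV. g (x $ i))"
proof -
  have "(Basis::(real^3) set) = (\<lambda>i. axis i 1) ` UNIV" by (auto simp: Basis_vec_def)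
  then have "(\<Prod>b\<in>(Basis::(real^3) set). g (x \<bullet> b)) = (\<Prod>b\<in>(\<lambda>i. axis i 1) ` UNIV. g (x \<bullet> b))"
    by (rule arg_cong)
  also have "\<dots> = (\<Prod>i\<in>UNIV. g (x $ i))"
    by (subst prod.reindex) (auto simp: inj_on_def axis_eq_axis inner_axis)
  finally show ?thesis .
qed

text \<open>The weight is a product over the three coordinates, so the one-dimensional bound enters
  to the third power.\<close>

lemma weight_integral:
  assumes h: "0 < h"
  defines "W \<equiv> \<lambda>x::real^3. (\<Prod>l\<leftarrow>[1,2,3]. 1 + (norm (cis (- (x $ l)) - 1))^2 / h^2)"
  shows "integrable torus (\<lambda>x. 1 / W x)" "(\<integral>x. 1 / W x \<partial>torus) \<le> (2 * pi * h)^3"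
proof -
  have W1: "1 \<le> 1 + (norm (cis (- s) - 1))^2 / h^2" for s :: real by simp
  have Wpos: "W x > 0" for x unfolding W_def by (auto intro!: mult_pos_pos add_pos_nonneg)
  show int: "integrable torus (\<lambda>x. 1 / W x)"
  proof (rule integrable_torus_continuous)
    have "continuous_on UNIV W" unfolding W_def by (auto intro!: continuous_intros simp: less_imp_neq[OF h, symmetric])
    then show "continuous_on UNIV (\<lambda>x. 1 / W x)" using Wpos
      by (intro continuous_intros) (auto simp: less_imp_neq[symmetric])
  qed
  let ?g = "\<lambda>t. ennreal (1 / (1 + (norm (cis (- t) - 1))^2 / h^2)) * indicator {0..2*pi} t"
  have [measurable]: "(\<lambda>t. cis (- t)) \<in> bmeas"
    by (intro borel_measurable_continuous_onI continuous_intros)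
  have gm: "(\<lambda>t. 1 / (1 + (norm (cis (- t) - 1))^2 / h^2)) \<in> bmeas"
    by measurable
  have gm': "?g \<in> bmeas" using gm by measurable
  have Wm: "(\<lambda>x. 1 / W x) \<in> bmeas" using borel_measurable_integrable[OF int] by simp
  have "ennreal (\<integral>x. 1 / W x \<partial>torus) = (\<integral>\<^sup>+x. ennreal (1 / W x) \<partial>torus)"
    using int Wpos by (subst nn_integral_eq_integral) (auto simp: less_imp_le)
  also have "\<dots> = (\<integral>\<^sup>+x. indicator cube x * ennreal (1 / W x) \<partial>lborel)"
    using Wm by (intro nn_integral_torus) auto
  also have "\<dots> = (\<integral>\<^sup>+x. (\<Prod>b\<in>Basis. ?g (x \<bullet> b)) \<partial>(lborel::(real^3) measure))"
  proof (intro nn_integral_cong)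
    fix x :: "real^3"
    have "(\<Prod>b\<in>Basis. ?g (x \<bullet> b)) = (\<Prod>i\<in>UNIV. ?g (x $ i))" by (rule prod_Basis_vec)
    also have "\<dots> = indicator cube x * ennreal (1 / W x)"
    proof (cases "x \<in> cube")
      case True
      then have "(\<Prod>i\<in>UNIV. ?g (x $ i)) = (\<Prod>i\<in>UNIV. ennreal (1 / (1 + (norm (cis (- (x $ i)) - 1))^2 / h^2)))"
        by (intro prod.cong) (auto simp: cube_def)
      also have "\<dots> = ennreal (\<Prod>i\<in>UNIV. 1 / (1 + (norm (cis (- (x $ i)) - 1))^2 / h^2))"
        by (intro prod_ennreal) (auto intro: add_nonneg_nonneg)
      also have "(\<Prod>i\<in>UNIV. 1 / (1 + (norm (cis (- (x $ i)) - 1))^2 / h^2)) = 1 / W x"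
      proof -
        have "W x = (\<Prod>i\<in>UNIV. 1 + (norm (cis (- (x $ i)) - 1))^2 / h^2)"
          unfolding W_def UNIV_3 by simp
        then show ?thesis by (simp only: prod_dividef prod.neutral_const)
      qed
      finally show ?thesis using True by simp
    next
      case False
      then obtain i where "\<not> (0 \<le> x $ i \<and> x $ i \<le> 2*pi)" by (auto simp: cube_def)
      then have "?g (x $ i) = 0" by (auto simp: indicator_def)
      then have "(\<Prod>i\<in>UNIV. ?g (x $ i)) = 0" by (intro prod_zero) auto
      then show ?thesis using False by simp
    qed
    finally show "indicator cube x * ennreal (1 / W x) = (\<Prod>b\<in>Basis. ?g (x \<bullet> b))" ..
  qed
  also have "\<dots> = (\<Prod>b\<in>(Basis::(real^3) set). (\<integral>\<^sup>+t. ?g t \<partial>lborel))"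
    using gm' by (rule nn_integral_lborel_prod) (rule zero_le)
  also have "\<dots> = (\<integral>\<^sup>+t. ?g t \<partial>lborel)^3" by simp
  also have "\<dots> \<le> (ennreal (2 * pi * h))^3"
    using weight_integral_1d[OF h] by (intro power_mono) auto
  also have "\<dots> = ennreal ((2 * pi * h)^3)" using h by (simp add: ennreal_power)
  finally show "(\<integral>x. 1 / W x \<partial>torus) \<le> (2 * pi * h)^3"
    using h by (subst (asm) ennreal_le_iff) auto
qed

text \<open>A common bound for both kernel estimates. \<open>17^3\<close> counts lattice points:
  \<open>2 n + 1 \<le> 17/h\<close> when \<open>n \<le> 8/h\<close> and \<open>h \<le> 1\<close>.
  Under the root, 8 stems from the three directions of the weight and \<open>(2*pi)^6\<close> from
  Parseval and the weight integral together.\<close>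

definition KC :: real where "KC = 17^3 + sqrt (8 * (2*pi)^6 * 17^3)"

lemma KC: "17^3 \<le> KC" "sqrt (8 * (2*pi)^6 * 17^3) \<le> KC" by (auto simp: KC_def)

text \<open>Cauchy-Schwarz with the weight \<open>W\<close>: the weighted square integral grows like
  the number \<open>h^(-3)\<close> of lattice points, the integral of \<open>1/W\<close> is
  \<open>O(h^3)\<close>, so the \<open>L^1\<close> bound is uniform in \<open>h\<close>. One
  difference per coordinate explains the three derivatives. The sup bound merely counts lattice
  points.\<close>

lemma kernel_bound:
  assumes f: "bd 3 UNIV f M" and M: "0 \<le> M" and supp: "\<And>x. 4 < norm x \<Longrightarrow> f x = 0" and h: "0 < h" "h \<le> 1"
    and A: "finite A" "\<And>k. norm (h *\<^sub>R rvec k) \<le> 4 \<Longrightarrow> k \<in> A"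
  shows "(\<integral>x. norm (tp A (\<lambda>k. of_real (f (h *\<^sub>R rvec k))) x) \<partial>torus) \<le> KC * M"
    and "norm (tp A (\<lambda>k. of_real (f (h *\<^sub>R rvec k))) x) \<le> KC * M * (1/h)^3"
proof -
  let ?m = "\<lambda>k. complex_of_real (f (h *\<^sub>R rvec k))"
  \<comment> \<open>The support radius \<open>4/h\<close> in lattice units, plus one lattice step
    for each of the three differences.\<close>
  define n where "n = nat \<lceil>4/h\<rceil> + 3"
  have n1: "4/h + 3 \<le> real n" unfolding n_def using h by (simp add: of_nat_ceiling)
  have n2: "real n \<le> 8/h"
  proof -
    have "real n \<le> 4/h + 1 + 3" unfolding n_def using h by (simp add: of_nat_nat) linarith
    also have "\<dots> \<le> 4/h + 4/h" using h by (simp add: field_simps)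
    finally show ?thesis by simp
  qed
  have out: "f (h *\<^sub>R rvec k) = 0" if kn: "k \<notin> bx n" for k
  proof -
    obtain i where i: "int n < \<bar>k $ i\<bar>" using kn by (auto simp: bx_def not_le)
    have "4 \<le> h * real n" using n1 h by (simp add: field_simps)
    also have "\<dots> < h * \<bar>real_of_int (k $ i)\<bar>" using i h by simp
    also have "\<dots> = \<bar>(h *\<^sub>R rvec k) $ i\<bar>" using h by (simp add: rvec_def abs_mult)
    also have "\<dots> \<le> norm (h *\<^sub>R rvec k)" by (rule component_le_norm_cart)
    finally show ?thesis using supp by simp
  qed
  have tpA: "tp A ?m x = tp (bx n) ?m x" for x
  proof -
    have "f (h *\<^sub>R rvec k) = 0" if "k \<notin> A" for k
      using A(2)[of k] that by (intro supp) (simp add: not_le[symmetric], blast)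
    then have "tp A ?m x = tp (A \<union> bx n) ?m x" using A(1) by (intro tp_mono_neutral) auto
    also have "\<dots> = tp (bx n) ?m x"
    proof (rule tp_mono_neutral[symmetric])
      fix k assume "k \<in> A \<union> bx n - bx n"
      then show "?m k = 0" using out by simp
    next
      show "finite (A \<union> bx n)" using A by simp
    qed auto
    finally show ?thesis .
  qed
  have card: "real (card (bx n)) \<le> (17/h)^3"
  proof -
    have "real (card (bx n)) \<le> real ((2*n+1)^3)" using card_bx by (simp only: of_nat_le_iff)
    also have "\<dots> = (2 * real n + 1)^3" by (simp add: add.commute)
    also have "\<dots> \<le> (17/h)^3"
    proof (rule power_mono)
      have "1 \<le> 1/h" using h by simp
      then show "2 * real n + 1 \<le> 17/h" using n2 by (simp add: field_simps)
    qed simp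
    finally show ?thesis .
  qed
  define W where "W x = (\<Prod>l\<leftarrow>[1,2,3]. 1 + (norm (cis (- (x $ l)) - 1))^2 / h^2)" for x :: "real^3"
  have Wpos: "W x > 0" for x unfolding W_def by (auto intro!: mult_pos_pos add_pos_nonneg)
  have Wc: "continuous_on UNIV W" unfolding W_def using h by (auto intro!: continuous_intros)
  have P: "(\<integral>x. (norm (tp (bx n) ?m x))^2 * W x \<partial>torus) \<le> 8 * ((2*pi)^3 * real (card (bx n)) * M^2)"
  proof -
    have "f x = 0" if "4 < \<bar>x $ i\<bar>" for x i
      using that component_le_norm_cart[of x i] supp[of x] by linarith
    moreover have "4 + 3 * h \<le> h * real n" using n1 h by (simp add: field_simps)
    moreover have "bd (length [1,2,3::3]) UNIV f M" using f by (simp add: numeral_3_eq_3)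
    ultimately show ?thesis
      using weighted_Parseval[OF h(1), of "[1,2,3]" f M 4 n] M by (simp add: W_def)
  qed
  have "(\<integral>x. norm (tp (bx n) ?m x) \<partial>torus)
      = (\<integral>x. ((norm (tp (bx n) ?m x))^2 * W x) powr (1/2) * (1 / W x) powr (1/2) \<partial>torus)"
  proof (intro Bochner_Integration.integral_cong refl)
    fix x
    show "norm (tp (bx n) ?m x) = ((norm (tp (bx n) ?m x))^2 * W x) powr (1/2) * (1 / W x) powr (1/2)"
      using Wpos[of x] by (simp add: powr_half_sqrt real_sqrt_mult real_sqrt_divide)
  qed
  also have "\<dots> \<le> (\<integral>x. (norm (tp (bx n) ?m x))^2 * W x \<partial>torus) powr (1/2) * (\<integral>x. 1 / W x \<partial>torus) powr (1/2)"
  proof (rule Holder_integral)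
    show "integrable torus (\<lambda>x. (norm (tp (bx n) ?m x))^2 * W x)"
      by (intro integrable_torus_continuous continuous_intros Wc)
    show "integrable torus (\<lambda>x. 1 / W x)" using weight_integral(1)[OF h(1)] by (simp add: W_def)
  qed (use Wpos in \<open>auto simp: less_imp_le\<close>)
  also have "\<dots> \<le> (8 * ((2*pi)^3 * (17/h)^3 * M^2)) powr (1/2) * ((2*pi*h)^3) powr (1/2)"
  proof (intro mult_mono powr_mono2)
    have "8 * ((2*pi)^3 * real (card (bx n)) * M^2) \<le> 8 * ((2*pi)^3 * (17/h)^3 * M^2)"
      using card by (intro mult_left_mono mult_right_mono) auto
    then show "(\<integral>x. (norm (tp (bx n) ?m x))^2 * W x \<partial>torus) \<le> 8 * ((2*pi)^3 * (17/h)^3 * M^2)"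
      using P by linarith
    show "(\<integral>x. 1 / W x \<partial>torus) \<le> (2 * pi * h)^3" using weight_integral(2)[OF h(1)] by (simp add: W_def)
    show "0 \<le> (\<integral>x. (norm (tp (bx n) ?m x))^2 * W x \<partial>torus)" using Wpos by (simp add: less_imp_le)
    show "0 \<le> (\<integral>x. 1 / W x \<partial>torus)" using Wpos by (simp add: less_imp_le)
  qed auto
  also have "\<dots> = sqrt (8 * (2*pi)^6 * 17^3 * M^2)"
  proof -
    have "8 * ((2*pi)^3 * (17/h)^3 * M^2) * (2*pi*h)^3 = 8 * (2*pi)^6 * 17^3 * M^2"
      using h by (simp add: power_divide power_mult_distrib field_simps power_add[symmetric])
    then show ?thesis using h M by (simp add: powr_half_sqrt real_sqrt_mult[symmetric])
  qed
  also have "\<dots> = sqrt (8 * (2*pi)^6 * 17^3) * M" using M by (simp add: real_sqrt_mult)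
  also have "\<dots> \<le> KC * M" using KC M by (intro mult_right_mono) auto
  finally have 1: "(\<integral>x. norm (tp (bx n) ?m x) \<partial>torus) \<le> KC * M" .
  have 2: "norm (tp (bx n) ?m x) \<le> KC * M * (1/h)^3" for x
  proof -
    have "norm (tp (bx n) ?m x) \<le> (\<Sum>k\<in>bx n. norm (?m k))" by (rule tp_bound)
    also have "\<dots> \<le> (\<Sum>k\<in>bx n. M)" using bd_bound[OF f] by (intro sum_mono) auto
    also have "\<dots> \<le> (17/h)^3 * M" using card M by (simp add: mult_right_mono)
    also have "\<dots> = 17^3 * (M * (1/h)^3)" by (simp add: power_divide)
    also have "\<dots> \<le> KC * (M * (1/h)^3)" using KC M h by (intro mult_right_mono) auto
    finally show ?thesis by (simp add: mult.assoc)
  qed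
  show "(\<integral>x. norm (tp A ?m x) \<partial>torus) \<le> KC * M" "norm (tp A ?m x) \<le> KC * M * (1/h)^3"
    unfolding tpA by (rule 1 2)+
qed

section \<open>Littlewood--Paley blocks\<close>

lemma norm_rvec_sq: "(norm (rvec k))^2 = ksq k"
  unfolding power2_norm_eq_inner rvec_inner ksq_def by (simp add: rvec_def power2_eq_square)

lemma norm_rvec_ge_1: "k \<noteq> 0 \<Longrightarrow> 1 \<le> norm (rvec k)"
proof -
  assume "k \<noteq> 0"
  then obtain i where "k $ i \<noteq> 0" by (auto simp: vec_eq_iff)
  then have "1 \<le> \<bar>real_of_int (k $ i)\<bar>" by linarith
  also have "\<dots> = \<bar>rvec k $ i\<bar>" by (simp add: rvec_def)
  also have "\<dots> \<le> norm (rvec k)" by (rule component_le_norm_cart)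
  finally show ?thesis .
qed

abbreviation heat_sg :: "real \<Rightarrow> field \<Rightarrow> field" where
  "heat_sg \<tau> c \<equiv> \<lambda>k. exp (- \<tau> * ksq k) *\<^sub>R c k"

lemma ksq_nonneg[simp]: "0 \<le> ksq k" by (simp add: ksq_def sum_nonneg)

text \<open>A rational substitute for \<open>exp (- c 4^j \<tau>)\<close>. Its integral over the
  half-line is exactly \<open>1/4^j\<close> and its square root is explicit; the time convolutions
  use both.\<close>

definition kap :: "nat \<Rightarrow> real \<Rightarrow> real" where "kap j \<tau> = 1 / (1 + 4^j * \<tau>)^2"

definition hj :: "nat \<Rightarrow> real" where "hj j = (1/2)^j"

text \<open>A finite box containing every frequency of the \<open>j\<close>-th block, over which all
  block sums run. It increases with \<open>j\<close>, so the blocks up to \<open>n\<close> can be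
  summed over \<open>B n\<close>.\<close>

definition B :: "nat \<Rightarrow> (int^3) set" where "B j = bx (2^(j+3))"

lemma finite_B[simp]: "finite (B j)" by (simp add: B_def)

lemma hj_pos[simp]: "0 < hj j" "hj j \<le> 1" "hj j \<noteq> 0" by (auto simp: hj_def power_le_one)

lemma in_B: "norm (hj j *\<^sub>R rvec k) \<le> 8 \<Longrightarrow> k \<in> B j"
proof -
  assume "norm (hj j *\<^sub>R rvec k) \<le> 8"
  then have "norm (rvec k) \<le> 8 * 2^j" by (simp add: hj_def power_one_over field_simps)
  moreover have "\<bar>rvec k $ i\<bar> \<le> norm (rvec k)" for i by (rule component_le_norm_cart)
  ultimately have "\<bar>real_of_int (k $ i)\<bar> \<le> 8 * 2^j" for i by (simp add: rvec_def) (meson order_trans)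
  then have "\<bar>k $ i\<bar> \<le> 8 * 2^j" for i
  proof -
    have "real_of_int \<bar>k $ i\<bar> \<le> real_of_int (8 * 2^j)" using \<open>\<And>i. \<bar>real_of_int (k $ i)\<bar> \<le> 8 * 2^j\<close>[of i] by simp
    then show ?thesis by (simp only: of_int_le_iff)
  qed
  then show ?thesis by (simp add: B_def bx_def power_add mult.commute)
qed

abbreviation hmul :: "(real^3 \<Rightarrow> real) \<Rightarrow> nat \<Rightarrow> real \<Rightarrow> (real^3 \<Rightarrow> complex) \<Rightarrow> real^3 \<Rightarrow> complex" where
  "hmul g j \<tau> f \<equiv> tp (B j) (\<lambda>k. of_real (g (hj j *\<^sub>R rvec k) * exp (- \<tau> * ksq k)) * fc f k)"

text \<open>With \<open>h = 2^(-j)\<close> the heat factor \<open>exp (- \<tau> |k|^2)\<close>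
  equals \<open>exp (- 4^j \<tau> |h k|^2)\<close>. Every block thus reduces to one family of
  symbols on \<open>annulus\<close> with parameter \<open>4^j \<tau>\<close>, to which the uniform
  kernel bound applies.\<close>

lemma heat_multiplier:
  assumes g: "bd 3 annulus g M" "0 \<le> M" and supp: "\<And>x. norm x < 1/4 \<or> 4 < norm x \<Longrightarrow> g x = 0"
  obtains C where "C > 0"
    "\<And>\<tau> j q f b. 0 \<le> \<tau> \<Longrightarrow> 1 < q \<Longrightarrow> f \<in> bmeas \<Longrightarrow> (\<And>x. norm (f x) \<le> b) \<Longrightarrow>
       lpn q (hmul g j \<tau> f) \<le> C * kap j \<tau> * lpn q f"
    "\<And>\<tau> j q f b x. 0 \<le> \<tau> \<Longrightarrow> 1 < q \<Longrightarrow> f \<in> bmeas \<Longrightarrow> (\<And>x. norm (f x) \<le> b) \<Longrightarrow>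
       norm (hmul g j \<tau> f x)
         \<le> C * kap j \<tau> * (8^j) powr (1/q) * lpn q f"
proof -
  obtain C1 where C1: "C1 \<ge> 0" "\<And>\<tau>. \<tau> \<ge> 0 \<Longrightarrow> bd 3 UNIV (\<lambda>x. g x * exp (- \<tau> * (norm x)^2)) (C1 / (1 + \<tau>)^2)"
    using heat_multiplier_bd[OF g supp] by blast
  let ?m = "\<lambda>\<tau> j k. complex_of_real (g (hj j *\<^sub>R rvec k) * exp (- \<tau> * ksq k))"
  have K: "(\<integral>x. norm (tp (B j) (?m \<tau> j) x) \<partial>torus) \<le> KC * C1 * kap j \<tau>"
          "norm (tp (B j) (?m \<tau> j) x) \<le> (KC * C1 * kap j \<tau>) * 8^j" if \<tau>: "0 \<le> \<tau>" for \<tau> j x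
  proof -
    define F where "F x = g x * exp (- (4^j * \<tau>) * (norm x)^2)" for x
    have eq: "F (hj j *\<^sub>R rvec k) = g (hj j *\<^sub>R rvec k) * exp (- \<tau> * ksq k)" for k
    proof -
      have "(norm (hj j *\<^sub>R rvec k))^2 = (hj j)^2 * ksq k" by (simp add: power_mult_distrib norm_rvec_sq)
      moreover have "(hj j)^2 * 4^j = 1"
        by (simp add: hj_def power_one_over power_mult[symmetric] mult.commute[of j 2] power_mult)
      ultimately have "4^j * \<tau> * (norm (hj j *\<^sub>R rvec k))^2 = \<tau> * ksq k"
        by (metis (no_types, opaque_lifting) mult.assoc mult.commute mult_1)
      then show ?thesis unfolding F_def by (simp only: mult_minus_left)
    qed
    have F: "bd 3 UNIV F (C1 * kap j \<tau>)" using C1(2)[of "4^j * \<tau>"] \<tau> by (simp add: F_def[abs_def] kap_def)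
    have supF: "F x = 0" if "4 < norm x" for x using supp that by (simp add: F_def)
    have M0: "0 \<le> C1 * kap j \<tau>" using C1 by (simp add: kap_def)
    have k4: "k \<in> B j" if "norm (hj j *\<^sub>R rvec k) \<le> 4" for k using that by (intro in_B) linarith
    have "1 / hj j = 2^j" by (simp add: hj_def power_one_over)
    then have h8: "(1 / hj j)^3 = 8^j" by (simp add: power_mult[symmetric] mult.commute[of j 3]) (simp add: power_mult)
    show "(\<integral>x. norm (tp (B j) (?m \<tau> j) x) \<partial>torus) \<le> KC * C1 * kap j \<tau>"
      using kernel_bound(1)[OF F M0 supF hj_pos(1)[of j] hj_pos(2)[of j] finite_B k4] unfolding eq by (simp only: mult.assoc)
    show "norm (tp (B j) (?m \<tau> j) x) \<le> (KC * C1 * kap j \<tau>) * 8^j"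
      using kernel_bound(2)[OF F M0 supF hj_pos(1)[of j] hj_pos(2)[of j] finite_B k4] unfolding eq h8 by (simp only: mult.assoc)
  qed
  define C where "C = KC * C1 + 1"
  have Cpos: "C > 0" using C1 order_trans[OF _ KC(1), of 0] by (simp add: C_def add_nonneg_pos)
  have le: "KC * C1 * kap j \<tau> \<le> C * kap j \<tau>" for j \<tau>
  proof -
    have "0 \<le> kap j \<tau>" by (simp add: kap_def)
    then show ?thesis by (simp add: C_def distrib_right)
  qed
  show ?thesis
  proof (rule that[OF Cpos])
    fix \<tau> q b :: real and j :: nat and f :: "real^3 \<Rightarrow> complex"
    assume a: "0 \<le> \<tau>" "1 < q" "f \<in> bmeas" "\<And>x. norm (f x) \<le> b"
    have "lpn q (tp (B j) (\<lambda>k. ?m \<tau> j k * fc f k)) \<le> (\<integral>x. norm (tp (B j) (?m \<tau> j) x) \<partial>torus) * lpn q f"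
      by (rule multiplier_lpn[OF a(3,4,2)])
    also have "\<dots> \<le> (C * kap j \<tau>) * lpn q f" using K(1)[OF a(1)] le by (intro mult_right_mono) (auto intro: order_trans)
    finally show "lpn q (tp (B j) (\<lambda>k. ?m \<tau> j k * fc f k)) \<le> C * kap j \<tau> * lpn q f" .
    fix x
    have "norm (tp (B j) (\<lambda>k. ?m \<tau> j k * fc f k) x) \<le> (C * kap j \<tau>) * (8^j) powr (1/q) * lpn q f"
    proof (rule multiplier_sup[OF a(3,4,2)])
      show "(\<integral>y. norm (tp (B j) (?m \<tau> j) y) \<partial>torus) \<le> C * kap j \<tau>" using K(1)[OF a(1)] le by (rule order_trans)
      show "norm (tp (B j) (?m \<tau> j) y) \<le> C * kap j \<tau> * 8^j" for y
        using K(2)[OF a(1)] mult_right_mono[OF le] by (rule order_trans) simp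
    qed simp
    then show "norm (tp (B j) (\<lambda>k. ?m \<tau> j k * fc f k) x) \<le> C * kap j \<tau> * (8^j) powr (1/q) * lpn q f" .
  qed
qed

text \<open>\<open>L^p\<close> lies halfway between \<open>L^(p/2)\<close> and
  \<open>L^\<infinity>\<close>. This converts the two bounds of a multiplier on
  \<open>L^(p/2)\<close> into one from \<open>L^(p/2)\<close> to \<open>L^p\<close>.\<close>

lemma lpn_interpolate_sup:
  fixes g :: "real^3 \<Rightarrow> complex"
  assumes [measurable]: "g \<in> bmeas" and S: "\<And>x. norm (g x) \<le> S" and p: "p > 0"
  shows "lpn p g \<le> sqrt (S * lpn (p/2) g)"
proof (rule lpn_leI[OF p])
  have S0: "0 \<le> S" using S[of 0] norm_ge_zero order_trans by blast
  show "0 \<le> sqrt (S * lpn (p/2) g)" using S0 by simp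
  have "(\<integral>x. norm (g x) powr p \<partial>torus) \<le> (\<integral>x. S powr (p/2) * norm (g x) powr (p/2) \<partial>torus)"
  proof (rule integral_mono)
    show "integrable torus (\<lambda>x. norm (g x) powr p)" using integrable_powr_torus[OF assms(1) S p] .
    show "integrable torus (\<lambda>x. S powr (p/2) * norm (g x) powr (p/2))"
      using integrable_powr_torus[OF assms(1) S, of "p/2"] p by simp
    show "norm (g x) powr p \<le> S powr (p/2) * norm (g x) powr (p/2)" for x
    proof -
      have "norm (g x) powr p = norm (g x) powr (p/2) * norm (g x) powr (p/2)" by (simp add: powr_add[symmetric])
      also have "\<dots> \<le> S powr (p/2) * norm (g x) powr (p/2)" using S p by (intro mult_right_mono powr_mono2) auto
      finally show ?thesis .
    qed
  qed
  also have "\<dots> = S powr (p/2) * lpn (p/2) g powr (p/2)" using p by (simp add: lpn_powr)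
  also have "\<dots> = (S * lpn (p/2) g) powr (p/2)" using S0 by (simp add: powr_mult)
  also have "\<dots> = sqrt (S * lpn (p/2) g) powr p"
  proof -
    have "0 \<le> S * lpn (p/2) g" using S0 by simp
    then show ?thesis by (simp add: powr_half_sqrt[symmetric] powr_powr)
  qed
  finally show "(\<integral>x. norm (g x) powr p \<partial>torus) \<le> sqrt (S * lpn (p/2) g) powr p" .
qed

text \<open>The symbol of the entry \<open>(l, i)\<close> of the Leray projector composed with the
  derivative in direction \<open>m\<close>, up to the factor \<open>\<i>\<close>. The leading factor
  makes it vanish at the origin, whatever value the quotient takes there.\<close>

definition mu :: "3 \<Rightarrow> 3 \<Rightarrow> 3 \<Rightarrow> real^3 \<Rightarrow> real" where
  "mu l i m \<xi> = \<xi> $ m * ((if l = i then 1 else 0) - \<xi> $ l * \<xi> $ i * (1 / (norm \<xi>)^2))"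

lemma mu_scale: "c > 0 \<Longrightarrow> mu l i m (c *\<^sub>R \<xi>) = c * mu l i m \<xi>"
  by (simp add: mu_def power_mult_distrib power2_eq_square)

lemma bd_mu: "\<exists>M\<ge>0. bd n annulus (mu l i m) M"
proof -
  obtain M where M: "M \<ge> 0" "bd n annulus (\<lambda>x. 1 / (norm x)^2) M" using bd_annulus_inverse by blast
  let ?M1 = "2^n * (2^n * 5 * 5) * M"
  have 1: "bd n annulus (\<lambda>x. x $ l * x $ i * (1 / (norm x)^2)) ?M1"
    using M by (intro bd_mult bd_annulus_coord) auto
  have 2: "bd n annulus (\<lambda>x. (if l = i then 1 else 0) + (- 1) * (x $ l * x $ i * (1 / (norm x)^2))) (1 + \<bar>- 1\<bar> * ?M1)"
    by (intro bd_add bd_const bd_cmult 1) auto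
  have "bd n annulus (\<lambda>x. x $ m * ((if l = i then 1 else 0) + (- 1) * (x $ l * x $ i * (1 / (norm x)^2)))) (2^n * 5 * (1 + \<bar>- 1\<bar> * ?M1))"
    using M by (intro bd_mult bd_annulus_coord 2) auto
  then have "bd n annulus (mu l i m) (2^n * 5 * (1 + \<bar>- 1\<bar> * ?M1))" by (simp add: mu_def[abs_def])
  then show ?thesis using M by (intro exI[of _ "2^n * 5 * (1 + \<bar>- 1\<bar> * ?M1)"]) auto
qed

text \<open>The zero mode, which \<open>leray\<close> leaves untouched, causes no discrepancy
  because the divergence vanishes there.\<close>

lemma leray_component:
  "Pdiv_tensor a b k $ l = \<i> * (\<Sum>i\<in>UNIV. \<Sum>m\<in>UNIV. of_real (mu l i m (rvec k)) * conv (\<lambda>n. a n $ i) (\<lambda>n. b n $ m) k)"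
proof -
  define v where "v i = \<i> * (\<Sum>j\<in>UNIV. complex_of_real (real_of_int (k $ j)) * conv (\<lambda>m. a m $ i) (\<lambda>m. b m $ j) k)" for i
  have P: "Pdiv_tensor a b k = leray k (\<chi> i. v i)" by (simp add: Pdiv_tensor_def v_def)
  have m: "\<i> * (\<Sum>i\<in>UNIV. \<Sum>m\<in>UNIV. of_real (mu l i m (rvec k)) * conv (\<lambda>n. a n $ i) (\<lambda>n. b n $ m) k)
     = (\<Sum>i\<in>UNIV. of_real ((if l = i then 1 else 0) - real_of_int (k $ l) * real_of_int (k $ i) / ksq k) * v i)"
    unfolding v_def mu_def norm_rvec_sq
    by (simp add: sum_distrib_left rvec_def mult_ac)
  show ?thesis
  proof (cases "k = 0")
    case True
    have "v i = 0" for i by (simp add: v_def True)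
    then show ?thesis unfolding P m by (simp add: leray_def True)
  next
    case False
    have "(\<Sum>i\<in>UNIV. of_real ((if l = i then 1 else 0) - real_of_int (k $ l) * real_of_int (k $ i) / ksq k) * v i)
      = (\<Sum>i\<in>UNIV. (if l = i then v i else 0)) - (\<Sum>i\<in>UNIV. of_real (real_of_int (k $ i)) * v i) / of_real (ksq k) * of_real (real_of_int (k $ l))"
      unfolding sum_divide_distrib sum_distrib_right sum_subtractf[symmetric]
      by (intro sum.cong) (auto simp: algebra_simps)
    then show ?thesis unfolding P m using False by (simp add: leray_def)
  qed
qed

section \<open>Dyadic partition of unity and block norms\<close>

locale besov_setup =
  fixes p :: real and chi :: "real^3 \<Rightarrow> real"
  assumes p3: "p > 3" and cutoff: "lp_cutoff chi"
begin

lemma chi_smooth: "smooth3 chi" and chi_1: "norm \<xi> \<le> 1 \<Longrightarrow> chi \<xi> = 1" and chi_0': "norm \<xi> > 2 \<Longrightarrow> chi \<xi> = 0"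
  using cutoff by (auto simp: lp_cutoff_def)

lemma chi_cont: "continuous_on UNIV chi" using chi_smooth by (rule smooth3.cases) auto

text \<open>Continuity extends the vanishing to the sphere of radius 2. The boundary case does
  occur: lattice points of norm one are doubled onto it.\<close>

lemma chi_0: assumes "norm \<xi> \<ge> 2" shows "chi \<xi> = 0"
proof -
  have "(\<lambda>n. (1 + inverse (real (Suc n))) *\<^sub>R \<xi>) \<longlonglongrightarrow> (1 + 0) *\<^sub>R \<xi>"
    by (intro tendsto_intros LIMSEQ_inverse_real_of_nat)
  then have "(\<lambda>n. chi ((1 + inverse (real (Suc n))) *\<^sub>R \<xi>)) \<longlonglongrightarrow> chi ((1 + 0) *\<^sub>R \<xi>)"
    by (rule continuous_on_tendsto_compose[OF chi_cont]) auto
  moreover have "chi ((1 + inverse (real (Suc n))) *\<^sub>R \<xi>) = 0" for n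
  proof (rule chi_0')
    have "2 < (1 + inverse (real (Suc n))) * 2" by simp
    also have "\<dots> \<le> (1 + inverse (real (Suc n))) * norm \<xi>" using assms by (intro mult_left_mono) auto
    also have "\<dots> = norm ((1 + inverse (real (Suc n))) *\<^sub>R \<xi>)" by (simp add: abs_of_nonneg)
    finally show "2 < norm ((1 + inverse (real (Suc n))) *\<^sub>R \<xi>)" .
  qed
  ultimately show ?thesis by (simp add: LIMSEQ_const_iff)
qed

definition phi :: "real^3 \<Rightarrow> real" where "phi x = chi x - chi (2 *\<^sub>R x)"
text \<open>A fattened cutoff equal to one on the support of \<open>phi\<close>; inserting it turns
  an operator on a block into a multiplier applied to that block.\<close>

definition phit :: "real^3 \<Rightarrow> real" where "phit x = chi ((1/2) *\<^sub>R x) - chi (4 *\<^sub>R x)"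
definition ph :: "nat \<Rightarrow> int^3 \<Rightarrow> real" where "ph j k = phi (hj j *\<^sub>R rvec k)"

lemma phi_supp: "norm x < 1/4 \<or> 4 < norm x \<Longrightarrow> phi x = 0"
  by (auto simp: phi_def chi_1 chi_0)
lemma phit_supp: "norm x < 1/4 \<or> 4 < norm x \<Longrightarrow> phit x = 0"
  by (auto simp: phit_def chi_1 chi_0)
lemma phit_phi: "phit x * phi x = phi x"
proof (cases "norm x \<le> 1/2 \<or> norm x > 2")
  case True then have "phi x = 0" by (auto simp: phi_def chi_1 chi_0)
  then show ?thesis by simp
next
  case False then have "phit x = 1" by (auto simp: phit_def chi_1 chi_0)
  then show ?thesis by simp
qed

lemma bd_chi_diff: "\<exists>M\<ge>0. bd n annulus (\<lambda>x. chi (a *\<^sub>R x) - chi (b *\<^sub>R x)) M"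
proof -
  obtain M where M: "M \<ge> 0" "bd n annulus (\<lambda>x. chi (a *\<^sub>R x)) M" using smooth3_bd[OF bounded_annulus chi_smooth] by blast
  obtain M' where M': "M' \<ge> 0" "bd n annulus (\<lambda>x. chi (b *\<^sub>R x)) M'" using smooth3_bd[OF bounded_annulus chi_smooth] by blast
  have "bd n annulus (\<lambda>x. chi (a *\<^sub>R x) + (- 1) * chi (b *\<^sub>R x)) (M + \<bar>- 1\<bar> * M')"
    using M M' by (intro bd_add bd_cmult) auto
  then show ?thesis using M M' by (intro exI[of _ "M + \<bar>- 1\<bar> * M'"]) simp
qed

lemma bd_phi: "\<exists>M\<ge>0. bd n annulus phi M"
  using bd_chi_diff[of n 1 2] by (simp add: phi_def[abs_def])
lemma bd_phit: "\<exists>M\<ge>0. bd n annulus phit M"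
  using bd_chi_diff[of n "1/2" 4] by (simp add: phit_def[abs_def])

definition blkf :: "nat \<Rightarrow> field \<Rightarrow> real^3 \<Rightarrow> complex^3" where
  "blkf j c x = (\<Sum>k\<in>B j. (of_real (ph j k) * cis (rvec k \<bullet> x)) *s c k)"

definition cmp :: "nat \<Rightarrow> field \<Rightarrow> 3 \<Rightarrow> real^3 \<Rightarrow> complex" where
  "cmp j c i = tp (B j) (\<lambda>k. of_real (ph j k) * c k $ i)"

definition N :: "nat \<Rightarrow> field \<Rightarrow> real" where "N j c = lpn p (blkf j c)"

lemma ph_out: "k \<notin> B j \<Longrightarrow> ph j k = 0"
  using in_B[of j k] phi_supp[of "hj j *\<^sub>R rvec k"] unfolding ph_def by force

lemma LP_block_nat: "LP_block chi (int j) c = blkf j c"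
proof
  fix x
  have e: "2 powr (- real_of_int (int j)) = hj j" "2 powr (- real_of_int (int j - 1)) = 2 * hj j"
  proof -
    show 1: "2 powr (- real_of_int (int j)) = hj j" by (simp add: powr_minus powr_realpow hj_def power_one_over inverse_eq_divide)
    have "2 powr (- real_of_int (int j - 1)) = 2 powr (1 + - real_of_int (int j))" by (rule arg_cong) simp
    also have "\<dots> = 2 * hj j" by (subst powr_add) (simp add: 1[simplified])
    finally show "2 powr (- real_of_int (int j - 1)) = 2 * hj j" .
  qed
  have "LP_block chi (int j) c x = (\<Sum>\<^sub>\<infinity>k\<in>UNIV. (of_real (ph j k) * cis (rvec k \<bullet> x)) *s c k)"
    unfolding LP_block_def e by (simp add: ph_def phi_def)
  also have "\<dots> = (\<Sum>\<^sub>\<infinity>k\<in>B j. (of_real (ph j k) * cis (rvec k \<bullet> x)) *s c k)"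
    by (rule infsum_cong_neutral) (auto simp: ph_out vec_eq_iff)
  also have "\<dots> = blkf j c x" by (simp add: blkf_def)
  finally show "LP_block chi (int j) c x = blkf j c x" .
qed

lemma LP_block_neg:
  assumes "j < 0" "c 0 = 0"
  shows "LP_block chi j c = (\<lambda>_. 0)"
proof
  fix x
  have "(complex_of_real (chi ((2 powr (- real_of_int j)) *\<^sub>R rvec k) - chi ((2 powr (- real_of_int (j - 1))) *\<^sub>R rvec k))
       * cis (rvec k \<bullet> x)) *s c k = 0" for k
  proof (cases "k = 0")
    case False
    have "norm ((2 powr s) *\<^sub>R rvec k) \<ge> 2" if "s \<ge> 1" for s
    proof -
      have "(2::real) powr 1 \<le> 2 powr s" using that by (intro powr_mono) auto
      then have "2 * 1 \<le> 2 powr s * norm (rvec k)" using norm_rvec_ge_1[OF False] by (intro mult_mono) auto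
      then show ?thesis by simp
    qed
    then have "chi ((2 powr (- real_of_int j)) *\<^sub>R rvec k) = 0" "chi ((2 powr (- real_of_int (j - 1))) *\<^sub>R rvec k) = 0"
      using assms(1) by (auto intro!: chi_0)
    then show ?thesis by (simp add: vec_eq_iff)
  qed (simp add: assms)
  then show "LP_block chi j c x = 0" unfolding LP_block_def by (rule infsum_0)
qed

lemma blkf_cmp: "blkf j c x $ i = cmp j c i x"
  by (simp add: blkf_def cmp_def tp_def sum_component vector_scalar_mult_def mult_ac)

lemma cmp_measurable[measurable]: "cmp j c i \<in> bmeas" unfolding cmp_def by measurable

lemma blkf_eq: "blkf j c = (\<lambda>x. \<chi> i. cmp j c i x)" by (auto simp: vec_eq_iff blkf_cmp)

lemma continuous_blkf: "continuous_on UNIV (blkf j c)"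
  unfolding blkf_eq cmp_def by (intro continuous_intros)

lemma blkf_measurable[measurable]: "blkf j c \<in> bmeas"
  by (rule borel_measurable_continuous_onI[OF continuous_blkf])

definition cmpB :: "nat \<Rightarrow> field \<Rightarrow> real" where "cmpB j c = (\<Sum>i\<in>UNIV. \<Sum>k\<in>B j. norm (complex_of_real (ph j k) * c k $ i))"

lemma norm_vec_le_sum: "norm (v::complex^3) \<le> (\<Sum>i\<in>UNIV. norm (v $ i))"
  unfolding norm_vec_def by (rule L2_set_le_sum) auto

lemma cmp_bound: "norm (cmp j c i x) \<le> cmpB j c"
proof -
  have "norm (cmp j c i x) \<le> (\<Sum>k\<in>B j. norm (complex_of_real (ph j k) * c k $ i))" unfolding cmp_def by (rule tp_bound)
  also have "\<dots> \<le> cmpB j c" unfolding cmpB_def by (rule member_le_sum) (auto intro: sum_nonneg)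
  finally show ?thesis .
qed

lemma blkf_bound: "norm (blkf j c x) \<le> cmpB j c"
  unfolding cmpB_def
  by (rule order_trans[OF norm_vec_le_sum], intro sum_mono) (simp only: blkf_cmp cmp_def tp_bound)

lemma N_nonneg[simp]: "0 \<le> N j c" by (simp add: N_def)

lemma Lp_norm_block: "Lp_norm p (LP_block chi (int j) c) = N j c"
  unfolding LP_block_nat N_def by (rule Lp_norm_lpn) measurable

lemma lpn_cmp_le: "lpn p (cmp j c i) \<le> N j c"
  unfolding N_def using p3
  by (intro lpn_mono[where B="cmpB j c"] blkf_bound) (auto simp: blkf_cmp[symmetric] Finite_Cartesian_Product.norm_nth_le)

lemma N_le_sum:
  assumes "\<And>i. lpn p (cmp j c i) \<le> b i"
  shows "N j c \<le> (\<Sum>i\<in>UNIV. b i)"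
proof -
  have "N j c \<le> (\<Sum>i\<in>UNIV. lpn p (cmp j c i))"
    unfolding N_def using p3
    using norm_vec_le_sum[of "blkf j c _"] unfolding blkf_cmp
    by (intro lpn_sum_le[where B'="\<lambda>_. cmpB j c"]) (auto simp: cmp_bound)
  also have "\<dots> \<le> (\<Sum>i\<in>UNIV. b i)" using assms by (intro sum_mono) auto
  finally show ?thesis .
qed

lemma fc_cmp: "k \<in> B j \<Longrightarrow> fc (cmp j c i) k = of_real (ph j k) * c k $ i"
  by (simp add: cmp_def fc_tp)

lemma tp_cong: "(\<And>k. k \<in> A \<Longrightarrow> c k = d k) \<Longrightarrow> tp A c = tp A d"
  by (auto simp: tp_def fun_eq_iff intro!: sum.cong)

text \<open>Since \<open>phit * phi = phi\<close>, the heat evolution of a block is a multiplier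
  with symbol \<open>phit\<close> times the heat factor, applied to the block itself. Bernstein's
  inequality is the sup bound at \<open>\<tau> = 0\<close>. The factor 3 counts components.\<close>

lemma heat_block:
  obtains C where "C > 0" "\<And>\<tau> j c. 0 \<le> \<tau> \<Longrightarrow> N j (heat_sg \<tau> c) \<le> C * kap j \<tau> * N j c"
    "\<And>j c i x. norm (cmp j c i x) \<le> C * (8^j) powr (1/p) * N j c"
proof -
  obtain M where M: "M \<ge> 0" "bd 3 annulus phit M" using bd_phit by blast
  obtain C where C: "C > 0"
    "\<And>\<tau> j q f b. 0 \<le> \<tau> \<Longrightarrow> 1 < q \<Longrightarrow> f \<in> bmeas \<Longrightarrow> (\<And>x. norm (f x) \<le> b) \<Longrightarrow>
       lpn q (hmul phit j \<tau> f) \<le> C * kap j \<tau> * lpn q f"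
    "\<And>\<tau> j q f b x. 0 \<le> \<tau> \<Longrightarrow> 1 < q \<Longrightarrow> f \<in> bmeas \<Longrightarrow> (\<And>x. norm (f x) \<le> b) \<Longrightarrow>
       norm (hmul phit j \<tau> f x)
         \<le> C * kap j \<tau> * (8^j) powr (1/q) * lpn q f"
    by (rule heat_multiplier[OF M(2,1) phit_supp]) blast+
  have eq: "hmul phit j \<tau> (cmp j c i) = cmp j (heat_sg \<tau> c) i"
    for \<tau> j c i
  proof -
    have "of_real (phit (hj j *\<^sub>R rvec k) * exp (- \<tau> * ksq k)) * (of_real (ph j k) * c k $ i)
        = of_real (ph j k) * (exp (- \<tau> * ksq k) *\<^sub>R c k) $ i" for k
    proof -
      have "phit (hj j *\<^sub>R rvec k) * ph j k = ph j k" by (simp add: ph_def phit_phi)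
      then have "complex_of_real (phit (hj j *\<^sub>R rvec k)) * of_real (ph j k) = of_real (ph j k)"
        unfolding of_real_mult[symmetric] by simp
      moreover have "(exp (- \<tau> * ksq k) *\<^sub>R c k) $ i = of_real (exp (- \<tau> * ksq k)) * c k $ i"
        by (simp add: scaleR_conv_of_real[where 'a=complex])
      moreover have "P * E * (H * X) = (P * H) * (E * X)" for P E H X :: complex by (simp add: mult_ac)
      ultimately show ?thesis unfolding of_real_mult by auto
    qed
    then show ?thesis unfolding cmp_def[of j "\<lambda>k. exp (- \<tau> * ksq k) *\<^sub>R c k"] by (intro tp_cong) (simp only: fc_cmp)
  qed
  have p1: "1 < p" using p3 by simp
  show ?thesis
  proof (rule that[of "3 * C"])
    show "3 * C > 0" using C by simp
    fix \<tau> :: real and j c assume \<tau>: "0 \<le> \<tau>"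
    have "N j (heat_sg \<tau> c) \<le> (\<Sum>i\<in>(UNIV::3 set). C * kap j \<tau> * N j c)"
    proof (rule N_le_sum)
      fix i
      have "lpn p (cmp j (heat_sg \<tau> c) i) \<le> C * kap j \<tau> * lpn p (cmp j c i)"
        using C(2)[OF \<tau> p1 cmp_measurable cmp_bound, of j j c i] unfolding eq .
      also have "\<dots> \<le> C * kap j \<tau> * N j c" using C(1) by (intro mult_left_mono lpn_cmp_le) (auto simp: kap_def)
      finally show "lpn p (cmp j (heat_sg \<tau> c) i) \<le> C * kap j \<tau> * N j c" .
    qed
    then show "N j (heat_sg \<tau> c) \<le> 3 * C * kap j \<tau> * N j c" by simp
  next
    fix j i x and c :: field
    have e: "(\<lambda>k. exp (- 0 * ksq k) *\<^sub>R c k) = c" by simp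
    have "norm (cmp j c i x) \<le> C * kap j 0 * (8^j) powr (1/p) * lpn p (cmp j c i)"
      using C(3)[OF order_refl p1 cmp_measurable cmp_bound, of j j c i x] unfolding eq e .
    also have "\<dots> \<le> C * 1 * (8^j) powr (1/p) * N j c" using C(1) by (intro mult_mono lpn_cmp_le) (auto simp: kap_def)
    also have "\<dots> \<le> 3 * C * (8^j) powr (1/p) * N j c" using C(1) by (intro mult_right_mono) auto
    finally show "norm (cmp j c i x) \<le> 3 * C * (8^j) powr (1/p) * N j c" .
  qed
qed

text \<open>The symbol of \<open>exp (\<tau> \<Delta>) P div \<Delta>\<^sub>j\<close>; since \<open>mu\<close> is homogeneous of degree one the
  derivative costs a factor \<open>2^j\<close>.\<close>
definition msym :: "nat \<Rightarrow> real \<Rightarrow> 3 \<Rightarrow> 3 \<Rightarrow> 3 \<Rightarrow> int^3 \<Rightarrow> complex" where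
  "msym j \<tau> l i m k = of_real (ph j k * exp (- \<tau> * ksq k) * mu l i m (rvec k))"

abbreviation mlp :: "nat \<Rightarrow> real \<Rightarrow> 3 \<Rightarrow> 3 \<Rightarrow> 3 \<Rightarrow> (int^3 \<Rightarrow> complex) \<Rightarrow> real" where
  "mlp j \<tau> l i m c \<equiv> lpn p (tp (B j) (\<lambda>k. msym j \<tau> l i m k * c k))"

text \<open>For the second bound the multiplier is estimated on \<open>L^(p/2)\<close>, and from
  \<open>L^(p/2)\<close> to \<open>L^\<infinity>\<close> with factor \<open>8^(2j/p)\<close>;
  interpolation takes the square root of this factor. The exponent \<open>p/2\<close> exceeds 1
  because \<open>p > 3\<close>.\<close>

lemma Pdiv_multiplier:
  obtains C where "C > 0"
    "\<And>l i m \<tau> j f b. 0 \<le> \<tau> \<Longrightarrow> f \<in> bmeas \<Longrightarrow> (\<And>x. norm (f x) \<le> b) \<Longrightarrow>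
       mlp j \<tau> l i m (fc f) \<le> C * 2^j * kap j \<tau> * lpn p f"
    "\<And>l i m \<tau> j f b. 0 \<le> \<tau> \<Longrightarrow> f \<in> bmeas \<Longrightarrow> (\<And>x. norm (f x) \<le> b) \<Longrightarrow>
       mlp j \<tau> l i m (fc f) \<le> C * 2^j * kap j \<tau> * ((8^j) powr (1/p) * lpn (p/2) f)"
proof -
  obtain M where M: "M \<ge> 0" "bd 3 annulus phi M" using bd_phi by blast
  \<comment> \<open>The constant depends on \<open>l\<close>, \<open>i\<close>, \<open>m\<close>.
    Collecting its properties in a predicate allows a choice for each of the 27 triples; the sum of
    the chosen constants serves all of them.\<close>
  define Q where "Q l i m C \<longleftrightarrow> C > 0 \<and> (\<forall>\<tau> j f b. 0 \<le> \<tau> \<longrightarrow> f \<in> bmeas \<longrightarrow> (\<forall>x. norm (f x) \<le> b) \<longrightarrow>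
       mlp j \<tau> l i m (fc f) \<le> C * 2^j * kap j \<tau> * lpn p f \<and>
       mlp j \<tau> l i m (fc f) \<le> C * 2^j * kap j \<tau> * ((8^j) powr (1/p) * lpn (p/2) f))" for l i m C
  have ex: "\<exists>C. Q l i m C" for l i m
  proof -
    obtain M' where M': "M' \<ge> 0" "bd 3 annulus (mu l i m) M'" using bd_mu by blast
    define g where "g x = phi x * mu l i m x" for x
    have g: "bd 3 annulus g (2^3 * M * M')" unfolding g_def[abs_def] using M M' by (intro bd_mult) auto
    have g0: "0 \<le> 2^3 * M * M'" using M M' by simp
    have gs: "g x = 0" if "norm x < 1/4 \<or> 4 < norm x" for x using phi_supp[OF that] by (simp add: g_def)
    obtain C where C: "C > 0"
      "\<And>\<tau> j q f b. 0 \<le> \<tau> \<Longrightarrow> 1 < q \<Longrightarrow> f \<in> bmeas \<Longrightarrow> (\<And>x. norm (f x) \<le> b) \<Longrightarrow>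
         lpn q (hmul g j \<tau> f) \<le> C * kap j \<tau> * lpn q f"
      "\<And>\<tau> j q f b x. 0 \<le> \<tau> \<Longrightarrow> 1 < q \<Longrightarrow> f \<in> bmeas \<Longrightarrow> (\<And>x. norm (f x) \<le> b) \<Longrightarrow>
         norm (hmul g j \<tau> f x)
           \<le> C * kap j \<tau> * (8^j) powr (1/q) * lpn q f"
      by (rule heat_multiplier[OF g g0 gs]) blast+
    show ?thesis
    proof (intro exI[of _ C], unfold Q_def, intro conjI allI impI)
      fix \<tau> b :: real and j :: nat and f :: "real^3 \<Rightarrow> complex"
      assume \<tau>: "0 \<le> \<tau>" and f: "f \<in> bmeas" "\<forall>x. norm (f x) \<le> b"
      define G where "G = hmul g j \<tau> f"
      have kp: "0 \<le> C * kap j \<tau>" using C by (simp add: kap_def)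
      have eq: "tp (B j) (\<lambda>k. msym j \<tau> l i m k * fc f k) = (\<lambda>x. of_real (2^j) * G x)"
      proof -
        have "2^j * g (hj j *\<^sub>R rvec k) = ph j k * mu l i m (rvec k)" for k
          by (simp add: g_def mu_scale ph_def) (simp add: hj_def power_one_over)
        then have "msym j \<tau> l i m k = of_real (2^j) * of_real (g (hj j *\<^sub>R rvec k) * exp (- \<tau> * ksq k))" for k
          unfolding msym_def of_real_mult[symmetric] by (simp add: mult_ac del: of_real_mult)
        then show ?thesis unfolding G_def tp_def sum_distrib_left by (simp only: mult.assoc)
      qed
      have s: "lpn p (\<lambda>x. of_real (2^j) * G x) = 2^j * lpn p G"
        using p3 by (intro lpn_cmult) (auto simp: norm_mult norm_power)
      have "lpn p G \<le> C * kap j \<tau> * lpn p f" unfolding G_def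
        by (rule C(2)[OF \<tau> _ f(1), where b=b]) (use p3 f(2) in auto)
      then show "mlp j \<tau> l i m (fc f) \<le> C * 2^j * kap j \<tau> * lpn p f"
        unfolding eq s using mult_left_mono[of "lpn p G" _ "2^j"] by (simp add: mult_ac)
      let ?S = "C * kap j \<tau> * (8^j) powr (1/(p/2)) * lpn (p/2) f"
      have h: "lpn (p/2) G \<le> C * kap j \<tau> * lpn (p/2) f" unfolding G_def
        by (rule C(2)[OF \<tau> _ f(1), where b=b]) (use p3 f(2) in auto)
      have S: "norm (G x) \<le> ?S" for x unfolding G_def
        by (rule C(3)[OF \<tau> _ f(1), where b=b]) (use p3 f(2) in auto)
      have Gm: "G \<in> bmeas" unfolding G_def by measurable
      have S0: "0 \<le> ?S" using kp by simp
      have "lpn p G \<le> sqrt (?S * lpn (p/2) G)" using p3 by (intro lpn_interpolate_sup Gm S) auto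
      also have "\<dots> \<le> sqrt (?S * (C * kap j \<tau> * lpn (p/2) f))" using h S0 by (intro real_sqrt_le_mono mult_left_mono)
      also have "?S * (C * kap j \<tau> * lpn (p/2) f) = (C * kap j \<tau> * ((8^j) powr (1/p) * lpn (p/2) f))^2"
      proof -
        have "(8^j) powr (1/(p/2)) = ((8^j) powr (1/p) :: real)^2"
          by (simp add: power2_eq_square powr_add[symmetric])
        then show ?thesis by (simp add: power2_eq_square mult_ac)
      qed
      also have "sqrt \<dots> = C * kap j \<tau> * ((8^j) powr (1/p) * lpn (p/2) f)" using kp by (simp add: real_sqrt_abs2)
      finally show "mlp j \<tau> l i m (fc f) \<le> C * 2^j * kap j \<tau> * ((8^j) powr (1/p) * lpn (p/2) f)"
        unfolding eq s using mult_left_mono[of "lpn p G" _ "2^j"] by (simp add: mult_ac)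
    qed (rule C(1))
  qed
  define C where "C l i m = (SOME C. Q l i m C)" for l i m
  have Q: "Q l i m (C l i m)" for l i m
    using ex[of l i m] unfolding C_def by (rule someI_ex)
  then have C: "C l i m > 0"
    "0 \<le> \<tau> \<Longrightarrow> f \<in> bmeas \<Longrightarrow> (\<And>x. norm (f x) \<le> b) \<Longrightarrow>
       mlp j \<tau> l i m (fc f) \<le> C l i m * 2^j * kap j \<tau> * lpn p f \<and>
       mlp j \<tau> l i m (fc f) \<le> C l i m * 2^j * kap j \<tau> * ((8^j) powr (1/p) * lpn (p/2) f)"
    for l i m \<tau> j f b unfolding Q_def by blast+
  define C' where "C' = (\<Sum>(l,i,m)\<in>UNIV. C l i m)"
  have le: "C l i m \<le> C'" for l i m
    using member_le_sum[of "(l,i,m)" UNIV "\<lambda>(l,i,m). C l i m"] C(1) by (auto simp: C'_def less_imp_le)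
  have le2: "C l i m * 2^j * kap j \<tau> * y \<le> C' * 2^j * kap j \<tau> * y" if "0 \<le> y" for l i m j \<tau> y
    using le that by (intro mult_right_mono) (auto simp: kap_def)
  show ?thesis
  proof (rule that[of C'])
    show "C' > 0" using le[of 1 1 1] C(1)[of 1 1 1] by linarith
  next
    fix l i m :: 3 and \<tau> b :: real and j :: nat and f :: "real^3 \<Rightarrow> complex"
    assume a: "0 \<le> \<tau>" "f \<in> bmeas" "\<And>x. norm (f x) \<le> b"
    show "mlp j \<tau> l i m (fc f) \<le> C' * 2^j * kap j \<tau> * lpn p f"
      using C(2)[OF a, of j l i m] le2[of "lpn p f" l i m j \<tau>] lpn_nonneg by (meson order_trans)
    show "mlp j \<tau> l i m (fc f) \<le> C' * 2^j * kap j \<tau> * ((8^j) powr (1/p) * lpn (p/2) f)"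
      using C(2)[OF a, of j l i m] le2[of "(8^j) powr (1/p) * lpn (p/2) f" l i m j \<tau>] mult_nonneg_nonneg[OF powr_ge_zero lpn_nonneg]
      by (meson order_trans)
  qed
qed

end

section \<open>Bilinear estimates for the blocks\<close>

abbreviation CS :: "(int^3) measure" where "CS \<equiv> count_space UNIV"

text \<open>Both sides are zero by convention when the family is not summable. As an integral over
  counting measure the convolution becomes open to dominated convergence and to measurability in a
  parameter.\<close>

lemma conv_integral: "conv a b k = (\<integral>m. a m * b (k - m) \<partial>CS)"
proof (cases "integrable CS (\<lambda>m. a m * b (k - m))")
  case True
  then have "Infinite_Set_Sum.abs_summable_on (\<lambda>m. a m * b (k - m)) UNIV"
    by (simp add: Infinite_Set_Sum.abs_summable_on_def)
  from infsetsum_infsum[OF this] show ?thesis by (simp add: conv_def infsetsum_def)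
next
  case False
  then have "\<not> (\<lambda>m. a m * b (k - m)) summable_on UNIV"
    unfolding summable_on_iff_abs_summable_on_complex abs_summable_equivalent
    by (simp add: Infinite_Set_Sum.abs_summable_on_def)
  then show ?thesis using False by (simp add: conv_def infsum_not_exists not_integrable_integral_eq)
qed

lemma bij_reflect: "bij (\<lambda>m::int^3. k - m)"
  by (rule bij_betwI[of _ _ _ "\<lambda>m. k - m"]) auto

lemma conv_commute: "conv a b k = conv b a k"
proof -
  have "conv a b k = (\<Sum>\<^sub>\<infinity>m. a (k - m) * b (k - (k - m)))"
    unfolding conv_def by (rule infsum_reindex_bij_betw[OF bij_reflect, symmetric])
  then show ?thesis by (simp add: conv_def mult.commute)
qed

text \<open>Finite \<open>el2\<close> of both factors makes \<open>conv\<close> absolutely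
  convergent; as an extended real it can be bounded before its finiteness is known.\<close>

definition el2 :: "(int^3 \<Rightarrow> complex) \<Rightarrow> ennreal" where
  "el2 a = (\<integral>\<^sup>+m. ennreal (norm (a m)) ^ 2 \<partial>CS)"

lemma ennreal_power2_le_imp_le:
  fixes x y :: ennreal
  assumes "x^2 \<le> y^2"
  shows "x \<le> y"
proof (cases "y = \<infinity>")
  case False
  then obtain b where b: "0 \<le> b" "y = ennreal b" by (cases y) auto
  have "x \<noteq> \<infinity>"
  proof
    assume "x = \<infinity>"
    then have "\<infinity> \<le> ennreal (b^2)" using assms b by (simp add: ennreal_power)
    then show False by (simp add: top_unique)
  qed
  then obtain a where a: "0 \<le> a" "x = ennreal a" by (cases x) auto
  have "a^2 \<le> b^2" using assms a b by (simp add: ennreal_power)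
  then show ?thesis using a b by (auto intro: ennreal_leI power2_le_imp_le)
qed simp

text \<open>Cauchy-Schwarz after reflecting the second factor. The hypotheses are stated with
  squares so that no root of an extended real has to be taken.\<close>

lemma conv_nn_bound:
  assumes "el2 a \<le> A^2" "el2 b \<le> D^2"
  shows "(\<integral>\<^sup>+m. ennreal (norm (a m * b (k - m))) \<partial>CS) \<le> A * D"
proof (rule ennreal_power2_le_imp_le)
  have "(\<integral>\<^sup>+m. ennreal (norm (a m * b (k - m))) \<partial>CS)^2 = (\<integral>\<^sup>+m. ennreal (norm (a m)) * ennreal (norm (b (k - m))) \<partial>CS)^2"
    by (simp add: norm_mult ennreal_mult)
  also have "\<dots> \<le> el2 a * (\<integral>\<^sup>+m. ennreal (norm (b (k - m))) ^ 2 \<partial>CS)"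
    unfolding el2_def by (rule Cauchy_Schwarz_nn_integral) auto
  also have "(\<integral>\<^sup>+m. ennreal (norm (b (k - m))) ^ 2 \<partial>CS) = el2 b"
    unfolding el2_def by (rule nn_integral_bij_count_space[OF bij_reflect])
  also have "el2 a * el2 b \<le> A^2 * D^2" using assms by (rule mult_mono) auto
  finally show "(\<integral>\<^sup>+m. ennreal (norm (a m * b (k - m))) \<partial>CS)^2 \<le> (A * D)^2" by (simp add: power_mult_distrib)
qed

lemma conv_integrable:
  assumes "el2 a < \<infinity>" "el2 b < \<infinity>"
  shows "integrable CS (\<lambda>m. a m * b (k - m))"
proof -
  have fin: "\<exists>A. e \<le> A^2 \<and> A < \<infinity>" if e: "e < \<infinity>" for e :: ennreal
  proof -
    obtain r where "0 \<le> r" "e = ennreal r" using e by (cases e) auto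
    then show ?thesis by (intro exI[of _ "ennreal (sqrt r)"]) (auto simp: ennreal_power)
  qed
  obtain A D where AD: "el2 a \<le> A^2" "A < \<infinity>" "el2 b \<le> D^2" "D < \<infinity>" using fin[OF assms(1)] fin[OF assms(2)] by auto
  have "(\<integral>\<^sup>+m. ennreal (norm (a m * b (k - m))) \<partial>CS) \<le> A * D" by (rule conv_nn_bound[OF AD(1,3)])
  also have "\<dots> < \<infinity>" using AD by (simp add: ennreal_mult_less_top)
  finally show ?thesis by (simp add: integrable_iff_bounded)
qed

lemma conv_bound:
  assumes "el2 a \<le> A^2" "el2 b \<le> D^2"
  shows "ennreal (norm (conv a b k)) \<le> A * D"
proof (cases "integrable CS (\<lambda>m. a m * b (k - m))")
  case True
  have "ennreal (norm (conv a b k)) \<le> (\<integral>\<^sup>+m. ennreal (norm (a m * b (k - m))) \<partial>CS)"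
    unfolding conv_integral using True by (rule integral_norm_bound_ennreal)
  then show ?thesis using conv_nn_bound[OF assms] order_trans by blast
next
  case False
  then show ?thesis by (simp add: conv_integral not_integrable_integral_eq)
qed

lemma conv_diff_left:
  assumes "el2 a < \<infinity>" "el2 a' < \<infinity>" "el2 b < \<infinity>"
  shows "conv (\<lambda>m. a m - a' m) b k = conv a b k - conv a' b k"
  unfolding conv_integral left_diff_distrib
  by (rule Bochner_Integration.integral_diff) (intro conv_integrable assms)+

lemma integrable_tp_mult: "integrable torus (\<lambda>x. tp A c x * tp A' d x)"
  by (intro integrable_torus_continuous continuous_intros)

lemma fc_sum:
  assumes "\<And>i. i \<in> I \<Longrightarrow> integrable torus (f i)"
  shows "fc (\<lambda>x. \<Sum>i\<in>I. f i x) k = (\<Sum>i\<in>I. fc (f i) k)"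
proof -
  have int: "integrable torus (\<lambda>y. cis (- (rvec k \<bullet> y)) * f i y)" if "i \<in> I" for i
    by (rule Bochner_Integration.integrable_bound[OF assms[OF that]])
       (use borel_measurable_integrable[OF assms[OF that]] in \<open>auto simp: norm_mult\<close>)
  then show ?thesis
    unfolding fc_def sum_distrib_left by (subst Bochner_Integration.integral_sum) (auto simp: sum_divide_distrib)
qed

lemma fc_mult_tp:
  assumes A: "finite A" and c: "\<And>k. k \<notin> A \<Longrightarrow> c k = 0" and d: "\<And>k. k \<notin> A \<Longrightarrow> d k = 0"
  shows "fc (\<lambda>x. tp A c x * tp A d x) k = conv c d k"
proof -
  have eq: "tp A c x * tp A d x = (\<Sum>m\<in>A. tp {m} (\<lambda>_. c m) x * tp A d x)" for x
    by (simp add: tp_def sum_distrib_right)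
  have single: "fc (\<lambda>x. tp {m} (\<lambda>_. c m) x * tp A d x) k = c m * d (k - m)" for m
  proof -
    have "(\<integral>x. cis (- (rvec k \<bullet> x)) * (tp {m} (\<lambda>_. c m) x * tp A d x) \<partial>torus)
        = (\<integral>x. c m * (cis (- (rvec (k - m) \<bullet> x)) * tp A d x) \<partial>torus)"
    proof (intro Bochner_Integration.integral_cong refl)
      fix x
      have "cis (- (rvec k \<bullet> x)) * cis (rvec m \<bullet> x) = cis (- (rvec (k - m) \<bullet> x))"
        by (simp add: cis_mult rvec_diff inner_diff_left)
      then show "cis (- (rvec k \<bullet> x)) * (tp {m} (\<lambda>_. c m) x * tp A d x) = c m * (cis (- (rvec (k - m) \<bullet> x)) * tp A d x)"
        by (simp add: tp_def[of "{m}"] mult_ac)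
    qed
    then have "fc (\<lambda>x. tp {m} (\<lambda>_. c m) x * tp A d x) k = c m * fc (tp A d) (k - m)"
      by (simp add: fc_def)
    then show ?thesis using fc_tp[OF A, of d "k - m"] d by (auto split: if_splits)
  qed
  have "fc (\<lambda>x. tp A c x * tp A d x) k = (\<Sum>m\<in>A. c m * d (k - m))"
    unfolding eq by (subst fc_sum) (auto simp: single integrable_tp_mult)
  also have "\<dots> = conv c d k"
    unfolding conv_def using A c by (subst infsum_finite[symmetric], simp) (rule infsum_cong_neutral, auto)
  finally show ?thesis .
qed

lemma lpn_tp_tendsto:
  assumes A: "finite A" and lim: "\<And>k. k \<in> A \<Longrightarrow> (\<lambda>n. c n k) \<longlonglongrightarrow> c' k" and q: "q > 1"
  shows "(\<lambda>n. lpn q (tp A (c n))) \<longlonglongrightarrow> lpn q (tp A c')"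
proof -
  have tri: "lpn q (tp A a) \<le> lpn q (tp A b) + lpn q (tp A (\<lambda>k. a k - b k))" for a b
  proof -
    have "lpn q (tp A a) \<le> (\<Sum>s\<in>{True, False}. lpn q (if s then tp A b else tp A (\<lambda>k. a k - b k)))"
    proof (rule lpn_sum_le)
      show "norm (tp A a x) \<le> (\<Sum>s\<in>{True, False}. norm ((if s then tp A b else tp A (\<lambda>k. a k - b k)) x))" for x
      proof -
        have "tp A a x = tp A b x + tp A (\<lambda>k. a k - b k) x" by (simp add: tp_def sum.distrib[symmetric] algebra_simps)
        then show ?thesis by (simp add: norm_triangle_ineq)
      qed
      show "norm ((if s then tp A b else tp A (\<lambda>k. a k - b k)) x) \<le> (\<Sum>k\<in>A. norm (b k)) + (\<Sum>k\<in>A. norm (a k - b k))" for s x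
      proof -
        have "0 \<le> (\<Sum>k\<in>A. norm (b k))" "0 \<le> (\<Sum>k\<in>A. norm (a k - b k))" by (auto intro: sum_nonneg)
        then show ?thesis using tp_bound[of A b x] tp_bound[of A "\<lambda>k. a k - b k" x]
          by (cases s) auto
      qed
    qed (use q in auto)
    then show ?thesis by simp
  qed
  have sm: "lpn q (tp A (\<lambda>k. a k - b k)) \<le> ((2*pi)^3) powr (1/q) * (\<Sum>k\<in>A. norm (a k - b k))" for a b
    using q by (intro lpn_le_sup tp_bound) auto
  have "(\<lambda>n. ((2*pi)^3) powr (1/q) * (\<Sum>k\<in>A. norm (c n k - c' k))) \<longlonglongrightarrow> ((2*pi)^3) powr (1/q) * (\<Sum>k\<in>A. norm (c' k - c' k))"
    by (intro tendsto_intros lim)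
  then have z: "(\<lambda>n. ((2*pi)^3) powr (1/q) * (\<Sum>k\<in>A. norm (c n k - c' k))) \<longlonglongrightarrow> 0" by simp
  have "\<bar>lpn q (tp A (c n)) - lpn q (tp A c')\<bar> \<le> ((2*pi)^3) powr (1/q) * (\<Sum>k\<in>A. norm (c n k - c' k))" for n
    using tri[of "c n" c'] tri[of c' "c n"] sm[of "c n" c'] sm[of c' "c n"] by (simp add: norm_minus_commute[of "c' _"])
  then have "(\<lambda>n. lpn q (tp A (c n)) - lpn q (tp A c')) \<longlonglongrightarrow> 0"
    by (intro Lim_null_comparison[OF _ z]) auto
  then show ?thesis by (simp add: LIM_zero_iff)
qed

lemma lpn_2_le:
  fixes f :: "real^3 \<Rightarrow> complex"
  assumes [measurable]: "f \<in> bmeas" and b: "\<And>x. norm (f x) \<le> b" and q: "q > 2"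
  shows "lpn 2 f \<le> ((2*pi)^3) powr (1/2 - 1/q) * lpn q f"
proof (rule lpn_leI)
  have "(\<integral>x. (norm (f x) powr q) powr (2/q) * 1 powr (1 - 2/q) \<partial>torus)
    \<le> (\<integral>x. norm (f x) powr q \<partial>torus) powr (2/q) * (\<integral>x. 1 \<partial>torus) powr (1 - 2/q)"
    using q b by (intro Holder_integral integrable_powr_torus) auto
  also have "(\<integral>x. norm (f x) powr q \<partial>torus) powr (2/q) = lpn q f powr 2"
    using q by (simp add: lpn_def powr_powr)
  also have "(\<integral>x. 1 \<partial>torus) powr (1 - 2/q) = (((2*pi)^3) powr (1/2 - 1/q)) powr 2"
    by (simp add: powr_powr algebra_simps)
  finally show "(\<integral>x. norm (f x) powr 2 \<partial>torus) \<le> (((2*pi)^3) powr (1/2 - 1/q) * lpn q f) powr 2"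
    using q by (simp add: powr_powr powr_mult mult_ac)
qed auto

section \<open>Smooth truncations, limits of products, and bilinear block bounds\<close>

context besov_setup
begin

text \<open>The low-frequency cutoff \<open>S_n\<close>. Its smooth symbol has kernels bounded in
  \<open>L^1\<close> uniformly in \<open>n\<close>, so truncations of a bounded field stay uniformly
  bounded; on mean-free fields it is also the sum of the blocks up to \<open>n\<close>.\<close>

definition tr :: "nat \<Rightarrow> (int^3 \<Rightarrow> complex) \<Rightarrow> int^3 \<Rightarrow> complex" where
  "tr n a k = of_real (chi (hj n *\<^sub>R rvec k)) * a k"

lemma chi_bounded: obtains M where "M \<ge> 1" "\<And>x. \<bar>chi x\<bar> \<le> M"
proof -
  obtain M where M: "M \<ge> 0" "bd 0 annulus (\<lambda>x. chi (1 *\<^sub>R x)) M" using smooth3_bd[OF bounded_annulus chi_smooth] by blast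
  have "\<bar>chi x\<bar> \<le> M + 1" for x
  proof (cases "norm x \<le> 1 \<or> norm x \<ge> 2")
    case True then show ?thesis using M by (auto simp: chi_1 chi_0)
  next
    case False
    then have "x \<in> annulus" by (auto simp: annulus_def)
    then have "\<bar>chi x\<bar> \<le> M" using M by simp
    then show ?thesis by simp
  qed
  then show ?thesis using M by (intro that[of "M + 1"]) auto
qed

lemma tr_out: "k \<notin> B n \<Longrightarrow> tr n a k = 0"
  using in_B[of n k] chi_0[of "hj n *\<^sub>R rvec k"] unfolding tr_def by force

lemma tr_tendsto: "(\<lambda>n. tr n a k) \<longlonglongrightarrow> a k"
proof -
  have "(\<lambda>n. (1/2::real)^n * norm (rvec k)) \<longlonglongrightarrow> 0 * norm (rvec k)"
    by (intro tendsto_intros LIMSEQ_realpow_zero) auto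
  then have "eventually (\<lambda>n. (1/2::real)^n * norm (rvec k) < 1) sequentially"
    by (intro order_tendstoD(2)) auto
  then have "eventually (\<lambda>n. tr n a k = a k) sequentially"
    by eventually_elim (simp add: tr_def chi_1 hj_def)
  then show ?thesis by (rule tendsto_eventually)
qed

text \<open>Dominated convergence over counting measure: the cutoff is bounded, and the untruncated
  convolution converges absolutely.\<close>

lemma conv_tr_tendsto:
  assumes "el2 a < \<infinity>" "el2 b < \<infinity>"
  shows "(\<lambda>n. conv (tr n a) (tr n b) k) \<longlonglongrightarrow> conv a b k"
proof -
  obtain M where M: "M \<ge> 1" "\<And>x. \<bar>chi x\<bar> \<le> M" by (rule chi_bounded) blast
  show ?thesis unfolding conv_integral
  proof (rule integral_dominated_convergence)
    show "integrable CS (\<lambda>m. M * M * norm (a m * b (k - m)))"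
      by (intro integrable_mult_right integrable_norm conv_integrable assms)
    show "AE m in CS. (\<lambda>n. tr n a m * tr n b (k - m)) \<longlonglongrightarrow> a m * b (k - m)"
      by (intro AE_I2 tendsto_intros tr_tendsto)
    show "AE m in CS. norm (tr n a m * tr n b (k - m)) \<le> M * M * norm (a m * b (k - m))" for n
    proof (rule AE_I2)
      fix m
      have "norm (tr n a m * tr n b (k - m)) = (\<bar>chi (hj n *\<^sub>R rvec m)\<bar> * \<bar>chi (hj n *\<^sub>R rvec (k - m))\<bar>) * norm (a m * b (k - m))"
        by (simp add: tr_def norm_mult)
      also have "\<dots> \<le> (M * M) * norm (a m * b (k - m))" using M by (intro mult_right_mono mult_mono) auto
      finally show "norm (tr n a m * tr n b (k - m)) \<le> M * M * norm (a m * b (k - m))" .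
    qed
  qed auto
qed

text \<open>The sum telescopes, and its lower end \<open>chi (2 k)\<close> vanishes because nonzero
  lattice points have norm at least one.\<close>

lemma sum_ph: assumes "k \<noteq> 0" shows "(\<Sum>j\<le>n. ph j k) = chi (hj n *\<^sub>R rvec k)"
proof (induction n)
  case 0
  have "norm (2 *\<^sub>R rvec k) \<ge> 2" using norm_rvec_ge_1[OF assms] by simp
  then show ?case by (simp add: ph_def phi_def hj_def chi_0)
next
  case (Suc n)
  have "2 * hj (Suc n) = hj n" by (simp add: hj_def)
  then show ?case using Suc by (simp add: ph_def phi_def)
qed

lemma B_mono: "j \<le> n \<Longrightarrow> B j \<subseteq> B n"
proof -
  assume "j \<le> n"
  then have "int (2^(j+3)) \<le> int (2^(n+3))" by (simp only: of_nat_le_iff) (rule power_increasing, auto)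
  then show ?thesis by (auto simp: B_def bx_def simp del: of_nat_power intro: order_trans)
qed

lemma tp_tr_blocks:
  assumes "a 0 = 0"
  shows "tp (B n) (tr n (\<lambda>k. a k $ i)) x = (\<Sum>j\<le>n. cmp j a i x)"
proof -
  have "cmp j a i x = tp (B n) (\<lambda>k. of_real (ph j k) * a k $ i) x" if "j \<le> n" for j
    unfolding cmp_def using B_mono[OF that] by (intro tp_mono_neutral) (auto simp: ph_out)
  then have "(\<Sum>j\<le>n. cmp j a i x) = (\<Sum>j\<le>n. tp (B n) (\<lambda>k. of_real (ph j k) * a k $ i) x)" by simp
  also have "\<dots> = (\<Sum>k\<in>B n. (\<Sum>j\<le>n. of_real (ph j k)) * a k $ i * cis (rvec k \<bullet> x))"
    unfolding tp_def by (subst sum.swap) (simp add: sum_distrib_right)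
  also have "\<dots> = tp (B n) (tr n (\<lambda>k. a k $ i)) x"
    unfolding tp_def
  proof (intro sum.cong refl)
    fix k
    show "(\<Sum>j\<le>n. of_real (ph j k)) * a k $ i * cis (rvec k \<bullet> x) = tr n (\<lambda>k. a k $ i) k * cis (rvec k \<bullet> x)"
      using sum_ph[of k n] assms by (cases "k = 0") (auto simp: tr_def of_real_sum[symmetric] simp del: of_real_sum)
  qed
  finally show ?thesis ..
qed

text \<open>The norm of \<open>B^0_(p,1)\<close>. It controls the \<open>L^2\<close> norm, so that
  convolutions converge, and is itself controlled by the norm of \<open>B^(3/p)_(p,2)\<close>, hence
  finite at almost every time.\<close>

definition NS :: "field \<Rightarrow> ennreal" where "NS a = (\<Sum>j. ennreal (N j a))"

text \<open>Parseval bounds every truncation, and Fatou's lemma for counting measure passes to the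
  limit.\<close>

lemma el2_tr_limit:
  assumes "\<And>n. (\<integral>x. (norm (tp (B n) (tr n a) x))^2 \<partial>torus) \<le> K"
  shows "el2 a \<le> ennreal K"
proof -
  have K0: "0 \<le> K" using assms[of 0] by (rule order_trans[rotated]) simp
  have el: "el2 (tr n a) \<le> ennreal K" for n
  proof -
    have "el2 (tr n a) = (\<integral>\<^sup>+m. ennreal ((norm (tr n a m))^2) \<partial>CS)" by (simp add: el2_def ennreal_power)
    also have "\<dots> = (\<Sum>m\<in>B n. ennreal ((norm (tr n a m))^2))"
      by (rule nn_integral_count_space'[of "B n"]) (auto simp: tr_out)
    also have "\<dots> = ennreal (\<Sum>m\<in>B n. (norm (tr n a m))^2)" by (rule sum_ennreal) auto
    also have "\<dots> \<le> ennreal K"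
    proof (rule ennreal_leI)
      have "1 \<le> (2*pi)^3" using pi_ge_two by (intro one_le_power) auto
      then have "1 * (\<Sum>m\<in>B n. (norm (tr n a m))^2) \<le> (2*pi)^3 * (\<Sum>m\<in>B n. (norm (tr n a m))^2)"
        by (intro mult_right_mono sum_nonneg) auto
      then show "(\<Sum>m\<in>B n. (norm (tr n a m))^2) \<le> K" using assms[of n] by (simp add: Parseval_tp)
    qed
    finally show ?thesis .
  qed
  have "el2 a = (\<integral>\<^sup>+m. liminf (\<lambda>n. ennreal (norm (tr n a m)) ^ 2) \<partial>CS)"
    unfolding el2_def
  proof (intro nn_integral_cong)
    fix m
    have "(\<lambda>n. ennreal ((norm (tr n a m))^2)) \<longlonglongrightarrow> ennreal ((norm (a m))^2)"
      by (intro tendsto_ennrealI tendsto_intros tr_tendsto)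
    then have "liminf (\<lambda>n. ennreal ((norm (tr n a m))^2)) = ennreal ((norm (a m))^2)"
      by (rule lim_imp_Liminf[OF sequentially_bot])
    then show "ennreal (norm (a m)) ^ 2 = liminf (\<lambda>n. ennreal (norm (tr n a m)) ^ 2)"
      by (simp add: ennreal_power)
  qed
  also have "\<dots> \<le> liminf (\<lambda>n. el2 (tr n a))" unfolding el2_def by (rule nn_integral_liminf) auto
  also have "\<dots> \<le> liminf (\<lambda>n. ennreal K)" by (intro Liminf_mono always_eventually allI el)
  also have "\<dots> = ennreal K" by (simp add: Liminf_const)
  finally show ?thesis .
qed

lemma el2_NS: obtains C where "C > 0" "\<And>a i. a 0 = 0 \<Longrightarrow> el2 (\<lambda>k. a k $ i) \<le> (ennreal C * NS a)^2"
proof -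
  define C where "C = ((2*pi)^3) powr (1/2 - 1/p)"
  have C: "C > 0" by (simp add: C_def)
  have "el2 (\<lambda>k. a k $ i) \<le> (ennreal C * NS a)^2" if a0: "a 0 = 0" for a :: field and i
  proof (cases "NS a = \<infinity>")
    case True
    then show ?thesis using C by (simp add: ennreal_mult_top power2_eq_square)
  next
    case False
    then obtain s where s: "0 \<le> s" "NS a = ennreal s" by (cases "NS a") auto
    have "(\<integral>x. (norm (tp (B n) (tr n (\<lambda>k. a k $ i)) x))^2 \<partial>torus) \<le> (C * s)^2" for n
    proof -
      have "lpn 2 (tp (B n) (tr n (\<lambda>k. a k $ i))) \<le> (\<Sum>j\<le>n. lpn 2 (cmp j a i))"
        by (rule lpn_sum_le[where B'="\<lambda>j. cmpB j a"]) (auto simp: tp_tr_blocks[of a, OF a0] norm_sum cmp_bound)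
      also have "\<dots> \<le> (\<Sum>j\<le>n. C * N j a)"
      proof (rule sum_mono)
        fix j
        have "lpn 2 (cmp j a i) \<le> C * lpn p (cmp j a i)" unfolding C_def using p3 by (intro lpn_2_le[where b="cmpB j a"] cmp_bound) auto
        also have "\<dots> \<le> C * N j a" using C by (intro mult_left_mono lpn_cmp_le) auto
        finally show "lpn 2 (cmp j a i) \<le> C * N j a" .
      qed
      also have "\<dots> = C * (\<Sum>j\<le>n. N j a)" by (simp add: sum_distrib_left)
      also have "\<dots> \<le> C * s"
      proof (intro mult_left_mono)
        have "ennreal (\<Sum>j\<le>n. N j a) = (\<Sum>j\<le>n. ennreal (N j a))" by (simp add: sum_ennreal)
        also have "\<dots> \<le> NS a" unfolding NS_def by (rule sum_le_suminf) auto
        finally show "(\<Sum>j\<le>n. N j a) \<le> s" using s by simp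
      qed (use C in auto)
      finally have "lpn 2 (tp (B n) (tr n (\<lambda>k. a k $ i))) powr 2 \<le> (C * s) powr 2" by (intro powr_mono2) auto
      then show ?thesis using C s by (subst (asm) lpn_powr) (auto simp: powr_numeral)
    qed
    then have "el2 (\<lambda>k. a k $ i) \<le> ennreal ((C * s)^2)" by (rule el2_tr_limit)
    then show ?thesis using C s by (simp add: ennreal_mult' ennreal_power[symmetric])
  qed
  with C show ?thesis by (rule that)
qed

text \<open>The cutoff itself has compact support and involves no division by \<open>norm x\<close>,
  so the kernel bound applies to it directly at scale \<open>2^(-n)\<close>, on a ball in place of
  the annulus.\<close>

lemma tr_sup:
  obtains C where "C > 0" "\<And>f M n x. f \<in> bmeas \<Longrightarrow> (AE x in torus. norm (f x) \<le> M) \<Longrightarrow> 0 \<le> M \<Longrightarrow>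
      norm (tp (B n) (tr n (fc f)) x) \<le> C * M"
proof -
  have "\<exists>M\<ge>0. bd 3 (ball 0 5) (\<lambda>x. chi (1 *\<^sub>R x)) M" by (rule smooth3_bd[OF bounded_ball chi_smooth])
  then obtain M1 where M1: "M1 \<ge> 0" "bd 3 (ball 0 5) chi M1" by auto
  have bdc: "bd 3 UNIV chi M1"
    by (rule bd_extend[of "ball 0 5" "cball 0 2"]) (use M1 chi_0' in \<open>auto\<close>)
  have K: "(\<integral>x. norm (tp (B n) (\<lambda>k. of_real (chi (hj n *\<^sub>R rvec k))) x) \<partial>torus) \<le> KC * M1" for n
    by (rule kernel_bound(1)[OF bdc M1(1)]) (auto simp: chi_0 intro!: in_B)
  show ?thesis
  proof (rule that[of "KC * M1 + 1"])
    show "KC * M1 + 1 > 0" using order_trans[OF _ KC(1), of 0] M1 by (simp add: add_nonneg_pos)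
    fix f :: "real^3 \<Rightarrow> complex" and M n x assume f: "f \<in> bmeas" "AE x in torus. norm (f x) \<le> M" "0 \<le> M"
    have "norm (tp (B n) (tr n (fc f)) x) \<le> (\<integral>y. norm (tp (B n) (\<lambda>k. of_real (chi (hj n *\<^sub>R rvec k))) y) \<partial>torus) * M"
      using multiplier_sup_AE[OF f(1,2)] unfolding tr_def .
    also have "\<dots> \<le> (KC * M1 + 1) * M" using K[of n] f(3) by (intro mult_right_mono) auto
    finally show "norm (tp (B n) (tr n (fc f)) x) \<le> (KC * M1 + 1) * M" .
  qed
qed

lemma el2_fc:
  obtains C where "C > 0" "\<And>f M. f \<in> bmeas \<Longrightarrow> (AE x in torus. norm (f x) \<le> M) \<Longrightarrow> 0 \<le> M \<Longrightarrow>
      el2 (fc f) \<le> (ennreal (C * M))^2"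
proof -
  obtain C where C: "C > 0" "\<And>f M n x. f \<in> bmeas \<Longrightarrow> (AE x in torus. norm (f x) \<le> M) \<Longrightarrow> 0 \<le> M \<Longrightarrow>
      norm (tp (B n) (tr n (fc f)) x) \<le> C * M" by (rule tr_sup) blast
  define C' where "C' = sqrt ((2*pi)^3) * C"
  show ?thesis
  proof (rule that[of C'])
    show "C' > 0" using C by (simp add: C'_def)
    fix f :: "real^3 \<Rightarrow> complex" and M assume f: "f \<in> bmeas" "AE x in torus. norm (f x) \<le> M" "0 \<le> M"
    have "(\<integral>x. (norm (tp (B n) (tr n (fc f)) x))^2 \<partial>torus) \<le> (C' * M)^2" for n
    proof -
      have "(\<integral>x. (norm (tp (B n) (tr n (fc f)) x))^2 \<partial>torus) \<le> (\<integral>x. (C * M)^2 \<partial>torus)"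
        using C(2)[OF f] by (intro integral_mono integrable_torus_continuous continuous_intros power_mono) auto
      also have "\<dots> = (C' * M)^2" by (simp add: C'_def power_mult_distrib)
      finally show ?thesis .
    qed
    then have "el2 (fc f) \<le> ennreal ((C' * M)^2)" by (rule el2_tr_limit)
    then show "el2 (fc f) \<le> (ennreal (C' * M))^2" using C f(3) by (simp add: C'_def ennreal_power)
  qed
qed

text \<open>The Bernstein factor \<open>2^((3/p) m)\<close>, where \<open>m\<close> is the least of
  the two input frequencies and the output frequency.\<close>

definition w :: "nat \<Rightarrow> nat \<Rightarrow> nat \<Rightarrow> real" where "w j i i' = (8 ^ (min i (min i' j))) powr (1/p)"

text \<open>All pairs of input blocks are kept for every output block. The minimum with
  \<open>j\<close> in the weight does the work that the frequency support of a product would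
  otherwise do.\<close>

definition EN :: "nat \<Rightarrow> field \<Rightarrow> field \<Rightarrow> ennreal" where
  "EN j a b = (\<Sum>i. \<Sum>i'. ennreal (w j i i' * N i a * N i' b))"

text \<open>A block involves finitely many coefficients, so their pointwise convergence suffices to
  carry a bound from truncations to the full convolution.\<close>

lemma lpn_scaled_limit:
  assumes lim: "\<And>k. k \<in> B j \<Longrightarrow> (\<lambda>n. c n k) \<longlonglongrightarrow> c' k"
    and le: "\<And>n. ennreal (lpn p (tp (B j) (\<lambda>k. m k * c n k))) \<le> E"
  shows "ennreal (lpn p (tp (B j) (\<lambda>k. m k * c' k))) \<le> E"
proof -
  have "(\<lambda>n. lpn p (tp (B j) (\<lambda>k. m k * c n k))) \<longlonglongrightarrow> lpn p (tp (B j) (\<lambda>k. m k * c' k))"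
    using p3 by (intro lpn_tp_tendsto) (auto intro!: tendsto_intros lim)
  then have "(\<lambda>n. ennreal (lpn p (tp (B j) (\<lambda>k. m k * c n k)))) \<longlonglongrightarrow> ennreal (lpn p (tp (B j) (\<lambda>k. m k * c' k)))"
    by (rule tendsto_ennrealI)
  then show ?thesis by (rule LIMSEQ_le_const2) (rule exI[of _ 0], simp add: le)
qed

lemma cmp_prod_bound: "norm (cmp i1 a i x * cmp i2 b m x) \<le> cmpB i1 a * cmpB i2 b"
  unfolding norm_mult by (rule mult_mono) (auto simp: cmp_bound intro: order_trans[OF norm_ge_zero cmp_bound])

text \<open>The convolution is approximated by that of truncations. These are trigonometric
  polynomials, whose product is a finite sum of products of blocks; each is estimated separately and
  the limit is taken at the end.\<close>

lemma msym_conv: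
  obtains C where "C > 0" "\<And>j \<tau> l i m a b. 0 \<le> \<tau> \<Longrightarrow> a 0 = 0 \<Longrightarrow> b 0 = 0 \<Longrightarrow> NS a < \<infinity> \<Longrightarrow> NS b < \<infinity> \<Longrightarrow>
     ennreal (mlp j \<tau> l i m (conv (\<lambda>n. a n $ i) (\<lambda>n. b n $ m)))
       \<le> ennreal (C * 2^j * kap j \<tau>) * EN j a b"
proof -
  obtain C1 where C1: "C1 > 0"
    "\<And>l i m \<tau> j f b. 0 \<le> \<tau> \<Longrightarrow> f \<in> bmeas \<Longrightarrow> (\<And>x. norm (f x) \<le> b) \<Longrightarrow>
       mlp j \<tau> l i m (fc f) \<le> C1 * 2^j * kap j \<tau> * lpn p f"
    "\<And>l i m \<tau> j f b. 0 \<le> \<tau> \<Longrightarrow> f \<in> bmeas \<Longrightarrow> (\<And>x. norm (f x) \<le> b) \<Longrightarrow>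
       mlp j \<tau> l i m (fc f) \<le> C1 * 2^j * kap j \<tau> * ((8^j) powr (1/p) * lpn (p/2) f)"
    by (rule Pdiv_multiplier) blast
  obtain C2 where C2: "C2 > 0" "\<And>j c i x. norm (cmp j c i x) \<le> C2 * (8^j) powr (1/p) * N j c"
    by (rule heat_block) blast
  obtain C3 where C3: "C3 > 0" "\<And>a i. a 0 = 0 \<Longrightarrow> el2 (\<lambda>k. a k $ i) \<le> (ennreal C3 * NS a)^2" by (rule el2_NS) blast
  \<comment> \<open>\<open>C2 + 1\<close> dominates the Bernstein constant \<open>C2\<close>, used
    when an input frequency is lowest, and also 1, used when the output frequency is lowest.\<close>
  define C where "C = C1 * (C2 + 1)"
  have Cpos: "C > 0" using C1 C2 by (simp add: C_def)
  have blk: "mlp j \<tau> l i m (fc (\<lambda>x. cmp i1 a i x * cmp i2 b m x))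
      \<le> C * 2^j * kap j \<tau> * (w j i1 i2 * N i1 a * N i2 b)" (is "?L \<le> _") if \<tau>: "0 \<le> \<tau>" for j \<tau> l i m a b i1 i2
  proof -
    let ?f = "\<lambda>x. cmp i1 a i x * cmp i2 b m x"
    have fm: "?f \<in> bmeas" by measurable
    have K0: "0 \<le> 2^j * kap j \<tau>" by (simp add: kap_def)
    have L1: "?L \<le> C1 * 2^j * kap j \<tau> * lpn p ?f" by (rule C1(2)[OF \<tau> fm cmp_prod_bound])
    have L2: "?L \<le> C1 * 2^j * kap j \<tau> * ((8^j) powr (1/p) * lpn (p/2) ?f)" by (rule C1(3)[OF \<tau> fm cmp_prod_bound])
    have prodle: "lpn p (\<lambda>x. cmp i1 a i x * cmp i2 b m x) \<le> C2 * (8^i1) powr (1/p) * N i1 a * N i2 b" for i1 i2 a b i m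
    proof -
      have "lpn p (\<lambda>x. cmp i1 a i x * cmp i2 b m x) \<le> lpn p (\<lambda>x. of_real (C2 * (8^i1) powr (1/p) * N i1 a) * cmp i2 b m x)"
        using p3 C2 cmp_bound[of i2 b m]
        by (intro lpn_mono[where B="C2 * (8^i1) powr (1/p) * N i1 a * cmpB i2 b"])
           (auto simp: norm_mult abs_mult intro!: mult_right_mono mult_left_mono)
      also have "\<dots> = (C2 * (8^i1) powr (1/p) * N i1 a) * lpn p (cmp i2 b m)"
        using p3 C2(1) by (intro lpn_cmult) (auto simp: norm_mult)
      also have "\<dots> \<le> (C2 * (8^i1) powr (1/p) * N i1 a) * N i2 b" using C2(1) by (intro mult_left_mono lpn_cmp_le) auto
      finally show ?thesis .
    qed
    have prodle': "lpn p ?f \<le> C2 * (8^i2) powr (1/p) * N i1 a * N i2 b"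
      using prodle[of i2 b m i1 a i] by (simp add: mult_ac)
    have half: "lpn (p/2) ?f \<le> N i1 a * N i2 b"
    proof -
      have "lpn (p/2) ?f \<le> lpn p (cmp i1 a i) * lpn p (cmp i2 b m)"
        using p3 by (intro lpn_mult_half[OF _ _ cmp_bound cmp_bound]) auto
      also have "\<dots> \<le> N i1 a * N i2 b" by (intro mult_mono lpn_cmp_le) auto
      finally show ?thesis .
    qed
    have nn: "0 \<le> N i1 a * N i2 b" by simp
    have step: "C1 * 2^j * kap j \<tau> * X \<le> C * 2^j * kap j \<tau> * (y * N i1 a * N i2 b)"
      if "X \<le> (C2 + 1) * (y * (N i1 a * N i2 b))" for X y
    proof -
      have "C1 * (2^j * kap j \<tau>) * X \<le> C1 * (2^j * kap j \<tau>) * ((C2 + 1) * (y * (N i1 a * N i2 b)))"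
        using C1 K0 that by (intro mult_left_mono) auto
      then show ?thesis by (simp add: C_def mult_ac)
    qed
    \<comment> \<open>Bernstein's inequality is spent on the lowest frequency: on one of the
      factors, then measured in sup norm, or on the product, taken from \<open>L^(p/2)\<close> to
      \<open>L^p\<close>.\<close>
    consider "min i1 (min i2 j) = i1" | "min i1 (min i2 j) = i2" | "min i1 (min i2 j) = j" by linarith
    then show ?thesis
    proof cases
      case 1
      have "lpn p ?f \<le> (C2 + 1) * (w j i1 i2 * (N i1 a * N i2 b))"
        using prodle[of i1 a i i2 b m] nn unfolding w_def 1 by (simp add: algebra_simps) (smt (verit) mult_nonneg_nonneg N_nonneg powr_ge_zero)
      then show ?thesis using L1 step by (meson order_trans)
    next
      case 2
      have "lpn p ?f \<le> (C2 + 1) * (w j i1 i2 * (N i1 a * N i2 b))"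
        using prodle' nn unfolding w_def 2 by (simp add: algebra_simps) (smt (verit) mult_nonneg_nonneg N_nonneg powr_ge_zero)
      then show ?thesis using L1 step by (meson order_trans)
    next
      case 3
      have "(8^j) powr (1/p) * lpn (p/2) ?f \<le> 1 * (w j i1 i2 * (N i1 a * N i2 b))"
        using half unfolding w_def 3 by (simp add: mult_left_mono)
      also have "\<dots> \<le> (C2 + 1) * (w j i1 i2 * (N i1 a * N i2 b))" using C2(1) by (intro mult_right_mono) (auto simp: w_def)
      finally show ?thesis using L2 step by (meson order_trans)
    qed
  qed
  show ?thesis
  proof (rule that[OF Cpos])
    fix j l i m and \<tau> :: real and a b :: field
    assume \<tau>: "0 \<le> \<tau>" and a0: "a 0 = 0" "b 0 = 0" and fin: "NS a < \<infinity>" "NS b < \<infinity>"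
    have l2: "el2 (\<lambda>k. a k $ i) < \<infinity>" "el2 (\<lambda>k. b k $ m) < \<infinity>"
      by (rule le_less_trans[OF C3(2)[of a, OF a0(1)]], use fin in \<open>simp add: ennreal_mult_less_top power_less_top_ennreal\<close>)
         (rule le_less_trans[OF C3(2)[of b, OF a0(2)]], use fin in \<open>simp add: ennreal_mult_less_top power_less_top_ennreal\<close>)
    show "ennreal (mlp j \<tau> l i m (conv (\<lambda>n. a n $ i) (\<lambda>n. b n $ m)))
       \<le> ennreal (C * 2^j * kap j \<tau>) * EN j a b"
    proof (rule lpn_scaled_limit)
      show "(\<lambda>n. conv (tr n (\<lambda>k. a k $ i)) (tr n (\<lambda>k. b k $ m)) k) \<longlonglongrightarrow> conv (\<lambda>n. a n $ i) (\<lambda>n. b n $ m) k" for k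
        by (rule conv_tr_tendsto[OF l2])
      fix n :: nat
      let ?F = "\<lambda>(i1, i2) x. cmp i1 a i x * cmp i2 b m x"
      let ?I = "{..n} \<times> {..n}"
      have int: "integrable torus (?F s)" for s
        by (cases s) (auto simp: cmp_def intro: integrable_tp_mult)
      have "conv (tr n (\<lambda>k. a k $ i)) (tr n (\<lambda>k. b k $ m)) k = (\<Sum>s\<in>?I. fc (?F s) k)" for k
      proof -
        have "conv (tr n (\<lambda>k. a k $ i)) (tr n (\<lambda>k. b k $ m)) k
            = fc (\<lambda>x. tp (B n) (tr n (\<lambda>k. a k $ i)) x * tp (B n) (tr n (\<lambda>k. b k $ m)) x) k"
          by (rule fc_mult_tp[symmetric]) (auto simp: tr_out)
        also have "\<dots> = fc (\<lambda>x. \<Sum>s\<in>?I. ?F s x) k"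
          unfolding tp_tr_blocks[of a, OF a0(1)] tp_tr_blocks[of b, OF a0(2)] sum_product sum.cartesian_product
          by (simp add: case_prod_unfold)
        also have "\<dots> = (\<Sum>s\<in>?I. fc (?F s) k)" by (rule fc_sum) (rule int)
        finally show ?thesis .
      qed
      then have eq: "tp (B j) (\<lambda>k. msym j \<tau> l i m k * conv (tr n (\<lambda>k. a k $ i)) (tr n (\<lambda>k. b k $ m)) k) x
          = (\<Sum>s\<in>?I. tp (B j) (\<lambda>k. msym j \<tau> l i m k * fc (?F s) k) x)" for x
        unfolding tp_def by (subst sum.swap) (simp add: sum_distrib_left sum_distrib_right)
      have "mlp j \<tau> l i m (\<lambda>k. conv (tr n (\<lambda>k. a k $ i)) (tr n (\<lambda>k. b k $ m)) k)
         \<le> (\<Sum>s\<in>?I. mlp j \<tau> l i m (fc (?F s)))"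
        using p3 by (intro lpn_sum_le[where B'="\<lambda>s. \<Sum>k\<in>B j. norm (msym j \<tau> l i m k * fc (?F s) k)"])
          (auto simp: eq norm_sum simp del: norm_mult intro!: tp_bound)
      also have "\<dots> \<le> (\<Sum>(i1,i2)\<in>?I. C * 2^j * kap j \<tau> * (w j i1 i2 * N i1 a * N i2 b))"
        by (rule sum_mono) (auto intro!: blk[OF \<tau>])
      also have "\<dots> = C * 2^j * kap j \<tau> * (\<Sum>i1\<le>n. \<Sum>i2\<le>n. w j i1 i2 * N i1 a * N i2 b)"
        unfolding sum.cartesian_product sum_distrib_left by (simp add: case_prod_unfold)
      finally have "ennreal (mlp j \<tau> l i m (\<lambda>k. conv (tr n (\<lambda>k. a k $ i)) (tr n (\<lambda>k. b k $ m)) k))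
         \<le> ennreal (C * 2^j * kap j \<tau> * (\<Sum>i1\<le>n. \<Sum>i2\<le>n. w j i1 i2 * N i1 a * N i2 b))" by (rule ennreal_leI)
      also have "\<dots> = ennreal (C * 2^j * kap j \<tau>) * (\<Sum>i1\<le>n. \<Sum>i2\<le>n. ennreal (w j i1 i2 * N i1 a * N i2 b))"
        using Cpos by (subst ennreal_mult) (auto simp: kap_def w_def sum_ennreal sum_nonneg)
      also have "\<dots> \<le> ennreal (C * 2^j * kap j \<tau>) * EN j a b"
      proof (rule mult_left_mono)
        have "(\<Sum>i1\<le>n. \<Sum>i2\<le>n. ennreal (w j i1 i2 * N i1 a * N i2 b)) \<le> (\<Sum>i1\<le>n. \<Sum>i2. ennreal (w j i1 i2 * N i1 a * N i2 b))"
          by (intro sum_mono sum_le_suminf) auto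
        also have "\<dots> \<le> EN j a b" unfolding EN_def by (rule sum_le_suminf) auto
        finally show "(\<Sum>i1\<le>n. \<Sum>i2\<le>n. ennreal (w j i1 i2 * N i1 a * N i2 b)) \<le> EN j a b" .
      qed simp
      finally show "ennreal (mlp j \<tau> l i m (\<lambda>k. conv (tr n (\<lambda>k. a k $ i)) (tr n (\<lambda>k. b k $ m)) k))
        \<le> ennreal (C * 2^j * kap j \<tau>) * EN j a b" .
    qed
  qed
qed

text \<open>Only \<open>b\<close> is split into blocks. The truncations of \<open>f\<close> keep a
  sup bound independent of \<open>n\<close>, so the product costs a multiple of \<open>M\<close> and
  no Bernstein factor.\<close>

lemma msym_conv_u:
  obtains C where "C > 0" "\<And>j \<tau> l i m f M b i'. 0 \<le> \<tau> \<Longrightarrow> f \<in> bmeas \<Longrightarrow> (AE x in torus. norm (f x) \<le> M) \<Longrightarrow> 0 \<le> M \<Longrightarrow>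
     b 0 = 0 \<Longrightarrow> NS b < \<infinity> \<Longrightarrow>
     ennreal (mlp j \<tau> l i m (conv (fc f) (\<lambda>n. b n $ i')))
       \<le> ennreal (C * 2^j * kap j \<tau> * M) * NS b"
proof -
  obtain C1 where C1: "C1 > 0"
    "\<And>l i m \<tau> j f b. 0 \<le> \<tau> \<Longrightarrow> f \<in> bmeas \<Longrightarrow> (\<And>x. norm (f x) \<le> b) \<Longrightarrow>
       mlp j \<tau> l i m (fc f) \<le> C1 * 2^j * kap j \<tau> * lpn p f"
    by (rule Pdiv_multiplier) blast
  obtain C2 where C2: "C2 > 0" "\<And>f M n x. f \<in> bmeas \<Longrightarrow> (AE x in torus. norm (f x) \<le> M) \<Longrightarrow> 0 \<le> M \<Longrightarrow>
      norm (tp (B n) (tr n (fc f)) x) \<le> C2 * M" by (rule tr_sup) blast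
  obtain C3 where C3: "C3 > 0" "\<And>a i. a 0 = 0 \<Longrightarrow> el2 (\<lambda>k. a k $ i) \<le> (ennreal C3 * NS a)^2" by (rule el2_NS) blast
  obtain C4 where C4: "C4 > 0" "\<And>f M. f \<in> bmeas \<Longrightarrow> (AE x in torus. norm (f x) \<le> M) \<Longrightarrow> 0 \<le> M \<Longrightarrow>
      el2 (fc f) \<le> (ennreal (C4 * M))^2" by (rule el2_fc) blast
  define C where "C = C1 * C2"
  have Cpos: "C > 0" using C1 C2 by (simp add: C_def)
  show ?thesis
  proof (rule that[OF Cpos])
    fix j l i m i' and \<tau> M :: real and f :: "real^3 \<Rightarrow> complex" and b :: field
    assume \<tau>: "0 \<le> \<tau>" and f: "f \<in> bmeas" "AE x in torus. norm (f x) \<le> M" "0 \<le> M"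
      and b0: "b 0 = 0" and fin: "NS b < \<infinity>"
    have l2: "el2 (fc f) < \<infinity>" "el2 (\<lambda>k. b k $ i') < \<infinity>"
      by (rule le_less_trans[OF C4(2)[OF f]], simp add: power_less_top_ennreal)
         (rule le_less_trans[OF C3(2)[of b, OF b0]], use fin in \<open>simp add: ennreal_mult_less_top power_less_top_ennreal\<close>)
    show "ennreal (mlp j \<tau> l i m (conv (fc f) (\<lambda>n. b n $ i')))
       \<le> ennreal (C * 2^j * kap j \<tau> * M) * NS b"
    proof (rule lpn_scaled_limit)
      show "(\<lambda>n. conv (tr n (fc f)) (tr n (\<lambda>k. b k $ i')) k) \<longlonglongrightarrow> conv (fc f) (\<lambda>n. b n $ i') k" for k
        by (rule conv_tr_tendsto[OF l2])
      fix n :: nat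
      let ?u = "tp (B n) (tr n (fc f))"
      let ?F = "\<lambda>i2 x. ?u x * cmp i2 b i' x"
      have ub: "norm (?u x) \<le> C2 * M" for x by (rule C2(2)[OF f])
      have int: "integrable torus (?F s)" for s unfolding cmp_def by (rule integrable_tp_mult)
      have "conv (tr n (fc f)) (tr n (\<lambda>k. b k $ i')) k = (\<Sum>s\<le>n. fc (?F s) k)" for k
      proof -
        have "conv (tr n (fc f)) (tr n (\<lambda>k. b k $ i')) k
            = fc (\<lambda>x. ?u x * tp (B n) (tr n (\<lambda>k. b k $ i')) x) k"
          by (rule fc_mult_tp[symmetric]) (auto simp: tr_out)
        also have "\<dots> = fc (\<lambda>x. \<Sum>s\<le>n. ?F s x) k"
          unfolding tp_tr_blocks[of b, OF b0] sum_distrib_left by simp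
        also have "\<dots> = (\<Sum>s\<le>n. fc (?F s) k)" by (rule fc_sum) (rule int)
        finally show ?thesis .
      qed
      then have eq: "tp (B j) (\<lambda>k. msym j \<tau> l i m k * conv (tr n (fc f)) (tr n (\<lambda>k. b k $ i')) k) x
          = (\<Sum>s\<le>n. tp (B j) (\<lambda>k. msym j \<tau> l i m k * fc (?F s) k) x)" for x
        unfolding tp_def[of "B j"] by (subst sum.swap) (simp add: sum_distrib_left sum_distrib_right)
      have blk: "mlp j \<tau> l i m (fc (?F s)) \<le> C * 2^j * kap j \<tau> * M * N s b" for s
      proof -
        have Fb: "norm (?F s x) \<le> C2 * M * cmpB s b" for x
          unfolding norm_mult using C2 f(3) by (intro mult_mono ub cmp_bound) auto
        have "lpn p (?F s) \<le> lpn p (\<lambda>x. of_real (C2 * M) * cmp s b i' x)"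
          using p3 C2(1) f(3) cmp_bound[of s b i'] ub
          by (intro lpn_mono[where B="C2 * M * cmpB s b"])
             (auto simp: norm_mult abs_mult intro!: mult_right_mono mult_left_mono)
        also have "\<dots> = (C2 * M) * lpn p (cmp s b i')"
          using p3 C2(1) f(3) by (intro lpn_cmult) (auto simp: norm_mult abs_mult)
        also have "\<dots> \<le> (C2 * M) * N s b" using C2(1) f(3) by (intro mult_left_mono lpn_cmp_le) auto
        finally have 1: "lpn p (?F s) \<le> C2 * M * N s b" .
        have "mlp j \<tau> l i m (fc (?F s)) \<le> C1 * 2^j * kap j \<tau> * lpn p (?F s)"
          by (rule C1(2)[OF \<tau> _ Fb]) measurable
        also have "\<dots> \<le> C1 * 2^j * kap j \<tau> * (C2 * M * N s b)"
          using C1 1 by (intro mult_left_mono) (auto simp: kap_def)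
        finally show ?thesis by (simp add: C_def mult_ac)
      qed
      have "mlp j \<tau> l i m (\<lambda>k. conv (tr n (fc f)) (tr n (\<lambda>k. b k $ i')) k)
         \<le> (\<Sum>s\<le>n. mlp j \<tau> l i m (fc (?F s)))"
        using p3 by (intro lpn_sum_le[where B'="\<lambda>s. \<Sum>k\<in>B j. norm (msym j \<tau> l i m k * fc (?F s) k)"])
          (auto simp: eq norm_sum simp del: norm_mult intro!: tp_bound)
      also have "\<dots> \<le> (\<Sum>s\<le>n. C * 2^j * kap j \<tau> * M * N s b)"
        by (rule sum_mono) (rule blk)
      also have "\<dots> = C * 2^j * kap j \<tau> * M * (\<Sum>s\<le>n. N s b)" by (simp add: sum_distrib_left)
      finally have "ennreal (mlp j \<tau> l i m (\<lambda>k. conv (tr n (fc f)) (tr n (\<lambda>k. b k $ i')) k))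
         \<le> ennreal (C * 2^j * kap j \<tau> * M * (\<Sum>s\<le>n. N s b))" by (rule ennreal_leI)
      also have "\<dots> = ennreal (C * 2^j * kap j \<tau> * M) * (\<Sum>s\<le>n. ennreal (N s b))"
        using Cpos f(3) by (subst ennreal_mult) (auto simp: kap_def sum_ennreal sum_nonneg)
      also have "\<dots> \<le> ennreal (C * 2^j * kap j \<tau> * M) * NS b"
        unfolding NS_def by (intro mult_left_mono sum_le_suminf) auto
      finally show "ennreal (mlp j \<tau> l i m (\<lambda>k. conv (tr n (fc f)) (tr n (\<lambda>k. b k $ i')) k))
        \<le> ennreal (C * 2^j * kap j \<tau> * M) * NS b" .
    qed
  qed
qed

text \<open>27 counts the output component together with the two tensor indices.\<close>

lemma N_Pdiv_le:
  assumes le: "\<And>l i m. ennreal (mlp j \<tau> l i m (conv (\<lambda>n. a n $ i) (\<lambda>n. b n $ m))) \<le> E"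
  shows "ennreal (N j (heat_sg \<tau> (Pdiv_tensor a b))) \<le> 27 * E"
proof -
  let ?g = "\<lambda>l i m. tp (B j) (\<lambda>k. msym j \<tau> l i m k * conv (\<lambda>n. a n $ i) (\<lambda>n. b n $ m) k)"
  have eq: "cmp j (heat_sg \<tau> (Pdiv_tensor a b)) l x = \<i> * (\<Sum>(i,m)\<in>UNIV. ?g l i m x)" for l x
  proof -
    have "of_real (ph j k) * (exp (- \<tau> * ksq k) *\<^sub>R Pdiv_tensor a b k) $ l
        = \<i> * (\<Sum>(i,m)\<in>UNIV. msym j \<tau> l i m k * conv (\<lambda>n. a n $ i) (\<lambda>n. b n $ m) k)" for k
      unfolding UNIV_Times_UNIV[symmetric] sum.cartesian_product[symmetric] vector_scaleR_component leray_component
      by (simp add: msym_def scaleR_conv_of_real sum_distrib_left mult_ac)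
    then show ?thesis unfolding cmp_def tp_def
      by (simp only: sum_distrib_left sum_distrib_right case_prod_unfold mult.assoc) (rule sum.swap)
  qed
  have "lpn p (cmp j (heat_sg \<tau> (Pdiv_tensor a b)) l) \<le> (\<Sum>s\<in>UNIV. lpn p (?g l (fst s) (snd s)))" for l
  proof (rule lpn_sum_le)
    show "norm (cmp j (heat_sg \<tau> (Pdiv_tensor a b)) l x) \<le> (\<Sum>s\<in>UNIV. norm (?g l (fst s) (snd s) x))" for x
      unfolding eq norm_mult by (simp add: case_prod_unfold norm_sum)
    show "norm (?g l (fst s) (snd s) x) \<le> (\<Sum>k\<in>B j. norm (msym j \<tau> l (fst s) (snd s) k * conv (\<lambda>n. a n $ fst s) (\<lambda>n. b n $ snd s) k))" for s x
      by (rule tp_bound)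
  qed (use p3 in auto)
  then have "N j (heat_sg \<tau> (Pdiv_tensor a b)) \<le> (\<Sum>l\<in>UNIV. \<Sum>s\<in>UNIV. lpn p (?g l (fst s) (snd s)))"
    by (rule N_le_sum)
  then have "ennreal (N j (heat_sg \<tau> (Pdiv_tensor a b))) \<le> (\<Sum>l\<in>UNIV. \<Sum>s\<in>UNIV. ennreal (lpn p (?g l (fst s) (snd s))))"
    by (simp add: sum_ennreal sum_nonneg ennreal_leI)
  also have "\<dots> \<le> (\<Sum>l\<in>(UNIV::3 set). \<Sum>s\<in>(UNIV::(3\<times>3) set). E)" by (intro sum_mono le)
  also have "\<dots> = 27 * E" by (simp add: mult.assoc[symmetric])
  finally show ?thesis .
qed

lemma mult_27: "0 \<le> x \<Longrightarrow> 27 * (ennreal x * E) = ennreal (27 * x) * E"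
  by (simp add: ennreal_mult' mult.assoc)

lemma Pdiv_block:
  obtains C where "C > 0" "\<And>j \<tau> a b. 0 \<le> \<tau> \<Longrightarrow> a 0 = 0 \<Longrightarrow> b 0 = 0 \<Longrightarrow> NS a < \<infinity> \<Longrightarrow> NS b < \<infinity> \<Longrightarrow>
     ennreal (N j (heat_sg \<tau> (Pdiv_tensor a b))) \<le> ennreal (C * 2^j * kap j \<tau>) * EN j a b"
proof -
  obtain C where C: "C > 0" "\<And>j \<tau> l i m a b. 0 \<le> \<tau> \<Longrightarrow> a 0 = 0 \<Longrightarrow> b 0 = 0 \<Longrightarrow> NS a < \<infinity> \<Longrightarrow> NS b < \<infinity> \<Longrightarrow>
     ennreal (mlp j \<tau> l i m (conv (\<lambda>n. a n $ i) (\<lambda>n. b n $ m)))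
       \<le> ennreal (C * 2^j * kap j \<tau>) * EN j a b" by (rule msym_conv) blast
  have e: "27 * (ennreal (C * 2^j * kap j \<tau>) * E) = ennreal (27 * C * 2^j * kap j \<tau>) * E" for j \<tau> E
    using C(1) mult_27[of "C * 2^j * kap j \<tau>" E] by (simp only: mult.assoc) (simp add: kap_def)
  show ?thesis
  proof (rule that[of "27 * C"])
    show "27 * C > 0" using C by simp
    fix j and \<tau> :: real and a b :: field
    assume a: "0 \<le> \<tau>" "a 0 = 0" "b 0 = 0" "NS a < \<infinity>" "NS b < \<infinity>"
    show "ennreal (N j (heat_sg \<tau> (Pdiv_tensor a b))) \<le> ennreal (27 * C * 2^j * kap j \<tau>) * EN j a b"
      unfolding e[symmetric] by (intro N_Pdiv_le C(2) a)
  qed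
qed

lemma Pdiv_block_u:
  obtains C where "C > 0" "\<And>j \<tau> a f M b. 0 \<le> \<tau> \<Longrightarrow> (\<And>i. f i \<in> bmeas) \<Longrightarrow> (\<And>i. AE x in torus. norm (f i x) \<le> M) \<Longrightarrow> 0 \<le> M \<Longrightarrow>
     (\<And>i. (\<lambda>k. a k $ i) = fc (f i)) \<Longrightarrow> b 0 = 0 \<Longrightarrow> NS b < \<infinity> \<Longrightarrow>
     ennreal (N j (heat_sg \<tau> (Pdiv_tensor a b))) \<le> ennreal (C * 2^j * kap j \<tau> * M) * NS b \<and>
     ennreal (N j (heat_sg \<tau> (Pdiv_tensor b a))) \<le> ennreal (C * 2^j * kap j \<tau> * M) * NS b"
proof -
  obtain C where C: "C > 0" "\<And>j \<tau> l i m f M b i'. 0 \<le> \<tau> \<Longrightarrow> f \<in> bmeas \<Longrightarrow> (AE x in torus. norm (f x) \<le> M) \<Longrightarrow> 0 \<le> M \<Longrightarrow>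
     b 0 = 0 \<Longrightarrow> NS b < \<infinity> \<Longrightarrow>
     ennreal (mlp j \<tau> l i m (conv (fc f) (\<lambda>n. b n $ i')))
       \<le> ennreal (C * 2^j * kap j \<tau> * M) * NS b" by (rule msym_conv_u) blast
  have e: "27 * (ennreal (C * 2^j * kap j \<tau> * M) * E) = ennreal (27 * C * 2^j * kap j \<tau> * M) * E" if "0 \<le> M" for j \<tau> E M
    using C(1) that mult_27[of "C * 2^j * kap j \<tau> * M" E] by (simp only: mult.assoc) (simp add: kap_def)
  show ?thesis
  proof (rule that[of "27 * C"])
    show "27 * C > 0" using C by simp
    fix j and \<tau> M :: real and f :: "3 \<Rightarrow> real^3 \<Rightarrow> complex" and a b :: field
    assume a: "0 \<le> \<tau>" "\<And>i. f i \<in> bmeas" "\<And>i. AE x in torus. norm (f i x) \<le> M" "0 \<le> M"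
      "\<And>i. (\<lambda>k. a k $ i) = fc (f i)" "b 0 = 0" "NS b < \<infinity>"
    have "ennreal (mlp j \<tau> l i m (conv (\<lambda>n. a n $ i) (\<lambda>n. b n $ m))) \<le> ennreal (C * 2^j * kap j \<tau> * M) * NS b" for l i m
      unfolding a(5) by (rule C(2)[OF a(1,2,3,4,6,7)])
    moreover have "ennreal (mlp j \<tau> l i m (conv (\<lambda>n. b n $ i) (\<lambda>n. a n $ m))) \<le> ennreal (C * 2^j * kap j \<tau> * M) * NS b" for l i m
      unfolding a(5) conv_commute[of "\<lambda>n. b n $ i"] by (rule C(2)[OF a(1,2,3,4,6,7)])
    ultimately show "ennreal (N j (heat_sg \<tau> (Pdiv_tensor a b))) \<le> ennreal (27 * C * 2^j * kap j \<tau> * M) * NS b \<and>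
     ennreal (N j (heat_sg \<tau> (Pdiv_tensor b a))) \<le> ennreal (27 * C * 2^j * kap j \<tau> * M) * NS b"
      unfolding e[OF a(4), symmetric] by (intro conjI N_Pdiv_le)
  qed
qed

end

section \<open>Time estimates\<close>

text \<open>Extended by zero to negative times, so that Duhamel integrals become convolutions on the
  whole line with causality built in.\<close>

definition Kf :: "nat \<Rightarrow> real \<Rightarrow> ennreal" where "Kf j \<tau> = ennreal (kap j \<tau>) * indicator {0..} \<tau>"

lemma Kf_measurable[measurable]: "Kf j \<in> bmeas"
  unfolding Kf_def kap_def by measurable

abbreviation Kc :: "nat \<Rightarrow> (real \<Rightarrow> ennreal) \<Rightarrow> real \<Rightarrow> ennreal" where
  "Kc j f t \<equiv> \<integral>\<^sup>+s. Kf j (t - s) * f s \<partial>lborel"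

lemma Kf_le_1: "Kf j \<tau> \<le> 1"
proof (cases "0 \<le> \<tau>")
  case True
  then have "1 \<le> (1 + 4^j * \<tau>)^2" by (intro one_le_power) simp
  moreover have "1 / x \<le> 1" if "1 \<le> x" for x :: real using that by simp
  ultimately have "kap j \<tau> \<le> 1" unfolding kap_def by blast
  then show ?thesis using True by (simp add: Kf_def)
qed (simp add: Kf_def)

lemma Kf_integral: "(\<integral>\<^sup>+\<tau>. Kf j \<tau> \<partial>lborel) = ennreal (1 / 4^j)"
proof -
  define F where "F \<tau> = - 1 / (4^j * (1 + 4^j * \<tau>))" for \<tau> :: real
  have "(\<integral>\<^sup>+\<tau>. ennreal (kap j \<tau>) * indicator {0..} \<tau> \<partial>lborel) = ennreal (0 - F 0)"
  proof (rule nn_integral_FTC_atLeast)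
    show "kap j \<in> bmeas" unfolding kap_def[abs_def] by measurable
    fix x :: real assume x: "0 \<le> x"
    show "0 \<le> kap j x" by (simp add: kap_def)
    have nz: "1 + 4^j * x \<noteq> 0" using x by (smt (verit) mult_nonneg_nonneg zero_le_power)
    show "DERIV F x :> kap j x"
      unfolding F_def kap_def using nz by (auto intro!: derivative_eq_intros simp: power2_eq_square)
  next
    have "((\<lambda>\<tau>::real. inverse (4^j * (1 + 4^j * \<tau>))) \<longlongrightarrow> 0) at_top"
    proof (rule tendsto_inverse_0_at_top)
      have "filterlim (\<lambda>\<tau>::real. 4^j * \<tau>) at_top at_top"
        by (rule filterlim_tendsto_pos_mult_at_top[OF tendsto_const _ filterlim_ident]) simp
      then have "filterlim (\<lambda>\<tau>::real. 1 + 4^j * \<tau>) at_top at_top" by (rule filterlim_tendsto_add_at_top[OF tendsto_const])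
      then show "filterlim (\<lambda>\<tau>::real. 4^j * (1 + 4^j * \<tau>)) at_top at_top"
        by (rule filterlim_tendsto_pos_mult_at_top[OF tendsto_const, rotated]) simp
    qed
    then have "((\<lambda>\<tau>::real. - inverse (4^j * (1 + 4^j * \<tau>))) \<longlongrightarrow> - 0) at_top" by (rule tendsto_minus)
    then show "(F \<longlongrightarrow> 0) at_top" by (simp add: F_def[abs_def] inverse_eq_divide)
  qed
  then show ?thesis by (simp add: Kf_def F_def)
qed

lemma Kf_integral_left: "(\<integral>\<^sup>+s. Kf j (t - s) \<partial>lborel) = ennreal (1 / 4^j)"
  using nn_integral_real_affine[of "Kf j" "-1" t] by (simp add: Kf_integral)

lemma Kf_integral_right: "(\<integral>\<^sup>+t. Kf j (t - s) \<partial>lborel) = ennreal (1 / 4^j)"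
  using nn_integral_lborel_translate[of "Kf j" "- s"] by (simp add: Kf_integral)

lemma T2_sup:
  assumes "(\<integral>\<^sup>+s. v s \<partial>lborel) \<le> V"
  shows "Kc j v t \<le> V"
proof -
  have "Kc j v t \<le> (\<integral>\<^sup>+s. 1 * v s \<partial>lborel)"
    by (intro nn_integral_mono mult_right_mono Kf_le_1) auto
  then show ?thesis using assms by simp
qed

lemma Kc_integral:
  assumes [measurable]: "v \<in> bmeas"
  shows "(\<integral>\<^sup>+t. Kc j v t \<partial>lborel) = ennreal (1/4^j) * (\<integral>\<^sup>+s. v s \<partial>lborel)"
proof -
  have "(\<integral>\<^sup>+t. Kc j v t \<partial>lborel) = (\<integral>\<^sup>+s. (\<integral>\<^sup>+t. Kf j (t - s) * v s \<partial>lborel) \<partial>lborel)"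
    by (rule lborel_pair.Fubini') measurable
  then show ?thesis by (simp add: nn_integral_multc Kf_integral_right nn_integral_cmult)
qed

lemma Kc_cmult:
  assumes [measurable]: "f \<in> bmeas"
  shows "Kc j (\<lambda>s. c * f s) t = c * Kc j f t"
  unfolding mult.left_commute[of _ c] by (rule nn_integral_cmult) measurable

lemma Kc_suminf:
  fixes f :: "nat \<Rightarrow> real \<Rightarrow> ennreal"
  assumes [measurable]: "\<And>i. f i \<in> bmeas"
  shows "Kc j (\<lambda>s. \<Sum>i. f i s) t = (\<Sum>i. Kc j (f i) t)"
  unfolding ennreal_suminf_cmult[symmetric] by (rule nn_integral_suminf) measurable

lemma quarter_power: "ennreal (1/4^j) = (ennreal (1/2^j))^2"
proof -
  have "(1/2^j)^2 = (1/4^j :: real)" by (simp add: power_divide power_mult[symmetric] mult.commute[of j]) (simp add: power_mult)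
  then show ?thesis by (subst ennreal_power) auto
qed

text \<open>Interpolation between the bound into \<open>L^\<infinity>\<close>, where the kernel is
  at most 1, and the one into \<open>L^1\<close>, where its integral is \<open>4^(-j)\<close>; the
  geometric mean is \<open>2^(-j)\<close>.\<close>

lemma T2_L2:
  assumes [measurable]: "v \<in> bmeas" and V: "(\<integral>\<^sup>+s. v s \<partial>lborel) \<le> V"
  shows "(\<integral>\<^sup>+t. (Kc j v t)^2 \<partial>lborel) \<le> (V * ennreal (1/2^j))^2"
proof -
  have "(\<integral>\<^sup>+t. (Kc j v t)^2 \<partial>lborel) \<le> (\<integral>\<^sup>+t. V * Kc j v t \<partial>lborel)"
    unfolding power2_eq_square by (intro nn_integral_mono mult_right_mono T2_sup V) auto
  also have "\<dots> = V * (\<integral>\<^sup>+t. Kc j v t \<partial>lborel)" by (rule nn_integral_cmult) measurable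
  also have "\<dots> = V * (ennreal (1/4^j) * (\<integral>\<^sup>+s. v s \<partial>lborel))" by (subst Kc_integral) auto
  also have "\<dots> \<le> V * (ennreal (1/4^j) * V)" using V by (intro mult_left_mono) auto
  also have "\<dots> = (V * ennreal (1/2^j))^2" by (simp add: quarter_power power2_eq_square mult_ac)
  finally show ?thesis .
qed

text \<open>The kernel is the square of \<open>K1\<close>. In Cauchy-Schwarz one factor
  \<open>K1\<close> stands alone and yields the integral \<open>4^(-j)\<close> of the kernel, the
  other accompanies \<open>g\<close> and restores the kernel in front of \<open>g^2\<close>.\<close>

lemma T1_pointwise:
  assumes [measurable]: "g \<in> bmeas" and h: "\<And>s. h s \<le> M"
  shows "(Kc j (\<lambda>s. g s * h s) t)^2 \<le> M^2 * (ennreal (1/4^j) * Kc j (\<lambda>s. (g s)^2) t)"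
proof -
  define K1 where "K1 \<tau> = ennreal (1 / (1 + 4^j * \<tau>)) * indicator {0..} \<tau>" for \<tau>
  have [measurable]: "K1 \<in> bmeas" unfolding K1_def by measurable
  have K1: "Kf j \<tau> = K1 \<tau> * K1 \<tau>" for \<tau>
    by (auto simp: Kf_def K1_def kap_def indicator_def ennreal_mult'[symmetric] power2_eq_square)
  have "Kc j (\<lambda>s. g s * h s) t \<le> (\<integral>\<^sup>+s. M * (K1 (t - s) * (K1 (t - s) * g s)) \<partial>lborel)"
  proof (rule nn_integral_mono)
    fix s
    have "Kf j (t - s) * (g s * h s) \<le> Kf j (t - s) * (g s * M)" by (intro mult_left_mono h) auto
    then show "Kf j (t - s) * (g s * h s) \<le> M * (K1 (t - s) * (K1 (t - s) * g s))" by (simp add: K1 mult_ac)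
  qed
  also have "\<dots> = M * (\<integral>\<^sup>+s. K1 (t - s) * (K1 (t - s) * g s) \<partial>lborel)" by (rule nn_integral_cmult) measurable
  finally have "(Kc j (\<lambda>s. g s * h s) t)^2 \<le> (M * (\<integral>\<^sup>+s. K1 (t - s) * (K1 (t - s) * g s) \<partial>lborel))^2"
    by (rule power_mono) auto
  also have "\<dots> = M^2 * (\<integral>\<^sup>+s. K1 (t - s) * (K1 (t - s) * g s) \<partial>lborel)^2" by (simp add: power_mult_distrib)
  also have "\<dots> \<le> M^2 * ((\<integral>\<^sup>+s. (K1 (t - s))^2 \<partial>lborel) * (\<integral>\<^sup>+s. (K1 (t - s) * g s)^2 \<partial>lborel))"
    by (intro mult_left_mono Cauchy_Schwarz_nn_integral) auto
  also have "(\<integral>\<^sup>+s. (K1 (t - s))^2 \<partial>lborel) = ennreal (1/4^j)"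
    unfolding power2_eq_square K1[symmetric] by (rule Kf_integral_left)
  also have "(\<integral>\<^sup>+s. (K1 (t - s) * g s)^2 \<partial>lborel) = Kc j (\<lambda>s. (g s)^2) t"
    by (simp add: power2_eq_square K1 mult_ac)
  finally show ?thesis .
qed

lemma T1_sup:
  assumes [measurable]: "g \<in> bmeas" and h: "\<And>s. h s \<le> M" and G: "(\<integral>\<^sup>+s. (g s)^2 \<partial>lborel) \<le> G^2"
  shows "Kc j (\<lambda>s. g s * h s) t \<le> M * G * ennreal (1/2^j)"
proof (rule ennreal_power2_le_imp_le)
  have "(Kc j (\<lambda>s. g s * h s) t)^2 \<le> M^2 * (ennreal (1/4^j) * Kc j (\<lambda>s. (g s)^2) t)" by (rule T1_pointwise[OF _ h]) measurable
  also have "\<dots> \<le> M^2 * (ennreal (1/4^j) * G^2)" by (intro mult_left_mono T2_sup G) auto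
  finally show "(Kc j (\<lambda>s. g s * h s) t)^2 \<le> (M * G * ennreal (1/2^j))^2" by (simp add: quarter_power power2_eq_square mult_ac)
qed

lemma T1_L2:
  assumes [measurable]: "g \<in> bmeas" and h: "\<And>s. h s \<le> M" and G: "(\<integral>\<^sup>+s. (g s)^2 \<partial>lborel) \<le> G^2"
  shows "(\<integral>\<^sup>+t. (Kc j (\<lambda>s. g s * h s) t)^2 \<partial>lborel) \<le> (M * G * ennreal (1/4^j))^2"
proof -
  have "(\<integral>\<^sup>+t. (Kc j (\<lambda>s. g s * h s) t)^2 \<partial>lborel)
      \<le> (\<integral>\<^sup>+t. M^2 * (ennreal (1/4^j) * Kc j (\<lambda>s. (g s)^2) t) \<partial>lborel)"
    by (intro nn_integral_mono T1_pointwise h) measurable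
  also have "\<dots> = M^2 * (ennreal (1/4^j) * (\<integral>\<^sup>+t. Kc j (\<lambda>s. (g s)^2) t \<partial>lborel))"
    by (subst nn_integral_cmult, measurable, subst nn_integral_cmult, measurable)
  also have "(\<integral>\<^sup>+t. Kc j (\<lambda>s. (g s)^2) t \<partial>lborel) = ennreal (1/4^j) * (\<integral>\<^sup>+s. (g s)^2 \<partial>lborel)" by (rule Kc_integral) measurable
  also have "M^2 * (ennreal (1/4^j) * (ennreal (1/4^j) * (\<integral>\<^sup>+s. (g s)^2 \<partial>lborel))) \<le> M^2 * (ennreal (1/4^j) * (ennreal (1/4^j) * G^2))"
    by (intro mult_left_mono G) auto
  also have "\<dots> = (M * G * ennreal (1/4^j))^2" by (simp add: power2_eq_square mult_ac)
  finally show ?thesis .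
qed

section \<open>Cauchy-Schwarz and Minkowski inequalities for extended-real functions\<close>

lemma L1_of_L2:
  assumes [measurable]: "f \<in> borel_measurable M" "g \<in> borel_measurable M"
    and E: "(\<integral>\<^sup>+t. (f t)^2 \<partial>M) \<le> E^2" "(\<integral>\<^sup>+t. (g t)^2 \<partial>M) \<le> E'^2"
  shows "(\<integral>\<^sup>+t. f t * g t \<partial>M) \<le> E * E'"
proof (rule ennreal_power2_le_imp_le)
  have "(\<integral>\<^sup>+t. f t * g t \<partial>M)^2 \<le> (\<integral>\<^sup>+t. (f t)^2 \<partial>M) * (\<integral>\<^sup>+t. (g t)^2 \<partial>M)" by (rule Cauchy_Schwarz_nn_integral) auto
  also have "\<dots> \<le> E^2 * E'^2" by (intro mult_mono E) auto
  finally show "(\<integral>\<^sup>+t. f t * g t \<partial>M)^2 \<le> (E * E')^2" by (simp add: power_mult_distrib)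
qed

lemma Minkowski_L2:
  assumes [measurable]: "f \<in> borel_measurable M" "g \<in> borel_measurable M"
    and E: "(\<integral>\<^sup>+t. (f t)^2 \<partial>M) \<le> E^2" "(\<integral>\<^sup>+t. (g t)^2 \<partial>M) \<le> E'^2"
  shows "(\<integral>\<^sup>+t. (f t + g t)^2 \<partial>M) \<le> (E + E')^2"
proof -
  have cross: "(\<integral>\<^sup>+t. f t * g t \<partial>M) \<le> E * E'" by (rule L1_of_L2[OF _ _ E]) measurable
  have "(\<integral>\<^sup>+t. (f t + g t)^2 \<partial>M) = (\<integral>\<^sup>+t. (f t)^2 + (f t * g t + f t * g t) + (g t)^2 \<partial>M)"
    by (intro nn_integral_cong) (simp add: power2_eq_square algebra_simps)
  also have "\<dots> = (\<integral>\<^sup>+t. (f t)^2 \<partial>M) + ((\<integral>\<^sup>+t. f t * g t \<partial>M) + (\<integral>\<^sup>+t. f t * g t \<partial>M)) + (\<integral>\<^sup>+t. (g t)^2 \<partial>M)"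
    by (simp add: nn_integral_add)
  also have "\<dots> \<le> E^2 + (E * E' + E * E') + E'^2" by (intro add_mono E cross)
  also have "\<dots> = (E + E')^2" by (simp add: power2_eq_square algebra_simps)
  finally show ?thesis .
qed

text \<open>Induction handles partial sums, Fatou's lemma the limit.\<close>

lemma Minkowski_L2_suminf:
  fixes f :: "nat \<Rightarrow> 'a \<Rightarrow> ennreal"
  assumes [measurable]: "\<And>i. f i \<in> borel_measurable M" and E: "\<And>i. (\<integral>\<^sup>+t. (f i t)^2 \<partial>M) \<le> (E i)^2"
  shows "(\<integral>\<^sup>+t. (\<Sum>i. f i t)^2 \<partial>M) \<le> (\<Sum>i. E i)^2"
proof -
  have fin: "(\<integral>\<^sup>+t. (\<Sum>i<n. f i t)^2 \<partial>M) \<le> (\<Sum>i<n. E i)^2" for n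
    by (induction n) (auto intro!: Minkowski_L2 E)
  have "(\<integral>\<^sup>+t. (\<Sum>i. f i t)^2 \<partial>M) = (\<integral>\<^sup>+t. liminf (\<lambda>n. (\<Sum>i<n. f i t)^2) \<partial>M)"
  proof (intro nn_integral_cong)
    fix t
    have "(\<lambda>n. \<Sum>i<n. f i t) \<longlonglongrightarrow> (\<Sum>i. f i t)" by (rule summable_LIMSEQ) simp
    from tendsto_mult_ennreal[OF this this]
    have "(\<lambda>n. (\<Sum>i<n. f i t) * (\<Sum>i<n. f i t)) \<longlonglongrightarrow> (\<Sum>i. f i t) * (\<Sum>i. f i t)" by auto
    then have "(\<lambda>n. (\<Sum>i<n. f i t)^2) \<longlonglongrightarrow> (\<Sum>i. f i t)^2" by (simp add: power2_eq_square)
    from lim_imp_Liminf[OF sequentially_bot this] show "(\<Sum>i. f i t)^2 = liminf (\<lambda>n. (\<Sum>i<n. f i t)^2)" by simp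
  qed
  also have "\<dots> \<le> liminf (\<lambda>n. \<integral>\<^sup>+t. (\<Sum>i<n. f i t)^2 \<partial>M)" by (rule nn_integral_liminf) measurable
  also have "\<dots> \<le> liminf (\<lambda>n. (\<Sum>i. E i)^2)"
  proof (intro Liminf_mono always_eventually allI)
    fix n
    have "(\<Sum>i<n. E i)^2 \<le> (\<Sum>i. E i)^2" by (intro power_mono sum_le_suminf) auto
    then show "(\<integral>\<^sup>+t. (\<Sum>i<n. f i t)^2 \<partial>M) \<le> (\<Sum>i. E i)^2" using fin order_trans by blast
  qed
  also have "\<dots> = (\<Sum>i. E i)^2" by (simp add: Liminf_const)
  finally show ?thesis .
qed

lemma suminf_swap_ennreal:
  fixes f :: "nat \<Rightarrow> nat \<Rightarrow> ennreal"
  shows "(\<Sum>i. \<Sum>k. f i k) = (\<Sum>k. \<Sum>i. f i k)"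
proof -
  have "(\<Sum>i. \<Sum>k. f i k) = (\<integral>\<^sup>+i. (\<Sum>k. f i k) \<partial>count_space UNIV)" by (simp add: nn_integral_count_space_nat)
  also have "\<dots> = (\<Sum>k. \<integral>\<^sup>+i. f i k \<partial>count_space UNIV)" by (rule nn_integral_suminf) auto
  finally show ?thesis by (simp add: nn_integral_count_space_nat)
qed

section \<open>Geometric off-diagonal weights and frequency envelopes\<close>

definition gd :: "real \<Rightarrow> nat \<Rightarrow> nat \<Rightarrow> real" where "gd c i j = 2 powr (- c * \<bar>real i - real j\<bar>)"

lemma gd_commute: "gd c i j = gd c j i" by (simp add: gd_def abs_minus_commute)
lemma gd_nonneg[simp]: "0 \<le> gd c i j" by (simp add: gd_def)

lemma gd_sum:
  assumes c: "c > 0"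
  shows "(\<Sum>i. ennreal (gd c i j)) \<le> ennreal (2 / (1 - 2 powr (- c)))"
proof -
  define r where "r = 2 powr (- c)"
  have "2 powr (- c) < 2 powr 0" using c by (intro powr_less_mono) auto
  then have r: "0 < r" "r < 1" by (auto simp: r_def)
  have pw: "2 powr (- c * real n) = r ^ n" for n
  proof -
    have "r ^ n = r powr real n" using r by (simp add: powr_realpow)
    then show ?thesis by (simp add: r_def powr_powr)
  qed
  have S: "(\<Sum>n. ennreal (r ^ n)) = ennreal (1 / (1 - r))"
    using r by (intro suminf_ennreal_eq geometric_sums) auto
  have 1: "(\<Sum>i. ennreal (gd c (i + j) j)) = ennreal (1 / (1 - r))"
  proof -
    have "gd c (n + j) j = r ^ n" for n unfolding pw[symmetric] gd_def by simp
    then show ?thesis by (simp add: S)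
  qed
  \<comment> \<open>One power of \<open>r\<close> is given away, so that the reversed sum starts at
    exponent 0 and is bounded by the full geometric series.\<close>
  have "(\<Sum>i<j. ennreal (gd c i j)) \<le> (\<Sum>i<j. ennreal (r ^ (j - Suc i)))"
  proof (intro sum_mono ennreal_leI)
    fix i assume "i \<in> {..<j}"
    then have "gd c i j = r ^ (j - i)" unfolding pw[symmetric] gd_def by (simp add: of_nat_diff)
    also have "\<dots> \<le> r ^ (j - Suc i)" using r by (intro power_decreasing) auto
    finally show "gd c i j \<le> r ^ (j - Suc i)" .
  qed
  also have "\<dots> = (\<Sum>i<j. ennreal (r ^ i))"
    by (rule sum.nat_diff_reindex)
  also have "\<dots> \<le> (\<Sum>n. ennreal (r ^ n))" by (rule sum_le_suminf) auto
  finally have 2: "(\<Sum>i<j. ennreal (gd c i j)) \<le> ennreal (1 / (1 - r))" unfolding S .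
  have "(\<Sum>i. ennreal (gd c i j)) = (\<Sum>i. ennreal (gd c (i + j) j)) + (\<Sum>i<j. ennreal (gd c i j))"
    by (rule suminf_offset) simp
  also have "\<dots> \<le> ennreal (1 / (1 - r)) + ennreal (1 / (1 - r))"
    unfolding 1 by (intro add_left_mono 2)
  also have "\<dots> = ennreal (2 / (1 - r))"
    using r by (subst ennreal_plus[symmetric]) (auto simp: add_divide_distrib[symmetric])
  finally show ?thesis unfolding r_def .
qed

text \<open>All majorants in the fixed point argument are multiples of one frequency envelope, which
  reduces it to scalars.\<close>
definition envelope :: "real \<Rightarrow> real \<Rightarrow> ennreal \<Rightarrow> (nat \<Rightarrow> ennreal) \<Rightarrow> bool" where
  "envelope c C X D \<longleftrightarrow> (\<forall>j. D j \<le> X) \<and> (\<forall>j. (\<Sum>i. ennreal (gd c i j) * D i) \<le> ennreal C * D j)"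

text \<open>Constant envelopes describe fields whose weighted block norms are merely bounded,
  without summability; this is the case used for uniqueness.\<close>

lemma envelope_const:
  assumes "c > 0"
  shows "envelope c (2 / (1 - 2 powr (- c))) 1 (\<lambda>_. 1)"
  unfolding envelope_def using gd_sum[OF assms] by simp

lemma suminf_Cauchy_Schwarz:
  fixes f g :: "nat \<Rightarrow> ennreal"
  shows "(\<Sum>i. f i * g i)^2 \<le> (\<Sum>i. (f i)^2) * (\<Sum>i. (g i)^2)"
  using Cauchy_Schwarz_nn_integral[of f "count_space UNIV" g] by (simp add: nn_integral_count_space_nat)

text \<open>\<open>D\<close> is the convolution of \<open>d\<close> with the weight of half the
  rate. By the triangle inequality half of the rate \<open>c\<close> suffices to move the centre
  from \<open>i\<close> to \<open>j\<close>; the other half remains for the sum over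
  \<open>i\<close>, which gives the envelope property. Square summability is Schur's test.\<close>

lemma envelope_exists:
  fixes d :: "nat \<Rightarrow> ennreal"
  assumes c: "c > 0" and X: "(\<Sum>i. (d i)^2) \<le> X^2"
  defines "C \<equiv> 2 / (1 - 2 powr (- (c/2)))"
  obtains D where "envelope c C (ennreal C * X) D" "\<And>i. d i \<le> D i" "(\<Sum>i. (D i)^2) \<le> (ennreal C * X)^2"
proof -
  define D where "D j = (\<Sum>i. ennreal (gd (c/2) i j) * d i)" for j
  have c2: "c/2 > 0" using c by simp
  have S: "(\<Sum>i. ennreal (gd (c/2) i j)) \<le> ennreal C" "(\<Sum>j. ennreal (gd (c/2) i j)) \<le> ennreal C" for i j
    using gd_sum[OF c2, of j] gd_sum[OF c2, of i] by (simp_all add: C_def gd_commute)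
  have sub: "gd c i j * gd (c/2) l i \<le> gd (c/2) i j * gd (c/2) l j" for i j l
  proof -
    have "- c * \<bar>real i - real j\<bar> + - (c/2) * \<bar>real l - real i\<bar> \<le> - (c/2) * \<bar>real i - real j\<bar> + - (c/2) * \<bar>real l - real j\<bar>"
    proof -
      have "\<bar>real l - real j\<bar> \<le> \<bar>real i - real j\<bar> + \<bar>real l - real i\<bar>" by linarith
      then have "(c/2) * \<bar>real l - real j\<bar> \<le> (c/2) * (\<bar>real i - real j\<bar> + \<bar>real l - real i\<bar>)" using c by (intro mult_left_mono) auto
      then show ?thesis by (simp add: algebra_simps)
    qed
    then show ?thesis unfolding gd_def powr_add[symmetric] by (intro powr_mono) auto
  qed
  have env: "(\<Sum>i. ennreal (gd c i j) * D i) \<le> ennreal C * D j" for j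
  proof -
    have "(\<Sum>i. ennreal (gd c i j) * D i) = (\<Sum>i. \<Sum>l. ennreal (gd c i j * gd (c/2) l i) * d l)"
      unfolding D_def by (simp add: ennreal_mult mult.assoc)
    also have "\<dots> \<le> (\<Sum>i. \<Sum>l. ennreal (gd (c/2) i j) * (ennreal (gd (c/2) l j) * d l))"
      unfolding mult.assoc[symmetric] ennreal_mult[OF gd_nonneg gd_nonneg, symmetric]
      by (rule suminf_le, rule suminf_le, rule mult_right_mono, rule ennreal_leI, rule sub) simp_all
    also have "\<dots> = (\<Sum>i. ennreal (gd (c/2) i j)) * D j"
      unfolding D_def by (simp add: ennreal_suminf_multc ennreal_suminf_cmult)
    also have "\<dots> \<le> ennreal C * D j" by (intro mult_right_mono S) auto
    finally show ?thesis .
  qed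
  have ptw: "(D j)^2 \<le> ennreal C * (\<Sum>i. ennreal (gd (c/2) i j) * (d i)^2)" for j
  proof -
    have sq: "ennreal (gd (c/2) i j) = (ennreal (sqrt (gd (c/2) i j)))^2" for i by (subst ennreal_power) auto
    have "D j = (\<Sum>i. ennreal (sqrt (gd (c/2) i j)) * (ennreal (sqrt (gd (c/2) i j)) * d i))"
      unfolding D_def sq by (simp add: power2_eq_square mult.assoc)
    then have "(D j)^2 \<le> (\<Sum>i. ennreal (gd (c/2) i j)) * (\<Sum>i. (ennreal (sqrt (gd (c/2) i j)) * d i)^2)"
      using suminf_Cauchy_Schwarz[of "\<lambda>i. ennreal (sqrt (gd (c/2) i j))" "\<lambda>i. ennreal (sqrt (gd (c/2) i j)) * d i"] by (simp add: sq[symmetric])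
    also have "\<dots> \<le> ennreal C * (\<Sum>i. ennreal (gd (c/2) i j) * (d i)^2)"
      unfolding power_mult_distrib sq[symmetric] by (intro mult_right_mono S) auto
    finally show ?thesis .
  qed
  have l2: "(\<Sum>j. (D j)^2) \<le> (ennreal C * X)^2"
  proof -
    have "(\<Sum>j. (D j)^2) \<le> (\<Sum>j. ennreal C * (\<Sum>i. ennreal (gd (c/2) i j) * (d i)^2))" by (intro suminf_le ptw) auto
    also have "\<dots> = ennreal C * (\<Sum>j. \<Sum>i. ennreal (gd (c/2) i j) * (d i)^2)" by (rule ennreal_suminf_cmult)
    also have "\<dots> \<le> ennreal C * (ennreal C * X^2)"
    proof (rule mult_left_mono)
      have "(\<Sum>j. \<Sum>i. ennreal (gd (c/2) i j) * (d i)^2) = (\<Sum>i. \<Sum>j. ennreal (gd (c/2) i j) * (d i)^2)" by (rule suminf_swap_ennreal)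
      also have "\<dots> = (\<Sum>i. (\<Sum>j. ennreal (gd (c/2) i j)) * (d i)^2)" by (simp add: ennreal_suminf_multc)
      also have "\<dots> \<le> (\<Sum>i. ennreal C * (d i)^2)" by (intro suminf_le mult_right_mono S) auto
      also have "\<dots> = ennreal C * (\<Sum>i. (d i)^2)" by (rule ennreal_suminf_cmult)
      also have "\<dots> \<le> ennreal C * X^2" by (intro mult_left_mono X) auto
      finally show "(\<Sum>j. \<Sum>i. ennreal (gd (c/2) i j) * (d i)^2) \<le> ennreal C * X^2" .
    qed simp
    finally show ?thesis by (simp add: power2_eq_square mult_ac)
  qed
  have "D j \<le> ennreal C * X" for j
  proof (rule ennreal_power2_le_imp_le)
    have "(D j)^2 = (\<Sum>i\<in>{j}. (D i)^2)" by simp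
    also have "\<dots> \<le> (\<Sum>i. (D i)^2)" by (rule sum_le_suminf) auto
    finally show "(D j)^2 \<le> (ennreal C * X)^2" using l2 by simp
  qed
  moreover have "d i \<le> D i" for i
  proof -
    have "d i = (\<Sum>l\<in>{i}. ennreal (gd (c/2) l i) * d l)" by (simp add: gd_def)
    also have "\<dots> \<le> D i" unfolding D_def by (rule sum_le_suminf) auto
    finally show ?thesis .
  qed
  ultimately show ?thesis using env l2 by (intro that[of D]) (auto simp: envelope_def)
qed

section \<open>Space-time norms of blocks and the parabolic estimates in them\<close>

context besov_setup
begin

definition sg :: real where "sg = -1 + 3/p"
text \<open>The rate of geometric decay off the diagonal: \<open>-sg\<close> is available for low
  input frequencies and \<open>sg + 1\<close> for high ones. It is positive because
  \<open>-1 < sg < 0\<close>, where the upper bound is the condition \<open>p > 3\<close>.\<close>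

definition dl :: real where "dl = min (-sg) (sg + 1)"

lemma sg: "-1 < sg" "sg < 0" using p3 by (auto simp: sg_def field_simps)
lemma dl: "0 < dl" "dl \<le> -sg" "dl \<le> sg + 1" "dl \<le> 1" using sg by (auto simp: dl_def)

abbreviation lo :: "nat \<Rightarrow> ennreal" where "lo j \<equiv> ennreal (2 powr (real j * sg))"
abbreviation hi :: "nat \<Rightarrow> ennreal" where "hi j \<equiv> ennreal (2 powr (real j * (sg + 1)))"

abbreviation loi :: "nat \<Rightarrow> ennreal" where "loi j \<equiv> ennreal (2 powr (- real j * sg))"
abbreviation hii :: "nat \<Rightarrow> ennreal" where "hii j \<equiv> ennreal (2 powr (- real j * (sg + 1)))"

text \<open>The Chemin--Lerner norms \<open>L^\<infinity> B^\<sigma>\<close> and \<open>L^2 B^(\<sigma>+1)\<close> of a single block.\<close>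
definition outb :: "real set \<Rightarrow> nat \<Rightarrow> (real \<Rightarrow> ennreal) \<Rightarrow> ennreal \<Rightarrow> bool" where
  "outb J j F E \<longleftrightarrow> (\<forall>t\<in>J. lo j * F t \<le> E) \<and> (\<integral>\<^sup>+t\<in>J. (hi j * F t)^2 \<partial>lborel) \<le> E^2"

lemma outb_mono: "outb J j F E \<Longrightarrow> (\<And>t. t \<in> J' \<Longrightarrow> G t \<le> F t) \<Longrightarrow> J' \<subseteq> J \<Longrightarrow> E \<le> E' \<Longrightarrow> outb J' j G E'"
proof -
  assume *: "outb J j F E" "\<And>t. t \<in> J' \<Longrightarrow> G t \<le> F t" "J' \<subseteq> J" "E \<le> E'"
  have "lo j * G t \<le> E'" if "t \<in> J'" for t
  proof -
    have "lo j * G t \<le> lo j * F t" by (intro mult_left_mono *(2) that) auto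
    also have "\<dots> \<le> E" using * that by (auto simp: outb_def)
    finally show ?thesis using *(4) by simp
  qed
  moreover have "(\<integral>\<^sup>+t. (hi j * G t)^2 * indicator J' t \<partial>lborel) \<le> E'^2"
  proof -
    have "(\<integral>\<^sup>+t. (hi j * G t)^2 * indicator J' t \<partial>lborel) \<le> (\<integral>\<^sup>+t\<in>J. (hi j * F t)^2 \<partial>lborel)"
      using *(2,3) by (intro nn_integral_mono) (auto simp: indicator_def intro!: power_mono mult_left_mono)
    also have "\<dots> \<le> E^2" using * by (auto simp: outb_def)
    also have "\<dots> \<le> E'^2" by (intro power_mono *) auto
    finally show ?thesis .
  qed
  ultimately show ?thesis by (auto simp: outb_def)
qed

lemma outb_le: "outb J j F E \<Longrightarrow> E \<le> E' \<Longrightarrow> outb J j F E'"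
  by (rule outb_mono) auto

lemma indicator_square: "(x * indicator J t :: ennreal)^2 = x^2 * indicator J t"
  by (simp add: indicator_def)

lemma outb_add:
  assumes [measurable]: "F \<in> bmeas" "G \<in> bmeas" "J \<in> sets borel"
    and F: "outb J j F E" and G: "outb J j G E'"
  shows "outb J j (\<lambda>t. F t + G t) (E + E')"
proof -
  have e: "(\<integral>\<^sup>+t. (hi j * F t * indicator J t)^2 \<partial>lborel) \<le> E^2" "(\<integral>\<^sup>+t. (hi j * G t * indicator J t)^2 \<partial>lborel) \<le> E'^2"
    unfolding indicator_square using F G by (auto simp: outb_def)
  have "(\<integral>\<^sup>+t. (hi j * F t * indicator J t + hi j * G t * indicator J t)^2 \<partial>lborel) \<le> (E + E')^2"
    by (rule Minkowski_L2) (use e in auto)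
  also have "(\<integral>\<^sup>+t. (hi j * F t * indicator J t + hi j * G t * indicator J t)^2 \<partial>lborel) = (\<integral>\<^sup>+t\<in>J. (hi j * (F t + G t))^2 \<partial>lborel)"
    by (intro nn_integral_cong) (auto simp: indicator_def algebra_simps)
  finally show ?thesis using F G by (auto simp: outb_def distrib_left add_mono)
qed

lemma outb_suminf:
  fixes F :: "nat \<Rightarrow> real \<Rightarrow> ennreal"
  assumes [measurable]: "\<And>i. F i \<in> bmeas" "J \<in> sets borel"
    and F: "\<And>i. outb J j (F i) (E i)"
  shows "outb J j (\<lambda>t. \<Sum>i. F i t) (\<Sum>i. E i)"
proof -
  have e: "(\<integral>\<^sup>+t. (hi j * F i t * indicator J t)^2 \<partial>lborel) \<le> (E i)^2" for i
    unfolding indicator_square using F[of i] by (auto simp: outb_def)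
  have "(\<integral>\<^sup>+t. (\<Sum>i. hi j * F i t * indicator J t)^2 \<partial>lborel) \<le> (\<Sum>i. E i)^2"
    by (rule Minkowski_L2_suminf) (use e in auto)
  also have "(\<integral>\<^sup>+t. (\<Sum>i. hi j * F i t * indicator J t)^2 \<partial>lborel) = (\<integral>\<^sup>+t\<in>J. (hi j * (\<Sum>i. F i t))^2 \<partial>lborel)"
    by (intro nn_integral_cong) (auto simp: indicator_def ennreal_suminf_cmult)
  finally have L2: "(\<integral>\<^sup>+t\<in>J. (hi j * (\<Sum>i. F i t))^2 \<partial>lborel) \<le> (\<Sum>i. E i)^2" .
  have "lo j * (\<Sum>i. F i t) \<le> (\<Sum>i. E i)" if "t \<in> J" for t
  proof -
    have "lo j * (\<Sum>i. F i t) = (\<Sum>i. lo j * F i t)" by simp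
    also have "\<dots> \<le> (\<Sum>i. E i)" using F that by (intro suminf_le) (auto simp: outb_def)
    finally show ?thesis .
  qed
  with L2 show ?thesis by (simp add: outb_def)
qed

lemma outb_cmult:
  assumes [measurable]: "F \<in> bmeas" "J \<in> sets borel" and F: "outb J j F E"
  shows "outb J j (\<lambda>t. c * F t) (c * E)"
proof -
  have "(\<integral>\<^sup>+t\<in>J. (hi j * (c * F t))^2 \<partial>lborel) = (\<integral>\<^sup>+t. c^2 * ((hi j * F t)^2 * indicator J t) \<partial>lborel)"
    by (intro nn_integral_cong) (simp add: power_mult_distrib mult_ac)
  also have "\<dots> = c^2 * (\<integral>\<^sup>+t\<in>J. (hi j * F t)^2 \<partial>lborel)" by (rule nn_integral_cmult) measurable
  also have "\<dots> \<le> c^2 * E^2" using F by (intro mult_left_mono) (auto simp: outb_def)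
  finally have "(\<integral>\<^sup>+t\<in>J. (hi j * (c * F t))^2 \<partial>lborel) \<le> (c * E)^2" by (simp add: power_mult_distrib)
  moreover have "lo j * (c * F t) \<le> c * E" if "t \<in> J" for t
    using F that by (auto simp: outb_def mult.left_commute[of _ c] intro!: mult_left_mono)
  ultimately show ?thesis by (auto simp: outb_def)
qed

lemma powr2_nat: "(2::real)^n = 2 powr (real n)" by (simp add: powr_realpow)

text \<open>The prefactor \<open>2^j\<close> is the cost of the divergence. A source that is a
  product of an \<open>L^2\<close> and an \<open>L^\<infinity>\<close> function gains
  \<open>2^(-j)\<close> in sup norm and \<open>4^(-j)\<close> in \<open>L^2\<close>; as
  \<open>hi j = 2^j * lo j\<close>, both norms end with the weight \<open>lo j\<close>.\<close>

lemma outb_T1: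
  assumes [measurable]: "g \<in> bmeas" and h: "\<And>s. h s \<le> M" and G: "(\<integral>\<^sup>+s. (g s)^2 \<partial>lborel) \<le> G^2"
    and [measurable]: "h \<in> bmeas"
  shows "outb UNIV j (\<lambda>t. ennreal (2^j) * Kc j (\<lambda>s. g s * h s) t) (lo j * (M * G))"
proof -
  let ?F = "\<lambda>t. \<integral>\<^sup>+s. Kf j (t - s) * (g s * h s) \<partial>lborel"
  have "lo j * (ennreal (2^j) * ?F t) \<le> lo j * (M * G)" for t
  proof -
    have "ennreal (2^j) * ?F t \<le> ennreal (2^j) * (M * G * ennreal (1/2^j))"
      by (intro mult_left_mono T1_sup h G) auto
    also have "\<dots> = M * G * (ennreal (2^j) * ennreal (1/2^j))" by (simp add: mult_ac)
    also have "ennreal (2^j) * ennreal (1/2^j) = 1" by (subst ennreal_mult[symmetric]) auto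
    finally show ?thesis by (intro mult_left_mono) auto
  qed
  moreover have "(\<integral>\<^sup>+t. (hi j * (ennreal (2^j) * ?F t))^2 * indicator UNIV t \<partial>lborel) \<le> (lo j * (M * G))^2"
  proof -
    have "(\<integral>\<^sup>+t. (hi j * (ennreal (2^j) * ?F t))^2 * indicator UNIV t \<partial>lborel) = (\<integral>\<^sup>+t. (hi j * ennreal (2^j))^2 * (?F t)^2 \<partial>lborel)"
      by (intro nn_integral_cong) (simp add: power_mult_distrib mult_ac)
    also have "\<dots> = (hi j * ennreal (2^j))^2 * (\<integral>\<^sup>+t. (?F t)^2 \<partial>lborel)" by (rule nn_integral_cmult) measurable
    also have "\<dots> \<le> (hi j * ennreal (2^j))^2 * (M * G * ennreal (1/4^j))^2" by (intro mult_left_mono T1_L2 h G) auto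
    also have "\<dots> = (hi j * ennreal (2^j) * ennreal (1/4^j) * (M * G))^2" by (simp add: power_mult_distrib mult_ac)
    also have "hi j * ennreal (2^j) * ennreal (1/4^j) = lo j"
    proof -
      have "(4::real)^j = 2 powr (2 * real j)" by (simp add: powr_powr[symmetric] powr_realpow)
      then have "2 powr (real j * (sg + 1)) * 2^j * (1/4^j) = 2 powr (real j * (sg + 1)) * 2 powr (real j) * 2 powr (- (2 * real j))"
        unfolding powr2_nat by (simp add: powr_minus_divide)
      also have "\<dots> = 2 powr (real j * sg)" unfolding powr_add[symmetric] by (simp add: algebra_simps)
      finally show ?thesis by (simp add: ennreal_mult[symmetric])
    qed
    finally show ?thesis .
  qed
  ultimately show ?thesis by (simp add: outb_def)
qed

text \<open>An \<open>L^1\<close> source gains nothing in sup norm and \<open>2^(-j)\<close> in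
  \<open>L^2\<close>, so the output weight is \<open>hi j\<close>. This is favourable when the
  source stems from frequencies above \<open>j\<close>.\<close>

lemma outb_T2:
  assumes [measurable]: "v \<in> bmeas" and V: "(\<integral>\<^sup>+s. v s \<partial>lborel) \<le> V"
  shows "outb UNIV j (\<lambda>t. ennreal (2^j) * Kc j v t) (hi j * V)"
proof -
  let ?F = "\<lambda>t. \<integral>\<^sup>+s. Kf j (t - s) * v s \<partial>lborel"
  have lohi: "lo j * ennreal (2^j) = hi j"
    by (subst ennreal_mult[symmetric]) (auto simp: powr2_nat powr_add[symmetric] algebra_simps)
  have "lo j * (ennreal (2^j) * ?F t) \<le> hi j * V" for t
    unfolding mult.assoc[symmetric] lohi by (intro mult_left_mono T2_sup V) auto
  moreover have "(\<integral>\<^sup>+t. (hi j * (ennreal (2^j) * ?F t))^2 * indicator UNIV t \<partial>lborel) \<le> (hi j * V)^2"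
  proof -
    have "(\<integral>\<^sup>+t. (hi j * (ennreal (2^j) * ?F t))^2 * indicator UNIV t \<partial>lborel) = (\<integral>\<^sup>+t. (hi j * ennreal (2^j))^2 * (?F t)^2 \<partial>lborel)"
      by (intro nn_integral_cong) (simp add: power_mult_distrib mult_ac)
    also have "\<dots> = (hi j * ennreal (2^j))^2 * (\<integral>\<^sup>+t. (?F t)^2 \<partial>lborel)" by (rule nn_integral_cmult) measurable
    also have "\<dots> \<le> (hi j * ennreal (2^j))^2 * (V * ennreal (1/2^j))^2" by (intro mult_left_mono T2_L2 V) auto
    also have "\<dots> = (hi j * V * (ennreal (2^j) * ennreal (1/2^j)))^2" by (simp add: power_mult_distrib mult_ac)
    also have "ennreal (2^j) * ennreal (1/2^j) = 1" by (subst ennreal_mult[symmetric]) auto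
    finally show ?thesis by simp
  qed
  ultimately show ?thesis by (simp add: outb_def)
qed

definition MJ :: "real set \<Rightarrow> (nat \<Rightarrow> real \<Rightarrow> ennreal) \<Rightarrow> (nat \<Rightarrow> ennreal) \<Rightarrow> bool" where
  "MJ J a D \<longleftrightarrow> (\<forall>j. outb J j (a j) (D j))"

lemma MJ_sup: "MJ J a D \<Longrightarrow> a i s * indicator J s \<le> loi i * D i"
proof -
  assume "MJ J a D"
  then have *: "s \<in> J \<Longrightarrow> lo i * a i s \<le> D i" by (simp add: MJ_def outb_def)
  have "loi i * lo i = 1" by (subst ennreal_mult[symmetric]) (auto simp: powr_add[symmetric])
  then have "a i s = loi i * (lo i * a i s)" by (simp add: mult.assoc[symmetric])
  moreover have "s \<in> J \<Longrightarrow> loi i * (lo i * a i s) \<le> loi i * D i"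
    using * by (intro mult_left_mono) auto
  ultimately show ?thesis by (auto simp: indicator_def)
qed

lemma MJ_L2:
  assumes [measurable]: "a i \<in> bmeas" "J \<in> sets borel" and "MJ J a D"
  shows "(\<integral>\<^sup>+s. (a i s * indicator J s)^2 \<partial>lborel) \<le> (hii i * D i)^2"
proof -
  have *: "(\<integral>\<^sup>+t\<in>J. (hi i * a i t)^2 \<partial>lborel) \<le> (D i)^2" using assms(3) by (simp add: MJ_def outb_def)
  have 1: "hii i * hi i = 1" by (subst ennreal_mult[symmetric]) (auto simp: powr_add[symmetric])
  have "a i s = hii i * (hi i * a i s)" for s unfolding mult.assoc[symmetric] 1 by simp
  then have "(a i s * indicator J s)^2 = (hii i)^2 * ((hi i * a i s)^2 * indicator J s)" for s
    by (simp add: indicator_def power_mult_distrib[symmetric])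
  then have "(\<integral>\<^sup>+s. (a i s * indicator J s)^2 \<partial>lborel) = (hii i)^2 * (\<integral>\<^sup>+s\<in>J. (hi i * a i s)^2 \<partial>lborel)"
    by (simp add: nn_integral_cmult)
  also have "\<dots> \<le> (hii i)^2 * (D i)^2" by (intro mult_left_mono *) auto
  finally show ?thesis by (simp add: power_mult_distrib)
qed

text \<open>Input frequencies \<open>i \<le> j\<close> use the sup norm of \<open>a i\<close> and
  leave \<open>2^((j-i) sg)\<close>, which decays as \<open>sg < 0\<close>; higher ones use its
  \<open>L^2\<close> norm and leave \<open>2^((j-i) (sg+1))\<close>, which decays as
  \<open>sg + 1 > 0\<close>. The envelope property sums both ranges.\<close>

lemma outb_lin:
  assumes [measurable]: "\<And>i. a i \<in> bmeas" "J \<in> sets borel" "v \<in> bmeas"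
    and a: "MJ J a (\<lambda>i. \<alpha> * D i)" and v: "(\<integral>\<^sup>+s. (v s * indicator J s)^2 \<partial>lborel) \<le> G^2" and D: "envelope dl C X D"
  shows "outb UNIV j (\<lambda>t. ennreal (2^j) * Kc j (\<lambda>s. v s * (\<Sum>i. a i s) * indicator J s) t) (G * \<alpha> * (ennreal C * D j))"
proof -
  define F where "F i t = ennreal (2^j) * Kc j (\<lambda>s. (v s * indicator J s) * (a i s * indicator J s)) t" for i t
  have [measurable]: "F i \<in> bmeas" for i unfolding F_def by measurable
  have bi: "outb UNIV j (F i) (G * \<alpha> * (ennreal (gd dl i j) * D i))" for i
  proof (cases "i \<le> j")
    case True
    have "outb UNIV j (F i) (lo j * ((loi i * (\<alpha> * D i)) * G))"
      unfolding F_def by (rule outb_T1[OF _ MJ_sup[OF a] v]) measurable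
    moreover have "lo j * ((loi i * (\<alpha> * D i)) * G) \<le> G * \<alpha> * (ennreal (gd dl i j) * D i)"
    proof -
      have "2 powr (real j * sg) * 2 powr (- real i * sg) \<le> gd dl i j"
        unfolding gd_def powr_add[symmetric]
      proof (rule powr_mono)
        have "dl * (real j - real i) \<le> (- sg) * (real j - real i)" using dl True by (intro mult_right_mono) auto
        then show "real j * sg + - real i * sg \<le> - dl * \<bar>real i - real j\<bar>" using True by (simp add: algebra_simps)
      qed simp
      then have "lo j * loi i \<le> ennreal (gd dl i j)"
        by (subst ennreal_mult[symmetric]) (auto intro: ennreal_leI)
      then have "lo j * loi i * (\<alpha> * D i * G) \<le> ennreal (gd dl i j) * (\<alpha> * D i * G)" by (intro mult_right_mono) auto
      then show ?thesis by (simp add: mult_ac)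
    qed
    ultimately show ?thesis by (rule outb_le)
  next
    case False
    have "outb UNIV j (F i) (hi j * (G * (hii i * (\<alpha> * D i))))"
      unfolding F_def by (rule outb_T2, measurable) (rule L1_of_L2[OF _ _ v MJ_L2[OF _ _ a]], measurable)
    moreover have "hi j * (G * (hii i * (\<alpha> * D i))) \<le> G * \<alpha> * (ennreal (gd dl i j) * D i)"
    proof -
      have "2 powr (real j * (sg + 1)) * 2 powr (- real i * (sg + 1)) \<le> gd dl i j"
        unfolding gd_def powr_add[symmetric]
      proof (rule powr_mono)
        have "dl * (real i - real j) \<le> (sg + 1) * (real i - real j)" using dl False by (intro mult_right_mono) auto
        then show "real j * (sg + 1) + - real i * (sg + 1) \<le> - dl * \<bar>real i - real j\<bar>" using False by (simp add: algebra_simps)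
      qed simp
      then have "hi j * hii i \<le> ennreal (gd dl i j)"
        by (subst ennreal_mult[symmetric]) (auto intro: ennreal_leI)
      then have "hi j * hii i * (\<alpha> * D i * G) \<le> ennreal (gd dl i j) * (\<alpha> * D i * G)" by (intro mult_right_mono) auto
      then show ?thesis by (simp add: mult_ac)
    qed
    ultimately show ?thesis by (rule outb_le)
  qed
  have "outb UNIV j (\<lambda>t. \<Sum>i. F i t) (\<Sum>i. G * \<alpha> * (ennreal (gd dl i j) * D i))"
    by (rule outb_suminf) (auto intro: bi)
  moreover have "(\<Sum>i. F i t) = ennreal (2^j) * Kc j (\<lambda>s. v s * (\<Sum>i. a i s) * indicator J s) t" for t
  proof -
    have "v s * (\<Sum>i. a i s) * indicator J s = (\<Sum>i. (v s * indicator J s) * (a i s * indicator J s))" for s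
      by (auto simp: indicator_def)
    then have "Kc j (\<lambda>s. v s * (\<Sum>i. a i s) * indicator J s) t = (\<Sum>i. Kc j (\<lambda>s. (v s * indicator J s) * (a i s * indicator J s)) t)"
      by (simp only:) (subst Kc_suminf; measurable)
    then show ?thesis unfolding F_def by (simp only: ennreal_suminf_cmult)
  qed
  moreover have "(\<Sum>i. G * \<alpha> * (ennreal (gd dl i j) * D i)) \<le> G * \<alpha> * (ennreal C * D j)"
    unfolding ennreal_suminf_cmult using D by (intro mult_left_mono) (auto simp: envelope_def)
  ultimately show ?thesis by (rule_tac outb_mono) auto
qed

text \<open>The bound of \<open>gd_sum\<close> for row sums at rate \<open>dl\<close>, hence also
  the constant of the constant envelope.\<close>

definition CD :: real where "CD = 2 / (1 - 2 powr (- dl))"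

lemma CD_pos: "CD > 0"
proof -
  have "2 powr (- dl) < 2 powr 0" using dl by (intro powr_less_mono) auto
  then show ?thesis by (simp add: CD_def)
qed

lemma w_powr: "w j i i' = 2 powr (real (min i (min i' j)) * (sg + 1))"
proof -
  have "(8::real) ^ n = 2 powr (3 * real n)" for n by (simp add: powr_powr[symmetric] powr_realpow)
  then show ?thesis by (simp add: w_def powr_powr sg_def mult_ac)
qed

text \<open>If an input frequency is lowest, that factor enters in sup norm and the other in
  \<open>L^2\<close>; if the output is lowest, both enter in \<open>L^2\<close>. The envelope of one
  factor is bounded by \<open>X\<close>, and the double sum is closed with the envelope of the
  other.\<close>

lemma outb_bilin:
  assumes [measurable]: "\<And>i. a i \<in> bmeas" "\<And>i. b i \<in> bmeas" "J \<in> sets borel"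
    and a: "MJ J a (\<lambda>i. \<alpha> * D i)" and b: "MJ J b (\<lambda>i. \<beta> * D i)" and D: "envelope dl C X D"
  shows "outb UNIV j (\<lambda>t. ennreal (2^j) * Kc j (\<lambda>s. (\<Sum>i. \<Sum>i'. ennreal (w j i i') * a i s * b i' s) * indicator J s) t)
     (ennreal (2 * CD * C) * X * \<alpha> * \<beta> * D j)"
proof -
  define F where "F i i' t = ennreal (w j i i') * (ennreal (2^j) * Kc j (\<lambda>s. (a i s * indicator J s) * (b i' s * indicator J s)) t)" for i i' t
  have [measurable]: "F i i' \<in> bmeas" for i i' unfolding F_def by measurable
  \<comment> \<open>Decay from \<open>i\<close> to \<open>min i' j\<close> allows the sum over
    \<open>i\<close>; decay from \<open>i'\<close> to \<open>j\<close> allows the sum over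
    \<open>i'\<close> against the envelope.\<close>
  define A where "A i i' = ennreal (gd dl i (min i' j)) * (ennreal (gd dl i' j) * D i')" for i i'
  have DX: "D i \<le> X" for i using D by (simp add: envelope_def)
  have CC: "0 \<le> C \<or> ennreal C = 0" by (auto simp: ennreal_eq_0_iff)
  have T1': "outb UNIV j (F i i') (ennreal (w j i i') * (lo j * ((loi i * (\<alpha> * D i)) * (hii i' * (\<beta> * D i')))))" for i i'
    unfolding F_def mult.commute[of "a i _ * indicator J _"]
    by (rule outb_cmult, measurable) (rule outb_T1[OF _ MJ_sup[OF a] MJ_L2[OF _ _ b]], measurable)
  have T1'': "outb UNIV j (F i i') (ennreal (w j i i') * (lo j * ((loi i' * (\<beta> * D i')) * (hii i * (\<alpha> * D i)))))" for i i'
    unfolding F_def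
    by (rule outb_cmult, measurable) (rule outb_T1[OF _ MJ_sup[OF b] MJ_L2[OF _ _ a]], measurable)
  have T2': "outb UNIV j (F i i') (ennreal (w j i i') * (hi j * ((hii i * (\<alpha> * D i)) * (hii i' * (\<beta> * D i')))))" for i i'
    unfolding F_def
    by (rule outb_cmult, measurable) (rule outb_T2, measurable, rule L1_of_L2[OF _ _ MJ_L2[OF _ _ a] MJ_L2[OF _ _ b]], measurable)
  have lem1: "2 powr (real i * (sg + 1)) * 2 powr (real j * sg) * (2 powr (- real i * sg) * 2 powr (- real i' * (sg + 1)))
      \<le> gd dl i (min i' j) * gd dl i' j" if ii: "i \<le> i'" "i \<le> j" for i i'
    unfolding gd_def powr_add[symmetric]
  proof (rule powr_mono)
    have 1: "dl * (real (min i' j) - real i) \<le> 1 * (real (min i' j) - real i)" using dl ii by (intro mult_right_mono) auto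
    have 2: "\<bar>real i - real (min i' j)\<bar> = real (min i' j) - real i" using ii by auto
    show "real i * (sg + 1) + real j * sg + (- real i * sg + - real i' * (sg + 1)) \<le> - dl * \<bar>real i - real (min i' j)\<bar> + - dl * \<bar>real i' - real j\<bar>"
    proof (cases "i' \<le> j")
      case True
      have "dl * (real j - real i') \<le> (- sg) * (real j - real i')" using dl True by (intro mult_right_mono) auto
      then show ?thesis using 1 2 True by (simp add: algebra_simps)
    next
      case False
      have "dl * (real i' - real j) \<le> (sg + 1) * (real i' - real j)" using dl False by (intro mult_right_mono) auto
      then show ?thesis using 1 2 False by (simp add: algebra_simps)
    qed
  qed simp
  have lem2: "2 powr (real j * (sg + 1)) * 2 powr (real j * (sg + 1)) * (2 powr (- real i * (sg + 1)) * 2 powr (- real i' * (sg + 1)))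
      \<le> gd dl i (min i' j) * gd dl i' j" if ii: "j < i" "j < i'" for i i'
    unfolding gd_def powr_add[symmetric]
  proof (rule powr_mono)
    have "dl * (real i - real j) \<le> (sg + 1) * (real i - real j)" using dl ii by (intro mult_right_mono) auto
    moreover have "dl * (real i' - real j) \<le> (sg + 1) * (real i' - real j)" using dl ii by (intro mult_right_mono) auto
    moreover have "\<bar>real i - real (min i' j)\<bar> = real i - real j" "\<bar>real i' - real j\<bar> = real i' - real j" using ii by auto
    ultimately show "real j * (sg + 1) + real j * (sg + 1) + (- real i * (sg + 1) + - real i' * (sg + 1)) \<le> - dl * \<bar>real i - real (min i' j)\<bar> + - dl * \<bar>real i' - real j\<bar>"
      by (simp add: algebra_simps)
  qed simp
  have conv4: "ennreal x1 * (ennreal x2 * ((ennreal x3 * (u * d)) * (ennreal x4 * (u' * d')))) \<le> X * u * u' * (ennreal y1 * (ennreal y2 * d'))"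
    if "x1 * x2 * (x3 * x4) \<le> y1 * y2" "0 \<le> x1" "0 \<le> x2" "0 \<le> x3" "0 \<le> x4" "0 \<le> y1" "0 \<le> y2" "d \<le> X" for x1 x2 x3 x4 y1 y2 u u' d d'
  proof -
    have "ennreal x1 * (ennreal x2 * ((ennreal x3 * (u * d)) * (ennreal x4 * (u' * d')))) = ennreal (x1 * x2 * (x3 * x4)) * (d * (u * u' * d'))"
      using that by (simp add: ennreal_mult mult_ac)
    also have "\<dots> \<le> ennreal (y1 * y2) * (X * (u * u' * d'))" by (rule mult_mono[OF ennreal_leI[OF that(1)] mult_right_mono[OF that(8)]]) auto
    also have "\<dots> = X * u * u' * (ennreal y1 * (ennreal y2 * d'))" using that by (simp add: ennreal_mult mult_ac)
    finally show ?thesis .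
  qed
  \<comment> \<open>Symmetrised, since either input may have the lower frequency; this is the factor
    2 in the final constant.\<close>
  have bi: "outb UNIV j (F i i') (X * \<alpha> * \<beta> * (A i i' + A i' i))" for i i'
  proof -
    consider "i \<le> i'" "i \<le> j" | "i' \<le> i" "i' \<le> j" | "j < i" "j < i'" by linarith
    then show ?thesis
    proof cases
      case 1
      have "w j i i' = 2 powr (real i * (sg + 1))" using 1 by (simp add: w_powr min_def)
      then have "ennreal (w j i i') * (lo j * ((loi i * (\<alpha> * D i)) * (hii i' * (\<beta> * D i'))))
        \<le> X * \<alpha> * \<beta> * A i i'" unfolding A_def by (intro conv4) (use lem1[OF 1] DX in auto)
      also have "\<dots> \<le> X * \<alpha> * \<beta> * (A i i' + A i' i)" by (intro mult_left_mono) auto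
      finally show ?thesis by (intro outb_mono[OF T1']) auto
    next
      case 2
      have "w j i i' = 2 powr (real i' * (sg + 1))" using 2 by (simp add: w_powr min_def)
      then have "ennreal (w j i i') * (lo j * ((loi i' * (\<beta> * D i')) * (hii i * (\<alpha> * D i))))
        \<le> X * \<beta> * \<alpha> * A i' i" unfolding A_def by (intro conv4) (use lem1[OF 2] DX in auto)
      also have "\<dots> = X * \<alpha> * \<beta> * A i' i" by (simp add: mult_ac)
      also have "\<dots> \<le> X * \<alpha> * \<beta> * (A i i' + A i' i)" by (intro mult_left_mono) auto
      finally show ?thesis by (intro outb_mono[OF T1'']) auto
    next
      case 3
      have "w j i i' = 2 powr (real j * (sg + 1))" using 3 by (simp add: w_powr min_def)
      then have "ennreal (w j i i') * (hi j * ((hii i * (\<alpha> * D i)) * (hii i' * (\<beta> * D i'))))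
        \<le> X * \<alpha> * \<beta> * A i i'" unfolding A_def by (intro conv4) (use lem2[OF 3] DX in auto)
      also have "\<dots> \<le> X * \<alpha> * \<beta> * (A i i' + A i' i)" by (intro mult_left_mono) auto
      finally show ?thesis by (intro outb_mono[OF T2']) auto
    qed
  qed
  have sumA: "(\<Sum>i. \<Sum>i'. A i' i) \<le> ennreal CD * (ennreal C * D j)"
  proof -
    have "(\<Sum>i. \<Sum>i'. A i' i) = (\<Sum>i. (\<Sum>i'. ennreal (gd dl i' (min i j))) * (ennreal (gd dl i j) * D i))"
      unfolding A_def by (simp add: ennreal_suminf_multc)
    also have "\<dots> \<le> (\<Sum>i. ennreal CD * (ennreal (gd dl i j) * D i))"
      unfolding CD_def by (intro suminf_le mult_right_mono gd_sum dl) auto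
    also have "\<dots> = ennreal CD * (\<Sum>i. ennreal (gd dl i j) * D i)" by (rule ennreal_suminf_cmult)
    also have "\<dots> \<le> ennreal CD * (ennreal C * D j)" using D by (intro mult_left_mono) (auto simp: envelope_def)
    finally show ?thesis .
  qed
  have "outb UNIV j (\<lambda>t. \<Sum>i. \<Sum>i'. F i i' t) (\<Sum>i. \<Sum>i'. X * \<alpha> * \<beta> * (A i i' + A i' i))"
    by (intro outb_suminf bi) measurable
  moreover have "(\<Sum>i. \<Sum>i'. X * \<alpha> * \<beta> * (A i i' + A i' i)) \<le> ennreal (2 * CD * C) * X * \<alpha> * \<beta> * D j"
  proof -
    have "(\<Sum>i. \<Sum>i'. X * \<alpha> * \<beta> * (A i i' + A i' i)) = X * \<alpha> * \<beta> * ((\<Sum>i. \<Sum>i'. A i i') + (\<Sum>i. \<Sum>i'. A i' i))"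
      by (simp add: ennreal_suminf_cmult suminf_add[symmetric])
    also have "(\<Sum>i. \<Sum>i'. A i i') = (\<Sum>i. \<Sum>i'. A i' i)" by (rule suminf_swap_ennreal)
    also have "X * \<alpha> * \<beta> * ((\<Sum>i. \<Sum>i'. A i' i) + (\<Sum>i. \<Sum>i'. A i' i)) \<le> X * \<alpha> * \<beta> * (ennreal CD * (ennreal C * D j) + ennreal CD * (ennreal C * D j))"
      by (intro mult_left_mono add_mono sumA) auto
    also have "\<dots> = ennreal (2 * CD * C) * X * \<alpha> * \<beta> * D j"
    proof -
      have "ennreal (2 * CD * C) = 2 * (ennreal CD * ennreal C)"
        using CC CD_pos by (auto simp: ennreal_mult' mult.assoc ennreal_eq_0_iff mult_nonneg_nonpos)
      then show ?thesis unfolding mult_2[symmetric] by (simp add: mult_ac)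
    qed
    finally show ?thesis .
  qed
  moreover have "(\<Sum>i. \<Sum>i'. F i i' t) = ennreal (2^j) * Kc j (\<lambda>s. (\<Sum>i. \<Sum>i'. ennreal (w j i i') * a i s * b i' s) * indicator J s) t" for t
  proof -
    have "(\<Sum>i. \<Sum>i'. ennreal (w j i i') * a i s * b i' s) * indicator J s
        = (\<Sum>i. \<Sum>i'. ennreal (w j i i') * ((a i s * indicator J s) * (b i' s * indicator J s)))" for s
      by (auto simp: indicator_def mult_ac)
    then have "Kc j (\<lambda>s. (\<Sum>i. \<Sum>i'. ennreal (w j i i') * a i s * b i' s) * indicator J s) t
        = (\<Sum>i. \<Sum>i'. Kc j (\<lambda>s. ennreal (w j i i') * ((a i s * indicator J s) * (b i' s * indicator J s))) t)"
      by (simp only:) (subst Kc_suminf, measurable, subst Kc_suminf, measurable)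
    also have "\<dots> = (\<Sum>i. \<Sum>i'. ennreal (w j i i') * Kc j (\<lambda>s. (a i s * indicator J s) * (b i' s * indicator J s)) t)"
      by (subst Kc_cmult) simp_all
    finally show ?thesis unfolding F_def mult.left_commute[of "ennreal (w j _ _)"] ennreal_suminf_cmult by simp
  qed
  ultimately show ?thesis by (rule_tac outb_mono) auto
qed

end

section \<open>Duhamel integrals of time-dependent coefficients\<close>

lemma measurable_vec_lambda:
  fixes f :: "'n::finite \<Rightarrow> 'a \<Rightarrow> complex"
  assumes [measurable]: "\<And>i. f i \<in> borel_measurable M"
  shows "(\<lambda>s. \<chi> i. f i s) \<in> borel_measurable M"
proof -
  have c: "(\<lambda>z::complex. axis i z) \<in> bmeas" for i :: 'n
  proof (rule borel_measurable_continuous_onI)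
    show "continuous_on UNIV (\<lambda>z::complex. axis i z)"
      unfolding axis_def
    proof (rule continuous_on_vec_lambda)
      fix j show "continuous_on UNIV (\<lambda>z::complex. if j = i then z else 0)" by (cases "j = i") auto
    qed
  qed
  have "(\<lambda>s. \<Sum>i\<in>UNIV. axis i (f i s)) \<in> borel_measurable M"
    by (intro borel_measurable_sum measurable_compose[OF _ c] assms)
  moreover have "(\<Sum>i\<in>UNIV. axis i (f i s)) = (\<chi> i. f i s)" for s
    by (simp add: vec_eq_iff axis_def)
  ultimately show ?thesis by simp
qed

lemma measurable_vec_nth[measurable (raw)]:
  fixes f :: "'a \<Rightarrow> complex^'n::finite"
  assumes "f \<in> borel_measurable M"
  shows "(\<lambda>s. f s $ i) \<in> borel_measurable M"
  by (rule measurable_compose[OF assms]) (intro borel_measurable_continuous_onI continuous_intros)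

lemma measurable_vec_iff:
  fixes f :: "'a \<Rightarrow> complex^'n::finite"
  assumes "\<And>i. (\<lambda>s. f s $ i) \<in> borel_measurable M"
  shows "f \<in> borel_measurable M"
  using measurable_vec_lambda[of "\<lambda>i s. f s $ i", OF assms] by simp

lemma measurable_conv:
  assumes [measurable]: "\<And>m. (\<lambda>s. a s m) \<in> borel_measurable M" "\<And>m. (\<lambda>s. b s m) \<in> borel_measurable M"
  shows "(\<lambda>s. conv (a s) (b s) k) \<in> borel_measurable M"
proof -
  interpret sigma_finite_measure CS by (rule sigma_finite_measure_count_space)
  have "(\<lambda>(m, s). a s m * b s (k - m)) \<in> borel_measurable (CS \<Otimes>\<^sub>M M)"
    by (rule measurable_pair_measure_countable1) auto
  then have "(\<lambda>(s, m). a s m * b s (k - m)) \<in> borel_measurable (M \<Otimes>\<^sub>M CS)"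
    by (subst measurable_pair_swap_iff) (simp add: case_prod_unfold)
  then show ?thesis unfolding conv_integral by (rule borel_measurable_lebesgue_integral)
qed

lemma measurable_Pdiv:
  assumes "\<And>m. (\<lambda>s. a s m) \<in> borel_measurable M" "\<And>m. (\<lambda>s. b s m) \<in> borel_measurable M"
  shows "(\<lambda>s. Pdiv_tensor (a s) (b s) k) \<in> borel_measurable M"
proof (rule measurable_vec_iff)
  fix l
  have [measurable]: "(\<lambda>s. conv (\<lambda>n. a s n $ i) (\<lambda>n. b s n $ m) k) \<in> borel_measurable M" for i m
    by (intro measurable_conv measurable_vec_nth assms)
  show "(\<lambda>s. Pdiv_tensor (a s) (b s) k $ l) \<in> borel_measurable M"
    unfolding leray_component by measurable
qed

text \<open>The constant depends on \<open>k\<close>: the bound serves to make single coefficients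
  integrable in time, not to estimate norms.\<close>

lemma Pdiv_bound:
  assumes "\<And>i. el2 (\<lambda>n. a n $ i) \<le> A^2" "\<And>i. el2 (\<lambda>n. b n $ i) \<le> D^2"
  shows "ennreal (norm (Pdiv_tensor a b k)) \<le> ennreal (\<Sum>l\<in>UNIV. \<Sum>i\<in>UNIV. \<Sum>m\<in>UNIV. \<bar>mu l i m (rvec k)\<bar>) * (A * D)"
proof -
  have "norm (Pdiv_tensor a b k) \<le> (\<Sum>l\<in>UNIV. norm (Pdiv_tensor a b k $ l))"
    unfolding norm_vec_def by (rule L2_set_le_sum) auto
  also have "\<dots> \<le> (\<Sum>l\<in>UNIV. \<Sum>i\<in>UNIV. \<Sum>m\<in>UNIV. \<bar>mu l i m (rvec k)\<bar> * norm (conv (\<lambda>n. a n $ i) (\<lambda>n. b n $ m) k))"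
    unfolding leray_component norm_mult
    by (auto intro!: sum_mono order_trans[OF norm_sum] simp: norm_mult)
  finally have "ennreal (norm (Pdiv_tensor a b k)) \<le> (\<Sum>l\<in>UNIV. \<Sum>i\<in>UNIV. \<Sum>m\<in>UNIV. ennreal \<bar>mu l i m (rvec k)\<bar> * ennreal (norm (conv (\<lambda>n. a n $ i) (\<lambda>n. b n $ m) k)))"
    unfolding ennreal_mult[OF abs_ge_zero norm_ge_zero, symmetric]
    by (subst sum_ennreal, simp, subst sum_ennreal, simp add: sum_nonneg, subst sum_ennreal, simp add: sum_nonneg, rule ennreal_leI)
  also have "\<dots> \<le> (\<Sum>l\<in>UNIV. \<Sum>i\<in>UNIV. \<Sum>m\<in>UNIV. ennreal \<bar>mu l i m (rvec k)\<bar> * (A * D))"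
    by (intro sum_mono mult_left_mono conv_bound assms) auto
  also have "\<dots> = ennreal (\<Sum>l\<in>UNIV. \<Sum>i\<in>UNIV. \<Sum>m\<in>UNIV. \<bar>mu l i m (rvec k)\<bar>) * (A * D)"
    unfolding sum_distrib_right[symmetric]
    by (subst sum_ennreal, simp, subst sum_ennreal, simp add: sum_nonneg, subst sum_ennreal, simp add: sum_nonneg, rule refl)
  finally show ?thesis .
qed

lemma Pdiv_diff_left:
  assumes "\<And>i. el2 (\<lambda>n. a n $ i) < \<infinity>" "\<And>i. el2 (\<lambda>n. a' n $ i) < \<infinity>" "\<And>i. el2 (\<lambda>n. b n $ i) < \<infinity>"
  shows "Pdiv_tensor (\<lambda>k. a k - a' k) b k = Pdiv_tensor a b k - Pdiv_tensor a' b k"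
    "Pdiv_tensor b (\<lambda>k. a k - a' k) k = Pdiv_tensor b a k - Pdiv_tensor b a' k"
  using assms by (simp_all add: vec_eq_iff leray_component conv_diff_left conv_commute[of "\<lambda>n. b n $ _"]
      sum_subtractf right_diff_distrib)

text \<open>A Lebesgue integral over the whole line, hence zero for negative \<open>t\<close>. It
  agrees with the gauge integral of \<open>PNS_duhamel\<close> once the coefficient is locally
  integrable.\<close>

definition Du :: "(real \<Rightarrow> field) \<Rightarrow> real \<Rightarrow> field" where
  "Du G t k = (\<integral>s. indicator {0..t} s *\<^sub>R (exp (- (t - s) * ksq k) *\<^sub>R G s k) \<partial>lborel)"

definition loc_int :: "(real \<Rightarrow> complex^3) \<Rightarrow> bool" where
  "loc_int g \<longleftrightarrow> (\<forall>t\<ge>0. integrable lborel (\<lambda>s. indicator {0..t} s *\<^sub>R g s))"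

lemma Du_integrable:
  assumes "loc_int (\<lambda>s. G s k)" "0 \<le> t"
  shows "integrable lborel (\<lambda>s. indicator {0..t} s *\<^sub>R (exp (- (t - s) * ksq k) *\<^sub>R G s k))"
proof (rule Bochner_Integration.integrable_bound)
  show i: "integrable lborel (\<lambda>s. indicator {0..t} s *\<^sub>R G s k)" using assms by (simp add: loc_int_def)
  have [measurable]: "(\<lambda>s. indicator {0..t} s *\<^sub>R G s k) \<in> borel_measurable lborel" using borel_measurable_integrable[OF i] .
  have "(\<lambda>s. indicator {0..t} s *\<^sub>R (exp (- (t - s) * ksq k) *\<^sub>R G s k)) = (\<lambda>s. exp (- (t - s) * ksq k) *\<^sub>R (indicator {0..t} s *\<^sub>R G s k))"
    by (auto simp: indicator_def)
  also have "\<dots> \<in> borel_measurable lborel" by measurable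
  finally show "(\<lambda>s. indicator {0..t} s *\<^sub>R (exp (- (t - s) * ksq k) *\<^sub>R G s k)) \<in> borel_measurable lborel" .
  show "AE s in lborel. norm (indicator {0..t} s *\<^sub>R (exp (- (t - s) * ksq k) *\<^sub>R G s k)) \<le> norm (indicator {0..t} s *\<^sub>R G s k)"
  proof (rule AE_I2)
    fix s
    have "exp (- (t - s) * ksq k) \<le> 1" if "s \<le> t" using that by (simp add: mult_nonpos_nonneg)
    then show "norm (indicator {0..t} s *\<^sub>R (exp (- (t - s) * ksq k) *\<^sub>R G s k)) \<le> norm (indicator {0..t} s *\<^sub>R G s k)"
      by (auto simp: indicator_def intro!: mult_left_le_one_le)
  qed
qed

lemma Du_has_integral:
  assumes "loc_int (\<lambda>s. G s k)" "0 \<le> t"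
  shows "((\<lambda>s. exp (- (t - s) * ksq k) *\<^sub>R G s k) has_integral Du G t k) {0..t}"
proof -
  have si: "set_integrable lborel {0..t} (\<lambda>s. exp (- (t - s) * ksq k) *\<^sub>R G s k)"
    using Du_integrable[of G k t, OF assms] by (simp add: set_integrable_def)
  have "Du G t k = integral {0..t} (\<lambda>s. exp (- (t - s) * ksq k) *\<^sub>R G s k)"
    using set_borel_integral_eq_integral(2)[OF si] by (simp add: Du_def set_lebesgue_integral_def)
  then show ?thesis using set_borel_integral_eq_integral(1)[OF si] by (simp add: integrable_integral)
qed

text \<open>Multiplication by \<open>exp (t * ksq k)\<close> removes \<open>t\<close> from the
  integrand and leaves an indefinite integral.\<close>

lemma Du_continuous:
  assumes "loc_int (\<lambda>s. G s k)"
  shows "continuous_on {0..} (\<lambda>t. Du G t k)"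
proof -
  have ee: "exp (t * ksq k) *\<^sub>R (exp (- (t - s) * ksq k) *\<^sub>R G s k) = exp (s * ksq k) *\<^sub>R G s k" for s t
  proof -
    have "exp (t * ksq k) * exp (- (t - s) * ksq k) = exp (s * ksq k)" by (simp add: mult_exp_exp algebra_simps)
    then show ?thesis by (simp only: scaleR_scaleR)
  qed
  have eq: "Du G t k = exp (- t * ksq k) *\<^sub>R integral {0..t} (\<lambda>s. exp (s * ksq k) *\<^sub>R G s k)" if "0 \<le> t" for t
  proof -
    have "((\<lambda>s. exp (t * ksq k) *\<^sub>R (exp (- (t - s) * ksq k) *\<^sub>R G s k)) has_integral exp (t * ksq k) *\<^sub>R Du G t k) {0..t}"
      by (intro has_integral_cmul Du_has_integral assms that)
    then have "integral {0..t} (\<lambda>s. exp (s * ksq k) *\<^sub>R G s k) = exp (t * ksq k) *\<^sub>R Du G t k"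
      unfolding ee by (rule integral_unique)
    then show ?thesis by (simp add: mult_exp_exp)
  qed
  have int: "(\<lambda>s. exp (s * ksq k) *\<^sub>R G s k) integrable_on {0..t}" if "0 \<le> t" for t
  proof -
    have "(\<lambda>s. exp (t * ksq k) *\<^sub>R (exp (- (t - s) * ksq k) *\<^sub>R G s k)) integrable_on {0..t}"
      using Du_has_integral[of G k t, OF assms that] by (intro integrable_cmul) blast
    then show ?thesis unfolding ee .
  qed
  have "continuous_on {0..T} (\<lambda>t. Du G t k)" if "0 \<le> T" for T
  proof -
    have "continuous_on {0..T} (\<lambda>t. exp (- t * ksq k) *\<^sub>R integral {0..t} (\<lambda>s. exp (s * ksq k) *\<^sub>R G s k))"
      by (intro continuous_intros indefinite_integral_continuous_1 int that)
    then show ?thesis by (rule continuous_on_eq) (simp only: eq atLeastAtMost_iff)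
  qed
  then have "continuous (at t within {0..}) (\<lambda>t. Du G t k)" if "0 \<le> t" for t
  proof -
    have "continuous_on {0..t+1} (\<lambda>t. Du G t k)" using \<open>\<And>T. 0 \<le> T \<Longrightarrow> continuous_on {0..T} (\<lambda>t. Du G t k)\<close> that by simp
    then have "continuous (at t within {0..t+1}) (\<lambda>t. Du G t k)" using that by (auto simp: continuous_on_eq_continuous_within)
    moreover have "at t within {0..t+1} = at t within {0..}"
      by (rule at_within_nhd[of _ "{..<t+1}"]) auto
    ultimately show ?thesis by simp
  qed
  then show ?thesis by (auto simp: continuous_on_eq_continuous_within)
qed

section \<open>Block norms as continuous seminorms, and the Besov norms built from them\<close>

context besov_setup
begin

lemma blkf_add: "blkf j (\<lambda>k. c k + d k) x = blkf j c x + blkf j d x"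
  by (simp add: blkf_def vector_add_ldistrib sum.distrib)

lemma blkf_diff: "blkf j (\<lambda>k. c k - d k) x = blkf j c x - blkf j d x"
  by (simp add: blkf_def vector_sub_rdistrib sum_subtractf vec_eq_iff algebra_simps vector_scalar_mult_def)

lemma N_sum2:
  assumes "\<And>x. norm (blkf j c x) \<le> norm (blkf j d x) + norm (blkf j e x)"
  shows "N j c \<le> N j d + N j e"
proof -
  have "lpn p (blkf j c) \<le> (\<Sum>s\<in>{True, False}. lpn p (if s then blkf j d else blkf j e))"
  proof (rule lpn_sum_le)
    show "norm ((if s then blkf j d else blkf j e) x) \<le> cmpB j d + cmpB j e" for s x
      using blkf_bound[of j d x] blkf_bound[of j e x] order_trans[OF norm_ge_zero blkf_bound[of j d x]] order_trans[OF norm_ge_zero blkf_bound[of j e x]]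
      by (cases s) auto
  qed (use p3 assms in auto)
  then show ?thesis by (simp add: N_def)
qed

lemma N_add: "N j (\<lambda>k. c k + d k) \<le> N j c + N j d"
  by (rule N_sum2) (simp add: blkf_add norm_triangle_ineq)

lemma N_diff: "N j (\<lambda>k. c k - d k) \<le> N j c + N j d"
  by (rule N_sum2) (simp add: blkf_diff norm_triangle_ineq4)

lemma N_cong: "(\<And>k. c k = d k) \<Longrightarrow> N j c = N j d"
  by (simp add: N_def blkf_def[abs_def])

lemma N_zero[simp]: "N j (\<lambda>k. 0) = 0"
proof -
  have "blkf j (\<lambda>k. 0) = (\<lambda>x. 0)" by (auto simp: blkf_def)
  then show ?thesis using p3 by (simp add: N_def lpn_def)
qed

lemma N_scale: "N j (\<lambda>k. r *\<^sub>R c k) = \<bar>r\<bar> * N j c"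
proof -
  have "blkf j (\<lambda>k. r *\<^sub>R c k) x = r *\<^sub>R blkf j c x" for x
    by (simp add: blkf_def scaleR_sum_right vec_eq_iff vector_scalar_mult_def)
  then show ?thesis unfolding N_def using p3 by (intro lpn_cmult) auto
qed

lemma N_le_coeff: "N j c \<le> ((2*pi)^3) powr (1/p) * cmpB j c"
  unfolding N_def using p3 by (intro lpn_le_sup blkf_bound) auto

lemma N_abs_diff: "\<bar>N j c - N j d\<bar> \<le> N j (\<lambda>k. c k - d k)"
proof -
  have "N j c \<le> N j (\<lambda>k. c k - d k) + N j d" using N_add[of j "\<lambda>k. c k - d k" d] by simp
  moreover have "N j d \<le> N j (\<lambda>k. c k - d k) + N j c" using N_diff[of j c "\<lambda>k. c k - d k"] by simp
  ultimately show ?thesis by linarith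
qed

lemma N_tendsto_0:
  assumes "\<And>k. ((\<lambda>t. c t k) \<longlongrightarrow> 0) F"
  shows "((\<lambda>t. N j (c t)) \<longlongrightarrow> 0) F"
proof (rule Lim_null_comparison)
  show "\<forall>\<^sub>F t in F. norm (N j (c t)) \<le> ((2*pi)^3) powr (1/p) * cmpB j (c t)" using N_le_coeff by simp
  have "((\<lambda>t. ((2*pi)^3) powr (1/p) * cmpB j (c t)) \<longlongrightarrow> ((2*pi)^3) powr (1/p) * (\<Sum>i\<in>(UNIV::3 set). \<Sum>k\<in>B j. norm (complex_of_real (ph j k) * (0::complex^3) $ i)))  F"
    unfolding cmpB_def by (intro tendsto_intros assms)
  then show "((\<lambda>t. ((2*pi)^3) powr (1/p) * cmpB j (c t)) \<longlongrightarrow> 0) F" by simp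
qed

lemma N_tendsto:
  assumes "\<And>k. ((\<lambda>t. c t k) \<longlongrightarrow> d k) F"
  shows "((\<lambda>t. N j (c t)) \<longlongrightarrow> N j d) F"
proof -
  have "((\<lambda>t. N j (\<lambda>k. c t k - d k)) \<longlongrightarrow> 0) F"
    using assms by (intro N_tendsto_0) (auto intro!: tendsto_eq_intros)
  then have "((\<lambda>t. N j (c t) - N j d) \<longlongrightarrow> 0) F"
    by (rule Lim_null_comparison[rotated]) (auto simp: N_abs_diff)
  then show ?thesis by (simp add: LIM_zero_iff)
qed

lemma measurable_blkf:
  assumes [measurable]: "\<And>k. (\<lambda>t. c t k) \<in> borel_measurable M"
  shows "(\<lambda>(t, x). blkf j (c t) x) \<in> borel_measurable (M \<Otimes>\<^sub>M borel)"
proof (rule measurable_vec_iff)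
  fix i
  have "(\<lambda>s. (case s of (t, x) \<Rightarrow> blkf j (c t) x) $ i) = (\<lambda>s. \<Sum>k\<in>B j. (of_real (ph j k) * c (fst s) k $ i) * cis (rvec k \<bullet> snd s))"
    by (auto simp: blkf_cmp cmp_def tp_def)
  also have "\<dots> \<in> borel_measurable (M \<Otimes>\<^sub>M borel)" by measurable
  finally show "(\<lambda>s. (case s of (t, x) \<Rightarrow> blkf j (c t) x) $ i) \<in> borel_measurable (M \<Otimes>\<^sub>M borel)" .
qed

lemma measurable_N:
  assumes "\<And>k. (\<lambda>t. c t k) \<in> borel_measurable M"
  shows "(\<lambda>t. N j (c t)) \<in> borel_measurable M"
proof -
  have [measurable]: "(\<lambda>(t, x). blkf j (c t) x) \<in> borel_measurable (M \<Otimes>\<^sub>M torus)"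
    using measurable_blkf[of c M j] assms by simp
  have "(\<lambda>(t, x). norm (blkf j (c t) x) powr p) \<in> borel_measurable (M \<Otimes>\<^sub>M torus)" by measurable
  then have "(\<lambda>t. \<integral>x. norm (blkf j (c t) x) powr p \<partial>torus) \<in> borel_measurable M"
    by (rule torus.borel_measurable_lebesgue_integral)
  then show ?thesis unfolding N_def lpn_def by measurable
qed

text \<open>Evaluating a block at a point is a finite linear combination of coefficients and
  commutes with the time integral; Minkowski's inequality then moves the norm inside.\<close>

lemma N_Du:
  assumes li: "\<And>k. loc_int (\<lambda>s. G s k)" and m: "\<And>k. (\<lambda>s. G s k) \<in> bmeas" and t: "0 \<le> t"
  shows "ennreal (N j (Du G t)) \<le> (\<integral>\<^sup>+s\<in>{0..t}. ennreal (N j (\<lambda>k. exp (- (t - s) * ksq k) *\<^sub>R G s k)) \<partial>lborel)"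
proof -
  define E where "E s k = exp (- (t - s) * ksq k) *\<^sub>R G s k" for s k
  define g where "g s x = indicator {0..t} s *\<^sub>R blkf j (E s) x" for s x
  have Ef: "E s = (\<lambda>k. exp (- (t - s) * ksq k) *\<^sub>R G s k)" for s by (auto simp: E_def)
  have Em: "(\<lambda>s. E s k) \<in> borel_measurable lborel" for k unfolding E_def using m[of k] by measurable
  have int: "integrable lborel (\<lambda>s. indicator {0..t} s *\<^sub>R E s k)" for k
    unfolding E_def by (rule Du_integrable[of G k t, OF li t])
  have bl: "bounded_linear (\<lambda>v::complex^3. a *s v)" for a
    unfolding linear_conv_bounded_linear[symmetric]
    by (rule linearI) (auto simp: vec_eq_iff vector_scalar_mult_def algebra_simps)
  have h: "blkf j (Du G t) x = (\<integral>s. g s x \<partial>lborel)" "integrable lborel (\<lambda>s. g s x)" for x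
  proof -
    have gs: "g s x = (\<Sum>k\<in>B j. (of_real (ph j k) * cis (rvec k \<bullet> x)) *s (indicator {0..t} s *\<^sub>R E s k))" for s
      by (simp add: g_def blkf_def indicator_def)
    have i: "integrable lborel (\<lambda>s. (of_real (ph j k) * cis (rvec k \<bullet> x)) *s (indicator {0..t} s *\<^sub>R E s k))" for k
      by (rule integrable_bounded_linear[OF bl int])
    show "integrable lborel (\<lambda>s. g s x)" unfolding gs by (intro Bochner_Integration.integrable_sum i)
    have "(\<integral>s. g s x \<partial>lborel) = (\<Sum>k\<in>B j. (\<integral>s. (of_real (ph j k) * cis (rvec k \<bullet> x)) *s (indicator {0..t} s *\<^sub>R E s k) \<partial>lborel))"
      unfolding gs by (rule Bochner_Integration.integral_sum) (rule i)
    also have "\<dots> = blkf j (Du G t) x"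
      unfolding blkf_def by (intro sum.cong refl, subst integral_bounded_linear[OF bl int]) (simp add: Du_def E_def)
    finally show "blkf j (Du G t) x = (\<integral>s. g s x \<partial>lborel)" ..
  qed
  have "ennreal (lpn p (blkf j (Du G t))) \<le> (\<integral>\<^sup>+s. ennreal (lpn p (g s)) \<partial>lborel)"
  proof (rule Minkowski_nn_integral)
    have [measurable]: "(\<lambda>(s, x). blkf j (E s) x) \<in> borel_measurable (lborel \<Otimes>\<^sub>M borel)"
      by (rule measurable_blkf[OF Em])
    show "(\<lambda>(s, x). g s x) \<in> borel_measurable (lborel \<Otimes>\<^sub>M borel)" unfolding g_def by measurable
    show "norm (blkf j (Du G t) x) \<le> cmpB j (Du G t)" for x by (rule blkf_bound)
    show "norm (g s x) \<le> cmpB j (E s)" for s x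
      using blkf_bound[of j "E s" x] order_trans[OF norm_ge_zero blkf_bound[of j "E s" x]] by (auto simp: g_def indicator_def)
    show "ennreal (norm (blkf j (Du G t) x)) \<le> (\<integral>\<^sup>+s. ennreal (norm (g s x)) \<partial>lborel)" for x
      unfolding h(1) by (rule integral_norm_bound_ennreal[OF h(2)])
  qed (use p3 in \<open>auto intro: sigma_finite_lborel\<close>)
  also have "\<dots> = (\<integral>\<^sup>+s\<in>{0..t}. ennreal (N j (E s)) \<partial>lborel)"
  proof (intro nn_integral_cong)
    fix s
    have "lpn p (g s) = indicator {0..t} s * N j (E s)"
      unfolding N_def using p3 by (intro lpn_cmult) (auto simp: g_def)
    then show "ennreal (lpn p (g s)) = ennreal (N j (E s)) * indicator {0..t} s" by (auto simp: indicator_def)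
  qed
  finally show ?thesis by (simp only: N_def Ef)
qed

text \<open>The cutoffs of finitely many blocks add up to 1 at a nonzero frequency, and in each
  block Parseval isolates the coefficient. This turns block estimates into convergence and
  continuity of single coefficients.\<close>

lemma coeff_bound:
  assumes k: "k \<noteq> 0"
  obtains C J where "C > 0" "\<And>c. norm (c k) \<le> C * (\<Sum>j\<le>J. N j c)"
proof -
  define C where "C = ((2*pi)^3) powr (1/2 - 1/p)"
  have C: "C > 0" by (simp add: C_def)
  have one: "norm (complex_of_real (ph j k) * c k $ i) \<le> C * N j c" for j c i
  proof (cases "k \<in> B j")
    case True
    have "1 \<le> (2*pi)^3" using pi_ge_two by (intro one_le_power) auto
    then have "1 * (norm (complex_of_real (ph j k) * c k $ i))^2 \<le> (2*pi)^3 * (\<Sum>k\<in>B j. (norm (complex_of_real (ph j k) * c k $ i))^2)"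
      using True by (intro mult_mono member_le_sum) auto
    also have "\<dots> = (\<integral>x. (norm (cmp j c i x))^2 \<partial>torus)" by (simp add: cmp_def Parseval_tp)
    also have "\<dots> = (lpn 2 (cmp j c i))^2" using lpn_powr[of 2 "cmp j c i"] by simp
    finally have "(norm (complex_of_real (ph j k) * c k $ i))^2 \<le> (lpn 2 (cmp j c i))^2"
      unfolding mult_1 .
    then have "norm (complex_of_real (ph j k) * c k $ i) \<le> lpn 2 (cmp j c i)"
      by (rule power2_le_imp_le) (rule lpn_nonneg)
    also have "\<dots> \<le> C * lpn p (cmp j c i)" unfolding C_def using p3 by (intro lpn_2_le[where b="cmpB j c"] cmp_bound) auto
    also have "\<dots> \<le> C * N j c" using C by (intro mult_left_mono lpn_cmp_le) auto
    finally show ?thesis .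
  next
    case False
    then show ?thesis using C by (simp add: ph_out)
  qed
  obtain J where J: "norm (rvec k) \<le> 2^J" using real_arch_pow[of 2 "norm (rvec k)"] by (auto intro: less_imp_le)
  have ci: "norm (c k $ i) \<le> C * (\<Sum>j\<le>J. N j c)" for c i
  proof -
    have "chi (hj J *\<^sub>R rvec k) = 1" using J by (intro chi_1) (simp add: hj_def power_one_over field_simps)
    then have "c k $ i = of_real (\<Sum>j\<le>J. ph j k) * c k $ i" using sum_ph[OF k, of J] by simp
    also have "\<dots> = (\<Sum>j\<le>J. of_real (ph j k) * c k $ i)" by (simp add: sum_distrib_right)
    finally have "norm (c k $ i) \<le> (\<Sum>j\<le>J. norm (complex_of_real (ph j k) * c k $ i))"
      using norm_sum[of "\<lambda>j. complex_of_real (ph j k) * c k $ i" "{..J}"] by simp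
    also have "\<dots> \<le> (\<Sum>j\<le>J. C * N j c)" by (intro sum_mono one)
    finally show ?thesis by (simp add: sum_distrib_left)
  qed
  have "norm (c k) \<le> 3 * C * (\<Sum>j\<le>J. N j c)" for c
  proof -
    have "norm (c k) \<le> (\<Sum>i\<in>UNIV. norm (c k $ i))" by (rule norm_vec_le_sum)
    also have "\<dots> \<le> (\<Sum>i\<in>(UNIV::3 set). C * (\<Sum>j\<le>J. N j c))" by (intro sum_mono ci)
    finally show ?thesis by simp
  qed
  with C show ?thesis by (intro that[of "3 * C" J]) auto
qed

lemma N_eq_0_imp: assumes "\<And>j. N j c = 0" "k \<noteq> 0" shows "c k = 0"
proof -
  obtain C J where "\<And>c. norm (c k) \<le> C * (\<Sum>j\<le>J. N j c)" by (rule coeff_bound[OF assms(2)]) blast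
  from this[of c] show ?thesis by (simp add: assms(1))
qed

lemma N_le_of_lo:
  assumes "lo j * ennreal (N j c) \<le> ennreal e" "0 \<le> e"
  shows "N j c \<le> 2 powr (- real j * sg) * e"
proof -
  have "ennreal (2 powr (real j * sg) * N j c) \<le> ennreal e" using assms(1) by (simp add: ennreal_mult)
  then have le: "2 powr (real j * sg) * N j c \<le> e" using assms(2) by (subst (asm) ennreal_le_iff) auto
  have "N j c = 2 powr (- real j * sg) * (2 powr (real j * sg) * N j c)"
    unfolding mult.assoc[symmetric] powr_add[symmetric] by simp
  also have "\<dots> \<le> 2 powr (- real j * sg) * e" by (intro mult_left_mono le) auto
  finally show ?thesis .
qed

lemma N_add_enn: "ennreal (N j (\<lambda>k. c k + d k)) \<le> ennreal (N j c) + ennreal (N j d)"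
  and N_diff_enn: "ennreal (N j (\<lambda>k. c k - d k)) \<le> ennreal (N j c) + ennreal (N j d)"
  using N_add[of j c d] N_diff[of j c d] by (simp_all add: ennreal_plus[symmetric] ennreal_leI del: ennreal_plus)

lemma besov_sq_sum:
  assumes "c 0 = 0"
  shows "besov_sq chi s p c = (\<Sum>j. (ennreal (2 powr (real j * s)) * ennreal (N j c))^2)"
proof -
  let ?f = "\<lambda>j. ennreal ((2 powr (real_of_int j * s) * Lp_norm p (LP_block chi j c))^2)"
  have z: "?f j = 0" if "j < 0" for j
  proof -
    have "Lp_norm p (LP_block chi j c) = 0" unfolding LP_block_neg[of j c, OF that assms] using p3 by (simp add: Lp_norm_def)
    then show ?thesis by simp
  qed
  have "besov_sq chi s p c = (\<integral>\<^sup>+ j. ?f j \<partial>count_space (range int))"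
    unfolding besov_sq_def
  proof (rule nn_integral_count_space_eq)
    fix j :: int assume "j \<in> UNIV - range int"
    then have "j < 0" by (metis DiffD2 not_le nonneg_int_cases rangeI)
    then show "?f j = 0" by (rule z)
  qed auto
  also have "\<dots> = (\<integral>\<^sup>+ j. ?f (int j) \<partial>count_space UNIV)"
    by (rule nn_integral_bij_count_space[symmetric]) (auto simp: bij_betw_def)
  also have "\<dots> = (\<Sum>j. ?f (int j))" by (rule nn_integral_count_space_nat)
  also have "\<dots> = (\<Sum>j. (ennreal (2 powr (real j * s)) * ennreal (N j c))^2)"
    unfolding Lp_norm_block by (simp add: ennreal_mult[symmetric] ennreal_power)
  finally show ?thesis .
qed

lemma besov_enn_sq: "(besov_enn chi s p c)^2 = besov_sq chi s p c"
proof (cases "besov_sq chi s p c < \<infinity>")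
  case True
  then obtain r where "0 \<le> r" "besov_sq chi s p c = ennreal r" by (cases "besov_sq chi s p c") auto
  then show ?thesis using True by (simp add: besov_enn_def in_besov_def besov_def ennreal_power)
next
  case False
  then have "besov_sq chi s p c = \<infinity>" by (metis infinity_ennreal_def top.not_eq_extremum)
  then show ?thesis by (simp add: besov_enn_def in_besov_def)
qed

lemma besov_sq_lo: "c 0 = 0 \<Longrightarrow> besov_sq chi (-1 + 3/p) p c = (\<Sum>j. (lo j * ennreal (N j c))^2)"
  by (simp add: besov_sq_sum sg_def)

lemma besov_sq_hi: "c 0 = 0 \<Longrightarrow> besov_sq chi (3/p) p c = (\<Sum>j. (hi j * ennreal (N j c))^2)"
  by (simp add: besov_sq_sum sg_def)

end

section \<open>The supremum norm in time\<close>

text \<open>The infimum defining the essential supremum is attained: the exceptional sets for the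
  bounds \<open>M + 1/(n+1)\<close> have a null union.\<close>

lemma Linf_le_iff: "Linf_norm f \<le> M \<longleftrightarrow> (AE x in lborel. x \<in> cube \<longrightarrow> ennreal (norm (f x)) \<le> M)"
proof
  assume M: "Linf_norm f \<le> M"
  show "AE x in lborel. x \<in> cube \<longrightarrow> ennreal (norm (f x)) \<le> M"
  proof (cases "M = \<infinity>")
    case False
    have "AE x in lborel. x \<in> cube \<longrightarrow> ennreal (norm (f x)) \<le> M + ennreal (1 / real (Suc n))" for n
    proof -
      have "M < M + ennreal (1 / real (Suc n))" using False by (cases M) (auto simp: ennreal_plus[symmetric] ennreal_less_iff simp del: ennreal_plus)
      then have "Linf_norm f < M + ennreal (1 / real (Suc n))" using M by (rule le_less_trans[rotated])
      then obtain K where "K < M + ennreal (1 / real (Suc n))" "AE x in lborel. x \<in> cube \<longrightarrow> ennreal (norm (f x)) \<le> K"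
        unfolding Linf_norm_def Inf_less_iff by auto
      then show ?thesis by (auto elim!: eventually_mono intro: order_trans less_imp_le)
    qed
    then have "AE x in lborel. \<forall>n. x \<in> cube \<longrightarrow> ennreal (norm (f x)) \<le> M + ennreal (1 / real (Suc n))"
      by (subst AE_all_countable) (rule allI)
    then show ?thesis
    proof eventually_elim
      case (elim x)
      show ?case
      proof
        assume x: "x \<in> cube"
        have "(\<lambda>n. M + ennreal (1 / real (Suc n))) \<longlonglongrightarrow> M + ennreal 0"
          by (intro tendsto_add tendsto_const tendsto_ennrealI LIMSEQ_Suc lim_1_over_n)
        then show "ennreal (norm (f x)) \<le> M" using elim x by (intro LIMSEQ_le_const[of _ "M + ennreal 0", simplified]) auto
      qed
    qed
  qed simp
next
  assume "AE x in lborel. x \<in> cube \<longrightarrow> ennreal (norm (f x)) \<le> M"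
  then show "Linf_norm f \<le> M" unfolding Linf_norm_def by (intro Inf_lower) auto
qed

lemma Linf_AE_torus: "AE x in torus. ennreal (norm (f x)) \<le> Linf_norm f"
  by (rule AE_torus) (simp add: Linf_le_iff[symmetric])

text \<open>Sublevel sets in time are described by the vanishing of an integral over the torus,
  which depends measurably on time.\<close>

lemma measurable_Linf:
  assumes u[measurable]: "(\<lambda>(t, x). u t x) \<in> borel_measurable (borel \<Otimes>\<^sub>M borel)"
  shows "(\<lambda>t. Linf_norm (u t)) \<in> bmeas"
proof (rule borel_measurableI_le)
  fix M :: ennreal
  have [measurable]: "(\<lambda>(t, x). u t x) \<in> borel_measurable (borel \<Otimes>\<^sub>M torus)" using u by simp
  have "{t. Linf_norm (u t) \<le> M} = {t. (\<integral>\<^sup>+x. (if ennreal (norm (u t x)) \<le> M then 0 else 1) \<partial>torus) = 0}"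
  proof (intro Collect_cong)
    fix t
    have [measurable]: "u t \<in> bmeas" using measurable_Pair2[OF u, of t] by simp
    have "Linf_norm (u t) \<le> M \<longleftrightarrow> (AE x in torus. ennreal (norm (u t x)) \<le> M)"
      unfolding Linf_le_iff torus_def by (subst AE_density) (auto simp: indicator_def)
    also have "\<dots> \<longleftrightarrow> (AE x in torus. (if ennreal (norm (u t x)) \<le> M then 0 else (1::ennreal)) = 0)"
      by (rule AE_cong) auto
    also have "\<dots> \<longleftrightarrow> (\<integral>\<^sup>+x. (if ennreal (norm (u t x)) \<le> M then 0 else 1) \<partial>torus) = 0"
      by (rule nn_integral_0_iff_AE[symmetric]) measurable
    finally show "Linf_norm (u t) \<le> M \<longleftrightarrow> (\<integral>\<^sup>+x. (if ennreal (norm (u t x)) \<le> M then 0 else 1) \<partial>torus) = 0" .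
  qed
  moreover have "(\<lambda>t. \<integral>\<^sup>+x. (if ennreal (norm (u t x)) \<le> M then 0 else 1) \<partial>torus) \<in> bmeas"
    by (rule torus.borel_measurable_nn_integral) measurable
  ultimately show "{t \<in> space borel. Linf_norm (u t) \<le> M} \<in> sets borel" by simp
qed

lemma fcoeff_fc:
  assumes "f \<in> bmeas"
  shows "fcoeff f k $ i = fc (\<lambda>x. complex_of_real (f x $ i)) k"
proof -
  have "(\<lambda>x. f x $ i) \<in> bmeas"
    by (rule measurable_compose[OF assms]) (intro borel_measurable_continuous_onI continuous_intros)
  then show ?thesis unfolding fcoeff_def fc_def by (simp add: set_integral_cube del: of_real_power)
qed

lemma measurable_fcoeff:
  assumes u[measurable]: "(\<lambda>(t, x). u t x) \<in> borel_measurable (borel \<Otimes>\<^sub>M borel)"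
  shows "(\<lambda>t. fcoeff (u t) k) \<in> bmeas"
proof (rule measurable_vec_iff)
  fix i
  have [measurable]: "u t \<in> bmeas" for t using measurable_Pair2[OF u, of t] by simp
  have [measurable]: "(\<lambda>x::real^3. x $ i) \<in> bmeas" by (intro borel_measurable_continuous_onI continuous_intros)
  have [measurable]: "(\<lambda>(t, x). u t x) \<in> borel_measurable (borel \<Otimes>\<^sub>M torus)" using u by simp
  have "(\<lambda>(t, x). cis (- (rvec k \<bullet> x)) * complex_of_real (u t x $ i)) \<in> borel_measurable (borel \<Otimes>\<^sub>M torus)"
    by measurable
  then have "(\<lambda>t. \<integral>x. cis (- (rvec k \<bullet> x)) * complex_of_real (u t x $ i) \<partial>torus) \<in> bmeas"
    by (rule torus.borel_measurable_lebesgue_integral)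
  then show "(\<lambda>t. fcoeff (u t) k $ i) \<in> bmeas"
    by (subst fcoeff_fc, measurable) (simp add: fc_def)
qed

section \<open>Splitting the time axis\<close>

text \<open>A function with finite integral is finite almost everywhere and may be replaced by the
  real function \<open>g\<close>, whose indefinite integral is continuous.\<close>

lemma cont_primitive:
  fixes f :: "real \<Rightarrow> ennreal"
  assumes [measurable]: "f \<in> bmeas" and fin: "(\<integral>\<^sup>+s\<in>{0..}. f s \<partial>lborel) < \<infinity>"
  obtains U :: "real \<Rightarrow> real" where "continuous_on {0..} U" "U 0 = 0" "\<And>a b. 0 \<le> a \<Longrightarrow> a \<le> b \<Longrightarrow> U a \<le> U b"
    "\<And>a b. 0 \<le> a \<Longrightarrow> a \<le> b \<Longrightarrow> (\<integral>\<^sup>+s\<in>{a..b}. f s \<partial>lborel) = ennreal (U b - U a)"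
proof -
  define g where "g s = enn2real (f s * indicator {0..} s)" for s
  have gm[measurable]: "g \<in> bmeas" unfolding g_def by measurable
  have "AE s in lborel. f s * indicator {0..} s \<noteq> \<infinity>"
    using fin by (intro nn_integral_PInf_AE) auto
  then have fg: "AE s in lborel. f s * indicator {0..} s = ennreal (g s)"
    by eventually_elim (simp add: g_def less_top)
  have g0: "0 \<le> g s" for s by (simp add: g_def)
  have gn: "g s = 0" if "s < 0" for s using that by (simp add: g_def)
  have int: "integrable lborel g"
  proof (rule integrableI_nonneg)
    have "(\<integral>\<^sup>+s. ennreal (g s) \<partial>lborel) = (\<integral>\<^sup>+s\<in>{0..}. f s \<partial>lborel)"
      using fg by (intro nn_integral_cong_AE) auto
    then show "(\<integral>\<^sup>+s. ennreal (g s) \<partial>lborel) < \<infinity>" using fin by simp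
  qed (auto simp: g0)
  have si: "set_integrable lborel {a..b} g" for a b
    unfolding set_integrable_def using int by (intro integrable_mult_indicator) auto
  define U where "U t = integral {0..t} g" for t
  have gi: "g integrable_on {a..b}" for a b by (rule set_borel_integral_eq_integral(1)[OF si])
  have diff: "U b - U a = integral {a..b} g" if "0 \<le> a" "a \<le> b" for a b
    unfolding U_def using Henstock_Kurzweil_Integration.integral_combine[OF that gi] by simp
  show ?thesis
  proof (rule that[of U])
    have "continuous_on {0..T} U" for T unfolding U_def by (rule indefinite_integral_continuous_1[OF gi])
    then have "continuous (at t within {0..}) U" if "0 \<le> t" for t
    proof -
      have "continuous_on {0..t+1} U" by fact
      then have "continuous (at t within {0..t+1}) U" using that by (auto simp: continuous_on_eq_continuous_within)
      moreover have "at t within {0..t+1} = at t within {0..}"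
        by (rule at_within_nhd[of _ "{..<t+1}"]) auto
      ultimately show ?thesis by simp
    qed
    then show "continuous_on {0..} U" by (auto simp: continuous_on_eq_continuous_within)
    show "U 0 = 0" by (simp add: U_def)
    show "U a \<le> U b" if "0 \<le> a" "a \<le> b" for a b
    proof -
      have "0 \<le> integral {a..b} g" using g0 by (intro Henstock_Kurzweil_Integration.integral_nonneg gi) auto
      then show ?thesis using diff[OF that] by linarith
    qed
    show "(\<integral>\<^sup>+s\<in>{a..b}. f s \<partial>lborel) = ennreal (U b - U a)" if "0 \<le> a" "a \<le> b" for a b
    proof -
      have "(\<integral>\<^sup>+s\<in>{a..b}. f s \<partial>lborel) = (\<integral>\<^sup>+s. ennreal (indicator {a..b} s *\<^sub>R g s) \<partial>lborel)"
        using fg by (intro nn_integral_cong_AE, eventually_elim) (use that in \<open>auto simp: indicator_def\<close>)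
      also have "\<dots> = ennreal (\<integral>s. indicator {a..b} s *\<^sub>R g s \<partial>lborel)"
        using si[of a b] g0 by (intro nn_integral_eq_integral) (auto simp: set_integrable_def)
      also have "(\<integral>s. indicator {a..b} s *\<^sub>R g s \<partial>lborel) = U b - U a"
        using set_borel_integral_eq_integral(2)[OF si[of a b]] diff[OF that] by (simp add: set_lebesgue_integral_def)
      finally show ?thesis .
    qed
  qed
qed

text \<open>\<open>\<nu> t\<close> is the integer part of \<open>U t / e\<close> for a primitive
  \<open>U\<close> of \<open>f\<close>. Monotonicity of \<open>U\<close> orders the pieces, its
  bound \<open>T\<close> limits their number, and on each piece \<open>U\<close> varies by at most
  \<open>e\<close>.\<close>

lemma pieces:
  fixes f :: "real \<Rightarrow> ennreal"
  assumes fm[measurable]: "f \<in> bmeas" and fin: "(\<integral>\<^sup>+s\<in>{0..}. f s \<partial>lborel) = ennreal T" "0 \<le> T"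
    and e: "0 < e"
  obtains \<nu> :: "real \<Rightarrow> nat" where "\<And>a b. 0 \<le> a \<Longrightarrow> a \<le> b \<Longrightarrow> \<nu> a \<le> \<nu> b" "\<And>t. 0 \<le> t \<Longrightarrow> real (\<nu> t) \<le> T / e"
    "\<And>n. {s. 0 \<le> s \<and> \<nu> s = n} \<in> sets borel" "\<And>n. (\<integral>\<^sup>+s\<in>{s. 0 \<le> s \<and> \<nu> s = n}. f s \<partial>lborel) \<le> ennreal e"
proof -
  have "(\<integral>\<^sup>+s\<in>{0..}. f s \<partial>lborel) < \<infinity>" using fin by simp
  from cont_primitive[OF fm this] obtain U :: "real \<Rightarrow> real" where U: "continuous_on {0..} U" "U 0 = 0" "\<And>a b. 0 \<le> a \<Longrightarrow> a \<le> b \<Longrightarrow> U a \<le> U b"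
    "\<And>a b. 0 \<le> a \<Longrightarrow> a \<le> b \<Longrightarrow> (\<integral>\<^sup>+s\<in>{a..b}. f s \<partial>lborel) = ennreal (U b - U a)"
    by blast
  define \<nu> where "\<nu> t = nat \<lfloor>U t / e\<rfloor>" for t
  define I where "I n = {s. 0 \<le> s \<and> \<nu> s = n}" for n
  have U0: "0 \<le> U t" if "0 \<le> t" for t using U(3)[of 0 t] U(2) that by simp
  have UT: "U t \<le> T" if "0 \<le> t" for t
  proof -
    have "ennreal (U t - U 0) = (\<integral>\<^sup>+s\<in>{0..t}. f s \<partial>lborel)" using U(4)[of 0 t] that by simp
    also have "\<dots> \<le> ennreal T" unfolding fin(1)[symmetric] by (intro nn_integral_mono) (auto simp: indicator_def)
    finally show ?thesis using U(2) fin(2) by simp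
  qed
  have In: "s \<in> I n \<longleftrightarrow> 0 \<le> s \<and> real n * e \<le> U s \<and> U s < (real n + 1) * e" for s n
  proof -
    have "\<nu> s = n \<longleftrightarrow> \<lfloor>U s / e\<rfloor> = int n" if "0 \<le> s" using U0[OF that] e by (auto simp: \<nu>_def nat_eq_iff)
    then show ?thesis using e by (auto simp: I_def floor_eq_iff field_simps)
  qed
  \<comment> \<open>The closed counterpart of \<open>I n\<close>. It contains the infimum and the
    supremum of bounded nonempty subsets of \<open>I n\<close>, which need not lie in
    \<open>I n\<close>.\<close>
  define Z where "Z n = {s. 0 \<le> s \<and> real n * e \<le> U s \<and> U s \<le> (real n + 1) * e}" for n
  have Zc: "closed (Z n)" for n
  proof -
    have "closed ({0..} \<inter> U -` {real n * e..(real n + 1) * e})"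
      by (intro continuous_closed_preimage U(1)) auto
    moreover have "{0..} \<inter> U -` {real n * e..(real n + 1) * e} = Z n" by (auto simp: Z_def)
    ultimately show ?thesis by simp
  qed
  have sub: "I n \<subseteq> Z n" for n by (auto simp: In Z_def)
  have Im: "I n \<in> sets borel" for n
  proof -
    have "I n = Z n - Z (Suc n)" using e by (auto simp: In Z_def algebra_simps)
    then show ?thesis using Zc by auto
  qed
  \<comment> \<open>The last piece is unbounded, so the estimate is made up to time \<open>k\<close>
    and completed by monotone convergence.\<close>
  have part: "(\<integral>\<^sup>+s. f s * indicator (I n \<inter> {..real k}) s \<partial>lborel) \<le> ennreal e" for n k
  proof (cases "I n \<inter> {..real k} = {}")
    case False
    let ?S = "I n \<inter> {..real k}"
    have bd: "bdd_above ?S" "bdd_below ?S" by (auto simp: In intro!: bdd_aboveI[of _ "real k"] bdd_belowI[of _ 0])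
    have "closure ?S \<subseteq> Z n" using sub by (intro closure_minimal Zc) auto
    then have "Inf ?S \<in> Z n" "Sup ?S \<in> Z n"
      using closure_contains_Inf[OF False bd(2)] closure_contains_Sup[OF False bd(1)] by auto
    then have z: "0 \<le> Inf ?S" "U (Sup ?S) - U (Inf ?S) \<le> e" by (auto simp: Z_def algebra_simps)
    obtain s where "s \<in> ?S" using False by auto
    then have le: "Inf ?S \<le> Sup ?S" using cInf_lower[OF _ bd(2)] cSup_upper[OF _ bd(1)] by (meson order_trans)
    have "(\<integral>\<^sup>+s. f s * indicator ?S s \<partial>lborel) \<le> (\<integral>\<^sup>+s\<in>{Inf ?S..Sup ?S}. f s \<partial>lborel)"
      using cInf_lower[OF _ bd(2)] cSup_upper[OF _ bd(1)]
      by (intro nn_integral_mono mult_left_mono) (auto simp: indicator_def)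
    also have "\<dots> \<le> ennreal e" unfolding U(4)[OF z(1) le] using z(2) by (rule ennreal_leI)
    finally show ?thesis .
  qed simp
  have full: "(\<integral>\<^sup>+s\<in>(I n). f s \<partial>lborel) \<le> ennreal e" for n
  proof -
    have [measurable]: "I n \<in> sets borel" by (rule Im)
    have "(\<integral>\<^sup>+s\<in>(I n). f s \<partial>lborel) = (\<integral>\<^sup>+s. (SUP k. f s * indicator (I n \<inter> {..real k}) s) \<partial>lborel)"
    proof (intro nn_integral_cong)
      fix s
      obtain k where "s \<le> real k" using real_arch_simple by blast
      then have "f s * indicator (I n) s \<le> f s * indicator (I n \<inter> {..real k}) s" by (auto simp: indicator_def)
      then have "f s * indicator (I n) s \<le> (SUP k. f s * indicator (I n \<inter> {..real k}) s)" by (rule SUP_upper2[OF UNIV_I])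
      moreover have "(SUP k. f s * indicator (I n \<inter> {..real k}) s) \<le> f s * indicator (I n) s"
        by (intro SUP_least) (auto simp: indicator_def)
      ultimately show "f s * indicator (I n) s = (SUP k. f s * indicator (I n \<inter> {..real k}) s)" by (rule antisym)
    qed
    also have "\<dots> = (SUP k. \<integral>\<^sup>+s. f s * indicator (I n \<inter> {..real k}) s \<partial>lborel)"
      by (rule nn_integral_monotone_convergence_SUP) (auto simp: incseq_def le_fun_def indicator_def)
    also have "\<dots> \<le> ennreal e" by (intro SUP_least part)
    finally show ?thesis .
  qed
  show ?thesis
  proof (rule that[of \<nu>])
    show "\<nu> a \<le> \<nu> b" if "0 \<le> a" "a \<le> b" for a b
      unfolding \<nu>_def using U(3)[OF that] e by (intro nat_mono floor_mono divide_right_mono) auto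
    show "real (\<nu> t) \<le> T / e" if "0 \<le> t" for t
    proof -
      have "real (\<nu> t) \<le> U t / e" unfolding \<nu>_def using U0[OF that] e by (simp add: of_nat_nat)
      also have "\<dots> \<le> T / e" using UT[OF that] e by (intro divide_right_mono) auto
      finally show ?thesis .
    qed
  qed (use Im full in \<open>auto simp: I_def\<close>)
qed

section \<open>Sources\<close>

text \<open>The constants of the spatial estimates become parameters, so that the thresholds for the
  data can be explicit expressions in them.\<close>

locale estimates = besov_setup +
  fixes Ch Cp Cu Ce Cf :: real
  assumes Cpos: "0 < Ch" "0 < Cp" "0 < Cu" "0 < Ce" "0 < Cf"
    and heat: "\<And>\<tau> j c. 0 \<le> \<tau> \<Longrightarrow> N j (heat_sg \<tau> c) \<le> Ch * kap j \<tau> * N j c"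
    and Pb: "\<And>j \<tau> a b. 0 \<le> \<tau> \<Longrightarrow> a 0 = 0 \<Longrightarrow> b 0 = 0 \<Longrightarrow> NS a < \<infinity> \<Longrightarrow> NS b < \<infinity> \<Longrightarrow>
     ennreal (N j (heat_sg \<tau> (Pdiv_tensor a b))) \<le> ennreal (Cp * 2^j * kap j \<tau>) * EN j a b"
    and Pu: "\<And>j \<tau> a f M b. 0 \<le> \<tau> \<Longrightarrow> (\<And>i. f i \<in> bmeas) \<Longrightarrow> (\<And>i. AE x in torus. norm (f i x) \<le> M) \<Longrightarrow> 0 \<le> M \<Longrightarrow>
     (\<And>i. (\<lambda>k. a k $ i) = fc (f i)) \<Longrightarrow> b 0 = 0 \<Longrightarrow> NS b < \<infinity> \<Longrightarrow>
     ennreal (N j (heat_sg \<tau> (Pdiv_tensor a b))) \<le> ennreal (Cu * 2^j * kap j \<tau> * M) * NS b \<and>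
     ennreal (N j (heat_sg \<tau> (Pdiv_tensor b a))) \<le> ennreal (Cu * 2^j * kap j \<tau> * M) * NS b"
    and el2N: "\<And>a i. a 0 = 0 \<Longrightarrow> el2 (\<lambda>k. a k $ i) \<le> (ennreal Ce * NS a)^2"
    and el2f: "\<And>f M. f \<in> bmeas \<Longrightarrow> (AE x in torus. norm (f x) \<le> M) \<Longrightarrow> 0 \<le> M \<Longrightarrow> el2 (fc f) \<le> (ennreal (Cf * M))^2"
begin

lemma fcoeff_bounds:
  fixes f :: "real^3 \<Rightarrow> real^3"
  assumes f: "f \<in> bmeas" and V: "Linf_norm f < \<infinity>"
  shows "el2 (\<lambda>k. fcoeff f k $ i) \<le> (ennreal Cf * Linf_norm f)^2"
    and "0 \<le> \<tau> \<Longrightarrow> b 0 = 0 \<Longrightarrow> NS b < \<infinity> \<Longrightarrow>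
      ennreal (N j (heat_sg \<tau> (Pdiv_tensor (fcoeff f) b))) \<le> ennreal (2^j * kap j \<tau>) * (ennreal Cu * (Linf_norm f * NS b))"
    and "0 \<le> \<tau> \<Longrightarrow> b 0 = 0 \<Longrightarrow> NS b < \<infinity> \<Longrightarrow>
      ennreal (N j (heat_sg \<tau> (Pdiv_tensor b (fcoeff f)))) \<le> ennreal (2^j * kap j \<tau>) * (ennreal Cu * (Linf_norm f * NS b))"
proof -
  obtain M where M: "0 \<le> M" "Linf_norm f = ennreal M" using V by (cases "Linf_norm f") auto
  define g where "g i x = complex_of_real (f x $ i)" for i x
  have fi: "(\<lambda>x. f x $ i) \<in> bmeas" for i
    by (rule measurable_compose[OF f]) (intro borel_measurable_continuous_onI continuous_intros)
  have g: "g i \<in> bmeas" for i unfolding g_def using fi[of i] by measurable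
  have gM: "AE x in torus. norm (g i x) \<le> M" for i
    using Linf_AE_torus[of f]
  proof eventually_elim
    case (elim x)
    then have "norm (f x) \<le> M" using M by simp
    moreover have "norm (g i x) \<le> norm (f x)" unfolding g_def using component_le_norm_cart[of "f x" i] by simp
    ultimately show ?case by simp
  qed
  have eq: "(\<lambda>k. fcoeff f k $ i) = fc (g i)" for i unfolding g_def by (rule ext) (rule fcoeff_fc[OF f])
  show "el2 (\<lambda>k. fcoeff f k $ i) \<le> (ennreal Cf * Linf_norm f)^2"
    unfolding eq M(2) using el2f[OF g gM M(1)] Cpos M(1) by (simp add: ennreal_mult')
  assume a: "0 \<le> \<tau>" "b 0 = 0" "NS b < \<infinity>"
  have e: "ennreal (Cu * 2^j * kap j \<tau> * M) * NS b = ennreal (2^j * kap j \<tau>) * (ennreal Cu * (Linf_norm f * NS b))"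
  proof -
    have "Cu * 2^j * kap j \<tau> * M = (2^j * kap j \<tau>) * (Cu * M)" by (simp add: mult_ac)
    moreover have "0 \<le> 2^j * kap j \<tau>" by (simp add: kap_def)
    ultimately have "ennreal (Cu * 2^j * kap j \<tau> * M) = ennreal (2^j * kap j \<tau>) * (ennreal Cu * ennreal M)"
      using Cpos M by (simp only: ennreal_mult' less_imp_le)
    then show ?thesis by (simp add: M(2) mult.assoc)
  qed
  show "ennreal (N j (heat_sg \<tau> (Pdiv_tensor (fcoeff f) b))) \<le> ennreal (2^j * kap j \<tau>) * (ennreal Cu * (Linf_norm f * NS b))"
    "ennreal (N j (heat_sg \<tau> (Pdiv_tensor b (fcoeff f)))) \<le> ennreal (2^j * kap j \<tau>) * (ennreal Cu * (Linf_norm f * NS b))"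
    unfolding e[symmetric] using Pu[OF a(1) g gM M(1) eq a(2,3)] by auto
qed

abbreviation Nt :: "(real \<Rightarrow> field) \<Rightarrow> nat \<Rightarrow> real \<Rightarrow> ennreal" where "Nt R \<equiv> \<lambda>j s. ennreal (N j (R s))"

text \<open>Enough information to make the quadratic and drift terms locally integrable in time; no
  sup bound in time is included. The mean has to vanish at negative times too, to which fields are
  extended.\<close>

definition Yc :: "(real \<Rightarrow> field) \<Rightarrow> bool" where
  "Yc R \<longleftrightarrow> (\<forall>k. (\<lambda>t. R t k) \<in> bmeas) \<and> (\<forall>t. R t 0 = 0)
     \<and> (\<integral>\<^sup>+s\<in>{0..}. (\<Sum>j. (hi j * Nt R j s)^2) \<partial>lborel) < \<infinity>"

lemma Yc_meas: "Yc R \<Longrightarrow> (\<lambda>t. R t k) \<in> bmeas" and Yc_0: "Yc R \<Longrightarrow> R t 0 = 0" by (auto simp: Yc_def)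

lemma Nt_meas: "(\<And>k. (\<lambda>t. R t k) \<in> bmeas) \<Longrightarrow> Nt R j \<in> bmeas"
  using measurable_N[of R borel j] by measurable

lemma NS_meas: "(\<And>k. (\<lambda>t::real. R t k) \<in> bmeas) \<Longrightarrow> (\<lambda>s. NS (R s)) \<in> bmeas"
proof -
  assume "\<And>k. (\<lambda>t::real. R t k) \<in> bmeas"
  then have [measurable]: "Nt R j \<in> bmeas" for j by (rule Nt_meas)
  show ?thesis unfolding NS_def by measurable
qed

definition Chi :: real where "Chi = 2 / (1 - 2 powr (- (2 * (sg + 1))))"

text \<open>Embedding of \<open>B^(3/p)_(p,2)\<close> into \<open>B^0_(p,1)\<close>: Cauchy-Schwarz
  against the weights \<open>2^(-(sg+1) j)\<close>, whose squares are summable because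
  \<open>sg + 1 > 0\<close>.\<close>

lemma NS_sq_le: "(NS c)^2 \<le> ennreal Chi * (\<Sum>j. (hi j * ennreal (N j c))^2)"
proof -
  have i: "ennreal (2 powr (- (sg + 1) * real j)) * (hi j * ennreal (N j c)) = ennreal (N j c)" for j
  proof -
    have "ennreal (2 powr (- (sg + 1) * real j)) * hi j = 1"
      by (subst ennreal_mult[symmetric]) (auto simp: powr_add[symmetric] algebra_simps)
    then show ?thesis by (simp add: mult.assoc[symmetric])
  qed
  have "(NS c)^2 = (\<Sum>j. ennreal (2 powr (- (sg + 1) * real j)) * (hi j * ennreal (N j c)))^2" unfolding NS_def i ..
  also have "\<dots> \<le> (\<Sum>j. (ennreal (2 powr (- (sg + 1) * real j)))^2) * (\<Sum>j. (hi j * ennreal (N j c))^2)" by (rule suminf_Cauchy_Schwarz)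
  also have "\<dots> \<le> ennreal Chi * (\<Sum>j. (hi j * ennreal (N j c))^2)"
  proof (rule mult_right_mono)
    have sq: "(ennreal (2 powr (- (sg + 1) * real j)))^2 = ennreal (gd (2 * (sg + 1)) j 0)" for j
      by (subst ennreal_power) (auto simp: gd_def power2_eq_square powr_add[symmetric] algebra_simps)
    show "(\<Sum>j. (ennreal (2 powr (- (sg + 1) * real j)))^2) \<le> ennreal Chi"
      unfolding sq Chi_def using sg by (intro gd_sum) simp
  qed simp
  finally show ?thesis .
qed

lemma Yc_NS2: assumes "Yc R" shows "(\<integral>\<^sup>+s\<in>{0..}. (NS (R s))^2 \<partial>lborel) < \<infinity>"
proof -
  have [measurable]: "Nt R j \<in> bmeas" for j by (intro Nt_meas Yc_meas assms)
  have "(\<integral>\<^sup>+s\<in>{0..}. (NS (R s))^2 \<partial>lborel) \<le> (\<integral>\<^sup>+s. ennreal Chi * ((\<Sum>j. (hi j * Nt R j s)^2) * indicator {0..} s) \<partial>lborel)"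
    unfolding mult.assoc[symmetric] by (intro nn_integral_mono mult_right_mono NS_sq_le) auto
  also have "\<dots> = ennreal Chi * (\<integral>\<^sup>+s\<in>{0..}. (\<Sum>j. (hi j * Nt R j s)^2) \<partial>lborel)" by (rule nn_integral_cmult) measurable
  also have "\<dots> < \<infinity>" using assms by (simp add: Yc_def ennreal_mult_less_top)
  finally show ?thesis .
qed

lemma Yc_NS_AE: assumes "Yc R" shows "AE s in lborel. 0 \<le> s \<longrightarrow> NS (R s) < \<infinity>"
proof -
  have [measurable]: "(\<lambda>s. NS (R s)) \<in> bmeas" by (intro NS_meas Yc_meas assms)
  have "AE s in lborel. (NS (R s))^2 * indicator {0..} s \<noteq> \<infinity>"
    using Yc_NS2[OF assms] by (intro nn_integral_PInf_AE) auto
  then show ?thesis by eventually_elim (auto simp: indicator_def power2_eq_square ennreal_mult_eq_top_iff less_top)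
qed

lemma Yc_diff: assumes R: "Yc R" and R': "Yc R'" shows "Yc (\<lambda>t k. R t k - R' t k)"
proof -
  have [measurable]: "Nt R j \<in> bmeas" "Nt R' j \<in> bmeas" for j
    by (intro Nt_meas Yc_meas R R')+
  have "(hi j * ennreal (N j (\<lambda>k. R s k - R' s k)))^2 \<le> 2 * (hi j * Nt R j s)^2 + 2 * (hi j * Nt R' j s)^2" for j s
  proof -
    let ?h = "2 powr (real j * (sg + 1))"
    have "(?h * N j (\<lambda>k. R s k - R' s k))^2 \<le> (?h * (N j (R s) + N j (R' s)))^2"
      by (intro power_mono mult_left_mono N_diff) auto
    also have "\<dots> \<le> 2 * (?h * N j (R s))^2 + 2 * (?h * N j (R' s))^2"
      using sum_squares_bound[of "?h * N j (R s)" "?h * N j (R' s)"] by (simp add: power2_eq_square algebra_simps)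
    finally have "ennreal ((?h * N j (\<lambda>k. R s k - R' s k))^2) \<le> ennreal (2 * (?h * N j (R s))^2 + 2 * (?h * N j (R' s))^2)" by (rule ennreal_leI)
    then show ?thesis
      by (simp add: ennreal_mult[symmetric] ennreal_power ennreal_plus[symmetric] ennreal_numeral[symmetric] del: ennreal_plus ennreal_numeral)
  qed
  then have "(\<Sum>j. (hi j * ennreal (N j (\<lambda>k. R s k - R' s k)))^2) \<le> 2 * (\<Sum>j. (hi j * Nt R j s)^2) + 2 * (\<Sum>j. (hi j * Nt R' j s)^2)" for s
    by (subst ennreal_suminf_cmult[symmetric], subst ennreal_suminf_cmult[symmetric], subst suminf_add) (auto intro: suminf_le)
  then have "(\<integral>\<^sup>+s\<in>{0..}. (\<Sum>j. (hi j * ennreal (N j (\<lambda>k. R s k - R' s k)))^2) \<partial>lborel)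
     \<le> (\<integral>\<^sup>+s. 2 * ((\<Sum>j. (hi j * Nt R j s)^2) * indicator {0..} s) + 2 * ((\<Sum>j. (hi j * Nt R' j s)^2) * indicator {0..} s) \<partial>lborel)"
    by (intro nn_integral_mono) (auto simp: indicator_def)
  also have "\<dots> = 2 * (\<integral>\<^sup>+s\<in>{0..}. (\<Sum>j. (hi j * Nt R j s)^2) \<partial>lborel) + 2 * (\<integral>\<^sup>+s\<in>{0..}. (\<Sum>j. (hi j * Nt R' j s)^2) \<partial>lborel)"
    by (subst nn_integral_add, measurable, subst nn_integral_cmult, measurable, subst nn_integral_cmult, measurable)
  also have "\<dots> < \<infinity>" using R R' by (simp add: Yc_def ennreal_mult_less_top)
  finally show ?thesis using R R' by (simp add: Yc_def borel_measurable_diff)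
qed

text \<open>A common interface for quadratic, drift and external sources. All \<open>\<tau>\<close>
  are included because a Duhamel integral evaluates the bound at \<open>\<tau> = t - s\<close>; the
  exceptional times are those at which a product may fail to converge.\<close>

definition dom :: "(real \<Rightarrow> field) \<Rightarrow> (nat \<Rightarrow> real \<Rightarrow> ennreal) \<Rightarrow> bool" where
  "dom G H \<longleftrightarrow> (AE s in lborel. 0 \<le> s \<longrightarrow> (\<forall>j \<tau>. 0 \<le> \<tau> \<longrightarrow> ennreal (N j (heat_sg \<tau> (G s))) \<le> ennreal (2^j * kap j \<tau>) * H j s))"

lemma dom_add: "dom G H \<Longrightarrow> dom G' H' \<Longrightarrow> dom (\<lambda>s k. G s k + G' s k) (\<lambda>j s. H j s + H' j s)"
  unfolding dom_def
proof (elim eventually_rev_mp, intro AE_I2 impI allI)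
  fix s j and \<tau> :: real
  assume 1: "0 \<le> s \<longrightarrow> (\<forall>j \<tau>. 0 \<le> \<tau> \<longrightarrow> ennreal (N j (heat_sg \<tau> (G s))) \<le> ennreal (2^j * kap j \<tau>) * H j s)"
    and 2: "0 \<le> s \<longrightarrow> (\<forall>j \<tau>. 0 \<le> \<tau> \<longrightarrow> ennreal (N j (heat_sg \<tau> (G' s))) \<le> ennreal (2^j * kap j \<tau>) * H' j s)"
    and 3: "0 \<le> s" "0 \<le> \<tau>"
  have "ennreal (N j (heat_sg \<tau> (\<lambda>k. (G s k + G' s k)))) \<le> ennreal (N j (heat_sg \<tau> (G s)) + N j (heat_sg \<tau> (G' s)))"
    unfolding scaleR_add_right by (intro ennreal_leI N_add)
  also have "\<dots> = ennreal (N j (heat_sg \<tau> (G s))) + ennreal (N j (heat_sg \<tau> (G' s)))"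
    by (rule ennreal_plus) auto
  also have "\<dots> \<le> ennreal (2^j * kap j \<tau>) * H j s + ennreal (2^j * kap j \<tau>) * H' j s"
    using 1 2 3 by (intro add_mono) auto
  finally show "ennreal (N j (heat_sg \<tau> (\<lambda>k. (G s k + G' s k)))) \<le> ennreal (2^j * kap j \<tau>) * (H j s + H' j s)"
    by (simp add: distrib_left)
qed

lemma N_Du_dom:
  assumes d: "dom G H" and li: "\<And>k. loc_int (\<lambda>s. G s k)" and m: "\<And>k. (\<lambda>s. G s k) \<in> bmeas"
    and Hm[measurable]: "\<And>j. H j \<in> bmeas" and t: "0 \<le> t"
  shows "ennreal (N j (Du G t)) \<le> ennreal (2^j) * Kc j (\<lambda>s. H j s * indicator {0..t} s) t"
proof -
  have "ennreal (N j (Du G t)) \<le> (\<integral>\<^sup>+s\<in>{0..t}. ennreal (N j (\<lambda>k. exp (- (t - s) * ksq k) *\<^sub>R G s k)) \<partial>lborel)"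
    by (rule N_Du[OF li m t])
  also have "\<dots> \<le> (\<integral>\<^sup>+s. ennreal (2^j) * (Kf j (t - s) * (H j s * indicator {0..t} s)) \<partial>lborel)"
  proof (rule nn_integral_mono_AE)
    show "AE s in lborel. ennreal (N j (\<lambda>k. exp (- (t - s) * ksq k) *\<^sub>R G s k)) * indicator {0..t} s \<le> ennreal (2^j) * (Kf j (t - s) * (H j s * indicator {0..t} s))"
      using d unfolding dom_def
    proof (rule eventually_mono)
      fix s assume 1: "0 \<le> s \<longrightarrow> (\<forall>j \<tau>. 0 \<le> \<tau> \<longrightarrow> ennreal (N j (heat_sg \<tau> (G s))) \<le> ennreal (2^j * kap j \<tau>) * H j s)"
      show "ennreal (N j (\<lambda>k. exp (- (t - s) * ksq k) *\<^sub>R G s k)) * indicator {0..t} s \<le> ennreal (2^j) * (Kf j (t - s) * (H j s * indicator {0..t} s))"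
      proof (cases "s \<in> {0..t}")
        case True
        then have "ennreal (N j (\<lambda>k. exp (- (t - s) * ksq k) *\<^sub>R G s k)) \<le> ennreal (2^j * kap j (t - s)) * H j s"
          using 1 by (simp only: atLeastAtMost_iff diff_ge_0_iff_ge)
        also have "ennreal (2^j * kap j (t - s)) = ennreal (2^j) * Kf j (t - s)"
          using True by (simp add: Kf_def ennreal_mult')
        finally show ?thesis using True by (simp add: mult.assoc)
      qed simp
    qed
  qed
  also have "\<dots> = ennreal (2^j) * Kc j (\<lambda>s. H j s * indicator {0..t} s) t"
    by (rule nn_integral_cmult) measurable
  finally show ?thesis .
qed

definition NLt :: "(real \<Rightarrow> field) \<Rightarrow> (real \<Rightarrow> field) \<Rightarrow> real \<Rightarrow> field" where
  "NLt a b s k = Pdiv_tensor (a s) (b s) k"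

definition Hb :: "(real \<Rightarrow> field) \<Rightarrow> (real \<Rightarrow> field) \<Rightarrow> nat \<Rightarrow> real \<Rightarrow> ennreal" where
  "Hb a b j s = ennreal Cp * (\<Sum>i. \<Sum>i'. ennreal (w j i i') * Nt a i s * Nt b i' s)"

lemma Hb_meas: "Yc a \<Longrightarrow> Yc b \<Longrightarrow> Hb a b j \<in> bmeas"
proof -
  assume "Yc a" "Yc b"
  then have [measurable]: "\<And>j. Nt a j \<in> bmeas" "\<And>j. Nt b j \<in> bmeas"
    by - (intro Nt_meas Yc_meas; assumption)+
  show ?thesis unfolding Hb_def by measurable
qed

lemma NLt_meas: "Yc a \<Longrightarrow> Yc b \<Longrightarrow> (\<lambda>s. NLt a b s k) \<in> bmeas"
  unfolding NLt_def by (intro measurable_Pdiv Yc_meas)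

lemma dom_NLt: assumes a: "Yc a" and b: "Yc b" shows "dom (NLt a b) (Hb a b)"
  unfolding dom_def
  using Yc_NS_AE[OF a] Yc_NS_AE[OF b]
proof eventually_elim
  case (elim s)
  show ?case
  proof (intro impI allI)
    fix j and \<tau> :: real assume s: "0 \<le> s" "0 \<le> \<tau>"
    have "ennreal (N j (heat_sg \<tau> (NLt a b s))) \<le> ennreal (Cp * 2^j * kap j \<tau>) * EN j (a s) (b s)"
      unfolding NLt_def using elim s by (intro Pb Yc_0 a b) auto
    also have "EN j (a s) (b s) = (\<Sum>i. \<Sum>i'. ennreal (w j i i') * Nt a i s * Nt b i' s)"
      unfolding EN_def by (simp add: ennreal_mult w_def)
    also have "ennreal (Cp * 2^j * kap j \<tau>) * \<dots> = ennreal (2^j * kap j \<tau>) * Hb a b j s"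
    proof -
      have "Cp * 2^j * kap j \<tau> = (2^j * kap j \<tau>) * Cp" "0 \<le> 2^j * kap j \<tau>" by (simp_all add: kap_def)
      then have "ennreal (Cp * 2^j * kap j \<tau>) = ennreal (2^j * kap j \<tau>) * ennreal Cp" using Cpos by (simp only: ennreal_mult' less_imp_le)
      then show ?thesis by (simp add: Hb_def mult.assoc)
    qed
    finally show "ennreal (N j (heat_sg \<tau> (NLt a b s))) \<le> ennreal (2^j * kap j \<tau>) * Hb a b j s" .
  qed
qed

lemma loc_intI:
  assumes m: "g \<in> bmeas" and fin: "(\<integral>\<^sup>+s\<in>{0..}. ennreal (norm (g s)) \<partial>lborel) < \<infinity>"
  shows "loc_int g"
  unfolding loc_int_def
proof (intro allI impI)
  fix t :: real
  have "(\<integral>\<^sup>+s. ennreal (norm (indicator {0..t} s *\<^sub>R g s)) \<partial>lborel) \<le> (\<integral>\<^sup>+s\<in>{0..}. ennreal (norm (g s)) \<partial>lborel)"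
    by (intro nn_integral_mono) (auto simp: indicator_def)
  then have "(\<integral>\<^sup>+s. ennreal (norm (indicator {0..t} s *\<^sub>R g s)) \<partial>lborel) < \<infinity>" using fin by (rule le_less_trans)
  then show "integrable lborel (\<lambda>s. indicator {0..t} s *\<^sub>R g s)"
    using m by (intro integrableI_bounded) auto
qed

lemma loc_int_add: "loc_int f \<Longrightarrow> loc_int g \<Longrightarrow> loc_int (\<lambda>s. f s + g s)"
  unfolding loc_int_def scaleR_add_right by auto

lemma L2_prod_finite:
  fixes f g :: "real \<Rightarrow> ennreal"
  assumes [measurable]: "f \<in> bmeas" "g \<in> bmeas"
    and fin: "(\<integral>\<^sup>+s\<in>{0..}. (f s)^2 \<partial>lborel) < \<infinity>" "(\<integral>\<^sup>+s\<in>{0..}. (g s)^2 \<partial>lborel) < \<infinity>"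
  shows "(\<integral>\<^sup>+s\<in>{0..}. (f s * g s) \<partial>lborel) < \<infinity>"
proof -
  have "(\<integral>\<^sup>+s. (f s * indicator {0..} s) * (g s * indicator {0..} s) \<partial>lborel)^2
     \<le> (\<integral>\<^sup>+s. (f s * indicator {0..} s)^2 \<partial>lborel) * (\<integral>\<^sup>+s. (g s * indicator {0..} s)^2 \<partial>lborel)"
    by (rule Cauchy_Schwarz_nn_integral) measurable
  also have "\<dots> < \<infinity>" unfolding indicator_square using fin by (simp add: ennreal_mult_less_top)
  finally have "(\<integral>\<^sup>+s. (f s * indicator {0..} s) * (g s * indicator {0..} s) \<partial>lborel) < \<infinity>"
    by (simp add: power_less_top_ennreal)
  moreover have "(f s * indicator {0..} s) * (g s * indicator {0..} s) = (f s * g s) * indicator {0..} s" for s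
    by (simp add: indicator_def)
  ultimately show ?thesis by simp
qed

lemma loc_int_NLt: assumes a: "Yc a" and b: "Yc b" shows "loc_int (\<lambda>s. NLt a b s k)"
proof (rule loc_intI)
  show "(\<lambda>s. NLt a b s k) \<in> bmeas" by (rule NLt_meas[OF a b])
  have [measurable]: "(\<lambda>s. NS (a s)) \<in> bmeas" "(\<lambda>s. NS (b s)) \<in> bmeas"
    by (intro NS_meas Yc_meas a b)+
  define C where "C = ennreal (\<Sum>l\<in>UNIV. \<Sum>i\<in>UNIV. \<Sum>m\<in>UNIV. \<bar>mu l i m (rvec k)\<bar>) * (ennreal Ce * ennreal Ce)"
  have "ennreal (norm (NLt a b s k)) \<le> C * (NS (a s) * NS (b s))" for s
  proof -
    have "ennreal (norm (NLt a b s k)) \<le> ennreal (\<Sum>l\<in>UNIV. \<Sum>i\<in>UNIV. \<Sum>m\<in>UNIV. \<bar>mu l i m (rvec k)\<bar>) * ((ennreal Ce * NS (a s)) * (ennreal Ce * NS (b s)))"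
      unfolding NLt_def using a b by (intro Pdiv_bound el2N Yc_0)
    then show ?thesis by (simp add: C_def mult_ac)
  qed
  then have "(\<integral>\<^sup>+s\<in>{0..}. ennreal (norm (NLt a b s k)) \<partial>lborel) \<le> (\<integral>\<^sup>+s. C * ((NS (a s) * NS (b s)) * indicator {0..} s) \<partial>lborel)"
    unfolding mult.assoc[symmetric] by (intro nn_integral_mono mult_right_mono) (auto simp: mult.assoc)
  also have "\<dots> = C * (\<integral>\<^sup>+s\<in>{0..}. (NS (a s) * NS (b s)) \<partial>lborel)" by (rule nn_integral_cmult) measurable
  also have "\<dots> < \<infinity>" using L2_prod_finite[OF _ _ Yc_NS2[OF a] Yc_NS2[OF b]] by (simp add: C_def ennreal_mult_less_top)
  finally show "(\<integral>\<^sup>+s\<in>{0..}. ennreal (norm (NLt a b s k)) \<partial>lborel) < \<infinity>" .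
qed

lemma Yc_el2: "Yc c \<Longrightarrow> NS (c s) < \<infinity> \<Longrightarrow> el2 (\<lambda>n. c s n $ i) < \<infinity>"
  by (rule le_less_trans[OF el2N[of "c s" i, OF Yc_0[of c s]]]) (auto simp: ennreal_mult_less_top power_less_top_ennreal)

lemma NLt_diff:
  assumes "Yc a" "Yc a'" "Yc b"
  shows "AE s in lborel. 0 \<le> s \<longrightarrow> (\<forall>k. NLt (\<lambda>t k. a t k - a' t k) b s k = NLt a b s k - NLt a' b s k)"
    "AE s in lborel. 0 \<le> s \<longrightarrow> (\<forall>k. NLt b (\<lambda>t k. a t k - a' t k) s k = NLt b a s k - NLt b a' s k)"
proof -
  show "AE s in lborel. 0 \<le> s \<longrightarrow> (\<forall>k. NLt (\<lambda>t k. a t k - a' t k) b s k = NLt a b s k - NLt a' b s k)"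
    using Yc_NS_AE[OF assms(1)] Yc_NS_AE[OF assms(2)] Yc_NS_AE[OF assms(3)]
    by eventually_elim (auto simp: NLt_def intro!: Pdiv_diff_left Yc_el2 assms)
  show "AE s in lborel. 0 \<le> s \<longrightarrow> (\<forall>k. NLt b (\<lambda>t k. a t k - a' t k) s k = NLt b a s k - NLt b a' s k)"
    using Yc_NS_AE[OF assms(1)] Yc_NS_AE[OF assms(2)] Yc_NS_AE[OF assms(3)]
    by eventually_elim (auto simp: NLt_def intro!: Pdiv_diff_left Yc_el2 assms)
qed

end

section \<open>The drift and the source terms it produces\<close>

locale drift = estimates +
  fixes u0 :: "real \<Rightarrow> real^3 \<Rightarrow> real^3"
  assumes u0m: "(\<lambda>(t, x). u0 t x) \<in> borel_measurable (borel \<Otimes>\<^sub>M borel)"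
    and u0fin: "(\<integral>\<^sup>+ t. (Linf_norm (u0 t))^2 * indicator {0..} t \<partial>lborel) < \<infinity>"
begin

abbreviation V :: "real \<Rightarrow> ennreal" where "V t \<equiv> Linf_norm (u0 t)"

lemma V_meas[measurable]: "V \<in> bmeas" using measurable_Linf[OF u0m] .

lemma u0_slice: "u0 t \<in> bmeas"
  using measurable_Pair2[OF u0m, of t] by simp

lemma V_AE: "AE s in lborel. 0 \<le> s \<longrightarrow> V s < \<infinity>"
proof -
  have "AE s in lborel. (V s)^2 * indicator {0..} s \<noteq> \<infinity>"
    using u0fin by (intro nn_integral_PInf_AE) auto
  then show ?thesis by eventually_elim (auto simp: indicator_def power2_eq_square ennreal_mult_eq_top_iff less_top)
qed

definition Qt :: "(real \<Rightarrow> field) \<Rightarrow> real \<Rightarrow> field" where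
  "Qt b s k = Pdiv_tensor (fcoeff (u0 s)) (b s) k + Pdiv_tensor (b s) (fcoeff (u0 s)) k"

definition Hu :: "(real \<Rightarrow> field) \<Rightarrow> nat \<Rightarrow> real \<Rightarrow> ennreal" where
  "Hu b j s = ennreal (2 * Cu) * (V s * (\<Sum>i. Nt b i s))"

lemma Hu_meas: "Yc b \<Longrightarrow> Hu b j \<in> bmeas"
proof -
  assume "Yc b"
  then have [measurable]: "Nt b j \<in> bmeas" for j
    by (intro Nt_meas Yc_meas; assumption)+
  show ?thesis unfolding Hu_def by measurable
qed

lemma Qt_meas: "Yc b \<Longrightarrow> (\<lambda>s. Qt b s k) \<in> bmeas"
  unfolding Qt_def by (intro borel_measurable_add measurable_Pdiv Yc_meas measurable_fcoeff[OF u0m])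

lemma dom_Qt: assumes b: "Yc b" shows "dom (Qt b) (Hu b)"
proof -
  have 1: "dom (\<lambda>s k. Pdiv_tensor (fcoeff (u0 s)) (b s) k) (\<lambda>j s. ennreal Cu * (V s * NS (b s)))"
    "dom (\<lambda>s k. Pdiv_tensor (b s) (fcoeff (u0 s)) k) (\<lambda>j s. ennreal Cu * (V s * NS (b s)))"
    unfolding dom_def using V_AE Yc_NS_AE[OF b]
    by (eventually_elim, use fcoeff_bounds[OF u0_slice] Yc_0[OF b] in blast)+
  have "(\<lambda>j s. ennreal Cu * (V s * NS (b s)) + ennreal Cu * (V s * NS (b s))) = Hu b"
    using Cpos by (intro ext) (simp add: Hu_def NS_def ennreal_mult' mult_2[symmetric] mult.assoc)
  then show ?thesis using dom_add[OF 1] by (simp add: Qt_def[abs_def])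
qed

lemma loc_int_Qt: assumes b: "Yc b" shows "loc_int (\<lambda>s. Qt b s k)"
proof (rule loc_intI)
  show "(\<lambda>s. Qt b s k) \<in> bmeas" by (rule Qt_meas[OF b])
  have [measurable]: "(\<lambda>s. NS (b s)) \<in> bmeas" by (intro NS_meas Yc_meas b)
  define S where "S = ennreal (\<Sum>l\<in>UNIV. \<Sum>i\<in>UNIV. \<Sum>m\<in>UNIV. \<bar>mu l i m (rvec k)\<bar>)"
  define C where "C = 2 * (S * (ennreal Cf * ennreal Ce))"
  have "AE s in lborel. ennreal (norm (Qt b s k)) * indicator {0..} s \<le> C * ((V s * NS (b s)) * indicator {0..} s)"
    using V_AE
  proof eventually_elim
    case (elim s)
    show ?case
    proof (cases "0 \<le> s")
      case True
      have u: "el2 (\<lambda>k. fcoeff (u0 s) k $ i) \<le> (ennreal Cf * V s)^2" for i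
        using elim True by (intro fcoeff_bounds(1) u0_slice) auto
      have bb: "el2 (\<lambda>k. b s k $ i) \<le> (ennreal Ce * NS (b s))^2" for i by (intro el2N Yc_0 b)
      have "ennreal (norm (Qt b s k)) \<le> ennreal (norm (Pdiv_tensor (fcoeff (u0 s)) (b s) k)) + ennreal (norm (Pdiv_tensor (b s) (fcoeff (u0 s)) k))"
        unfolding Qt_def by (rule order_trans[OF ennreal_leI[OF norm_triangle_ineq]]) simp
      also have "\<dots> \<le> S * ((ennreal Cf * V s) * (ennreal Ce * NS (b s))) + S * ((ennreal Ce * NS (b s)) * (ennreal Cf * V s))"
        unfolding S_def by (intro add_mono Pdiv_bound u bb)
      also have "\<dots> = C * (V s * NS (b s))" unfolding C_def by (simp add: mult_2 algebra_simps)
      finally show ?thesis using True by simp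
    qed simp
  qed
  then have "(\<integral>\<^sup>+s\<in>{0..}. ennreal (norm (Qt b s k)) \<partial>lborel) \<le> (\<integral>\<^sup>+s. C * ((V s * NS (b s)) * indicator {0..} s) \<partial>lborel)"
    by (rule nn_integral_mono_AE)
  also have "\<dots> = C * (\<integral>\<^sup>+s\<in>{0..}. (V s * NS (b s)) \<partial>lborel)" by (rule nn_integral_cmult) measurable
  also have "\<dots> < \<infinity>" using L2_prod_finite[OF _ _ u0fin Yc_NS2[OF b]] by (simp add: C_def S_def ennreal_mult_less_top)
  finally show "(\<integral>\<^sup>+s\<in>{0..}. ennreal (norm (Qt b s k)) \<partial>lborel) < \<infinity>" .
qed

lemma Qt_diff:
  assumes a: "Yc a" and b: "Yc b"
  shows "AE s in lborel. 0 \<le> s \<longrightarrow> (\<forall>k. Qt (\<lambda>t k. a t k - b t k) s k = Qt a s k - Qt b s k)"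
proof -
  have finu: "el2 (\<lambda>n. fcoeff (u0 s) n $ i) < \<infinity>" if "V s < \<infinity>" for s i
    by (rule le_less_trans[OF fcoeff_bounds(1)[OF u0_slice that]]) (use that in \<open>simp add: ennreal_mult_less_top power_less_top_ennreal\<close>)
  show ?thesis using V_AE Yc_NS_AE[OF a] Yc_NS_AE[OF b]
  proof eventually_elim
    case (elim s)
    show ?case
    proof (intro impI allI)
      fix k assume "0 \<le> s"
      with elim have f: "el2 (\<lambda>n. a s n $ i) < \<infinity>" "el2 (\<lambda>n. b s n $ i) < \<infinity>" "el2 (\<lambda>n. fcoeff (u0 s) n $ i) < \<infinity>" for i
        using Yc_el2 a b finu by auto
      show "Qt (\<lambda>t k. a t k - b t k) s k = Qt a s k - Qt b s k"
        unfolding Qt_def Pdiv_diff_left(1)[OF f] Pdiv_diff_left(2)[OF f] by simp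
    qed
  qed
qed

end

section \<open>Picard iteration\<close>

lemma Du_neg: "t < 0 \<Longrightarrow> Du G t k = 0"
  by (simp add: Du_def)

lemma Du_add:
  assumes "loc_int (\<lambda>s. G s k)" "loc_int (\<lambda>s. G' s k)"
  shows "Du (\<lambda>s k. G s k + G' s k) t k = Du G t k + Du G' t k"
proof (cases "0 \<le> t")
  case True
  then show ?thesis
    unfolding Du_def scaleR_add_right
    by (intro Bochner_Integration.integral_add Du_integrable[of G k t] Du_integrable[of G' k t] assms)
qed (simp add: Du_neg)

lemma Du_diff:
  assumes "loc_int (\<lambda>s. G s k)" "loc_int (\<lambda>s. G' s k)"
  shows "Du (\<lambda>s k. G s k - G' s k) t k = Du G t k - Du G' t k"
proof (cases "0 \<le> t")
  case True
  then show ?thesis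
    unfolding Du_def scaleR_diff_right
    by (intro Bochner_Integration.integral_diff Du_integrable[of G k t] Du_integrable[of G' k t] assms)
qed (simp add: Du_neg)

lemma Du_cong_AE:
  assumes [measurable]: "(\<lambda>s. G s k) \<in> bmeas" "(\<lambda>s. G' s k) \<in> bmeas"
    and "AE s in lborel. 0 \<le> s \<longrightarrow> (\<forall>k. G s k = G' s k)"
  shows "Du G t k = Du G' t k"
  unfolding Du_def
proof (rule integral_cong_AE)
  show "AE s in lborel. indicator {0..t} s *\<^sub>R (exp (- (t - s) * ksq k) *\<^sub>R G s k) = indicator {0..t} s *\<^sub>R (exp (- (t - s) * ksq k) *\<^sub>R G' s k)"
    using assms(3) by eventually_elim (auto simp: indicator_def)
qed measurable

lemma Du_meas:
  assumes "loc_int (\<lambda>s. G s k)"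
  shows "(\<lambda>t. Du G t k) \<in> bmeas"
proof -
  have "(\<lambda>t. indicator {0..} t *\<^sub>R Du G t k) \<in> bmeas"
    by (rule borel_measurable_continuous_on_indicator[OF _ Du_continuous[of G k, OF assms]]) simp
  moreover have "indicator {0..} t *\<^sub>R Du G t k = Du G t k" for t by (auto simp: indicator_def Du_neg)
  ultimately show ?thesis by simp
qed

context estimates
begin

lemma outb_Hb:
  assumes Y: "Yc a" "Yc b" and [measurable]: "J \<in> sets borel"
    and a: "MJ J (Nt a) (\<lambda>i. \<alpha> * D i)" and b: "MJ J (Nt b) (\<lambda>i. \<beta> * D i)" and D: "envelope dl C X D"
  shows "outb UNIV j (\<lambda>t. ennreal (2^j) * Kc j (\<lambda>s. Hb a b j s * indicator J s) t)
    (ennreal Cp * (ennreal (2 * CD * C) * X * \<alpha> * \<beta> * D j))"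
proof -
  have [measurable]: "\<And>j. Nt a j \<in> bmeas" "\<And>j. Nt b j \<in> bmeas"
    using Y by - (intro Nt_meas Yc_meas; assumption)+
  let ?F = "\<lambda>t. ennreal (2^j) * Kc j (\<lambda>s. (\<Sum>i. \<Sum>i'. ennreal (w j i i') * Nt a i s * Nt b i' s) * indicator J s) t"
  have "outb UNIV j ?F (ennreal (2 * CD * C) * X * \<alpha> * \<beta> * D j)"
    by (rule outb_bilin[OF _ _ _ a b D]) measurable
  then have "outb UNIV j (\<lambda>t. ennreal Cp * ?F t) (ennreal Cp * (ennreal (2 * CD * C) * X * \<alpha> * \<beta> * D j))"
    by (intro outb_cmult) measurable
  moreover have "ennreal Cp * ?F t = ennreal (2^j) * Kc j (\<lambda>s. Hb a b j s * indicator J s) t" for t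
    unfolding Hb_def mult.assoc[of "ennreal Cp"] by (subst Kc_cmult, measurable) (simp only: mult_ac)
  ultimately show ?thesis by simp
qed

end

context drift
begin

lemma outb_Hu:
  assumes Y: "Yc b" and [measurable]: "J \<in> sets borel" and b: "MJ J (Nt b) (\<lambda>i. \<beta> * D i)"
    and G: "(\<integral>\<^sup>+s\<in>J. (V s)^2 \<partial>lborel) \<le> G^2" and D: "envelope dl C X D"
  shows "outb UNIV j (\<lambda>t. ennreal (2^j) * Kc j (\<lambda>s. Hu b j s * indicator J s) t)
    (ennreal (2 * Cu) * (G * \<beta> * (ennreal C * D j)))"
proof -
  have [measurable]: "\<And>j. Nt b j \<in> bmeas"
    using Y by - (intro Nt_meas Yc_meas; assumption)+
  let ?F = "\<lambda>t. ennreal (2^j) * Kc j (\<lambda>s. V s * (\<Sum>i. Nt b i s) * indicator J s) t"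
  have "(\<integral>\<^sup>+s. (V s * indicator J s)^2 \<partial>lborel) \<le> G^2" unfolding indicator_square by (rule G)
  then have "outb UNIV j ?F (G * \<beta> * (ennreal C * D j))"
    by (intro outb_lin[OF _ _ _ b _ D]) measurable
  then have "outb UNIV j (\<lambda>t. ennreal (2 * Cu) * ?F t) (ennreal (2 * Cu) * (G * \<beta> * (ennreal C * D j)))"
    by (intro outb_cmult) measurable
  moreover have "ennreal (2 * Cu) * ?F t = ennreal (2^j) * Kc j (\<lambda>s. Hu b j s * indicator J s) t" for t
    unfolding Hu_def mult.assoc[of "ennreal (2 * Cu)"] by (subst Kc_cmult, measurable) (simp only: mult_ac)
  ultimately show ?thesis by simp
qed

end

text \<open>\<open>G\<close> bounds the \<open>L^2\<close> norm of the drift on each piece,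
  \<open>X\<close> the envelope. In \<open>small1\<close> the 4 is 2 for the two orders of the
  factors in the drift term times 2 for the sum over earlier pieces; in \<open>small2\<close> it is
  2 for the symmetrised sum times the same 2. The power \<open>2^Nm\<close> is the greatest height
  of the majorant.\<close>

locale picard = drift +
  fixes \<nu> :: "real \<Rightarrow> nat" and Nm :: nat and G X :: ennreal and Cv :: real and D :: "nat \<Rightarrow> ennreal" and L :: "real \<Rightarrow> field"
  assumes nu_mono: "\<And>a b. 0 \<le> a \<Longrightarrow> a \<le> b \<Longrightarrow> \<nu> a \<le> \<nu> b" and nu_le: "\<And>t. 0 \<le> t \<Longrightarrow> \<nu> t \<le> Nm"
    and nu_sets: "\<And>n. {s. 0 \<le> s \<and> \<nu> s = n} \<in> sets borel"
    and nu_V: "\<And>n. (\<integral>\<^sup>+s\<in>{s. 0 \<le> s \<and> \<nu> s = n}. (V s)^2 \<partial>lborel) \<le> G^2"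
    and Denv: "envelope dl Cv X D" and Cv0: "0 < Cv" and Xfin: "X < \<infinity>" and D2: "(\<Sum>j. (D j)^2) < \<infinity>"
    and small1: "ennreal (4 * Cu * Cv) * G \<le> ennreal (1/4)" and small2: "ennreal (4 * Cp * CD * Cv * 2^Nm) * X \<le> ennreal (1/16)"
begin

definition I :: "nat \<Rightarrow> real set" where "I n = {s. 0 \<le> s \<and> \<nu> s = n}"

lemma I_sets[measurable]: "I n \<in> sets borel" using nu_sets by (simp add: I_def)

text \<open>The factor \<open>2^n\<close> on the \<open>n\<close>-th piece of the time axis plays the role of Gronwall's lemma: the
  contributions of all earlier pieces sum up to at most twice the majorant of the current one.\<close>
definition MG :: "(real \<Rightarrow> field) \<Rightarrow> ennreal \<Rightarrow> bool" where
  "MG R \<alpha> \<longleftrightarrow> (\<forall>n\<le>Nm. MJ (I n) (Nt R) (\<lambda>i. (ennreal (2^n) * \<alpha>) * D i))"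

lemma MG_outb: "MG R \<alpha> \<Longrightarrow> n \<le> Nm \<Longrightarrow> outb (I n) j (Nt R j) ((ennreal (2^n) * \<alpha>) * D j)"
  by (simp add: MG_def MJ_def)

lemma MG_mono: "MG R \<alpha> \<Longrightarrow> \<alpha> \<le> \<beta> \<Longrightarrow> MG R \<beta>"
  unfolding MG_def MJ_def by (blast intro: outb_le mult_right_mono mult_left_mono zero_le)

lemma MG_sum:
  assumes a: "MG a \<alpha>" and b: "MG b \<beta>" and m: "\<And>k. (\<lambda>t. a t k) \<in> bmeas" "\<And>k. (\<lambda>t. b t k) \<in> bmeas"
    and le: "\<And>t j. 0 \<le> t \<Longrightarrow> N j (c t) \<le> N j (a t) + N j (b t)"
  shows "MG c (\<alpha> + \<beta>)"
  unfolding MG_def MJ_def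
proof (intro allI impI)
  fix n j assume n: "n \<le> Nm"
  have "outb (I n) j (\<lambda>t. Nt a j t + Nt b j t) ((ennreal (2^n) * \<alpha>) * D j + (ennreal (2^n) * \<beta>) * D j)"
    by (intro outb_add Nt_meas m MG_outb a b n I_sets)
  then show "outb (I n) j (Nt c j) ((ennreal (2^n) * (\<alpha> + \<beta>)) * D j)"
  proof (rule outb_mono)
    fix t assume "t \<in> I n"
    then have "N j (c t) \<le> N j (a t) + N j (b t)" by (intro le) (simp add: I_def)
    then show "Nt c j t \<le> Nt a j t + Nt b j t" by (simp add: ennreal_plus[symmetric] ennreal_leI del: ennreal_plus)
  qed (auto simp: algebra_simps)
qed

lemma MG_minus: "MG (\<lambda>t k. - a t k) \<alpha> \<longleftrightarrow> MG a \<alpha>"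
proof -
  have "Nt (\<lambda>t k. - a t k) = Nt a" using N_scale[of _ "-1"] by (intro ext) simp
  then show ?thesis by (simp add: MG_def)
qed

lemma MG_cong: "MG a \<alpha> \<Longrightarrow> (\<And>t k. 0 \<le> t \<Longrightarrow> a t k = b t k) \<Longrightarrow> MG b \<alpha>"
  unfolding MG_def MJ_def
proof (intro allI impI)
  fix n j assume *: "\<forall>n\<le>Nm. \<forall>j. outb (I n) j (Nt a j) (ennreal (2 ^ n) * \<alpha> * D j)" "\<And>t k. 0 \<le> t \<Longrightarrow> a t k = b t k" "n \<le> Nm"
  have "N j (b t) = N j (a t)" if "t \<in> I n" for t
  proof (rule N_cong)
    fix k show "b t k = a t k" using *(2)[of t k] that by (simp add: I_def)
  qed
  then have "\<And>t. t \<in> I n \<Longrightarrow> Nt b j t \<le> Nt a j t" by simp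
  moreover have "outb (I n) j (Nt a j) (ennreal (2 ^ n) * \<alpha> * D j)" using *(1,3) by blast
  ultimately show "outb (I n) j (Nt b j) (ennreal (2 ^ n) * \<alpha> * D j)" using outb_mono[of "I n" j "Nt a j" _ "I n" "Nt b j"] by blast
qed

lemma cover: "0 \<le> t \<Longrightarrow> t \<in> I (\<nu> t) \<and> \<nu> t \<le> Nm" using nu_le by (simp add: I_def)

lemma ind_cover: "(indicator {0..} s :: ennreal) = (\<Sum>n\<le>Nm. indicator (I n) s)"
proof (cases "0 \<le> s")
  case True
  have "(\<Sum>n\<le>Nm. indicator (I n) s :: ennreal) = (\<Sum>n\<le>Nm. if n = \<nu> s then 1 else 0)"
    using True by (intro sum.cong) (auto simp: I_def indicator_def)
  then show ?thesis using True nu_le[OF True] by simp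
qed (simp add: I_def)

text \<open>There are finitely many pieces and the envelope is square summable, so the blockwise
  \<open>L^2\<close> bounds add up to a finite norm.\<close>

lemma MG_Yc:
  assumes R: "MG R \<alpha>" and a: "\<alpha> < \<infinity>" and m: "\<And>k. (\<lambda>t. R t k) \<in> bmeas" and z: "\<And>t. R t 0 = 0"
  shows "Yc R"
  unfolding Yc_def
proof (intro conjI allI m z)
  have [measurable]: "\<And>j. Nt R j \<in> bmeas" by (intro Nt_meas m)
  have "(\<integral>\<^sup>+s\<in>{0..}. (\<Sum>j. (hi j * Nt R j s)^2) \<partial>lborel)
      = (\<integral>\<^sup>+s. (\<Sum>j. \<Sum>n\<le>Nm. (hi j * Nt R j s)^2 * indicator (I n) s) \<partial>lborel)"
    unfolding ind_cover by (intro nn_integral_cong) (simp only: sum_distrib_left[symmetric] ennreal_suminf_multc)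
  also have "\<dots> = (\<Sum>j. \<integral>\<^sup>+s. (\<Sum>n\<le>Nm. (hi j * Nt R j s)^2 * indicator (I n) s) \<partial>lborel)"
    by (rule nn_integral_suminf) measurable
  also have "\<dots> = (\<Sum>j. \<Sum>n\<le>Nm. \<integral>\<^sup>+s\<in>(I n). (hi j * Nt R j s)^2 \<partial>lborel)"
    by (rule suminf_cong, rule nn_integral_sum) measurable
  also have "\<dots> \<le> (\<Sum>j. \<Sum>n\<le>Nm. ((ennreal (2^n) * \<alpha>) * D j)^2)"
    using MG_outb[OF R] by (intro suminf_le sum_mono) (auto simp: outb_def)
  also have "\<dots> = (\<Sum>j. (\<Sum>n\<le>Nm. (ennreal (2^n) * \<alpha>)^2) * (D j)^2)"
    by (simp add: power_mult_distrib sum_distrib_right)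
  also have "\<dots> = (\<Sum>n\<le>Nm. (ennreal (2^n) * \<alpha>)^2) * (\<Sum>j. (D j)^2)" by (rule ennreal_suminf_cmult)
  also have "\<dots> < \<infinity>" using D2 a by (auto simp: ennreal_mult_less_top power_less_top_ennreal less_top)
  finally show "(\<integral>\<^sup>+s\<in>{0..}. (\<Sum>j. (hi j * Nt R j s)^2) \<partial>lborel) < \<infinity>" .
qed

text \<open>The source on each piece is treated as a source on the whole line and estimated
  separately. By causality and monotonicity of \<open>\<nu>\<close>, a time in the
  \<open>n\<close>-th piece is reached only from pieces \<open>l \<le> n\<close>.\<close>

lemma MG_Du:
  assumes d: "dom S H" and li: "\<And>k. loc_int (\<lambda>s. S s k)" and m: "\<And>k. (\<lambda>s. S s k) \<in> bmeas"
    and Hm[measurable]: "\<And>j. H j \<in> bmeas"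
    and H: "\<And>n j. n \<le> Nm \<Longrightarrow> outb UNIV j (\<lambda>t. ennreal (2^j) * Kc j (\<lambda>s. H j s * indicator (I n) s) t) ((ennreal (2^n) * \<gamma>) * D j)"
  shows "MG (Du S) (2 * \<gamma>)"
  unfolding MG_def MJ_def
proof (intro allI impI)
  fix n j assume n: "n \<le> Nm"
  let ?P = "\<lambda>l t. ennreal (2^j) * Kc j (\<lambda>s. H j s * indicator (I l) s) t"
  have fin: "finite A \<Longrightarrow> A \<subseteq> {..Nm} \<Longrightarrow> outb UNIV j (\<lambda>t. \<Sum>l\<in>A. ?P l t) (\<Sum>l\<in>A. (ennreal (2^l) * \<gamma>) * D j)" for A
  proof (induction A rule: finite_induct)
    case (insert l A)
    have "outb UNIV j (\<lambda>t. ?P l t + (\<Sum>l\<in>A. ?P l t)) ((ennreal (2^l) * \<gamma>) * D j + (\<Sum>l\<in>A. (ennreal (2^l) * \<gamma>) * D j))"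
      using insert by (intro outb_add H insert.IH) auto
    then show ?case using insert by simp
  qed (simp add: outb_def)
  have "outb UNIV j (\<lambda>t. \<Sum>l\<in>{..n}. ?P l t) (\<Sum>l\<in>{..n}. (ennreal (2^l) * \<gamma>) * D j)" using n by (intro fin) auto
  then show "outb (I n) j (Nt (Du S) j) ((ennreal (2^n) * (2 * \<gamma>)) * D j)"
  proof (rule outb_mono)
    fix t assume t: "t \<in> I n"
    then have t0: "0 \<le> t" by (simp add: I_def)
    have "Nt (Du S) j t \<le> ennreal (2^j) * Kc j (\<lambda>s. H j s * indicator {0..t} s) t"
      by (rule N_Du_dom[OF d li m Hm t0])
    also have "\<dots> \<le> ennreal (2^j) * (\<integral>\<^sup>+s. (\<Sum>l\<le>n. Kf j (t - s) * (H j s * indicator (I l) s)) \<partial>lborel)"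
    proof (intro mult_left_mono nn_integral_mono)
      fix s
      have "(indicator {0..t} s :: ennreal) \<le> (\<Sum>l\<le>n. indicator (I l) s)"
      proof (cases "s \<in> {0..t}")
        case True
        then have "\<nu> s \<le> n" using nu_mono[of s t] t by (simp add: I_def)
        then have "indicator (I (\<nu> s)) s \<le> (\<Sum>l\<le>n. indicator (I l) s :: ennreal)" by (intro member_le_sum) auto
        then show ?thesis using True by (simp add: I_def)
      qed simp
      then have "Kf j (t - s) * (H j s * indicator {0..t} s) \<le> Kf j (t - s) * (H j s * (\<Sum>l\<le>n. indicator (I l) s))"
        by (intro mult_left_mono) auto
      then show "Kf j (t - s) * (H j s * indicator {0..t} s) \<le> (\<Sum>l\<le>n. Kf j (t - s) * (H j s * indicator (I l) s))"
        by (simp only: sum_distrib_left)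
    qed auto
    also have "\<dots> = (\<Sum>l\<in>{..n}. ?P l t)" by (simp add: nn_integral_sum sum_distrib_left)
    finally show "Nt (Du S) j t \<le> (\<Sum>l\<in>{..n}. ?P l t)" .
  next
    have "(\<Sum>l\<le>n. ennreal (2^l)) \<le> ennreal (2^n) * 2"
    proof -
      have "(\<Sum>l\<le>n. (2::real)^l) \<le> 2^n * 2" by (induction n) auto
      then have "ennreal (\<Sum>l\<le>n. (2::real)^l) \<le> ennreal (2^n * 2)" by (rule ennreal_leI)
      then show ?thesis by (simp add: sum_ennreal ennreal_mult')
    qed
    then have "(\<Sum>l\<le>n. ennreal (2^l)) * (\<gamma> * D j) \<le> (ennreal (2^n) * 2) * (\<gamma> * D j)" by (rule mult_right_mono) simp
    then show "(\<Sum>l\<in>{..n}. (ennreal (2^l) * \<gamma>) * D j) \<le> (ennreal (2^n) * (2 * \<gamma>)) * D j"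
      unfolding sum_distrib_right by (simp only: mult_ac)
  qed auto
qed

definition q1 :: ennreal where "q1 = ennreal (4 * Cu * Cv) * G"
definition q2 :: ennreal where "q2 = ennreal (4 * Cp * CD * Cv * 2^Nm) * X"

lemma MG_NLt:
  assumes a: "Yc a" "MG a \<alpha>" and b: "Yc b" "MG b \<beta>"
  shows "MG (Du (NLt a b)) (q2 * \<alpha> * \<beta>)"
proof -
  let ?\<gamma> = "ennreal (2 * Cp * CD * Cv * 2^Nm) * X * \<alpha> * \<beta>"
  have "MG (Du (NLt a b)) (2 * ?\<gamma>)"
  proof (rule MG_Du[OF dom_NLt[OF a(1) b(1)] loc_int_NLt[OF a(1) b(1)] NLt_meas[OF a(1) b(1)] Hb_meas[OF a(1) b(1)]])
    fix n j assume n: "n \<le> Nm"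
    have "outb UNIV j (\<lambda>t. ennreal (2^j) * Kc j (\<lambda>s. Hb a b j s * indicator (I n) s) t)
       (ennreal Cp * (ennreal (2 * CD * Cv) * X * (ennreal (2^n) * \<alpha>) * (ennreal (2^n) * \<beta>) * D j))"
      using a(2) b(2) n by (intro outb_Hb a(1) b(1) I_sets Denv) (auto simp: MG_def)
    then show "outb UNIV j (\<lambda>t. ennreal (2^j) * Kc j (\<lambda>s. Hb a b j s * indicator (I n) s) t) ((ennreal (2^n) * ?\<gamma>) * D j)"
    proof (rule outb_mono)
      \<comment> \<open>The product of two majorants carries \<open>2^n\<close> twice: one factor is
        kept for the majorant of the result, the other is bounded by \<open>2^Nm\<close>.\<close>
      have "ennreal Cp * ennreal (2 * CD * Cv) * ennreal (2^n) \<le> ennreal (2 * Cp * CD * Cv * 2^Nm)"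
      proof -
        have "Cp * (2 * CD * Cv) * 2^n \<le> Cp * (2 * CD * Cv) * 2^Nm"
          using Cpos CD_pos Cv0 n by (intro mult_left_mono power_increasing) auto
        moreover have "ennreal Cp * ennreal (2 * CD * Cv) * ennreal (2^n) = ennreal (Cp * (2 * CD * Cv) * 2^n)"
          using Cpos CD_pos Cv0 by (simp add: ennreal_mult')
        ultimately show ?thesis by (simp only:) (rule ennreal_leI, simp add: mult_ac)
      qed
      then have "(ennreal Cp * ennreal (2 * CD * Cv) * ennreal (2^n)) * (X * \<alpha> * \<beta> * (ennreal (2^n) * D j))
        \<le> ennreal (2 * Cp * CD * Cv * 2^Nm) * (X * \<alpha> * \<beta> * (ennreal (2^n) * D j))" by (rule mult_right_mono) simp
      then show "ennreal Cp * (ennreal (2 * CD * Cv) * X * (ennreal (2^n) * \<alpha>) * (ennreal (2^n) * \<beta>) * D j) \<le> (ennreal (2^n) * ?\<gamma>) * D j"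
        by (simp only: mult_ac)
    qed auto
  qed
  moreover have "2 * ?\<gamma> = q2 * \<alpha> * \<beta>"
  proof -
    have "ennreal (4 * Cp * CD * Cv * 2^Nm) = 2 * ennreal (2 * Cp * CD * Cv * 2^Nm)"
      using Cpos CD_pos Cv0 ennreal_mult'[of 2 "2 * Cp * CD * Cv * 2^Nm"] by (simp add: mult_ac)
    then show ?thesis by (simp add: q2_def mult.assoc)
  qed
  ultimately show ?thesis by simp
qed

lemma MG_Qt:
  assumes b: "Yc b" "MG b \<beta>"
  shows "MG (Du (Qt b)) (q1 * \<beta>)"
proof -
  let ?\<gamma> = "ennreal (2 * Cu * Cv) * G * \<beta>"
  have "MG (Du (Qt b)) (2 * ?\<gamma>)"
  proof (rule MG_Du[OF dom_Qt[OF b(1)] loc_int_Qt[OF b(1)] Qt_meas[OF b(1)] Hu_meas[OF b(1)]])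
    fix n j assume n: "n \<le> Nm"
    have "outb UNIV j (\<lambda>t. ennreal (2^j) * Kc j (\<lambda>s. Hu b j s * indicator (I n) s) t)
       (ennreal (2 * Cu) * (G * (ennreal (2^n) * \<beta>) * (ennreal Cv * D j)))"
      using b(2) n nu_V[of n] by (intro outb_Hu[OF b(1) I_sets _ _ Denv]) (auto simp: MG_def I_def)
    then show "outb UNIV j (\<lambda>t. ennreal (2^j) * Kc j (\<lambda>s. Hu b j s * indicator (I n) s) t) ((ennreal (2^n) * ?\<gamma>) * D j)"
    proof (rule outb_mono)
      have "ennreal (2 * Cu) * ennreal Cv = ennreal (2 * Cu * Cv)" using Cpos Cv0 by (simp add: ennreal_mult')
      then have "ennreal (2 * Cu) * (G * (ennreal (2^n) * \<beta>) * (ennreal Cv * D j)) = (ennreal (2^n) * ?\<gamma>) * D j"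
      proof -
        assume *: "ennreal (2 * Cu) * ennreal Cv = ennreal (2 * Cu * Cv)"
        have "ennreal (2 * Cu) * (G * (ennreal (2^n) * \<beta>) * (ennreal Cv * D j)) = (ennreal (2 * Cu) * ennreal Cv) * (G * (ennreal (2^n) * \<beta>) * D j)"
          by (simp only: mult_ac)
        then show ?thesis unfolding * by (simp only: mult_ac)
      qed
      then show "ennreal (2 * Cu) * (G * (ennreal (2^n) * \<beta>) * (ennreal Cv * D j)) \<le> (ennreal (2^n) * ?\<gamma>) * D j" by simp
    qed auto
  qed
  moreover have "2 * ?\<gamma> = q1 * \<beta>"
  proof -
    have "ennreal (4 * Cu * Cv) = 2 * ennreal (2 * Cu * Cv)"
      using Cpos Cv0 ennreal_mult'[of 2 "2 * Cu * Cv"] by (simp add: mult_ac)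
    then show ?thesis by (simp add: q1_def mult.assoc)
  qed
  ultimately show ?thesis by simp
qed

end

section \<open>The full source term and its polarisation\<close>

context drift
begin

definition src :: "(real \<Rightarrow> field) \<Rightarrow> real \<Rightarrow> field" where "src R s k = NLt R R s k + Qt R s k"

lemma src_loc_int: "Yc R \<Longrightarrow> loc_int (\<lambda>s. src R s k)"
  unfolding src_def by (intro loc_int_add loc_int_NLt loc_int_Qt)

lemma src_meas: "Yc R \<Longrightarrow> (\<lambda>s. src R s k) \<in> bmeas"
  unfolding src_def by (intro borel_measurable_add NLt_meas Qt_meas)

text \<open>Polarisation: \<open>a \<otimes> a - b \<otimes> b = dw \<otimes> a + b \<otimes>
  dw\<close>. As bilinearity of \<open>conv\<close> rests on convergence, the identity is available
  at almost every time, which suffices under the Duhamel integral.\<close>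

lemma src_diff:
  assumes a: "Yc a" and b: "Yc b"
  defines "dw \<equiv> \<lambda>t k. a t k - b t k"
  shows "Du (src a) t k - Du (src b) t k = Du (NLt dw a) t k + Du (NLt b dw) t k + Du (Qt dw) t k"
proof -
  have w: "Yc dw" unfolding dw_def by (rule Yc_diff[OF a b])
  have li: "loc_int (\<lambda>s. NLt dw a s k)" "loc_int (\<lambda>s. NLt b dw s k)" "loc_int (\<lambda>s. Qt dw s k)"
    by (intro loc_int_NLt loc_int_Qt w a b)+
  have "Du (src a) t k - Du (src b) t k = Du (\<lambda>s k. src a s k - src b s k) t k"
    by (intro Du_diff[of "src a" k "src b", symmetric] src_loc_int a b)
  also have "\<dots> = Du (\<lambda>s k. (NLt dw a s k + NLt b dw s k) + Qt dw s k) t k"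
  proof (rule Du_cong_AE)
    show "(\<lambda>s. src a s k - src b s k) \<in> bmeas" by (intro borel_measurable_diff src_meas a b)
    show "(\<lambda>s. (NLt dw a s k + NLt b dw s k) + Qt dw s k) \<in> bmeas"
      by (intro borel_measurable_add NLt_meas Qt_meas a b w)
    show "AE s in lborel. 0 \<le> s \<longrightarrow> (\<forall>k. src a s k - src b s k = (NLt dw a s k + NLt b dw s k) + Qt dw s k)"
      using NLt_diff(1)[OF a b a] NLt_diff(2)[OF a b b] Qt_diff[OF a b]
    proof eventually_elim
      case (elim s)
      then show ?case unfolding dw_def by (auto simp: src_def)
    qed
  qed
  also have "\<dots> = Du (\<lambda>s k. NLt dw a s k + NLt b dw s k) t k + Du (Qt dw) t k"
    by (rule Du_add[of "\<lambda>s k. NLt dw a s k + NLt b dw s k" k "Qt dw"]) (intro loc_int_add li)+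
  also have "Du (\<lambda>s k. NLt dw a s k + NLt b dw s k) t k = Du (NLt dw a) t k + Du (NLt b dw) t k"
    by (rule Du_add[of "NLt dw a" k "NLt b dw"]) (intro li)+
  finally show ?thesis .
qed

lemma Pdiv_at_0: "Pdiv_tensor a b 0 = 0"
  by (simp add: vec_eq_iff leray_component mu_def)

lemma Du_src_0: "Du (src R) t 0 = 0" "Du (NLt a b) t 0 = 0" "Du (Qt b) t 0 = 0"
  by (simp_all add: Du_def src_def NLt_def Qt_def Pdiv_at_0)

end

context picard
begin

lemma Yc_Du_src: assumes "Yc a" shows "(\<lambda>t. Du (src a) t k) \<in> bmeas"
  by (rule Du_meas[of "src a" k]) (rule src_loc_int[OF assms])

definition Phi :: "(real \<Rightarrow> field) \<Rightarrow> real \<Rightarrow> field" where "Phi R t k = L t k - Du (src R) t k"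

lemma q_small: "q1 \<le> ennreal (1/4)" "q2 \<le> ennreal (1/16)" using small1 small2 by (auto simp: q1_def q2_def)

text \<open>With majorants at most 2 the two quadratic terms contribute \<open>2/16\<close> each and
  the drift \<open>1/4\<close>, in total the contraction factor \<open>1/2\<close>.\<close>

lemma MG_src:
  assumes a: "Yc a" "MG a \<alpha>" and b: "Yc b" "MG b \<alpha>'" and w: "MG (\<lambda>t k. a t k - b t k) \<delta>"
    and al: "\<alpha> \<le> 2" "\<alpha>' \<le> 2"
  shows "MG (\<lambda>t k. Du (src a) t k - Du (src b) t k) (ennreal (1/2) * \<delta>)"
proof -
  define dw where "dw t k = a t k - b t k" for t k
  have dwY: "Yc dw" unfolding dw_def by (rule Yc_diff[OF a(1) b(1)])
  have wM: "MG dw \<delta>" using w by (simp add: dw_def[abs_def])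
  have m: "(\<lambda>t. Du (NLt dw a) t k) \<in> bmeas" "(\<lambda>t. Du (NLt b dw) t k) \<in> bmeas" "(\<lambda>t. Du (Qt dw) t k) \<in> bmeas" for k
    by (rule Du_meas[of "NLt dw a" k], intro loc_int_NLt dwY a, rule Du_meas[of "NLt b dw" k], intro loc_int_NLt dwY b,
        rule Du_meas[of "Qt dw" k], intro loc_int_Qt dwY)
  have 1: "MG (\<lambda>t k. Du (NLt dw a) t k + Du (NLt b dw) t k) (q2 * \<delta> * \<alpha> + q2 * \<alpha>' * \<delta>)"
    by (rule MG_sum[OF MG_NLt[OF dwY wM a] MG_NLt[OF b dwY wM] m(1) m(2)]) (rule N_add)
  have 2: "MG (\<lambda>t k. (Du (NLt dw a) t k + Du (NLt b dw) t k) + Du (Qt dw) t k) ((q2 * \<delta> * \<alpha> + q2 * \<alpha>' * \<delta>) + q1 * \<delta>)"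
    by (rule MG_sum[OF 1 MG_Qt[OF dwY wM] borel_measurable_add[OF m(1) m(2)] m(3)]) (rule N_add)
  then have 3: "MG (\<lambda>t k. Du (src a) t k - Du (src b) t k) ((q2 * \<delta> * \<alpha> + q2 * \<alpha>' * \<delta>) + q1 * \<delta>)"
    using src_diff[OF a(1) b(1)] by (simp add: dw_def[abs_def])
  have "(q2 * \<delta> * \<alpha> + q2 * \<alpha>' * \<delta>) + q1 * \<delta> \<le> (ennreal (1/16) * \<delta> * 2 + ennreal (1/16) * 2 * \<delta>) + ennreal (1/4) * \<delta>"
    by (intro add_mono mult_mono q_small al) auto
  also have "\<dots> = ennreal (1/2) * \<delta>"
  proof -
    have "ennreal (1/16) * 2 = ennreal (1/8)" using ennreal_mult'[of "1/16" 2] by simp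
    then have "(ennreal (1/16) * \<delta> * 2 + ennreal (1/16) * 2 * \<delta>) + ennreal (1/4) * \<delta> = (ennreal (1/8) + ennreal (1/8) + ennreal (1/4)) * \<delta>"
      by (simp add: distrib_left distrib_right mult.commute mult.left_commute)
    also have "ennreal (1/8) + ennreal (1/8) + ennreal (1/4) = ennreal (1/2)" by (simp add: ennreal_plus[symmetric] del: ennreal_plus)
    finally show ?thesis .
  qed
  finally show ?thesis using 3 by (rule MG_mono[rotated])
qed

lemma MG_zero: "MG (\<lambda>t k. 0) \<alpha>"
  by (simp add: MG_def MJ_def outb_def)

lemma Yc_zero: "Yc (\<lambda>t k. 0)"
  by (simp add: Yc_def)

lemma src_zero: "Du (src (\<lambda>t k. 0)) t k = 0"
proof -
  have "Pdiv_tensor a (\<lambda>k. 0) k = 0" "Pdiv_tensor (\<lambda>k. 0) a k = 0" for a k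
    by (simp_all add: vec_eq_iff leray_component conv_def)
  then show ?thesis by (simp add: Du_def src_def NLt_def Qt_def)
qed

text \<open>Block norms are continuous in the coefficients, so the sup part passes to the limit
  directly and the \<open>L^2\<close> part by Fatou's lemma.\<close>

lemma MG_limit:
  assumes R: "\<And>n. MG (R n) \<alpha>" and m: "\<And>n k. (\<lambda>t. R n t k) \<in> bmeas" and lim: "\<And>t k. 0 \<le> t \<Longrightarrow> (\<lambda>n. R n t k) \<longlonglongrightarrow> S t k"
  shows "MG S \<alpha>"
  unfolding MG_def MJ_def
proof (intro allI impI)
  fix n j assume n: "n \<le> Nm"
  have [measurable]: "Nt (R i) j \<in> bmeas" for i by (intro Nt_meas m)
  have l: "(\<lambda>i. Nt (R i) j t) \<longlonglongrightarrow> Nt S j t" if "0 \<le> t" for t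
    by (intro tendsto_ennrealI N_tendsto lim that)
  have c: "outb (I n) j (Nt (R i) j) ((ennreal (2^n) * \<alpha>) * D j)" for i by (rule MG_outb[OF R n])
  show "outb (I n) j (Nt S j) ((ennreal (2^n) * \<alpha>) * D j)"
    unfolding outb_def
  proof (intro conjI ballI)
    fix t assume t: "t \<in> I n"
    then have "(\<lambda>i. lo j * Nt (R i) j t) \<longlonglongrightarrow> lo j * Nt S j t" by (intro ennreal_tendsto_cmult l) (auto simp: I_def)
    then show "lo j * Nt S j t \<le> (ennreal (2^n) * \<alpha>) * D j"
      by (rule LIMSEQ_le_const2) (use c t in \<open>auto simp: outb_def\<close>)
  next
    have "(\<integral>\<^sup>+t\<in>(I n). (hi j * Nt S j t)^2 \<partial>lborel) = (\<integral>\<^sup>+t. liminf (\<lambda>i. (hi j * Nt (R i) j t)^2 * indicator (I n) t) \<partial>lborel)"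
    proof (intro nn_integral_cong)
      fix t
      show "(hi j * Nt S j t)^2 * indicator (I n) t = liminf (\<lambda>i. (hi j * Nt (R i) j t)^2 * indicator (I n) t)"
      proof (cases "t \<in> I n")
        case True
        have "(\<lambda>i. ennreal ((2 powr (real j * (sg + 1)) * N j (R i t))^2)) \<longlonglongrightarrow> ennreal ((2 powr (real j * (sg + 1)) * N j (S t))^2)"
          using True by (intro tendsto_ennrealI tendsto_intros N_tendsto lim) (auto simp: I_def)
        then have "(\<lambda>i. (hi j * Nt (R i) j t)^2) \<longlonglongrightarrow> (hi j * Nt S j t)^2"
          by (simp add: ennreal_mult[symmetric] ennreal_power)
        from lim_imp_Liminf[OF sequentially_bot this] show ?thesis using True by simp
      qed (simp add: Liminf_const)
    qed
    also have "\<dots> \<le> liminf (\<lambda>i. \<integral>\<^sup>+t\<in>(I n). (hi j * Nt (R i) j t)^2 \<partial>lborel)"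
      by (rule nn_integral_liminf) measurable
    also have "\<dots> \<le> liminf (\<lambda>i::nat. ((ennreal (2^n) * \<alpha>) * D j)^2)"
      using c by (intro Liminf_mono always_eventually allI) (auto simp: outb_def)
    also have "\<dots> = ((ennreal (2^n) * \<alpha>) * D j)^2" by (simp add: Liminf_const)
    finally show "(\<integral>\<^sup>+t\<in>(I n). (hi j * Nt S j t)^2 \<partial>lborel) \<le> ((ennreal (2^n) * \<alpha>) * D j)^2" .
  qed
qed

lemma MG_pointwise:
  assumes "MG R \<alpha>" "0 \<le> t"
  shows "lo j * Nt R j t \<le> (ennreal (2^Nm) * \<alpha>) * D j"
proof -
  have "lo j * Nt R j t \<le> (ennreal (2^\<nu> t) * \<alpha>) * D j"
    using MG_outb[OF assms(1), of "\<nu> t" j] cover[OF assms(2)] by (auto simp: outb_def)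
  also have "\<dots> \<le> (ennreal (2^Nm) * \<alpha>) * D j"
    using cover[OF assms(2)] by (intro mult_right_mono ennreal_leI power_increasing) auto
  finally show ?thesis .
qed

text \<open>The constant depends neither on the field nor on the time, so each coefficient inherits
  the geometric decay of majorants.\<close>

lemma MG_coeff:
  assumes k: "k \<noteq> 0"
  obtains c where "\<And>R \<alpha> t. 0 \<le> \<alpha> \<Longrightarrow> MG R (ennreal \<alpha>) \<Longrightarrow> 0 \<le> t \<Longrightarrow> norm (R t k) \<le> c * \<alpha>"
proof -
  obtain C J where C: "C > 0" "\<And>c. norm (c k) \<le> C * (\<Sum>j\<le>J. N j c)" by (rule coeff_bound[OF k]) blast
  obtain x where x: "0 \<le> x" "X = ennreal x" using Xfin by (cases X) auto
  have DX: "D j \<le> ennreal x" for j using Denv x by (simp add: envelope_def)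
  show ?thesis
  proof (rule that[of "C * (\<Sum>j\<le>J. 2 powr (- real j * sg) * (2^Nm * x))"])
    fix R :: "real \<Rightarrow> field" and \<alpha> t :: real assume a: "0 \<le> \<alpha>" "MG R (ennreal \<alpha>)" "0 \<le> t"
    have Nb: "N j (R t) \<le> 2 powr (- real j * sg) * (2^Nm * x * \<alpha>)" for j
    proof (rule N_le_of_lo)
      have "lo j * Nt R j t \<le> (ennreal (2^Nm) * ennreal \<alpha>) * D j" by (rule MG_pointwise[OF a(2,3)])
      also have "\<dots> \<le> (ennreal (2^Nm) * ennreal \<alpha>) * ennreal x" by (intro mult_left_mono DX) auto
      also have "\<dots> = ennreal (2^Nm * x * \<alpha>)" using a x by (simp add: ennreal_mult mult_ac)
      finally show "lo j * Nt R j t \<le> ennreal (2^Nm * x * \<alpha>)" .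
    qed (use a x in auto)
    have "norm (R t k) \<le> C * (\<Sum>j\<le>J. N j (R t))" by (rule C(2))
    also have "\<dots> \<le> C * (\<Sum>j\<le>J. 2 powr (- real j * sg) * (2^Nm * x * \<alpha>))"
      using C(1) by (intro sum_mono mult_left_mono Nb) auto
    finally show "norm (R t k) \<le> C * (\<Sum>j\<le>J. 2 powr (- real j * sg) * (2^Nm * x)) * \<alpha>"
      by (simp add: sum_distrib_right mult.assoc)
  qed
qed

end

text \<open>The envelope absorbs the size of the data: the linear evolution has majorant 1, and the
  iteration lives in the ball of majorant 2.\<close>

locale picard_lin = picard +
  assumes L_meas: "\<And>k. (\<lambda>t. L t k) \<in> bmeas" and L0: "\<And>t. L t 0 = 0" and L_MG: "MG L 1"
begin

primrec Rn :: "nat \<Rightarrow> real \<Rightarrow> field" where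
  "Rn 0 = (\<lambda>t k. 0)"
| "Rn (Suc n) = Phi (Rn n)"

lemma Phi_Yc:
  assumes a: "Yc a" "MG a 2"
  shows "Yc (Phi a) \<and> MG (Phi a) 2"
proof -
  have m: "(\<lambda>t. Phi a t k) \<in> bmeas" for k
    unfolding Phi_def by (intro borel_measurable_diff L_meas Yc_Du_src a)
  \<comment> \<open>Comparison with the zero field turns the contraction estimate into a bound for
    the source term itself.\<close>
  have "MG (\<lambda>t k. Du (src a) t k - Du (src (\<lambda>t k. 0)) t k) (ennreal (1/2) * 2)"
    using a by (intro MG_src[OF a Yc_zero MG_zero, where \<alpha>' = 0]) auto
  then have s: "MG (Du (src a)) 1" unfolding src_zero using ennreal_mult'[of "1/2" 2] by simp
  have "MG (Phi a) (1 + 1)"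
    unfolding Phi_def[abs_def] by (rule MG_sum[OF L_MG s L_meas Yc_Du_src[OF a(1)]]) (rule N_diff)
  then have M: "MG (Phi a) 2" by simp
  moreover have "Yc (Phi a)" by (rule MG_Yc[OF M _ m]) (auto simp: Phi_def L0 Du_src_0)
  ultimately show ?thesis by simp
qed

lemma Rn_Yc: "Yc (Rn n) \<and> MG (Rn n) 2"
  by (induction n) (auto simp: Yc_zero MG_zero Phi_Yc)

lemma Phi_contract:
  assumes a: "Yc a" "MG a 2" and b: "Yc b" "MG b 2" and w: "MG (\<lambda>t k. a t k - b t k) (ennreal \<delta>)" and d: "0 \<le> \<delta>"
  shows "MG (\<lambda>t k. Phi a t k - Phi b t k) (ennreal (\<delta> / 2))"
proof -
  have "MG (\<lambda>t k. Du (src a) t k - Du (src b) t k) (ennreal (1/2) * ennreal \<delta>)"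
    by (rule MG_src[OF a b w]) auto
  then have "MG (\<lambda>t k. - (Du (src a) t k - Du (src b) t k)) (ennreal (\<delta> / 2))"
    unfolding MG_minus using ennreal_mult'[of "1/2" \<delta>] d by simp
  then show ?thesis by (rule MG_cong) (simp add: Phi_def)
qed

lemma Rn_diff: "MG (\<lambda>t k. Rn (Suc n) t k - Rn n t k) (ennreal ((1/2)^n))"
proof (induction n)
  case 0
  have "MG L (ennreal 1)" using L_MG by simp
  then show ?case by (rule MG_cong[THEN MG_mono]) (auto simp: Phi_def src_zero)
next
  case (Suc n)
  have "MG (\<lambda>t k. Phi (Rn (Suc n)) t k - Phi (Rn n) t k) (ennreal ((1/2)^n / 2))"
    using Rn_Yc[of "Suc n"] Rn_Yc[of n] Suc by (intro Phi_contract) auto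
  then show ?case by simp
qed

text \<open>The exact partial geometric sum is kept so that the induction closes.\<close>

lemma Rn_tail: "n \<le> m \<Longrightarrow> MG (\<lambda>t k. Rn m t k - Rn n t k) (ennreal (2 * (1/2)^n - 2 * (1/2)^m))"
proof (induction m rule: dec_induct)
  case base
  then show ?case using MG_zero by simp
next
  case (step m)
  have "(2::real) * (1/2)^m \<le> 2 * (1/2)^n" using step by (intro mult_left_mono power_decreasing) auto
  then have e: "ennreal (2 * (1/2)^n - 2 * (1/2)^m) + ennreal ((1/2)^m) = ennreal (2 * (1/2)^n - 2 * (1/2)^Suc m)"
    by (subst ennreal_plus[symmetric]) auto
  show ?case unfolding e[symmetric]
  proof (rule MG_sum[OF step.IH Rn_diff])
    show "(\<lambda>t. Rn m t k - Rn n t k) \<in> bmeas" "(\<lambda>t. Rn (Suc m) t k - Rn m t k) \<in> bmeas" for k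
      using Rn_Yc Yc_meas by (intro borel_measurable_diff; blast)+
    show "N j (\<lambda>k. Rn (Suc m) t k - Rn n t k) \<le> N j (\<lambda>k. Rn m t k - Rn n t k) + N j (\<lambda>k. Rn (Suc m) t k - Rn m t k)" for t j
      using N_add[of j "\<lambda>k. Rn m t k - Rn n t k" "\<lambda>k. Rn (Suc m) t k - Rn m t k"] by simp
  qed
qed

lemma Rn_tail': "n \<le> m \<Longrightarrow> MG (\<lambda>t k. Rn m t k - Rn n t k) (ennreal (2 * (1/2)^n))"
  by (rule MG_mono[OF Rn_tail]) (auto intro: ennreal_leI)

lemma Rn_convergent: assumes "0 \<le> t" shows "convergent (\<lambda>n. Rn n t k)"
proof (cases "k = 0")
  case True
  then have "Rn n t k = 0" for n using Rn_Yc[of n] by (simp add: Yc_0)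
  then show ?thesis by (simp add: convergent_const)
next
  case False
  obtain c where c: "\<And>R \<alpha> t. 0 \<le> \<alpha> \<Longrightarrow> MG R (ennreal \<alpha>) \<Longrightarrow> 0 \<le> t \<Longrightarrow> norm (R t k) \<le> c * \<alpha>"
    by (rule MG_coeff[OF False]) blast
  have b: "norm (Rn (Suc n) t k - Rn n t k) \<le> c * (1/2)^n" for n
    using c[OF _ Rn_diff[of n] assms] by simp
  have "summable (\<lambda>n. c * (1/2::real)^n)" by (intro summable_mult summable_geometric) simp
  then have "summable (\<lambda>n. Rn (Suc n) t k - Rn n t k)"
    by (rule summable_comparison_test') (rule b)
  then have "convergent (\<lambda>n. \<Sum>i<n. Rn (Suc i) t k - Rn i t k)" by (simp add: summable_iff_convergent)
  moreover have "(\<Sum>i<n. Rn (Suc i) t k - Rn i t k) = Rn n t k" for n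
    by (subst sum_lessThan_telescope) simp
  ultimately show ?thesis by simp
qed

text \<open>The limit is taken coefficient by coefficient; at negative times, where no convergence
  is claimed, the value 0 keeps it measurable.\<close>

definition Rs :: "real \<Rightarrow> field" where "Rs t k = (if 0 \<le> t then lim (\<lambda>n. Rn n t k) else 0)"

lemma Rs_lim: "0 \<le> t \<Longrightarrow> (\<lambda>n. Rn n t k) \<longlonglongrightarrow> Rs t k"
  using Rn_convergent[of t k] by (simp add: Rs_def convergent_LIMSEQ_iff)

lemma Rs_meas: "(\<lambda>t. Rs t k) \<in> bmeas"
proof (rule borel_measurable_LIMSEQ_metric)
  show "(\<lambda>t. indicator {0..} t *\<^sub>R Rn n t k) \<in> bmeas" for n
    by (intro borel_measurable_scaleR borel_measurable_indicator Yc_meas) (simp_all add: Rn_Yc)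
  show "(\<lambda>n. indicator {0..} t *\<^sub>R Rn n t k) \<longlonglongrightarrow> Rs t k" for t
    using Rs_lim[of t k] by (cases "0 \<le> t") (auto simp: Rs_def)
qed

lemma Rs_0: "Rs t 0 = 0"
proof -
  have "Rn n t 0 = 0" for n using Rn_Yc[of n] by (simp add: Yc_0)
  then show ?thesis by (simp add: Rs_def)
qed

lemma Rs_MG: "MG Rs 2"
  by (rule MG_limit[of Rn]) (use Rn_Yc Yc_meas Rs_lim in blast)+

lemma Rs_Yc: "Yc Rs"
  by (rule MG_Yc[OF Rs_MG _ Rs_meas Rs_0]) auto

text \<open>Continuity of \<open>Phi\<close> under coefficientwise convergence is not invoked. The
  tail estimate is passed to the limit and contracted once more, so that the iterates converge both
  to \<open>Rs\<close> and to \<open>Phi Rs\<close>.\<close>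

lemma Rs_fixed: assumes t: "0 \<le> t" shows "Rs t k = Phi Rs t k"
proof (cases "k = 0")
  case True then show ?thesis by (simp add: Rs_0 Phi_def L0 Du_src_0)
next
  case False
  obtain c where c: "\<And>R \<alpha> t. 0 \<le> \<alpha> \<Longrightarrow> MG R (ennreal \<alpha>) \<Longrightarrow> 0 \<le> t \<Longrightarrow> norm (R t k) \<le> c * \<alpha>"
    by (rule MG_coeff[OF False]) blast
  have tail: "MG (\<lambda>t k. Rs t k - Rn n t k) (ennreal (2 * (1/2)^n))" for n
  proof (rule MG_limit[of "\<lambda>m t k. Rn (m + n) t k - Rn n t k"])
    show "MG (\<lambda>t k. Rn (m + n) t k - Rn n t k) (ennreal (2 * (1/2)^n))" for m by (rule Rn_tail') simp
    show "(\<lambda>t. Rn (m + n) t k - Rn n t k) \<in> bmeas" for m k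
      using Rn_Yc Yc_meas by (intro borel_measurable_diff; blast)
    show "(\<lambda>m. Rn (m + n) t k - Rn n t k) \<longlonglongrightarrow> Rs t k - Rn n t k" if "0 \<le> t" for t k
      by (intro tendsto_diff tendsto_const LIMSEQ_ignore_initial_segment Rs_lim that)
  qed
  have "MG (\<lambda>t k. Phi Rs t k - Rn (Suc n) t k) (ennreal ((1/2)^n))" for n
  proof -
    have "MG (\<lambda>t k. Phi Rs t k - Phi (Rn n) t k) (ennreal (2 * (1/2)^n / 2))"
      using Rn_Yc[of n] by (intro Phi_contract Rs_Yc Rs_MG tail) auto
    then show ?thesis by simp
  qed
  then have "norm (Rn (Suc n) t k - Phi Rs t k) \<le> c * (1/2)^n" for n
  proof -
    assume *: "\<And>n. MG (\<lambda>t k. Phi Rs t k - Rn (Suc n) t k) (ennreal ((1/2)^n))"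
    have "norm (Phi Rs t k - Rn (Suc n) t k) \<le> c * (1/2)^n" by (rule c[OF _ * t]) simp
    then show ?thesis by (subst norm_minus_commute)
  qed
  moreover have "(\<lambda>n. c * (1/2)^n) \<longlonglongrightarrow> 0" by (intro tendsto_mult_right_zero LIMSEQ_realpow_zero) auto
  ultimately have "(\<lambda>n. Rn (Suc n) t k - Phi Rs t k) \<longlonglongrightarrow> 0"
    by (rule Lim_null_comparison[OF always_eventually[OF allI]])
  then have "(\<lambda>n. Rn (Suc n) t k) \<longlonglongrightarrow> Phi Rs t k" by (simp add: LIM_zero_iff)
  moreover have "(\<lambda>n. Rn (Suc n) t k) \<longlonglongrightarrow> Rs t k" using Rs_lim[OF t] by (rule LIMSEQ_Suc)
  ultimately show ?thesis using LIMSEQ_unique by blast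
qed

end

section \<open>The linear evolution of the data\<close>

text \<open>Duality with the vector \<open>x\<close> of the integrals itself: the sum of
  \<open>x_j^2\<close> is rewritten as one time integral, Cauchy-Schwarz in \<open>j\<close>
  produces \<open>sqrt r\<close>, and this factor is cancelled. Partial sums are used because they
  are known to be finite. It places a force in \<open>L^1\<close> with values in a Besov space into
  the larger Chemin-Lerner space.\<close>

lemma Minkowski_integral_l2:
  fixes f :: "nat \<Rightarrow> real \<Rightarrow> ennreal"
  assumes [measurable]: "\<And>j. f j \<in> bmeas" "g \<in> bmeas"
    and fg: "\<And>s. (\<Sum>j. (f j s)^2) \<le> (g s)^2" and g: "(\<integral>\<^sup>+s. g s \<partial>lborel) \<le> b" and b: "b < \<infinity>"
  shows "(\<Sum>j. (\<integral>\<^sup>+s. f j s \<partial>lborel)^2) \<le> b^2"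
proof (rule suminf_le_const)
  define x where "x j = (\<integral>\<^sup>+s. f j s \<partial>lborel)" for j
  obtain \<beta> where \<beta>: "0 \<le> \<beta>" "b = ennreal \<beta>" using b by (cases b) auto
  have part: "(\<Sum>j\<in>A. (f j s)^2) \<le> (g s)^2" if "finite A" for A s
    using sum_le_suminf[of "\<lambda>j. (f j s)^2" A] that fg[of s] by (meson order_trans summableI zero_le)
  have "f j s \<le> g s" for j s by (rule ennreal_power2_le_imp_le) (use part[of "{j}" s] in simp)
  then have xb: "x j \<le> b" for j unfolding x_def using nn_integral_mono[of lborel "f j" g] g by (meson order_trans)
  fix n
  have "(\<Sum>j<n. (x j)^2) < \<infinity>"
  proof -
    have "(\<Sum>j<n. (x j)^2) \<le> (\<Sum>j<n. b^2)" by (intro sum_mono power_mono xb) auto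
    also have "\<dots> < \<infinity>" using \<beta> by (simp add: ennreal_power ennreal_mult_less_top of_nat_less_top)
    finally show ?thesis .
  qed
  then obtain r where r: "0 \<le> r" "(\<Sum>j<n. (x j)^2) = ennreal r" by (cases "\<Sum>j<n. (x j)^2") auto
  have cs: "(\<Sum>j<n. x j * f j s) \<le> ennreal (sqrt r) * g s" for s
  proof (rule ennreal_power2_le_imp_le)
    have "(\<Sum>j<n. x j * f j s)^2 \<le> (\<Sum>j<n. (x j)^2) * (\<Sum>j<n. (f j s)^2)"
      using Cauchy_Schwarz_nn_integral[of x "count_space {..<n}" "\<lambda>j. f j s"] by (simp add: nn_integral_count_space_finite)
    also have "\<dots> \<le> ennreal r * (g s)^2" unfolding r by (intro mult_left_mono part) auto
    also have "ennreal r = (ennreal (sqrt r))^2" using r by (simp add: ennreal_power)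
    finally show "(\<Sum>j<n. x j * f j s)^2 \<le> (ennreal (sqrt r) * g s)^2" by (simp add: power_mult_distrib)
  qed
  have "ennreal r = (\<Sum>j<n. x j * x j)" using r by (simp add: power2_eq_square)
  also have "\<dots> = (\<Sum>j<n. \<integral>\<^sup>+s. x j * f j s \<partial>lborel)" by (subst (2) x_def) (simp add: nn_integral_cmult)
  also have "\<dots> = (\<integral>\<^sup>+s. (\<Sum>j<n. x j * f j s) \<partial>lborel)" by (rule nn_integral_sum[symmetric]) measurable
  also have "\<dots> \<le> (\<integral>\<^sup>+s. ennreal (sqrt r) * g s \<partial>lborel)" by (intro nn_integral_mono cs)
  also have "\<dots> = ennreal (sqrt r) * (\<integral>\<^sup>+s. g s \<partial>lborel)" by (rule nn_integral_cmult) measurable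
  also have "\<dots> \<le> ennreal (sqrt r) * ennreal \<beta>" using g \<beta> by (intro mult_left_mono) auto
  also have "\<dots> = ennreal (sqrt r * \<beta>)" using \<beta> r by (simp add: ennreal_mult)
  finally have "r \<le> sqrt r * \<beta>" using r \<beta> by (subst (asm) ennreal_le_iff) auto
  then have "sqrt r * sqrt r \<le> sqrt r * \<beta>" using r by simp
  then have "sqrt r \<le> \<beta>" using r \<beta> by (cases "r = 0") (simp_all only: mult_le_cancel_left, auto)
  then have "(sqrt r)^2 \<le> \<beta>^2" using r by (intro power_mono) auto
  then show "(\<Sum>j<n. (\<integral>\<^sup>+s. f j s \<partial>lborel)^2) \<le> b^2"
    unfolding x_def[symmetric] r(2) \<beta>(2) using r \<beta> by (simp add: ennreal_power ennreal_leI)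
qed simp

text \<open>Squaring preserves and reflects the order of extended reals. The Besov norm of the force
  is accessible through its square, a series of block norms.\<close>

lemma measurable_of_square:
  fixes g :: "'a \<Rightarrow> ennreal"
  assumes "(\<lambda>x. (g x)^2) \<in> borel_measurable M"
  shows "g \<in> borel_measurable M"
proof (rule borel_measurableI_le)
  fix a
  have "{x \<in> space M. g x \<le> a} = {x \<in> space M. (g x)^2 \<le> a^2}" using ennreal_power2_le_imp_le by (auto intro: power_mono)
  also have "\<dots> \<in> sets M" using assms by measurable
  finally show "{x \<in> space M. g x \<le> a} \<in> sets M" .
qed

context estimates
begin

definition Lin :: "field \<Rightarrow> (real \<Rightarrow> field) \<Rightarrow> real \<Rightarrow> field" where
  "Lin c G t k = (if t < 0 then 0 else exp (- t * ksq k) *\<^sub>R c k + Du G t k)"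

lemma loc_int_of_N:
  assumes m: "\<And>k. (\<lambda>s. G s k) \<in> bmeas" and z: "\<And>s. G s 0 = 0" and f: "\<And>j. (\<integral>\<^sup>+s. Nt G j s \<partial>lborel) < \<infinity>"
  shows "loc_int (\<lambda>s. G s k)"
proof (rule loc_intI[OF m])
  show "(\<integral>\<^sup>+s\<in>{0..}. ennreal (norm (G s k)) \<partial>lborel) < \<infinity>"
  proof (cases "k = 0")
    case False
    obtain C J where C: "C > 0" "\<And>c. norm (c k) \<le> C * (\<Sum>j\<le>J. N j c)" by (rule coeff_bound[OF False]) blast
    have [measurable]: "Nt G j \<in> bmeas" for j by (intro Nt_meas m)
    have "(\<integral>\<^sup>+s\<in>{0..}. ennreal (norm (G s k)) \<partial>lborel) \<le> (\<integral>\<^sup>+s. ennreal C * (\<Sum>j\<le>J. Nt G j s) \<partial>lborel)"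
    proof (rule nn_integral_mono)
      fix s
      have "ennreal (norm (G s k)) \<le> ennreal (C * (\<Sum>j\<le>J. N j (G s)))" by (rule ennreal_leI[OF C(2)])
      also have "\<dots> = ennreal C * (\<Sum>j\<le>J. Nt G j s)"
        using C(1) by (subst ennreal_mult') (auto simp: sum_nonneg)
      finally show "ennreal (norm (G s k)) * indicator {0..} s \<le> ennreal C * (\<Sum>j\<le>J. Nt G j s)"
        by (auto simp: indicator_def)
    qed
    also have "\<dots> = ennreal C * (\<Sum>j\<le>J. \<integral>\<^sup>+s. Nt G j s \<partial>lborel)"
      by (subst nn_integral_cmult, measurable) (subst nn_integral_sum, measurable)
    also have "\<dots> < \<infinity>" using f by (auto simp: ennreal_mult_less_top)
    finally show ?thesis .
  qed (simp add: z)
qed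

text \<open>For the data, \<open>hi j\<close> exceeds \<open>lo j\<close> by \<open>2^j\<close>,
  while the square of the heat profile integrates to at most \<open>4^(-j)\<close>, so both norms
  carry the weight \<open>lo j\<close>. The force acts as an \<open>L^1\<close> source without
  derivative.\<close>

lemma Lin_outb:
  assumes m: "\<And>k. (\<lambda>s. G s k) \<in> bmeas" and li: "\<And>k. loc_int (\<lambda>s. G s k)"
  shows "outb {0..} j (Nt (Lin c G) j) (ennreal Ch * (lo j * ennreal (N j c)) + ennreal Ch * (lo j * (\<integral>\<^sup>+s. Nt G j s \<partial>lborel)))"
proof -
  \<comment> \<open>The factor \<open>1 / 2^j\<close> compensates the \<open>2^j\<close> of
    \<open>dom\<close>, since the force carries no derivative.\<close>
  define H where "H j s = ennreal Ch * (ennreal (1 / 2^j) * Nt G j s)" for j s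
  have [measurable]: "Nt G j \<in> bmeas" for j by (intro Nt_meas m)
  have Hm[measurable]: "H j \<in> bmeas" for j unfolding H_def by measurable
  have c1: "ennreal (2^j) * ennreal (1 / 2^j) = 1" by (subst ennreal_mult[symmetric]) auto
  have d: "dom G H"
    unfolding dom_def
  proof (intro AE_I2 impI allI)
    fix s \<tau> :: real and j assume "0 \<le> \<tau>"
    have "ennreal (N j (heat_sg \<tau> (G s))) \<le> ennreal (Ch * kap j \<tau> * N j (G s))"
      by (intro ennreal_leI heat \<open>0 \<le> \<tau>\<close>)
    also have "\<dots> = ennreal ((2^j * kap j \<tau>) * (Ch * (1 / 2^j * N j (G s))))" by (simp add: mult_ac)
    also have "\<dots> = ennreal (2^j * kap j \<tau>) * H j s"
      using Cpos by (simp add: H_def ennreal_mult[symmetric] kap_def)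
    finally show "ennreal (N j (heat_sg \<tau> (G s))) \<le> ennreal (2^j * kap j \<tau>) * H j s" .
  qed
  have V: "(\<integral>\<^sup>+s. H j s \<partial>lborel) = ennreal Ch * (ennreal (1 / 2^j) * (\<integral>\<^sup>+s. Nt G j s \<partial>lborel))"
  proof -
    have "(\<integral>\<^sup>+s. H j s \<partial>lborel) = ennreal Ch * (\<integral>\<^sup>+s. ennreal (1 / 2^j) * Nt G j s \<partial>lborel)"
      unfolding H_def by (rule nn_integral_cmult) measurable
    also have "(\<integral>\<^sup>+s. ennreal (1 / 2^j) * Nt G j s \<partial>lborel) = ennreal (1 / 2^j) * (\<integral>\<^sup>+s. Nt G j s \<partial>lborel)"
      by (rule nn_integral_cmult) measurable
    finally show ?thesis .
  qed
  have hl: "hi j * ennreal (1 / 2^j) = lo j"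
    by (subst ennreal_mult[symmetric]) (auto simp: powr_add distrib_left powr_realpow field_simps powr_minus)
  have hl2: "hi j = lo j * ennreal (2^j)"
    by (subst ennreal_mult[symmetric]) (auto simp: powr_add distrib_left powr_realpow)
  have 2: "outb UNIV j (\<lambda>t. ennreal (2^j) * Kc j (H j) t) (ennreal Ch * (lo j * (\<integral>\<^sup>+s. Nt G j s \<partial>lborel)))"
  proof -
    have e: "hi j * (ennreal Ch * (ennreal (1 / 2^j) * (\<integral>\<^sup>+s. Nt G j s \<partial>lborel))) = ennreal Ch * (lo j * (\<integral>\<^sup>+s. Nt G j s \<partial>lborel))"
      unfolding hl[symmetric] by (simp only: mult_ac)
    show ?thesis using outb_T2[OF Hm[of j], of _ j, OF eq_refl[OF V]] unfolding e .
  qed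
  have 1: "outb UNIV j (\<lambda>t. ennreal (N j c) * (ennreal Ch * Kf j t)) (ennreal Ch * (lo j * ennreal (N j c)))"
    unfolding outb_def
  proof (intro conjI ballI)
    fix t
    have "lo j * (ennreal (N j c) * (ennreal Ch * Kf j t)) \<le> lo j * (ennreal (N j c) * (ennreal Ch * 1))"
      by (intro mult_left_mono Kf_le_1) auto
    then show "lo j * (ennreal (N j c) * (ennreal Ch * Kf j t)) \<le> ennreal Ch * (lo j * ennreal (N j c))" by (simp add: mult_ac)
  next
    have "(\<integral>\<^sup>+t. (hi j * (ennreal (N j c) * (ennreal Ch * Kf j t)))^2 * indicator UNIV t \<partial>lborel)
        \<le> (\<integral>\<^sup>+t. ((ennreal Ch * (lo j * ennreal (N j c)))^2 * ennreal (4^j)) * Kf j t \<partial>lborel)"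
    proof (rule nn_integral_mono)
      fix t
      have "(Kf j t)^2 \<le> Kf j t" using mult_left_mono[OF Kf_le_1, of "Kf j t" j t] by (simp add: power2_eq_square)
      then have "((ennreal Ch * (lo j * ennreal (N j c)))^2 * (ennreal (2^j))^2) * (Kf j t)^2
          \<le> ((ennreal Ch * (lo j * ennreal (N j c)))^2 * (ennreal (2^j))^2) * Kf j t" by (rule mult_left_mono) simp
      moreover have "(ennreal (2^j))^2 = ennreal (4^j)"
        using power_mult_distrib[of "2::real" 2 j] by (simp add: power2_eq_square ennreal_mult)
      ultimately show "(hi j * (ennreal (N j c) * (ennreal Ch * Kf j t)))^2 * indicator UNIV t
          \<le> ((ennreal Ch * (lo j * ennreal (N j c)))^2 * ennreal (4^j)) * Kf j t"
        unfolding hl2 by (simp add: power_mult_distrib mult_ac)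
    qed
    also have "\<dots> = ((ennreal Ch * (lo j * ennreal (N j c)))^2 * ennreal (4^j)) * (\<integral>\<^sup>+t. Kf j t \<partial>lborel)"
      by (rule nn_integral_cmult) measurable
    also have "\<dots> = (ennreal Ch * (lo j * ennreal (N j c)))^2 * (ennreal (4^j) * ennreal (1 / 4^j))"
      unfolding Kf_integral by (simp only: mult_ac)
    also have "ennreal (4^j) * ennreal (1 / 4^j) = 1" by (subst ennreal_mult[symmetric]) auto
    finally show "(\<integral>\<^sup>+t. (hi j * (ennreal (N j c) * (ennreal Ch * Kf j t)))^2 * indicator UNIV t \<partial>lborel) \<le> (ennreal Ch * (lo j * ennreal (N j c)))^2"
      by simp
  qed
  have "outb UNIV j (\<lambda>t. ennreal (N j c) * (ennreal Ch * Kf j t) + ennreal (2^j) * Kc j (H j) t)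
     (ennreal Ch * (lo j * ennreal (N j c)) + ennreal Ch * (lo j * (\<integral>\<^sup>+s. Nt G j s \<partial>lborel)))"
    by (rule outb_add[OF _ _ _ 1 2]) measurable
  then show ?thesis
  proof (rule outb_mono)
    fix t :: real assume "t \<in> {0..}"
    then have t: "0 \<le> t" by simp
    have "Nt (Lin c G) j t \<le> ennreal (N j (heat_sg t c)) + ennreal (N j (Du G t))"
      using N_add_enn[of j "heat_sg t c" "Du G t"] t by (simp add: Lin_def[abs_def])
    also have "\<dots> \<le> ennreal (N j c) * (ennreal Ch * Kf j t) + ennreal (2^j) * Kc j (H j) t"
    proof (rule add_mono)
      have "ennreal (N j (heat_sg t c)) \<le> ennreal (Ch * kap j t * N j c)" by (intro ennreal_leI heat t)
      also have "\<dots> = ennreal (N j c) * (ennreal Ch * Kf j t)"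
        using Cpos t by (simp add: Kf_def ennreal_mult[symmetric] kap_def mult_ac)
      finally show "ennreal (N j (heat_sg t c)) \<le> ennreal (N j c) * (ennreal Ch * Kf j t)" .
      have "ennreal (N j (Du G t)) \<le> ennreal (2^j) * Kc j (\<lambda>s. H j s * indicator {0..t} s) t"
        by (rule N_Du_dom[OF d li m Hm t])
      also have "\<dots> \<le> ennreal (2^j) * Kc j (H j) t"
        by (intro mult_left_mono nn_integral_mono) (auto simp: indicator_def)
      finally show "ennreal (N j (Du G t)) \<le> ennreal (2^j) * Kc j (H j) t" .
    qed
    finally show "Nt (Lin c G) j t \<le> ennreal (N j c) * (ennreal Ch * Kf j t) + ennreal (2^j) * Kc j (H j) t" .
  qed auto
qed

lemma Lin_continuous: assumes "loc_int (\<lambda>s. G s k)" shows "continuous_on {0..} (\<lambda>t. Lin c G t k)"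
proof -
  have "continuous_on {0..} (\<lambda>t. exp (- t * ksq k) *\<^sub>R c k + Du G t k)"
    by (intro continuous_intros Du_continuous[of G k] assms)
  then show ?thesis by (rule continuous_on_eq) (simp add: Lin_def)
qed

lemma Lin_meas: assumes "loc_int (\<lambda>s. G s k)" shows "(\<lambda>t. Lin c G t k) \<in> bmeas"
proof -
  have "(\<lambda>t. indicator {0..} t *\<^sub>R Lin c G t k) \<in> bmeas"
    by (rule borel_measurable_continuous_on_indicator[OF _ Lin_continuous[of G k, OF assms]]) simp
  moreover have "indicator {0..} t *\<^sub>R Lin c G t k = Lin c G t k" for t by (auto simp: indicator_def Lin_def)
  ultimately show ?thesis by simp
qed

lemma Lin_0: "c 0 = 0 \<Longrightarrow> (\<And>s. G s 0 = 0) \<Longrightarrow> Lin c G t 0 = 0"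
  by (simp add: Lin_def Du_def)

end

section \<open>Real-valued fields\<close>

definition herm :: "field \<Rightarrow> bool" where "herm c \<longleftrightarrow> (\<forall>k i. c (- k) $ i = cnj (c k $ i))"

lemma admissible_iff: "admissible c \<longleftrightarrow> c 0 = 0 \<and> herm c"
  by (simp add: admissible_def herm_def vec_eq_iff)

text \<open>Conjugation is its own inverse, so the two families are summable together; otherwise
  both sums are zero by convention.\<close>

lemma infsum_cnj: "(\<Sum>\<^sub>\<infinity>m\<in>A. cnj (f m)) = cnj (\<Sum>\<^sub>\<infinity>m\<in>A. f m)"
  by (rule infsum_bounded_linear_strong[OF summable_on_bounded_linear_iff[OF bounded_linear_cnj bounded_linear_cnj] bounded_linear_cnj]) simp

lemma conv_herm:
  assumes "\<And>m. a (- m) = cnj (a m)" "\<And>m. b (- m) = cnj (b m)"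
  shows "conv a b (- k) = cnj (conv a b k)"
proof -
  have "conv a b (- k) = (\<Sum>\<^sub>\<infinity>m\<in>UNIV. (\<lambda>m. a m * b (- k - m)) (- m))"
    unfolding conv_def by (rule infsum_reindex_bij_betw[symmetric]) (rule bij_uminus)
  also have "\<dots> = (\<Sum>\<^sub>\<infinity>m. cnj (a m * b (k - m)))"
  proof (rule infsum_cong)
    fix m
    have "- k - (- m) = - (k - m)" by simp
    then show "(\<lambda>m. a m * b (- k - m)) (- m) = cnj (a m * b (k - m))" by (simp only: assms complex_cnj_mult)
  qed
  finally show ?thesis unfolding infsum_cnj conv_def .
qed

lemma Pdiv_herm: assumes "herm a" "herm b" shows "herm (Pdiv_tensor a b)"
proof -
  have "conv (\<lambda>n. a n $ i) (\<lambda>n. b n $ m) (- k) = cnj (conv (\<lambda>n. a n $ i) (\<lambda>n. b n $ m) k)" for i m k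
    using assms by (intro conv_herm) (auto simp: herm_def)
  then show ?thesis unfolding herm_def leray_component
    by (simp add: mu_def rvec_minus sum_negf)
qed

lemma fcoeff_herm: "herm (fcoeff f)"
proof -
  have "(LINT x:cube|lborel. cis (- (rvec (- k) \<bullet> x)) * complex_of_real (f x $ i))
      = cnj (LINT x:cube|lborel. cis (- (rvec k \<bullet> x)) * complex_of_real (f x $ i))" for k i
  proof -
    have "(LINT x|lborel. indicator cube x *\<^sub>R (cis (- (rvec (- k) \<bullet> x)) * complex_of_real (f x $ i)))
        = (LINT x|lborel. cnj (indicator cube x *\<^sub>R (cis (- (rvec k \<bullet> x)) * complex_of_real (f x $ i))))"
      by (rule Bochner_Integration.integral_cong) (simp_all add: rvec_minus cis_cnj)
    then show ?thesis unfolding set_lebesgue_integral_def by (simp only: Bochner_Integration.integral_cnj)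
  qed
  then show ?thesis by (simp add: herm_def fcoeff_def)
qed

lemma ksq_minus: "ksq (- k) = ksq k" by (simp add: ksq_def)

lemma Du_herm:
  assumes li: "\<And>k. loc_int (\<lambda>s. G s k)" and h: "\<And>s. 0 \<le> s \<Longrightarrow> herm (G s)"
  shows "herm (Du G t)"
proof (cases "0 \<le> t")
  case True
  show ?thesis unfolding herm_def
  proof (intro allI)
    fix k i
    have c: "Du G t k $ i = (\<integral>s. (indicator {0..t} s *\<^sub>R (exp (- (t - s) * ksq k) *\<^sub>R G s k)) $ i \<partial>lborel)" for k
      unfolding Du_def by (rule integral_bounded_linear[symmetric, OF bounded_linear_vec_nth Du_integrable[of G k t, OF li True]])
    have "(\<integral>s. (indicator {0..t} s *\<^sub>R (exp (- (t - s) * ksq (- k)) *\<^sub>R G s (- k))) $ i \<partial>lborel)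
        = (\<integral>s. cnj ((indicator {0..t} s *\<^sub>R (exp (- (t - s) * ksq k) *\<^sub>R G s k)) $ i) \<partial>lborel)"
    proof (rule Bochner_Integration.integral_cong[OF refl])
      fix s
      show "(indicator {0..t} s *\<^sub>R (exp (- (t - s) * ksq (- k)) *\<^sub>R G s (- k))) $ i
          = cnj ((indicator {0..t} s *\<^sub>R (exp (- (t - s) * ksq k) *\<^sub>R G s k)) $ i)"
        using h[of s] by (cases "s \<in> {0..t}") (auto simp: herm_def ksq_minus)
    qed
    then show "Du G t (- k) $ i = cnj (Du G t k $ i)" unfolding c by (simp only: Bochner_Integration.integral_cnj)
  qed
qed (simp add: herm_def Du_neg)

lemma herm_add: "herm a \<Longrightarrow> herm b \<Longrightarrow> herm (\<lambda>k. a k + b k)"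
  and herm_diff: "herm a \<Longrightarrow> herm b \<Longrightarrow> herm (\<lambda>k. a k - b k)"
  by (simp_all add: herm_def)

lemma (in estimates) Lin_herm:
  assumes "herm c" "\<And>k. loc_int (\<lambda>s. G s k)" "\<And>s. 0 \<le> s \<Longrightarrow> herm (G s)"
  shows "herm (Lin c G t)"
  using Du_herm[of G t, OF assms(2,3)] assms(1) by (auto simp: herm_def Lin_def ksq_minus)

context drift
begin

lemma src_herm: assumes "herm (R s)" shows "herm (src R s)"
  unfolding src_def[abs_def] NLt_def Qt_def by (intro herm_add Pdiv_herm fcoeff_herm assms)

end

context picard_lin
begin

lemma Rs_herm:
  assumes "\<And>t. herm (L t)"
  shows "herm (Rs t)"
proof -
  have H: "herm (Rn n t)" for n t
  proof (induction n arbitrary: t)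
    case (Suc n)
    have "herm (Du (src (Rn n)) t)"
      by (rule Du_herm) (use Rn_Yc[of n] in \<open>auto intro: src_loc_int src_herm Suc\<close>)
    then show ?case using herm_diff[OF assms[of t]] by (simp add: Phi_def[abs_def])
  qed (simp add: herm_def)
  show ?thesis
  proof (cases "0 \<le> t")
    case True
    show ?thesis unfolding herm_def
    proof (intro allI)
      fix k i
      have "(\<lambda>n. Rn n t (- k) $ i) \<longlonglongrightarrow> Rs t (- k) $ i" by (intro tendsto_vec_nth Rs_lim True)
      moreover have "(\<lambda>n. Rn n t (- k) $ i) \<longlonglongrightarrow> cnj (Rs t k $ i)"
        using tendsto_cnj[OF tendsto_vec_nth[OF Rs_lim[OF True, of k], of i]] H[of _ t] by (simp add: herm_def)
      ultimately show "Rs t (- k) $ i = cnj (Rs t k $ i)" by (rule LIMSEQ_unique)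
    qed
  qed (simp add: Rs_def herm_def)
qed

end

section \<open>The solution class\<close>

context estimates
begin

lemma in_besov_lo:
  assumes "c 0 = 0" "in_besov chi (-1 + 3/p) p c"
  shows "lo j * ennreal (N j c) \<le> ennreal (besov chi (-1 + 3/p) p c)"
proof (rule ennreal_power2_le_imp_le)
  have "(lo j * ennreal (N j c))^2 \<le> (\<Sum>j. (lo j * ennreal (N j c))^2)"
    using sum_le_suminf[of "\<lambda>j. (lo j * ennreal (N j c))^2" "{j}"] by simp
  also have "\<dots> = (besov_enn chi (-1 + 3/p) p c)^2" using assms(1) by (simp only: besov_enn_sq besov_sq_lo)
  finally show "(lo j * ennreal (N j c))^2 \<le> (ennreal (besov chi (-1 + 3/p) p c))^2"
    using assms(2) by (simp add: besov_enn_def)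
qed

text \<open>\<open>besov\<close> is 0 by convention outside the space, so a bound on it is
  informative only together with membership. This is what makes the continuity clause of
  \<open>sol_class\<close> usable.\<close>

lemma in_besov_diff:
  assumes z: "c 0 = 0" "d 0 = 0" and i: "in_besov chi (-1 + 3/p) p c" "in_besov chi (-1 + 3/p) p d"
  shows "in_besov chi (-1 + 3/p) p (\<lambda>k. c k - d k)"
proof -
  let ?E = "\<lambda>c. besov_enn chi (-1 + 3/p) p c"
  have E: "(\<integral>\<^sup>+j. (lo j * ennreal (N j c))^2 \<partial>count_space UNIV) = (?E c)^2" if "c 0 = 0" for c
    unfolding besov_enn_sq besov_sq_lo[of c, OF that] by (simp add: nn_integral_count_space_nat)
  have "(?E (\<lambda>k. c k - d k))^2 = (\<integral>\<^sup>+j. (lo j * ennreal (N j (\<lambda>k. c k - d k)))^2 \<partial>count_space UNIV)"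
    by (rule E[symmetric]) (simp add: z)
  also have "\<dots> \<le> (\<integral>\<^sup>+j. (lo j * ennreal (N j c) + lo j * ennreal (N j d))^2 \<partial>count_space UNIV)"
  proof (intro nn_integral_mono power_mono)
    fix j
    have "ennreal (N j (\<lambda>k. c k - d k)) \<le> ennreal (N j c) + ennreal (N j d)"
      by (rule N_diff_enn)
    then show "lo j * ennreal (N j (\<lambda>k. c k - d k)) \<le> lo j * ennreal (N j c) + lo j * ennreal (N j d)"
      unfolding distrib_left[symmetric] by (rule mult_left_mono) simp
  qed simp
  also have "\<dots> \<le> (?E c + ?E d)^2" by (rule Minkowski_L2) (simp_all add: E z)
  also have "\<dots> < \<infinity>" using i by (simp add: besov_enn_def power_less_top_ennreal)
  finally show ?thesis by (simp add: besov_enn_sq in_besov_def)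
qed

text \<open>Continuity in the weaker space \<open>B^(sg)_(p,\<infinity>)\<close>: one modulus for
  all weighted blocks, without summability. Uniqueness calls for continuity in this sense
  only.\<close>

definition Bc :: "(real \<Rightarrow> field) \<Rightarrow> bool" where
  "Bc R \<longleftrightarrow> (\<forall>t\<ge>0. \<forall>e>0. \<exists>d>0. \<forall>t'\<ge>0. \<bar>t' - t\<bar> < d \<longrightarrow> (\<forall>j. lo j * ennreal (N j (\<lambda>k. R t' k - R t k)) \<le> ennreal e))"

lemma sol_0: "sol_class chi p R \<Longrightarrow> 0 \<le> t \<Longrightarrow> R t 0 = 0"
  by (simp add: sol_class_def admissible_def)

lemma sol_Bc: assumes R: "sol_class chi p R" shows "Bc R"
  unfolding Bc_def
proof (intro allI impI)
  fix t e :: real assume t: "0 \<le> t" and e: "0 < e"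
  obtain d where d: "d > 0" "\<And>t'. 0 \<le> t' \<Longrightarrow> \<bar>t' - t\<bar> < d \<Longrightarrow> besov chi (-1 + 3/p) p (\<lambda>k. R t' k - R t k) < e"
    using R t e unfolding sol_class_def by blast
  show "\<exists>d>0. \<forall>t'\<ge>0. \<bar>t' - t\<bar> < d \<longrightarrow> (\<forall>j. lo j * ennreal (N j (\<lambda>k. R t' k - R t k)) \<le> ennreal e)"
  proof (intro exI conjI allI impI)
    fix t' j assume t': "0 \<le> t'" "\<bar>t' - t\<bar> < d"
    have "in_besov chi (-1 + 3/p) p (\<lambda>k. R t' k - R t k)"
      using R t t' by (intro in_besov_diff sol_0[OF R]) (auto simp: sol_class_def)
    then have "lo j * ennreal (N j (\<lambda>k. R t' k - R t k)) \<le> ennreal (besov chi (-1 + 3/p) p (\<lambda>k. R t' k - R t k))"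
      by (intro in_besov_lo) (simp_all add: sol_0[OF R] t t')
    also have "\<dots> \<le> ennreal e" using d(2)[OF t'] by (intro ennreal_leI) simp
    finally show "lo j * ennreal (N j (\<lambda>k. R t' k - R t k)) \<le> ennreal e" .
  qed (rule d)
qed

lemma Bc_coeff:
  assumes R: "Bc R" and z: "\<And>t. 0 \<le> t \<Longrightarrow> R t 0 = 0"
  shows "continuous_on {0..} (\<lambda>t. R t k)"
proof (cases "k = 0")
  case True
  have "continuous_on {0..} (\<lambda>t::real. 0::complex^3)" by simp
  then show ?thesis by (rule continuous_on_eq) (simp add: True z)
next
  case False
  obtain C J where C: "C > 0" "\<And>c. norm (c k) \<le> C * (\<Sum>j\<le>J. N j c)" by (rule coeff_bound[OF False]) blast
  define S where "S = (\<Sum>j\<le>J. 2 powr (- real j * sg))"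
  have S: "S > 0" unfolding S_def by (rule sum_pos) auto
  show ?thesis
    unfolding continuous_on_iff
  proof (intro ballI allI impI)
    fix t e :: real assume "t \<in> {0..}" and e: "0 < e"
    then have t: "0 \<le> t" by simp
    define e' where "e' = e / (2 * C * S)"
    have e': "0 < e'" using e C S by (simp add: e'_def)
    obtain d where d: "d > 0" "\<forall>t'\<ge>0. \<bar>t' - t\<bar> < d \<longrightarrow> (\<forall>j. lo j * ennreal (N j (\<lambda>k. R t' k - R t k)) \<le> ennreal e')"
      using R[unfolded Bc_def, rule_format, OF t e'] by (elim exE conjE)
    show "\<exists>d>0. \<forall>x'\<in>{0..}. dist x' t < d \<longrightarrow> dist (R x' k) (R t k) < e"
    proof (intro exI conjI ballI impI)
      fix t' assume t': "t' \<in> {0..}" "dist t' t < d"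
      have Nb: "N j (\<lambda>k. R t' k - R t k) \<le> 2 powr (- real j * sg) * e'" for j
        using d(2)[rule_format, of t' j] t' e' by (intro N_le_of_lo) (auto simp: dist_real_def)
      have "norm (R t' k - R t k) \<le> C * (\<Sum>j\<le>J. N j (\<lambda>k. R t' k - R t k))" by (rule C(2))
      also have "\<dots> \<le> C * (\<Sum>j\<le>J. 2 powr (- real j * sg) * e')" using C(1) by (intro sum_mono mult_left_mono Nb) auto
      also have "\<dots> = C * (S * e')" unfolding S_def by (simp add: sum_distrib_right)
      also have "\<dots> = e / 2" using C S by (simp add: e'_def)
      finally show "dist (R t' k) (R t k) < e" using e by (simp add: dist_norm)
    qed (rule d)
  qed
qed

text \<open>The solution class says nothing about negative times, so the field is frozen there at
  its initial value. Measurability then follows from continuity of every coefficient.\<close>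

lemma sol_Yc: assumes R: "sol_class chi p R" shows "Yc (\<lambda>t. R (max 0 t))"
  unfolding Yc_def
proof (intro conjI allI)
  fix k
  have "continuous_on {0..} (\<lambda>t. R t k)" by (rule Bc_coeff[OF sol_Bc[OF R] sol_0[OF R]])
  then have "continuous_on UNIV (\<lambda>t. R (max 0 t) k)"
    by (rule continuous_on_compose2[of "{0..}" "\<lambda>t. R t k" UNIV "\<lambda>t. max 0 t"]) (auto intro!: continuous_intros)
  then show "(\<lambda>t. R (max 0 t) k) \<in> bmeas" by (rule borel_measurable_continuous_onI)
next
  have "(\<integral>\<^sup>+s\<in>{0..}. (\<Sum>j. (hi j * Nt (\<lambda>t. R (max 0 t)) j s)^2) \<partial>lborel)
      = (\<integral>\<^sup>+ t. indicator {0..} t * (besov_enn chi (3/p) p (R t))^2 \<partial>lborel)"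
    by (intro nn_integral_cong) (auto simp: indicator_def besov_enn_sq besov_sq_hi sol_0[OF R])
  then show "(\<integral>\<^sup>+s\<in>{0..}. (\<Sum>j. (hi j * Nt (\<lambda>t. R (max 0 t)) j s)^2) \<partial>lborel) < \<infinity>"
    using R by (simp add: sol_class_def)
qed (simp add: sol_0[OF R])

end

context picard_lin
begin

text \<open>The pointwise majorant by a square summable envelope gives membership and boundedness in
  the Besov space at every single time, beyond the blockwise bounds.\<close>

lemma Rs_sol_class:
  assumes h: "\<And>t. herm (L t)" and Lc: "\<And>k. continuous_on {0..} (\<lambda>t. L t k)"
  shows "sol_class chi p Rs"
proof -
  define M where "M = (\<Sum>j. ((ennreal (2^Nm) * 2) * D j)^2)"
  have Mfin: "M < \<infinity>" unfolding M_def power_mult_distrib[of "ennreal (2^Nm) * 2"] ennreal_suminf_cmult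
    using D2 by (simp add: ennreal_mult_less_top power_less_top_ennreal)
  have pt: "lo j * Nt Rs j t \<le> (ennreal (2^Nm) * 2) * D j" if "0 \<le> t" for j t by (rule MG_pointwise[OF Rs_MG that])
  have sq: "besov_sq chi (-1 + 3/p) p (Rs t) \<le> M" if "0 \<le> t" for t
    unfolding besov_sq_lo[of "Rs t", OF Rs_0] M_def using pt[OF that] by (intro suminf_le power_mono) auto
  have inb: "in_besov chi (-1 + 3/p) p (Rs t)" if "0 \<le> t" for t
    using sq[OF that] Mfin by (auto simp: in_besov_def)
  have coc: "continuous_on {0..} (\<lambda>t. Rs t k)" for k
  proof -
    have "continuous_on {0..} (\<lambda>t. Phi Rs t k)"
      unfolding Phi_def by (intro continuous_intros Lc Du_continuous[of "src Rs" k] src_loc_int Rs_Yc)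
    then show ?thesis by (rule continuous_on_eq) (simp add: Rs_fixed)
  qed
  \<comment> \<open>Along a sequence of times each block of the difference tends to zero because the
    coefficients are continuous; dominated convergence over \<open>j\<close> applies with the square
    summable envelope as majorant.\<close>
  have cont: "\<exists>d>0. \<forall>t'\<ge>0. \<bar>t' - t\<bar> < d \<longrightarrow> besov chi (-1 + 3/p) p (\<lambda>k. Rs t' k - Rs t k) < e" if t: "0 \<le> t" and e: "0 < e" for t e
  proof (rule ccontr)
    assume "\<not> ?thesis"
    then have "\<forall>d>0. \<exists>t'\<ge>0. \<bar>t' - t\<bar> < d \<and> e \<le> besov chi (-1 + 3/p) p (\<lambda>k. Rs t' k - Rs t k)" by (meson not_le)
    then have "\<forall>n. \<exists>t'\<ge>0. \<bar>t' - t\<bar> < inverse (real (Suc n)) \<and> e \<le> besov chi (-1 + 3/p) p (\<lambda>k. Rs t' k - Rs t k)"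
      by (intro allI) simp
    then obtain \<tau> where \<tau>: "\<And>n. 0 \<le> \<tau> n" "\<And>n. \<bar>\<tau> n - t\<bar> < inverse (real (Suc n))" "\<And>n. e \<le> besov chi (-1 + 3/p) p (\<lambda>k. Rs (\<tau> n) k - Rs t k)"
      by metis
    have "(\<lambda>n. \<tau> n - t) \<longlonglongrightarrow> 0"
      using \<tau>(2) by (intro Lim_null_comparison[OF always_eventually LIMSEQ_inverse_real_of_nat]) (auto intro: less_imp_le)
    then have "\<tau> \<longlonglongrightarrow> t" by (simp add: LIM_zero_iff)
    then have "(\<lambda>n. Rs (\<tau> n) k) \<longlonglongrightarrow> Rs t k" for k
      using coc[of k] t \<tau>(1) unfolding continuous_on_sequentially by (auto simp: o_def)
    then have "(\<lambda>n. Rs (\<tau> n) k - Rs t k) \<longlonglongrightarrow> 0" for k by (simp add: LIM_zero_iff)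
    then have N0: "(\<lambda>n. N j (\<lambda>k. Rs (\<tau> n) k - Rs t k)) \<longlonglongrightarrow> 0" for j by (rule N_tendsto_0)
    let ?f = "\<lambda>n j. (lo j * ennreal (N j (\<lambda>k. Rs (\<tau> n) k - Rs t k)))^2"
    have "(\<lambda>n. \<integral>\<^sup>+j. ?f n j \<partial>count_space UNIV) \<longlonglongrightarrow> (\<integral>\<^sup>+j. 0 \<partial>count_space (UNIV :: nat set))"
    proof (rule nn_integral_dominated_convergence[of ?f "count_space UNIV" "\<lambda>j. 0" "\<lambda>j. (2 * ((ennreal (2^Nm) * 2) * D j))^2"])
      show "AE j in count_space UNIV. ?f n j \<le> (2 * ((ennreal (2^Nm) * 2) * D j))^2" for n
      proof (intro AE_I2 power_mono)
        fix j
        have "ennreal (N j (\<lambda>k. Rs (\<tau> n) k - Rs t k)) \<le> Nt Rs j (\<tau> n) + Nt Rs j t"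
          by (rule N_diff_enn)
        then have "lo j * ennreal (N j (\<lambda>k. Rs (\<tau> n) k - Rs t k)) \<le> lo j * Nt Rs j (\<tau> n) + lo j * Nt Rs j t"
          unfolding distrib_left[symmetric] by (rule mult_left_mono) simp
        also have "\<dots> \<le> (ennreal (2^Nm) * 2) * D j + (ennreal (2^Nm) * 2) * D j" by (intro add_mono pt \<tau> t)
        finally show "lo j * ennreal (N j (\<lambda>k. Rs (\<tau> n) k - Rs t k)) \<le> 2 * ((ennreal (2^Nm) * 2) * D j)" by (simp only: mult_2)
      qed simp
      have "(\<integral>\<^sup>+j. (2 * ((ennreal (2^Nm) * 2) * D j))^2 \<partial>count_space UNIV) = 2^2 * M"
        unfolding M_def power_mult_distrib[of 2] by (simp add: nn_integral_count_space_nat)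
      then show "(\<integral>\<^sup>+j. (2 * ((ennreal (2^Nm) * 2) * D j))^2 \<partial>count_space UNIV) < \<infinity>"
        using Mfin by (simp add: ennreal_mult_less_top)
      show "AE j in count_space UNIV. (\<lambda>n. ?f n j) \<longlonglongrightarrow> 0"
      proof (rule AE_I2)
        fix j
        have "(\<lambda>n. ennreal ((2 powr (real j * sg) * N j (\<lambda>k. Rs (\<tau> n) k - Rs t k))^2)) \<longlonglongrightarrow> ennreal ((2 powr (real j * sg) * 0)^2)"
          by (intro tendsto_ennrealI tendsto_intros N0)
        then show "(\<lambda>n. ?f n j) \<longlonglongrightarrow> 0" by (simp add: ennreal_mult[symmetric] ennreal_power)
      qed
    qed auto
    moreover have "besov_sq chi (-1 + 3/p) p (\<lambda>k. Rs (\<tau> n) k - Rs t k) = (\<integral>\<^sup>+j. ?f n j \<partial>count_space UNIV)" for n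
      by (subst besov_sq_lo) (simp_all add: Rs_0 nn_integral_count_space_nat)
    ultimately have "(\<lambda>n. besov_sq chi (-1 + 3/p) p (\<lambda>k. Rs (\<tau> n) k - Rs t k)) \<longlonglongrightarrow> 0"
      by (simp only: nn_integral_const mult_zero_left)
    then have "(\<lambda>n. sqrt (enn2real (besov_sq chi (-1 + 3/p) p (\<lambda>k. Rs (\<tau> n) k - Rs t k)))) \<longlonglongrightarrow> sqrt (enn2real 0)"
      by (intro tendsto_real_sqrt tendsto_enn2real) auto
    then have "(\<lambda>n. besov chi (-1 + 3/p) p (\<lambda>k. Rs (\<tau> n) k - Rs t k)) \<longlonglongrightarrow> 0" by (simp add: besov_def)
    then have "e \<le> 0" by (rule LIMSEQ_le_const) (use \<tau>(3) in auto)
    then show False using e by simp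
  qed
  have bdd: "besov chi (-1 + 3/p) p (Rs t) \<le> sqrt (enn2real M)" if "0 \<le> t" for t
    unfolding besov_def using sq[OF that] Mfin by (intro real_sqrt_le_mono enn2real_mono) auto
  have "(\<integral>\<^sup>+ t. indicator {0..} t * (besov_enn chi (3/p) p (Rs t))^2 \<partial>lborel)
      = (\<integral>\<^sup>+s\<in>{0..}. (\<Sum>j. (hi j * Nt Rs j s)^2) \<partial>lborel)"
    by (intro nn_integral_cong) (simp add: besov_enn_sq besov_sq_hi Rs_0 mult.commute)
  then have "(\<integral>\<^sup>+ t. indicator {0..} t * (besov_enn chi (3/p) p (Rs t))^2 \<partial>lborel) < \<infinity>"
    using Rs_Yc by (simp add: Yc_def)
  then show ?thesis unfolding sol_class_def using cont bdd inb Rs_herm[of t for t, OF h] Rs_0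
    by (auto simp: admissible_iff)
qed

end

section \<open>Uniqueness\<close>

context drift
begin

context
  fixes a b dw :: "real \<Rightarrow> field" and t0 :: real
  assumes Y: "Yc a" "Yc b" "Yc dw" and t0: "0 \<le> t0"
    and eq: "\<And>t k. 0 \<le> t \<Longrightarrow> dw t k = - ((Du (NLt dw a) t k + Du (NLt b dw) t k) + Du (Qt dw) t k)"
    and zero: "\<And>s k. 0 \<le> s \<Longrightarrow> s < t0 \<Longrightarrow> dw s k = 0"
begin

text \<open>\<open>dw\<close> vanishes before \<open>t0\<close> and with it all three majorants of
  the sources, so the time integrals start at \<open>t0\<close>.\<close>

lemma diff_bound:
  assumes t: "t0 \<le> t"
  shows "Nt dw j t \<le> (ennreal (2^j) * Kc j (\<lambda>s. Hb dw a j s * indicator {t0..t} s) t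
     + ennreal (2^j) * Kc j (\<lambda>s. Hb b dw j s * indicator {t0..t} s) t)
     + ennreal (2^j) * Kc j (\<lambda>s. Hu dw j s * indicator {t0..t} s) t"
proof -
  have tt: "0 \<le> t" using t t0 by simp
  have N0: "N i (dw s) = 0" if "0 \<le> s" "s < t0" for i s
    using zero[OF that] N_cong[of "dw s" "\<lambda>k. 0" i] by simp
  have H0: "Hb dw a j s = 0" "Hb b dw j s = 0" "Hu dw j s = 0" if "0 \<le> s" "s < t0" for s
    using N0[OF that] by (simp_all add: Hb_def Hu_def)
  have loc: "Kc j (\<lambda>s. H s * indicator {0..t} s) t = Kc j (\<lambda>s. H s * indicator {t0..t} s) t"
    if "\<And>s. 0 \<le> s \<Longrightarrow> s < t0 \<Longrightarrow> H s = 0" for H :: "real \<Rightarrow> ennreal"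
    using that t0 by (intro nn_integral_cong) (auto simp: indicator_def)
  have "dw t k = - ((Du (NLt dw a) t k + Du (NLt b dw) t k) + Du (Qt dw) t k)" for k by (rule eq[OF tt])
  then have "N j (dw t) = N j (\<lambda>k. (-1) *\<^sub>R ((Du (NLt dw a) t k + Du (NLt b dw) t k) + Du (Qt dw) t k))"
    by (intro N_cong) simp
  also have "\<dots> = N j (\<lambda>k. (Du (NLt dw a) t k + Du (NLt b dw) t k) + Du (Qt dw) t k)" by (subst N_scale) simp
  also have "\<dots> \<le> (N j (Du (NLt dw a) t) + N j (Du (NLt b dw) t)) + N j (Du (Qt dw) t)"
    using N_add[of j "\<lambda>k. Du (NLt dw a) t k + Du (NLt b dw) t k" "Du (Qt dw) t"] N_add[of j "Du (NLt dw a) t" "Du (NLt b dw) t"] by linarith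
  finally have "Nt dw j t \<le> (ennreal (N j (Du (NLt dw a) t)) + ennreal (N j (Du (NLt b dw) t))) + ennreal (N j (Du (Qt dw) t))"
    by (simp add: ennreal_plus[symmetric] ennreal_leI del: ennreal_plus)
  also have "\<dots> \<le> (ennreal (2^j) * Kc j (\<lambda>s. Hb dw a j s * indicator {0..t} s) t
     + ennreal (2^j) * Kc j (\<lambda>s. Hb b dw j s * indicator {0..t} s) t)
     + ennreal (2^j) * Kc j (\<lambda>s. Hu dw j s * indicator {0..t} s) t"
    using N_Du_dom[OF dom_NLt[OF Y(3,1)] loc_int_NLt[OF Y(3,1)] NLt_meas[OF Y(3,1)] Hb_meas[OF Y(3,1)] tt, of j]
      N_Du_dom[OF dom_NLt[OF Y(2,3)] loc_int_NLt[OF Y(2,3)] NLt_meas[OF Y(2,3)] Hb_meas[OF Y(2,3)] tt, of j]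
      N_Du_dom[OF dom_Qt[OF Y(3)] loc_int_Qt[OF Y(3)] Qt_meas[OF Y(3)] Hu_meas[OF Y(3)] tt, of j]
    by (intro add_mono)
  finally show ?thesis by (simp only: loc[OF H0(1)] loc[OF H0(2)] loc[OF H0(3)])
qed

text \<open>At \<open>t0\<close> the remaining interval of integration is a single point. The two
  fields thus still agree at the first time of difference, and the problem restarts there with zero
  data.\<close>

lemma dw_t0: "dw t0 k = 0"
proof (cases "k = 0")
  case False
  have "Nt dw j t0 = 0" for j
  proof -
    have "Kc j (\<lambda>s. H s * indicator {t0..t0} s) t0 = 0" for H
    proof -
      have "Kc j (\<lambda>s. H s * indicator {t0..t0} s) t0 = (\<integral>\<^sup>+s. 0 \<partial>(lborel :: real measure))"
        using AE_lborel_singleton[of t0] by (intro nn_integral_cong_AE) (auto simp: indicator_def)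
      then show ?thesis by simp
    qed
    then show ?thesis using diff_bound[of t0 j] by simp
  qed
  then have "N j (dw t0) \<le> 0" for j by (simp only: ennreal_eq_0_iff)
  then have "N j (dw t0) = 0" for j by (rule antisym) simp
  then show ?thesis using N_eq_0_imp False by blast
qed (simp add: Yc_0[OF Y(3)])

text \<open>The contraction estimate for the constant envelope on one interval. Smallness of the
  quadratic part comes from the bounds for \<open>a\<close> and \<open>b\<close>, that of the drift
  part from \<open>g\<close>.\<close>

lemma diff_halve:
  assumes w: "MJ {t0..t1} (Nt dw) (\<lambda>i. ennreal \<eta> * 1)" and a: "MJ {t0..t1} (Nt a) (\<lambda>i. ennreal ra * 1)"
    and b: "MJ {t0..t1} (Nt b) (\<lambda>i. ennreal rb * 1)" and V: "(\<integral>\<^sup>+s\<in>{t0..t1}. (V s)^2 \<partial>lborel) \<le> (ennreal g)^2"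
    and pos: "0 \<le> \<eta>" "0 \<le> ra" "0 \<le> rb" "0 \<le> g" and small: "2 * Cp * CD * CD * (ra + rb) + 2 * Cu * CD * g \<le> 1/2"
  shows "MJ {t0..t1} (Nt dw) (\<lambda>i. ennreal (\<eta> / 2) * 1)"
  unfolding MJ_def
proof
  fix j
  let ?J = "{t0..t1}"
  have env: "envelope dl CD 1 (\<lambda>_. 1)" unfolding CD_def by (rule envelope_const[OF dl(1)])
  have J: "?J \<in> sets borel" by simp
  have m: "Hb dw a j \<in> bmeas" "Hb b dw j \<in> bmeas" "Hu dw j \<in> bmeas"
    by (intro Hb_meas Hu_meas Y)+
  note [measurable] = m
  have "outb UNIV j (\<lambda>t. (ennreal (2^j) * Kc j (\<lambda>s. Hb dw a j s * indicator ?J s) t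
     + ennreal (2^j) * Kc j (\<lambda>s. Hb b dw j s * indicator ?J s) t)
     + ennreal (2^j) * Kc j (\<lambda>s. Hu dw j s * indicator ?J s) t)
     ((ennreal Cp * (ennreal (2 * CD * CD) * 1 * ennreal \<eta> * ennreal ra * 1) + ennreal Cp * (ennreal (2 * CD * CD) * 1 * ennreal rb * ennreal \<eta> * 1))
       + ennreal (2 * Cu) * (ennreal g * ennreal \<eta> * (ennreal CD * 1)))" (is "outb UNIV j ?F ?E")
    by (intro outb_add outb_Hb[OF Y(3,1) J w a env] outb_Hb[OF Y(2,3) J b w env] outb_Hu[OF Y(3) J w V env]; measurable)
  then show "outb ?J j (Nt dw j) (ennreal (\<eta> / 2) * 1)"
  proof (rule outb_mono)
    fix t assume t: "t \<in> ?J"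
    have mono: "ennreal (2^j) * Kc j (\<lambda>s. H s * indicator {t0..t} s) t
       \<le> ennreal (2^j) * Kc j (\<lambda>s. H s * indicator ?J s) t" for H
      using t by (intro mult_left_mono nn_integral_mono) (auto simp: indicator_def)
    show "Nt dw j t \<le> ?F t"
      by (rule order_trans[OF diff_bound add_mono[OF add_mono]]) (use t mono in auto)
  next
    have "?E = ennreal ((2 * Cp * CD * CD * (ra + rb) + 2 * Cu * CD * g) * \<eta>)"
      using pos Cpos CD_pos by (simp add: ennreal_mult[symmetric] ennreal_plus[symmetric] algebra_simps del: ennreal_plus)
    also have "\<dots> \<le> ennreal (1/2 * \<eta>)" by (intro ennreal_leI mult_right_mono small pos)
    finally show "?E \<le> ennreal (\<eta> / 2) * 1" by simp
  qed auto
qed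

text \<open>Halving is iterated from one finite bound \<open>\<eta>\<close>, so no possibly infinite
  quantity has to be cancelled.\<close>

lemma diff_local_zero:
  assumes w: "MJ {t0..t1} (Nt dw) (\<lambda>i. ennreal \<eta> * 1)" and a: "MJ {t0..t1} (Nt a) (\<lambda>i. ennreal ra * 1)"
    and b: "MJ {t0..t1} (Nt b) (\<lambda>i. ennreal rb * 1)" and V: "(\<integral>\<^sup>+s\<in>{t0..t1}. (V s)^2 \<partial>lborel) \<le> (ennreal g)^2"
    and pos: "0 \<le> \<eta>" "0 \<le> ra" "0 \<le> rb" "0 \<le> g" and small: "2 * Cp * CD * CD * (ra + rb) + 2 * Cu * CD * g \<le> 1/2"
    and t: "t0 \<le> t" "t \<le> t1"
  shows "dw t k = 0"
proof (cases "k = 0")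
  case False
  have M: "MJ {t0..t1} (Nt dw) (\<lambda>i. ennreal (\<eta> / 2^n) * 1)" for n
  proof (induction n)
    case (Suc n)
    have "MJ {t0..t1} (Nt dw) (\<lambda>i. ennreal (\<eta> / 2^n / 2) * 1)"
      by (rule diff_halve[OF Suc a b V _ pos(2-4) small]) (simp add: pos)
    then show ?case by (simp add: mult.commute)
  qed (use w in simp)
  have "N j (dw t) = 0" for j
  proof -
    have le: "2 powr (real j * sg) * N j (dw t) \<le> \<eta> / 2^n" for n
    proof -
      have "ennreal (2 powr (real j * sg) * N j (dw t)) \<le> ennreal (\<eta> / 2^n)"
        using M[of n] t by (auto simp: MJ_def outb_def ennreal_mult)
      then show ?thesis using pos by (subst (asm) ennreal_le_iff) auto
    qed
    have "(\<lambda>n. \<eta> * (1/2)^n) \<longlonglongrightarrow> 0" by (intro tendsto_mult_right_zero LIMSEQ_realpow_zero) auto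
    then have "2 powr (real j * sg) * N j (dw t) \<le> 0"
      by (rule LIMSEQ_le_const) (use le in \<open>auto simp: power_one_over\<close>)
    then show ?thesis by (simp add: mult_le_0_iff antisym)
  qed
  then show ?thesis using N_eq_0_imp False by blast
qed (simp add: Yc_0[OF Y(3)])

end

end

lemma small_interval:
  fixes f :: "real \<Rightarrow> ennreal"
  assumes f: "f \<in> bmeas" "(\<integral>\<^sup>+s\<in>{0..}. f s \<partial>lborel) < \<infinity>" and t: "0 \<le> t" and e: "0 < (e::real)"
  obtains d where "0 < d" "(\<integral>\<^sup>+s\<in>{t..t + d}. f s \<partial>lborel) \<le> ennreal e"
proof -
  from cont_primitive[OF f] obtain U :: "real \<Rightarrow> real" where U: "continuous_on {0..} U"
    "\<And>a b. 0 \<le> a \<Longrightarrow> a \<le> b \<Longrightarrow> (\<integral>\<^sup>+s\<in>{a..b}. f s \<partial>lborel) = ennreal (U b - U a)" by metis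
  obtain d where d: "0 < d" "\<And>x. x \<in> {0..} \<Longrightarrow> dist x t < d \<Longrightarrow> dist (U x) (U t) < e"
    using U(1) t e unfolding continuous_on_iff by (meson atLeast_iff)
  show ?thesis
  proof (rule that[of "d/2"])
    have "dist (U (t + d/2)) (U t) < e" using d t by (intro d(2)) (auto simp: dist_real_def)
    then have "U (t + d/2) - U t \<le> e" by (simp add: dist_real_def)
    then show "(\<integral>\<^sup>+s\<in>{t..t + d/2}. f s \<partial>lborel) \<le> ennreal e" using U(2)[of t "t + d/2"] t d(1) by (simp add: ennreal_leI)
  qed (use d in simp)
qed

context drift
begin

lemma MJ_short:
  assumes R: "Yc R" and sup: "\<And>t j. t \<in> {t0..t1} \<Longrightarrow> lo j * Nt R j t \<le> ennreal r"
    and L2: "(\<integral>\<^sup>+s\<in>{t0..t1}. (\<Sum>j. (hi j * Nt R j s)^2) \<partial>lborel) \<le> ennreal (r^2)" and r: "0 \<le> r"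
  shows "MJ {t0..t1} (Nt R) (\<lambda>i. ennreal r * 1)"
  unfolding MJ_def outb_def
proof (intro allI conjI ballI)
  fix j
  have "(\<integral>\<^sup>+t\<in>{t0..t1}. (hi j * Nt R j t)^2 \<partial>lborel) \<le> (\<integral>\<^sup>+s\<in>{t0..t1}. (\<Sum>j. (hi j * Nt R j s)^2) \<partial>lborel)"
  proof (intro nn_integral_mono mult_right_mono)
    show "(hi j * Nt R j s)^2 \<le> (\<Sum>j. (hi j * Nt R j s)^2)" for s
      using sum_le_suminf[of "\<lambda>j. (hi j * Nt R j s)^2" "{j}"] by simp
  qed simp
  also have "\<dots> \<le> (ennreal r)^2" using L2 r by (simp add: ennreal_power)
  finally show "(\<integral>\<^sup>+t\<in>{t0..t1}. (hi j * Nt R j t)^2 \<partial>lborel) \<le> (ennreal r * 1)^2" by simp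
qed (use sup in simp)

text \<open>Only \<open>b\<close> has to be small. Just after the first time \<open>t0\<close> of
  difference, \<open>a\<close> differs from \<open>b\<close> by \<open>dw\<close>, which vanishes at
  \<open>t0\<close> and is small nearby by continuity; so \<open>a\<close> is small there with no
  global bound on its size.\<close>

lemma diff_zero:
  assumes Y: "Yc a" "Yc b" and B: "Bc a" "Bc b"
    and eq: "\<And>t k. 0 \<le> t \<Longrightarrow> a t k - b t k = - (Du (src a) t k - Du (src b) t k)"
    and rb: "\<And>t j. 0 \<le> t \<Longrightarrow> lo j * Nt b j t \<le> ennreal rb" "0 < rb" "4 * Cp * CD * CD * rb \<le> 1/8"
    and t: "0 \<le> t"
  shows "a t k = b t k"
proof (rule ccontr)
  assume ne: "a t k \<noteq> b t k"
  define dw where "dw t k = a t k - b t k" for t k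
  have dw: "dw = (\<lambda>t k. a t k - b t k)" by (simp add: fun_eq_iff dw_def)
  have wY: "Yc dw" unfolding dw by (rule Yc_diff[OF Y])
  have weq: "dw t k = - ((Du (NLt dw a) t k + Du (NLt b dw) t k) + Du (Qt dw) t k)" if "0 \<le> t" for t k
    using eq[OF that, of k] src_diff[OF Y, of t k] unfolding dw by simp
  define S where "S = {t. 0 \<le> t \<and> (\<exists>k. dw t k \<noteq> 0)}"
  have S: "t \<in> S" "S \<noteq> {}" "bdd_below S" using ne t by (auto simp: S_def dw_def intro!: bdd_belowI[of _ 0])
  define t0 where "t0 = Inf S"
  have t0: "0 \<le> t0" unfolding t0_def by (rule cInf_greatest[OF S(2)]) (simp add: S_def)
  have zero: "dw s k = 0" if "0 \<le> s" "s < t0" for s k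
    using cInf_lower[OF _ S(3), of s] that by (force simp: S_def t0_def)
  have w0: "a t0 k = b t0 k" for k using dw_t0[OF Y wY t0 weq zero, of k] by (simp add: dw_def)
  \<comment> \<open>\<open>\<eta>\<close> and \<open>g\<close> each contribute 1/8 to the
    contraction factor, and \<open>rb\<close> at most 1/8; the total 3/8 is below 1/2.\<close>
  define \<eta> where "\<eta> = 1 / (16 * Cp * CD * CD)"
  define g where "g = 1 / (16 * Cu * CD)"
  have pos: "0 < \<eta>" "0 < g" using Cpos CD_pos by (auto simp: \<eta>_def g_def)
  have small: "2 * Cp * CD * CD * ((\<eta> + rb) + rb) + 2 * Cu * CD * g \<le> 1/2"
  proof -
    have "2 * Cp * CD * CD * \<eta> = 1/8" "2 * Cu * CD * g = 1/8" using Cpos CD_pos by (auto simp: \<eta>_def g_def)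
    moreover have "2 * Cp * CD * CD * ((\<eta> + rb) + rb) = 2 * Cp * CD * CD * \<eta> + 4 * Cp * CD * CD * rb" by (simp add: algebra_simps)
    ultimately show ?thesis using rb(3) by simp
  qed
  have half: "0 < \<eta> / 2" using pos by simp
  obtain d1 where d1: "d1 > 0" "\<forall>t'\<ge>0. \<bar>t' - t0\<bar> < d1 \<longrightarrow> (\<forall>j. lo j * ennreal (N j (\<lambda>k. a t' k - a t0 k)) \<le> ennreal (\<eta> / 2))"
    using B(1)[unfolded Bc_def, rule_format, OF t0 half] by (elim exE conjE)
  obtain d2 where d2: "d2 > 0" "\<forall>t'\<ge>0. \<bar>t' - t0\<bar> < d2 \<longrightarrow> (\<forall>j. lo j * ennreal (N j (\<lambda>k. b t' k - b t0 k)) \<le> ennreal (\<eta> / 2))"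
    using B(2)[unfolded Bc_def, rule_format, OF t0 half] by (elim exE conjE)
  have Nm: "Nt R j \<in> bmeas" if "Yc R" for R j by (intro Nt_meas Yc_meas that)
  have fm: "(\<lambda>s. \<Sum>j. (hi j * Nt R j s)^2) \<in> bmeas" if "Yc R" for R
  proof -
    note [measurable] = Nm[OF that]
    show ?thesis by measurable
  qed
  have ff: "(\<integral>\<^sup>+s\<in>{0..}. (\<Sum>j. (hi j * Nt R j s)^2) \<partial>lborel) < \<infinity>" if "Yc R" for R using that by (simp add: Yc_def)
  obtain d3 where d3: "0 < d3" "(\<integral>\<^sup>+s\<in>{t0..t0 + d3}. (\<Sum>j. (hi j * Nt dw j s)^2) \<partial>lborel) \<le> ennreal (\<eta>^2)"
    by (rule small_interval[OF fm[OF wY] ff[OF wY] t0, of "\<eta>^2"]) (use pos in auto)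
  obtain d4 where d4: "0 < d4" "(\<integral>\<^sup>+s\<in>{t0..t0 + d4}. (\<Sum>j. (hi j * Nt b j s)^2) \<partial>lborel) \<le> ennreal (rb^2)"
    by (rule small_interval[OF fm[OF Y(2)] ff[OF Y(2)] t0, of "rb^2"]) (use rb(2) in auto)
  obtain d5 where d5: "0 < d5" "(\<integral>\<^sup>+s\<in>{t0..t0 + d5}. (V s)^2 \<partial>lborel) \<le> ennreal (g^2)"
    by (rule small_interval[of "\<lambda>s. (V s)^2" t0 "g^2"]) (use u0fin t0 pos in auto)
  define t1 where "t1 = t0 + min (min (d1/2) (d2/2)) (min d3 (min d4 d5))"
  have t1: "t0 < t1" "t1 \<le> t0 + d1/2" "t1 \<le> t0 + d2/2" "t1 \<le> t0 + d3" "t1 \<le> t0 + d4" "t1 \<le> t0 + d5"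
    using d1(1) d2(1) d3(1) d4(1) d5(1) by (auto simp: t1_def)
  have short: "(\<integral>\<^sup>+s\<in>{t0..t1}. f s \<partial>lborel) \<le> E" if "(\<integral>\<^sup>+s\<in>{t0..t0 + d}. f s \<partial>lborel) \<le> E" "t1 \<le> t0 + d" for f d E
    by (rule order_trans[OF nn_integral_mono that(1)]) (use that(2) in \<open>auto simp: indicator_def\<close>)
  have wsup: "lo j * Nt dw j s \<le> ennreal \<eta>" if s: "s \<in> {t0..t1}" for s j
  proof -
    have s': "0 \<le> s" "\<bar>s - t0\<bar> < d1" "\<bar>s - t0\<bar> < d2" using s t0 t1 d1(1) d2(1) by auto
    have e: "dw s = (\<lambda>k. (a s k - a t0 k) - (b s k - b t0 k))" by (simp add: fun_eq_iff dw_def w0)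
    have "Nt dw j s \<le> ennreal (N j (\<lambda>k. a s k - a t0 k)) + ennreal (N j (\<lambda>k. b s k - b t0 k))"
      unfolding e by (rule N_diff_enn)
    then have "lo j * Nt dw j s \<le> lo j * ennreal (N j (\<lambda>k. a s k - a t0 k)) + lo j * ennreal (N j (\<lambda>k. b s k - b t0 k))"
      unfolding distrib_left[symmetric] by (rule mult_left_mono) simp
    also have "\<dots> \<le> ennreal (\<eta>/2) + ennreal (\<eta>/2)" by (intro add_mono d1(2)[rule_format] d2(2)[rule_format] s')
    also have "\<dots> = ennreal \<eta>" using pos by (simp add: ennreal_plus[symmetric] del: ennreal_plus)
    finally show ?thesis .
  qed
  have Mw: "MJ {t0..t1} (Nt dw) (\<lambda>i. ennreal \<eta> * 1)"
    using pos by (intro MJ_short wY wsup short[OF d3(2) t1(4)]) auto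
  have Mb: "MJ {t0..t1} (Nt b) (\<lambda>i. ennreal rb * 1)"
    using rb(2) t0 by (intro MJ_short Y rb(1) short[OF d4(2) t1(5)]) auto
  \<comment> \<open>\<open>a = dw + b\<close> on the interval, hence the bound
    \<open>\<eta> + rb\<close>.\<close>
  have Ma: "MJ {t0..t1} (Nt a) (\<lambda>i. ennreal (\<eta> + rb) * 1)"
    unfolding MJ_def
  proof
    fix j
    have "outb {t0..t1} j (\<lambda>t. Nt dw j t + Nt b j t) (ennreal \<eta> * 1 + ennreal rb * 1)"
      using Mw Mb by (intro outb_add Nm wY Y) (auto simp: MJ_def)
    then show "outb {t0..t1} j (Nt a j) (ennreal (\<eta> + rb) * 1)"
    proof (rule outb_mono)
      fix t
      show "Nt a j t \<le> Nt dw j t + Nt b j t" using N_add_enn[of j "dw t" "b t"] by (simp add: dw_def)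
    qed (use pos rb(2) in auto)
  qed
  have MV: "(\<integral>\<^sup>+s\<in>{t0..t1}. (V s)^2 \<partial>lborel) \<le> (ennreal g)^2"
    using short[OF d5(2) t1(6)] pos by (simp add: ennreal_power)
  have z: "dw s k = 0" if "t0 \<le> s" "s \<le> t1" for s k
    by (rule diff_local_zero[OF Y wY t0 weq zero Mw Ma Mb MV _ _ _ _ small that]) (use pos rb(2) in auto)
  have "t1 \<le> Inf S"
  proof (rule cInf_greatest[OF S(2)])
    fix s assume s: "s \<in> S"
    then have "t0 \<le> s" unfolding t0_def by (rule cInf_lower[OF _ S(3)])
    then show "t1 \<le> s" using z[of s] s by (force simp: S_def)
  qed
  then show False using t1(1) by (simp add: t0_def)
qed

text \<open>Values of gauge integrals are unique, so the formulation by \<open>has_integral\<close>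
  becomes an equation for \<open>Du\<close>. \<open>G\<close> and \<open>R1\<close> agree with
  \<open>F\<close> and \<open>R\<close> at nonnegative times and have the regularity required on the
  whole line.\<close>

lemma duhamel_iff:
  assumes li: "\<And>k. loc_int (\<lambda>s. G s k)" and FG: "\<And>s. 0 \<le> s \<Longrightarrow> G s = F s" and Y: "Yc R1" and R: "\<And>s. 0 \<le> s \<Longrightarrow> R1 s = R s"
  shows "PNS_duhamel u0 R0 F R \<longleftrightarrow> (\<forall>t\<ge>0. \<forall>k. R t k = Lin R0 G t k - Du (src R1) t k)"
proof -
  have "((\<lambda>s. exp (- (t - s) * ksq k) *\<^sub>R (F s k - PNS_nonlin (fcoeff (u0 s)) (R s) k)) has_integral y) {0..t}
     \<longleftrightarrow> y = Du G t k - Du (src R1) t k" if t: "0 \<le> t" for t k y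
  proof -
    have "((\<lambda>s. exp (- (t - s) * ksq k) *\<^sub>R G s k - exp (- (t - s) * ksq k) *\<^sub>R src R1 s k) has_integral (Du G t k - Du (src R1) t k)) {0..t}"
      by (intro has_integral_diff Du_has_integral[of G k t] Du_has_integral[of "src R1" k t] li src_loc_int Y t)
    then have *: "((\<lambda>s. exp (- (t - s) * ksq k) *\<^sub>R (F s k - PNS_nonlin (fcoeff (u0 s)) (R s) k)) has_integral (Du G t k - Du (src R1) t k)) {0..t}"
    proof (rule has_integral_eq[rotated])
      fix s assume "s \<in> {0..t}"
      then have "0 \<le> s" by simp
      then show "exp (- (t - s) * ksq k) *\<^sub>R G s k - exp (- (t - s) * ksq k) *\<^sub>R src R1 s k
          = exp (- (t - s) * ksq k) *\<^sub>R (F s k - PNS_nonlin (fcoeff (u0 s)) (R s) k)"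
        using FG[of s] R[of s] by (simp add: src_def NLt_def Qt_def PNS_nonlin_def scaleR_diff_right add.assoc)
    qed
    then show ?thesis using has_integral_unique by blast
  qed
  then show ?thesis unfolding PNS_duhamel_def Lin_def by (auto simp: algebra_simps)
qed

end

context picard_lin
begin

lemma Rs_unique:
  assumes a: "Yc a" "Bc a" "\<And>t k. 0 \<le> t \<Longrightarrow> a t k = Phi a t k" and B: "Bc Rs"
    and rb: "ennreal (2^Nm * 2) * X \<le> ennreal rb" "0 < rb" "4 * Cp * CD * CD * rb \<le> 1/8"
    and t: "0 \<le> t"
  shows "a t k = Rs t k"
proof (rule diff_zero[OF a(1) Rs_Yc a(2) B _ _ rb(2,3) t])
  show "a t k - Rs t k = - (Du (src a) t k - Du (src Rs) t k)" if "0 \<le> t" for t k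
    using a(3)[OF that, of k] Rs_fixed[OF that, of k] by (simp add: Phi_def)
  show "lo j * Nt Rs j t \<le> ennreal rb" if "0 \<le> t" for t j
  proof -
    have "lo j * Nt Rs j t \<le> (ennreal (2^Nm) * 2) * D j" by (rule MG_pointwise[OF Rs_MG that])
    also have "\<dots> \<le> (ennreal (2^Nm) * 2) * X" using Denv by (intro mult_left_mono) (auto simp: envelope_def)
    also have "ennreal (2^Nm) * 2 = ennreal (2^Nm * 2)" by (simp add: ennreal_mult')
    finally show ?thesis using rb(1) by simp
  qed
qed

end

section \<open>Global well-posedness\<close>

context estimates
begin

definition cv :: real where "cv = 2 / (1 - 2 powr (- (dl / 2)))"
text \<open>Chosen so that \<open>4 * Cu * cv * sqrt eps = 1/4\<close>, the share of the drift in
  the contraction factor; \<open>cv\<close> is the constant of \<open>envelope_exists\<close> at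
  rate \<open>dl\<close>.\<close>

definition eps :: real where "eps = (1 / (16 * Cu * cv))^2"
text \<open>The constant \<open>C0\<close> of the theorem. The term \<open>ln 2 / eps\<close> bounds
  \<open>2^(T/eps)\<close> by \<open>exp (Cw * T)\<close>; the second term yields the threshold 1/16
  of the iteration, the third the bound on the solution that uniqueness demands.\<close>

definition Cw :: real where "Cw = ln 2 / eps + 64 * Cp * CD * cv * cv * Ch + 64 * Cp * CD * CD * cv * Ch"

lemma cv_pos: "0 < cv"
proof -
  have "2 powr (- (dl / 2)) < 2 powr 0" using dl by (intro powr_less_mono) auto
  then show ?thesis by (simp add: cv_def)
qed

lemma eps_pos: "0 < eps" using Cpos cv_pos by (simp add: eps_def)

lemma Cw_pos: "0 < Cw"
  using eps_pos Cpos CD_pos cv_pos by (auto simp: Cw_def intro!: add_pos_pos)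

text \<open>Both quantities are multiples of \<open>2^n * x\<close>. The exponential smallness of
  \<open>x\<close> cancels the growth of \<open>2^n\<close> and leaves
  \<open>1 / Cw\<close>.\<close>

lemma Cw_small:
  assumes x: "0 \<le> x" "x \<le> 1 / Cw * exp (- Cw * T)" and T: "0 \<le> T" and n: "real n \<le> T / eps"
  shows "4 * Cp * CD * cv * 2^n * (cv * (Ch * x)) \<le> 1/16" "2^n * 2 * (cv * (Ch * x)) \<le> 1 / (32 * Cp * CD * CD)"
proof -
  have "2^n = exp (real n * ln 2)" by (simp add: exp_of_nat_mult)
  also have "\<dots> \<le> exp (T / eps * ln 2)" by (intro exp_le_cancel_iff[THEN iffD2] mult_right_mono n) simp
  also have "\<dots> \<le> exp (Cw * T)"
  proof -
    have "ln 2 / eps \<le> Cw" using Cpos CD_pos cv_pos by (simp add: Cw_def)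
    then have "ln 2 / eps * T \<le> Cw * T" using T by (rule mult_right_mono)
    then show ?thesis by (simp add: mult.commute)
  qed
  finally have "2^n * x \<le> exp (Cw * T) * (1 / Cw * exp (- Cw * T))" using x by (intro mult_mono) auto
  also have "\<dots> = 1 / Cw" by (simp add: exp_minus field_simps)
  finally have nx: "2^n * x \<le> 1 / Cw" .
  have c: "64 * Cp * CD * cv * cv * Ch \<le> Cw" "64 * Cp * CD * CD * cv * Ch \<le> Cw"
    using Cpos CD_pos cv_pos eps_pos by (auto simp: Cw_def)
  have "4 * Cp * CD * cv * 2^n * (cv * (Ch * x)) = (4 * Cp * CD * cv * cv * Ch) * (2^n * x)" by (simp only: mult_ac)
  also have "\<dots> \<le> (4 * Cp * CD * cv * cv * Ch) * (1 / Cw)" using Cpos CD_pos cv_pos by (intro mult_left_mono nx) auto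
  also have "\<dots> \<le> 1/16" using c(1) Cw_pos by (simp add: field_simps)
  finally show "4 * Cp * CD * cv * 2^n * (cv * (Ch * x)) \<le> 1/16" .
  have "2^n * 2 * (cv * (Ch * x)) = (2 * cv * Ch) * (2^n * x)" by (simp only: mult_ac)
  also have "\<dots> \<le> (2 * cv * Ch) * (1 / Cw)" using Cpos cv_pos by (intro mult_left_mono nx) auto
  also have "\<dots> \<le> 1 / (32 * Cp * CD * CD)" using c(2) Cw_pos Cpos CD_pos by (simp add: field_simps)
  finally show "2^n * 2 * (cv * (Ch * x)) \<le> 1 / (32 * Cp * CD * CD)" .
qed

lemma well_posed:
  fixes R0 :: field and F :: "real \<Rightarrow> field" and u0 :: "real \<Rightarrow> real^3 \<Rightarrow> real^3"
  assumes R0: "admissible R0" "in_besov chi (-1 + 3/p) p R0"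
    and F: "\<And>t. 0 \<le> t \<Longrightarrow> admissible (F t)" "\<And>k. (\<lambda>t. F t k) \<in> borel_measurable lborel"
    and Ffin: "(\<integral>\<^sup>+ t. indicator {0..} t * besov_enn chi (-1 + 3/p) p (F t) \<partial>lborel) < \<infinity>"
    and um: "(\<lambda>(t, x). u0 t x) \<in> borel_measurable lborel"
    and ufin: "(\<integral>\<^sup>+ t. indicator {0..} t * (Linf_norm (u0 t))^2 \<partial>lborel) < \<infinity>"
    and small: "besov chi (-1 + 3/p) p R0 + enn2real (\<integral>\<^sup>+ t. indicator {0..} t * besov_enn chi (-1 + 3/p) p (F t) \<partial>lborel)
       \<le> 1 / Cw * exp (- Cw * enn2real (\<integral>\<^sup>+ t. indicator {0..} t * (Linf_norm (u0 t))^2 \<partial>lborel))"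
  shows "\<exists>R. sol_class chi p R \<and> PNS_duhamel u0 R0 F R
     \<and> (\<forall>R'. sol_class chi p R' \<and> PNS_duhamel u0 R0 F R' \<longrightarrow> (\<forall>t\<ge>0. R' t = R t))"
proof -
  define T where "T = enn2real (\<integral>\<^sup>+ t. indicator {0..} t * (Linf_norm (u0 t))^2 \<partial>lborel)"
  define bF where "bF = enn2real (\<integral>\<^sup>+ t. indicator {0..} t * besov_enn chi (-1 + 3/p) p (F t) \<partial>lborel)"
  define b0 where "b0 = besov chi (-1 + 3/p) p R0"
  have pos: "0 \<le> T" "0 \<le> bF" "0 \<le> b0" by (auto simp: T_def bF_def b0_def besov_def)
  have um': "(\<lambda>(t, x). u0 t x) \<in> borel_measurable (borel \<Otimes>\<^sub>M borel)" using um by (simp add: borel_prod)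
  have uint: "(\<integral>\<^sup>+ t. (Linf_norm (u0 t))^2 * indicator {0..} t \<partial>lborel) = ennreal T"
    using ufin by (simp add: T_def mult.commute)
  interpret drift p chi Ch Cp Cu Ce Cf u0 by unfold_locales (use um' uint in auto)
  have V2: "(\<lambda>s. (V s)^2) \<in> bmeas" by measurable
  obtain \<nu> where \<nu>: "\<And>a b. 0 \<le> a \<Longrightarrow> a \<le> b \<Longrightarrow> \<nu> a \<le> \<nu> b" "\<And>t. 0 \<le> t \<Longrightarrow> real (\<nu> t) \<le> T / eps"
    "\<And>n. {s. 0 \<le> s \<and> \<nu> s = n} \<in> sets borel"
    "\<And>n. (\<integral>\<^sup>+s\<in>{s. 0 \<le> s \<and> \<nu> s = n}. (V s)^2 \<partial>lborel) \<le> ennreal eps"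
    by (rule pieces[OF V2 uint pos(1) eps_pos]) (rule that)
  define Nm where "Nm = nat \<lfloor>T / eps\<rfloor>"
  have Nm: "real Nm \<le> T / eps" "\<And>t. 0 \<le> t \<Longrightarrow> \<nu> t \<le> Nm"
    using pos eps_pos \<nu>(2) by (auto simp: Nm_def le_nat_floor)
  \<comment> \<open>The force is set to zero at negative times, where it need not be
    mean-free.\<close>
  define F1 where "F1 s k = (if 0 \<le> s then F s k else 0)" for s k
  have F1: "F1 s = F s" if "0 \<le> s" for s using that by (simp add: fun_eq_iff F1_def)
  have F1m: "(\<lambda>s. F1 s k) \<in> bmeas" for k using F(2)[of k] unfolding F1_def by simp
  have F10: "F1 s 0 = 0" for s using F(1)[of s] by (simp add: F1_def admissible_def)
  have [measurable]: "Nt F1 j \<in> bmeas" for j by (intro Nt_meas F1m)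
  define g where "g s = indicator {0..} s * besov_enn chi (-1 + 3/p) p (F s)" for s :: real
  have g2: "(g s)^2 = (\<Sum>j. (lo j * Nt F1 j s)^2)" for s
  proof (cases "0 \<le> s")
    case True
    then show ?thesis using besov_sq_lo[of "F1 s", OF F10] by (simp add: g_def F1 besov_enn_sq)
  next
    case False
    then have "F1 s = (\<lambda>k. 0)" by (simp add: fun_eq_iff F1_def)
    then show ?thesis using False by (simp add: g_def)
  qed
  have gm: "g \<in> bmeas" by (rule measurable_of_square) (simp only: g2, measurable)
  have gint: "(\<integral>\<^sup>+s. g s \<partial>lborel) = ennreal bF" using Ffin by (simp add: g_def bF_def)
  define f where "f j = (\<integral>\<^sup>+s. Nt F1 j s \<partial>lborel)" for j
  have fl: "(\<integral>\<^sup>+s. lo j * Nt F1 j s \<partial>lborel) = lo j * f j" for j unfolding f_def by (rule nn_integral_cmult) measurable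
  have "(\<Sum>j. (\<integral>\<^sup>+s. lo j * Nt F1 j s \<partial>lborel)^2) \<le> (ennreal bF)^2"
    by (rule Minkowski_integral_l2[OF _ gm]) (auto simp: g2 gint)
  then have f2: "(\<Sum>j. (lo j * f j)^2) \<le> (ennreal bF)^2" by (simp only: fl)
  have ffin: "f j < \<infinity>" for j
  proof -
    have "(lo j * f j)^2 \<le> (\<Sum>j. (lo j * f j)^2)"
      using sum_le_suminf[of "\<lambda>j. (lo j * f j)^2" "{j}"] by simp
    from ennreal_power2_le_imp_le[OF order_trans[OF this f2]] have "lo j * f j \<le> ennreal bF" .
    then have "lo j * f j < \<infinity>" by (rule le_less_trans) simp
    then show ?thesis by (auto simp: ennreal_mult_less_top)
  qed
  have F1li: "loc_int (\<lambda>s. F1 s k)" for k by (rule loc_int_of_N[of F1, OF F1m F10]) (use ffin in \<open>simp add: f_def\<close>)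
  have R00: "R0 0 = 0" using R0(1) by (simp add: admissible_def)
  \<comment> \<open>The weighted size of the \<open>j\<close>-th block of the linear evolution. An
    envelope of this sequence serves as majorant throughout, so the linear part has majorant 1 by
    construction.\<close>
  define d where "d j = ennreal Ch * (lo j * ennreal (N j R0)) + ennreal Ch * (lo j * f j)" for j
  define x where "x = b0 + bF"
  have x: "0 \<le> x" "x \<le> 1 / Cw * exp (- Cw * T)" using small pos by (auto simp: x_def b0_def bF_def T_def)
  have d2: "(\<Sum>j. (d j)^2) \<le> (ennreal (Ch * x))^2"
  proof -
    have "(\<Sum>j. (ennreal Ch * (lo j * ennreal (N j R0)))^2) = (ennreal Ch)^2 * (besov_enn chi (-1 + 3/p) p R0)^2"
      by (simp only: power_mult_distrib[of "ennreal Ch"] ennreal_suminf_cmult besov_enn_sq besov_sq_lo[of R0, OF R00])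
    then have 1: "(\<Sum>j. (ennreal Ch * (lo j * ennreal (N j R0)))^2) \<le> (ennreal Ch * ennreal b0)^2"
      using R0(2) by (simp add: besov_enn_def b0_def power_mult_distrib)
    have 2: "(\<Sum>j. (ennreal Ch * (lo j * f j))^2) \<le> (ennreal Ch * ennreal bF)^2"
      unfolding power_mult_distrib[of "ennreal Ch"] ennreal_suminf_cmult by (intro mult_left_mono f2) simp
    have "(\<Sum>j. (d j)^2) \<le> (ennreal Ch * ennreal b0 + ennreal Ch * ennreal bF)^2"
      using Minkowski_L2[of "\<lambda>j. ennreal Ch * (lo j * ennreal (N j R0))" "count_space UNIV" "\<lambda>j. ennreal Ch * (lo j * f j)"] 1 2
      by (simp add: nn_integral_count_space_nat d_def)
    also have "ennreal Ch * ennreal b0 + ennreal Ch * ennreal bF = ennreal (Ch * x)"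
      using pos Cpos by (simp add: x_def ennreal_mult[symmetric] ennreal_plus[symmetric] distrib_left del: ennreal_plus)
    finally show ?thesis .
  qed
  from envelope_exists[OF dl(1) d2] obtain D where D: "envelope dl cv (ennreal cv * ennreal (Ch * x)) D" "\<And>i. d i \<le> D i"
    "(\<Sum>i. (D i)^2) \<le> (ennreal cv * ennreal (Ch * x))^2" unfolding cv_def[symmetric] by blast
  define X where "X = ennreal (cv * (Ch * x))"
  have Xe: "ennreal cv * ennreal (Ch * x) = X" using cv_pos Cpos x by (simp add: X_def ennreal_mult)
  note D = D[unfolded Xe]
  have sq: "sqrt eps = 1 / (16 * Cu * cv)" using Cpos cv_pos by (simp add: eps_def real_sqrt_abs)
  note sm = Cw_small[OF x pos(1) Nm(1)]
  interpret picard p chi Ch Cp Cu Ce Cf u0 \<nu> Nm "ennreal (sqrt eps)" X cv D "Lin R0 F1"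
  proof unfold_locales
    show "(\<integral>\<^sup>+s\<in>{s. 0 \<le> s \<and> \<nu> s = n}. (V s)^2 \<partial>lborel) \<le> (ennreal (sqrt eps))^2" for n
      using \<nu>(4)[of n] eps_pos by (simp add: ennreal_power)
    have "(\<Sum>j. (D j)^2) \<le> X^2" by (rule D(3))
    also have "\<dots> < \<infinity>" by (simp add: X_def power_less_top_ennreal)
    finally show "(\<Sum>j. (D j)^2) < \<infinity>" .
    have "4 * Cu * cv * sqrt eps \<le> 1/4" unfolding sq using Cpos cv_pos by simp
    then have "ennreal (4 * Cu * cv * sqrt eps) \<le> ennreal (1/4)" by (rule ennreal_leI)
    then show "ennreal (4 * Cu * cv) * ennreal (sqrt eps) \<le> ennreal (1/4)"
      using Cpos cv_pos eps_pos by (subst ennreal_mult[symmetric]) auto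
    have "ennreal (4 * Cp * CD * cv * 2^Nm) * X = ennreal (4 * Cp * CD * cv * 2^Nm * (cv * (Ch * x)))"
      unfolding X_def using Cpos cv_pos CD_pos x by (intro ennreal_mult[symmetric]) auto
    then show "ennreal (4 * Cp * CD * cv * 2^Nm) * X \<le> ennreal (1/16)" using ennreal_leI[OF sm(1)] by simp
    show "X < \<infinity>" by (simp add: X_def)
  qed (use \<nu>(1,3) Nm(2) D(1) cv_pos in auto)
  interpret picard_lin p chi Ch Cp Cu Ce Cf u0 \<nu> Nm "ennreal (sqrt eps)" X cv D "Lin R0 F1"
  proof unfold_locales
    show "MG (Lin R0 F1) 1"
      unfolding MG_def MJ_def
    proof (intro allI impI)
      fix n j assume "n \<le> Nm"
      show "outb (I n) j (Nt (Lin R0 F1) j) ((ennreal (2^n) * 1) * D j)"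
      proof (rule outb_mono)
        show "outb {0..} j (Nt (Lin R0 F1) j) (d j)" unfolding d_def f_def by (rule Lin_outb[OF F1m F1li])
        have "ennreal 1 \<le> ennreal (2^n)" by (rule ennreal_leI) simp
        then have "1 * D j \<le> ennreal (2^n) * D j" by (intro mult_right_mono) auto
        then show "d j \<le> (ennreal (2^n) * 1) * D j" using D(2)[of j] by simp
      qed (auto simp: I_def)
    qed
  qed (rule Lin_meas[of F1, OF F1li] Lin_0[of R0 F1, OF R00 F10])+
  have hF: "herm (F1 s)" for s using F(1)[of s] by (cases "0 \<le> s") (simp_all add: F1 admissible_iff, simp add: F1_def herm_def)
  have sol: "sol_class chi p Rs"
  proof (rule Rs_sol_class)
    show "herm (Lin R0 F1 t)" for t by (rule Lin_herm[of R0 F1, OF _ F1li hF]) (use R0(1) in \<open>simp add: admissible_iff\<close>)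
    show "continuous_on {0..} (\<lambda>t. Lin R0 F1 t k)" for k by (rule Lin_continuous[of F1 k, OF F1li])
  qed
  have duh: "PNS_duhamel u0 R0 F R \<longleftrightarrow> (\<forall>t\<ge>0. \<forall>k. R t k = Phi R1 t k)" if "Yc R1" "\<And>s. 0 \<le> s \<Longrightarrow> R1 s = R s" for R R1
    unfolding Phi_def by (rule duhamel_iff[of F1 F R1 R, OF F1li F1 that])
  have "PNS_duhamel u0 R0 F Rs" by (subst duh[OF Rs_Yc]) (auto simp: Rs_fixed)
  moreover have "R' t = Rs t" if R': "sol_class chi p R'" "PNS_duhamel u0 R0 F R'" and t: "0 \<le> t" for R' t
  proof
    fix k
    let ?a = "\<lambda>t. R' (max 0 t)"
    have Ya: "Yc ?a" by (rule sol_Yc[OF R'(1)])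
    have Ba: "Bc ?a" using sol_Bc[OF R'(1)] by (simp add: Bc_def)
    have fp: "?a t k = Phi ?a t k" if "0 \<le> t" for t k
      using R'(2) that duh[of ?a R', OF Ya] by simp
    have "?a t k = Rs t k"
    proof (rule Rs_unique[OF Ya Ba fp sol_Bc[OF sol]])
      have "ennreal (2^Nm * 2) * X = ennreal (2^Nm * 2 * (cv * (Ch * x)))"
        unfolding X_def using Cpos cv_pos x by (intro ennreal_mult[symmetric]) auto
      then show "ennreal (2^Nm * 2) * X \<le> ennreal (1 / (32 * Cp * CD * CD))" using ennreal_leI[OF sm(2)] by simp
      show "0 < 1 / (32 * Cp * CD * CD)" "4 * Cp * CD * CD * (1 / (32 * Cp * CD * CD)) \<le> 1/8" using Cpos CD_pos by auto
    qed (use t in auto)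
    then show "R' t k = Rs t k" using t by simp
  qed
  ultimately show ?thesis using sol by blast
qed

end

theorem theorem4:
  fixes p :: real and chi :: "real^3 \<Rightarrow> real"
  assumes "p > 3" and "lp_cutoff chi"
  shows "\<exists>C0>0. \<forall>(R0::field) (F::real \<Rightarrow> field) (u0::real \<Rightarrow> real^3 \<Rightarrow> real^3).
     admissible R0 \<and> in_besov chi (-1 + 3/p) p R0
   \<and> (\<forall>t\<ge>0. admissible (F t)) \<and> (\<forall>k. (\<lambda>t. F t k) \<in> borel_measurable lborel)
   \<and> (\<integral>\<^sup>+ t. indicator {0..} t * besov_enn chi (-1 + 3/p) p (F t) \<partial>lborel) < \<infinity>
   \<and> (\<lambda>(t, x). u0 t x) \<in> borel_measurable lborel
   \<and> (\<forall>t. periodic3 (u0 t) \<and> fcoeff (u0 t) 0 = 0)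
   \<and> (\<integral>\<^sup>+ t. indicator {0..} t * (Linf_norm (u0 t))^2 \<partial>lborel) < \<infinity>
   \<and> besov chi (-1 + 3/p) p R0
       + enn2real (\<integral>\<^sup>+ t. indicator {0..} t * besov_enn chi (-1 + 3/p) p (F t) \<partial>lborel)
     \<le> (1 / C0) * exp (- C0 * enn2real (\<integral>\<^sup>+ t. indicator {0..} t * (Linf_norm (u0 t))^2 \<partial>lborel))
   \<longrightarrow> (\<exists>R. sol_class chi p R \<and> PNS_duhamel u0 R0 F R
          \<and> (\<forall>R'. sol_class chi p R' \<and> PNS_duhamel u0 R0 F R' \<longrightarrow> (\<forall>t\<ge>0. R' t = R t)))"
proof -
  interpret besov_setup p chi by unfold_locales fact+
  show ?thesis
  \<comment> \<open>The spatial constants depend on \<open>p\<close> and \<open>chi\<close> only.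
    Eliminating them before the data are introduced makes \<open>Cw\<close> independent of the
    data.\<close>
  proof (rule heat_block, rule Pdiv_block, rule Pdiv_block_u, rule el2_NS, rule el2_fc, goal_cases)
    case (1 Ch Cp Cu Ce Cf)
    interpret estimates p chi Ch Cp Cu Ce Cf
      by unfold_locales (fact 1 | rule 1(7); simp)+
    show ?case
    proof (intro exI[of _ Cw] conjI allI impI Cw_pos, elim conjE)
      fix R0 :: field and F :: "real \<Rightarrow> field" and u0 :: "real \<Rightarrow> real^3 \<Rightarrow> real^3"
      assume "admissible R0" "in_besov chi (-1 + 3/p) p R0" and F: "\<forall>t\<ge>0. admissible (F t)" "\<forall>k. (\<lambda>t. F t k) \<in> borel_measurable lborel"
        and "(\<integral>\<^sup>+ t. indicator {0..} t * besov_enn chi (-1 + 3/p) p (F t) \<partial>lborel) < \<infinity>"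
        and "(\<lambda>(t, x). u0 t x) \<in> borel_measurable lborel"
        and "(\<integral>\<^sup>+ t. indicator {0..} t * (Linf_norm (u0 t))^2 \<partial>lborel) < \<infinity>"
        and "besov chi (-1 + 3/p) p R0 + enn2real (\<integral>\<^sup>+ t. indicator {0..} t * besov_enn chi (-1 + 3/p) p (F t) \<partial>lborel)
         \<le> 1 / Cw * exp (- Cw * enn2real (\<integral>\<^sup>+ t. indicator {0..} t * (Linf_norm (u0 t))^2 \<partial>lborel))"
      then show "\<exists>R. sol_class chi p R \<and> PNS_duhamel u0 R0 F R
       \<and> (\<forall>R'. sol_class chi p R' \<and> PNS_duhamel u0 R0 F R' \<longrightarrow> (\<forall>t\<ge>0. R' t = R t))"
        by (intro well_posed) simp_all
    qed
  qed
qed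

end
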